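(* Let $\mathfrak{M}$ be a weight matrix satisfying $[\mathfrak{M}.1]^{*}_{\mathrm{w}}$, $[\mathfrak{M}.2]'$, and $(NA)$. Let $\Omega \subseteq \mathbb{R}^d$ be open and let $\varphi_0,\varphi_1: \Omega \to \mathbb{C}$. For $\Theta\Subset\Omega$, $M\in\mathfrak{M}$, $h>0$ and an open set $V\subseteq\mathbb{R}^{d+1}$ with $V\cap\mathbb{R}^d=\Theta$, let $(\star)_{\Theta,M,h,V}$ denote the statement: there exists $\Phi\in C^2(V)$ such that $\Phi_{|\Theta}=\varphi_{0|\Theta}$, $\partial_y\Phi_{|\Theta}=\varphi_{1|\Theta}$, and $$\sup_{(x,y)\in V}|\Delta\Phi(x,y)|\,e^{\omega_{M^*}\left(\frac{1}{h|y|}\right)}<\infty .$$ Then the following are equivalent (in the Beurling case, respectively, in parentheses, in the Roumieu case): (a) $\varphi_0,\varphi_1\in\mathcal{E}^{[\mathfrak{M}]}(\Omega)$; (b) for all $\Theta\Subset\Omega$ and for all $M\in\mathfrak{M}$ and $h>0$ (for all $\Theta\Subset\Omega$, for some $M\in\mathfrak{M}$ and some $h>0$), $(\star)_{\Theta,M,h,V}$ holds for some open $V\subseteq\mathbb{R}^{d+1}$ with $V\cap\mathbb{R}^d=\Theta$; (c) for all $\Theta\Subset\Omega$ and for all $M\in\mathfrak{M}$ and $h>0$ (for all $\Theta\Subset\Omega$, for some $M\in\mathfrak{M}$ and some $h>0$), $(\star)_{\Theta,M,h,V}$ holds for all open $V\subseteq\mathbb{R}^{d+1}$ with $V\cap\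mathbb{R}^d=\Theta$.
   Context: Notation: $\mathbb{N}=\{0,1,2,\dots\}$, $\mathbb{Z}_+=\{1,2,\dots\}$. Points of $\mathbb{R}^{d+1}=\mathbb{R}^d\times\mathbb{R}$ are written $(x,y)$; $\mathbb{R}^d$ is identified with $\mathbb{R}^d\times\{0\}$. $\Delta$ is the Laplacian on $\mathbb{R}^{d+1}$. $\Theta\Subset\Omega$ means that $\Theta$ is a relatively compact open subset of $\Omega$. A weight sequence is a sequence $M=(M_p)_{p\in\mathbb{N}}$ of positive numbers with $M_0=1$ such that $m_p:=M_p/M_{p-1}$, $p\in\mathbb{Z}_+$, is increasing (non-strictly) and tends to $\infty$. Put $M^*_p=M_p/p!$ and $m^*_p=M^*_p/M^*_{p-1}=m_p/p$ (similarly $n_p,n_p^*$ for a sequence $N$). The associated function of $M^*$ is $\omega_{M^*}(t)=\sup_{p\in\mathbb{N}}\log (t^p/M^*_p)$, $t\ge 0$. A weight sequence $M$ satisfies $(NA)$ if for every $H>0$ there is $C>0$ with $p!\le CH^pM_p$ for all $p\in\mathbb{N}$. A weight matrix $\mathfrak{M}$ is a non-empty family of weight sequences that is totally ordered with respect to the pointwise order $\le$. It satisfies $(NA)$ if each $M\in\mathfrak{M}$ does. Further conditions: $(\mathfrak{M}.1)^*_{\mathrm{w}}$: $\forall M\in\mathfrak{M}\ \exists N\in\mathfrak{M}\ \exists C>0\ \forall p\in\mathbb{Z}_+\ \forall 1\le q\le p:\ n^*_q\le Cm^*_p$; $\{\mathfrak{M}.1\}^*_{\mathrm{w}}$: $\forall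 M\in\mathfrak{M}\ \exists N\in\mathfrak{M}\ \exists C>0\ \forall p\in\mathbb{Z}_+\ \forall 1\le q\le p:\ m^*_q\le Cn^*_p$; $(\mathfrak{M}.2)'$: $\forall M\in\mathfrak{M}\ \exists N\in\mathfrak{M}\ \exists C,H>0\ \forall p\in\mathbb{N}:\ N_{p+1}\le CH^pM_p$; $\{\mathfrak{M}.2\}'$: $\forall M\in\mathfrak{M}\ \exists N\in\mathfrak{M}\ \exists C,H>0\ \forall p\in\mathbb{N}:\ M_{p+1}\le CH^pN_p$. Convention: $[\,\cdot\,]$ stands either for $(\,\cdot\,)$ throughout (Beurling case) or for $\{\,\cdot\,\}$ throughout (Roumieu case), also in the names of the conditions. For $\Theta\subseteq\mathbb{R}^d$ open, a weight sequence $M$ and $h>0$, $\mathcal{B}^{M,h}(\Theta)$ is the space of $\varphi\in C^\infty(\Theta)$ with $\|\varphi\|_{\mathcal{B}^{M,h}(\Theta)}=\sup_{\alpha\in\mathbb{N}^d}\sup_{x\in\Theta}|\varphi^{(\alpha)}(x)|/(h^{|\alpha|}M_{|\alpha|})<\infty$. Put $\mathcal{B}^{(\mathfrak{M})}(\Theta)=\bigcap_{M\in\mathfrak{M}}\bigcap_{h>0}\mathcal{B}^{M,h}(\Theta)$ and $\mathcal{B}^{\{\mathfrak{M}\}}(\Theta)=\bigcup_{M\in\mathfrak{M}}\bigcup_{h>0}\mathcal{B}^{M,h}(\Theta)$. Then $\mathcal{E}^{[\mathfrak{M}]}(\Omega)$ is the space of functions on $\Omega$ whose restriction to every $\Theta\Subset\Omega$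 belongs to $\mathcal{B}^{[\mathfrak{M}]}(\Theta)$. The supremum over $V$ is understood over points with $y\neq0$ (finiteness then forces $\Delta\Phi=0$ on $V\cap\mathbb{R}^d$ by continuity). *)

theory Defs
  imports "HOL-Analysis.Analysis"
begin

section \<open>Differentiation\<close>

definition partial :: "'a::real_normed_vector \<Rightarrow> ('a \<Rightarrow> 'b::real_normed_vector) \<Rightarrow> 'a \<Rightarrow> 'b" where
  "partial b f x = frechet_derivative f (at x) b"

text \<open>Only meant for open sets \<open>S\<close>; for these, being \<open>C^(k+1)\<close> amounts to being (Frechet)
  differentiable with all first-order partial derivatives of class \<open>C^k\<close>.\<close>

primrec Ck_on :: "nat \<Rightarrow> ('a::euclidean_space \<Rightarrow> 'b::real_normed_vector) \<Rightarrow> 'a set \<Rightarrow> bool" where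
  "Ck_on 0 f S \<longleftrightarrow> continuous_on S f"
| "Ck_on (Suc k) f S \<longleftrightarrow>
     (\<forall>x\<in>S. f differentiable (at x)) \<and> (\<forall>b\<in>Basis. Ck_on k (partial b f) S)"

definition Cinf_on :: "('a::euclidean_space \<Rightarrow> 'b::real_normed_vector) \<Rightarrow> 'a set \<Rightarrow> bool" where
  "Cinf_on f S \<longleftrightarrow> (\<forall>k. Ck_on k f S)"

definition laplacian :: "('a::euclidean_space \<Rightarrow> 'b::real_normed_vector) \<Rightarrow> 'a \<Rightarrow> 'b" where
  "laplacian f x = (\<Sum>b\<in>Basis. partial b (partial b f) x)"

text \<open>The derivative of multi-index \<open>\<alpha>\<close>: coordinate \<open>i\<close> is differentiated \<open>\<alpha> i\<close> times.
  The index type carries no order, so the order of the differentiations is chosen arbitrarily; it is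
  irrelevant for smooth functions, the only ones to which this is applied.\<close>

definition mderiv :: "('d::finite \<Rightarrow> nat) \<Rightarrow> (real ^ 'd \<Rightarrow> 'b::real_normed_vector) \<Rightarrow> real ^ 'd \<Rightarrow> 'b" where
  "mderiv \<alpha> f = foldr (\<lambda>i. partial (axis i 1)) (SOME is. \<forall>i. count_list is i = \<alpha> i) f"

definition mlength :: "('d::finite \<Rightarrow> nat) \<Rightarrow> nat" where
  "mlength \<alpha> = (\<Sum>i\<in>UNIV. \<alpha> i)"

definition rel_compact_open :: "'a::topological_space set \<Rightarrow> 'a set \<Rightarrow> bool" (infix \<open>\<Subset>\<close> 50) where
  "\<Theta> \<Subset> \<Omega> \<longleftrightarrow> open \<Theta> \<and> compact (closure \<Theta>) \<and> closure \<Theta> \<subseteq> \<Omega>"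


section \<open>Weight sequences and weight matrices\<close>

text \<open>Only meant for \<open>p \<ge> 1\<close>: \<open>quot M p\<close> is \<open>m\<^sub>p\<close>, and \<open>quot (star M) p\<close> is \<open>m\<^sup>*\<^sub>p\<close>.\<close>

definition quot :: "(nat \<Rightarrow> real) \<Rightarrow> nat \<Rightarrow> real" where
  "quot M p = M p / M (p - 1)"

definition star :: "(nat \<Rightarrow> real) \<Rightarrow> nat \<Rightarrow> real" where
  "star M p = M p / fact p"

definition weight_sequence :: "(nat \<Rightarrow> real) \<Rightarrow> bool" where
  "weight_sequence M \<longleftrightarrow>
     (\<forall>p. 0 < M p) \<and> M 0 = 1 \<and> mono_on {1..} (quot M) \<and> filterlim (quot M) at_top sequentially"

text \<open>For a sequence \<open>M\<close> with (NA), the associated function of \<open>star M\<close> is finite, so a real-valued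
  supremum is adequate there. At \<open>t = 0\<close> the convention \<open>ln 0 = 0\<close> still gives the right value \<open>0\<close>.\<close>

definition assoc_fun :: "(nat \<Rightarrow> real) \<Rightarrow> real \<Rightarrow> real" where
  "assoc_fun M t = (SUP p. ln (t ^ p / M p))"

definition seq_NA :: "(nat \<Rightarrow> real) \<Rightarrow> bool" where
  "seq_NA M \<longleftrightarrow> (\<forall>H>0. \<exists>C>0. \<forall>p. fact p \<le> C * H ^ p * M p)"

definition weight_matrix :: "(nat \<Rightarrow> real) set \<Rightarrow> bool" where
  "weight_matrix \<MM> \<longleftrightarrow>
     \<MM> \<noteq> {} \<and> (\<forall>M\<in>\<MM>. weight_sequence M) \<and> (\<forall>M\<in>\<MM>. \<forall>N\<in>\<MM>. M \<le> N \<or> N \<le> M)"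

definition matrix_NA :: "(nat \<Rightarrow> real) set \<Rightarrow> bool" where
  "matrix_NA \<MM> \<longleftrightarrow> (\<forall>M\<in>\<MM>. seq_NA M)"

text \<open>The bracket \<open>[ ]\<close> stands for \<open>( )\<close> in the Beurling case and for \<open>{ }\<close> in the Roumieu case.\<close>

datatype bracket = Beurling | Roumieu

definition matrix_M1_star_w :: "bracket \<Rightarrow> (nat \<Rightarrow> real) set \<Rightarrow> bool" where
  "matrix_M1_star_w br \<MM> \<longleftrightarrow>
     (case br of
        Beurling \<Rightarrow> \<forall>M\<in>\<MM>. \<exists>N\<in>\<MM>. \<exists>C>0. \<forall>p\<ge>1. \<forall>q. 1 \<le> q \<and> q \<le> p \<longrightarrow>
                      quot (star N) q \<le> C * quot (star M) p
      | Roumieu \<Rightarrow> \<forall>M\<in>\<MM>. \<exists>N\<in>\<MM>. \<exists>C>0. \<forall>p\<ge>1. \<forall>q. 1 \<le> q \<and> q \<le> p \<longrightarrow>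
                      quot (star M) q \<le> C * quot (star N) p)"

definition matrix_M2' :: "bracket \<Rightarrow> (nat \<Rightarrow> real) set \<Rightarrow> bool" where
  "matrix_M2' br \<MM> \<longleftrightarrow>
     (case br of
        Beurling \<Rightarrow> \<forall>M\<in>\<MM>. \<exists>N\<in>\<MM>. \<exists>C>0. \<exists>H>0. \<forall>p. N (p + 1) \<le> C * H ^ p * M p
      | Roumieu \<Rightarrow> \<forall>M\<in>\<MM>. \<exists>N\<in>\<MM>. \<exists>C>0. \<exists>H>0. \<forall>p. M (p + 1) \<le> C * H ^ p * N p)"

text \<open>``For all \<open>M \<in> \<MM>\<close> and \<open>h > 0\<close>'', respectively ``for some \<open>M \<in> \<MM>\<close> and some \<open>h > 0\<close>''.\<close>

definition bracket_quant :: "bracket \<Rightarrow> (nat \<Rightarrow> real) set \<Rightarrow> ((nat \<Rightarrow> real) \<Rightarrow> real \<Rightarrow> bool) \<Rightarrow> bool" where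
  "bracket_quant br \<MM> P \<longleftrightarrow>
     (case br of Beurling \<Rightarrow> \<forall>M\<in>\<MM>. \<forall>h>0. P M h | Roumieu \<Rightarrow> \<exists>M\<in>\<MM>. \<exists>h>0. P M h)"


section \<open>Ultradifferentiable functions\<close>

text \<open>Functions on an open subset of \<open>\<real>\<^sup>d\<close> are represented by total functions whose values outside
  the subset do not matter.\<close>

definition B_norm :: "(nat \<Rightarrow> real) \<Rightarrow> real \<Rightarrow> (real ^ 'd::finite) set \<Rightarrow> (real ^ 'd \<Rightarrow> complex) \<Rightarrow> ennreal" where
  "B_norm M h \<Theta> \<phi> =
     (SUP \<alpha>. SUP x\<in>\<Theta>. ennreal (norm (mderiv \<alpha> \<phi> x) / (h ^ mlength \<alpha> * M (mlength \<alpha>))))"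

definition B_space :: "(nat \<Rightarrow> real) \<Rightarrow> real \<Rightarrow> (real ^ 'd::finite) set \<Rightarrow> (real ^ 'd \<Rightarrow> complex) set" where
  "B_space M h \<Theta> = {\<phi>. Cinf_on \<phi> \<Theta> \<and> B_norm M h \<Theta> \<phi> < \<infinity>}"

definition B_matrix_space :: "bracket \<Rightarrow> (nat \<Rightarrow> real) set \<Rightarrow> (real ^ 'd::finite) set \<Rightarrow> (real ^ 'd \<Rightarrow> complex) set" where
  "B_matrix_space br \<MM> \<Theta> =
     (case br of
        Beurling \<Rightarrow> (\<Inter>M\<in>\<MM>. \<Inter>h\<in>{0<..}. B_space M h \<Theta>)
      | Roumieu \<Rightarrow> (\<Union>M\<in>\<MM>. \<Union>h\<in>{0<..}. B_space M h \<Theta>))"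

definition E_matrix_space :: "bracket \<Rightarrow> (nat \<Rightarrow> real) set \<Rightarrow> (real ^ 'd::finite) set \<Rightarrow> (real ^ 'd \<Rightarrow> complex) set" where
  "E_matrix_space br \<MM> \<Omega> = {\<phi>. \<forall>\<Theta>. \<Theta> \<Subset> \<Omega> \<longrightarrow> \<phi> \<in> B_matrix_space br \<MM> \<Theta>}"


section \<open>Almost harmonic extensions\<close>

text \<open>\<open>\<real>\<^sup>d\<^sup>+\<^sup>1\<close> is \<open>(real ^ 'd) \<times> real\<close>, with the inner product and basis of the product space; \<open>(0, 1)\<close>
  is the basis vector of the last coordinate.\<close>

definition open_nbhd :: "(real ^ 'd::finite) set \<Rightarrow> ((real ^ 'd) \<times> real) set \<Rightarrow> bool" where
  "open_nbhd \<Theta> V \<longleftrightarrow> open V \<and> V \<inter> (UNIV \<times> {0}) = \<Theta> \<times> {0}"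

definition almost_harmonic_ext ::
    "(real ^ 'd::finite \<Rightarrow> complex) \<Rightarrow> (real ^ 'd \<Rightarrow> complex) \<Rightarrow> (real ^ 'd) set \<Rightarrow>
     (nat \<Rightarrow> real) \<Rightarrow> real \<Rightarrow> ((real ^ 'd) \<times> real) set \<Rightarrow> bool" where
  "almost_harmonic_ext \<phi>0 \<phi>1 \<Theta> M h V \<longleftrightarrow>
     (\<exists>\<Phi> :: (real ^ 'd) \<times> real \<Rightarrow> complex.
        Ck_on 2 \<Phi> V \<and>
        (\<forall>x\<in>\<Theta>. \<Phi> (x, 0) = \<phi>0 x) \<and>
        (\<forall>x\<in>\<Theta>. partial (0, 1) \<Phi> (x, 0) = \<phi>1 x) \<and>
        (SUP (x, y)\<in>{(x, y) \<in> V. y \<noteq> 0}.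
           ennreal (norm (laplacian \<Phi> (x, y)) * exp (assoc_fun (star M) (1 / (h * \<bar>y\<bar>))))) < \<infinity>)"

end

theory Submission
  imports Defs
begin

text \<open>From \<open>\<phi>\<^sub>0\<close>, \<open>\<phi>\<^sub>1\<close> to \<open>\<Phi>\<close>: the Cauchy problem for \<open>\<Delta>\<Phi> = 0\<close> has the formal solution \<open>\<Sum>\<^sub>p c\<^sub>p(x) y\<^sup>p / p!\<close>
  with \<open>c\<^sub>0 = \<phi>\<^sub>0\<close>, \<open>c\<^sub>1 = \<phi>\<^sub>1\<close>, \<open>c\<^sub>p\<^sub>+\<^sub>2 = - \<Delta>c\<^sub>p\<close>. As in Dyn'kin's construction, the \<open>p\<close>-th term is cut off
  at a height comparable to \<open>1 / max {m\<^sup>*\<^sub>q | q \<le> p + 2}\<close>, which makes the series converge near \<open>closure \<Theta>\<close>, and \<open>\<Delta>\<Phi>\<close>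
  then consists of the contributions of the cutoffs, which have the required size. Multiplying by a
  cutoff in \<open>x\<close> gives a function on the whole space, but destroys the smallness of its Laplacian away
  from \<open>\<Theta>\<close>. This is repaired by subtracting a solution, vanishing near \<open>closure \<Theta>\<close>, of Poisson's equation
  up to a sufficiently small error; this works because the correction may grow arbitrarily
  fast as \<open>y \<longrightarrow> 0\<close> away from \<open>\<Theta>\<close>, so that every \<open>V\<close> is covered by a function on the whole space.

  Conversely, let \<open>P\<^sub>t\<close> be an iterated mollifier of total radius \<open>t\<close>. By the mean value property,
  \<open>P\<^sub>t\<^sub>/\<^sub>2 \<Phi> - P\<^sub>t \<Phi>\<close> is controlled by the values of \<open>\<Delta>\<Phi>\<close> at height at most \<open>t\<close>, and so are its derivatives, up
  to powers of \<open>1 / t\<close>. Summing over \<open>t = \<rho> 2\<^sup>-\<^sup>k\<close> bounds the derivatives of \<open>\<Phi>\<close> at \<open>y = 0\<close>.\<close>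

section \<open>Calculus of \<open>C\<^sup>k\<close> functions\<close>

text \<open>The matrix may be quasianalytic, so a cutoff in x of the class of the data need not
  exist: an ordinary C^2 cutoff is used and its error removed. The removal rests on a
  Cauchy-Kovalevskaya effect. A datum analytic in x at scale \<delta> has a potential vanishing
  above height \<eta> once \<eta> is a small multiple of \<delta>; a merely continuous datum is
  replaced by a finite-order imitation of an analytic one, which spreads its support by \<delta>. On
  layers whose heights shrink geometrically the spreads have a finite sum, so a neighbourhood of K
  is never touched. The conditions are spent as follows. The quotients m*_q need not increase; their
  running maximum does, and [M.1]*_w compares it with the quotients of a second sequence. [M.2]'
  pays for fixed losses of orders: two, because a C^2 estimate of c_p involves derivatives up to
  order p + 2, and four, because \<Delta>\<Phi> is estimated after multiplication by y^4. (NA) makes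
  the associated functions finite and, in the converse, absorbs the terms G^p p! left by
  mollification at a fixed radius.\<close>

lemma partial_eq: "(f has_derivative f') (at x) \<Longrightarrow> partial b f x = f' b"
  by (metis frechet_derivative_at partial_def)

lemma has_derivative_partials:
  fixes f :: "'a::euclidean_space \<Rightarrow> 'b::real_normed_vector"
  assumes "f differentiable (at x)"
  shows "(f has_derivative (\<lambda>v. \<Sum>b\<in>Basis. (v \<bullet> b) *\<^sub>R partial b f x)) (at x)"
proof -
  obtain f' where f': "(f has_derivative f') (at x)"
    using assms by (auto simp: differentiable_def)
  then interpret bounded_linear f' by (rule has_derivative_bounded_linear)
  have "f' v = (\<Sum>b\<in>Basis. (v \<bullet> b) *\<^sub>R partial b f x)" for v
  proof -
    have "f' v = f' (\<Sum>b\<in>Basis. (v \<bullet> b) *\<^sub>R b)" by (simp add: euclidean_representation)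
    then show ?thesis by (simp add: sum scaleR partial_eq[OF f'])
  qed
  then show ?thesis using f' by (metis (no_types, lifting) ext)
qed

lemma partial_cong_open:
  assumes "open S" "x \<in> S" "\<And>y. y \<in> S \<Longrightarrow> f y = g y"
  shows "partial b f x = partial b g x"
proof -
  have "(f has_derivative f') (at x) \<longleftrightarrow> (g has_derivative f') (at x)" for f'
    using has_derivative_transform_within_open[OF _ assms(1,2), of f f' UNIV g]
      has_derivative_transform_within_open[OF _ assms(1,2), of g f' UNIV f] assms(3) by auto
  then show ?thesis by (simp add: partial_def frechet_derivative_def)
qed

lemma differentiable_cong_open:
  assumes "open S" "x \<in> S" "\<And>y. y \<in> S \<Longrightarrow> f y = g y" "f differentiable (at x)"
  shows "g differentiable (at x)"
  using has_derivative_transform_within_open[OF _ assms(1,2), of f _ UNIV g] assms(3,4)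
  by (auto simp: differentiable_def)

section \<open>Locality and algebra of C^k functions\<close>

lemma Ck_on_cong:
  assumes "open S" "\<And>y. y \<in> S \<Longrightarrow> f y = g y" "Ck_on k f S"
  shows "Ck_on k g S"
  using assms(2,3)
proof (induction k arbitrary: f g)
  case 0
  then show ?case by (simp cong: continuous_on_cong)
next
  case (Suc k)
  have "Ck_on k (partial b g) S" if "b \<in> Basis" for b
    using Suc.IH[of "partial b f" "partial b g"] Suc.prems that
    by (auto intro: partial_cong_open[OF assms(1)])
  then show ?case
    using Suc.prems differentiable_cong_open[OF assms(1), of _ f g] by auto
qed

lemma Ck_on_subset: "Ck_on k f S \<Longrightarrow> T \<subseteq> S \<Longrightarrow> Ck_on k f T"
  by (induction k arbitrary: f) (auto intro: continuous_on_subset)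

lemma Ck_on_local:
  assumes "\<And>x. x \<in> S \<Longrightarrow> \<exists>U. open U \<and> x \<in> U \<and> Ck_on k f U"
  shows "Ck_on k f S"
  using assms
proof (induction k arbitrary: f)
  case 0
  then have "isCont f x" if "x \<in> S" for x
    using that by (metis Ck_on.simps(1) continuous_on_eq_continuous_at)
  then show ?case by (simp add: continuous_at_imp_continuous_on)
next
  case (Suc k)
  then have "f differentiable (at x)" if "x \<in> S" for x
    using that by (metis Ck_on.simps(2))
  moreover have "Ck_on k (partial b f) S" if "b \<in> Basis" for b
    by (rule Suc.IH) (use Suc.prems that in \<open>metis Ck_on.simps(2)\<close>)
  ultimately show ?case by simp
qed

lemma Ck_on_Un: "open S \<Longrightarrow> open T \<Longrightarrow> Ck_on k f S \<Longrightarrow> Ck_on k f T \<Longrightarrow> Ck_on k f (S \<union> T)"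
  by (rule Ck_on_local) auto

lemma Ck_on_imp_continuous: "Ck_on k f S \<Longrightarrow> continuous_on S f"
  by (cases k) (auto intro!: continuous_at_imp_continuous_on differentiable_imp_continuous_within)

lemma Ck_on_SucD: "Ck_on (Suc k) f S \<Longrightarrow> Ck_on k f S"
  by (induction k arbitrary: f) (auto intro!: continuous_at_imp_continuous_on differentiable_imp_continuous_within)

lemma Ck_on_mono: "Ck_on k f S \<Longrightarrow> j \<le> k \<Longrightarrow> Ck_on j f S"
  by (induction k) (auto simp: le_Suc_eq simp del: Ck_on.simps(2) dest: Ck_on_SucD)

lemma Ck_on_differentiable: "Ck_on k f S \<Longrightarrow> 0 < k \<Longrightarrow> x \<in> S \<Longrightarrow> f differentiable (at x)"
  by (cases k) auto

text \<open>A list of directions instead of a multi-index lets inductions peel off single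
  derivatives. Because of \<open>foldr\<close>, the last entry is the derivative taken
  first.\<close>

abbreviation partials :: "'a::real_normed_vector list \<Rightarrow> ('a \<Rightarrow> 'b::real_normed_vector) \<Rightarrow> 'a \<Rightarrow> 'b" where
  "partials bs f \<equiv> foldr partial bs f"

lemma Ck_on_partials:
  "set bs \<subseteq> Basis \<Longrightarrow> Ck_on (k + length bs) f S \<Longrightarrow> Ck_on k (partials bs f) S"
proof (induction bs arbitrary: k)
  case (Cons b bs)
  then have "Ck_on (Suc k) (partials bs f) S" by (intro Cons.IH) (simp_all del: Ck_on.simps)
  then show ?case using Cons.prems by simp
qed simp

lemma partials_cong_open:
  assumes "open S" "x \<in> S" "\<And>y. y \<in> S \<Longrightarrow> f y = g y"
  shows "partials bs f x = partials bs g x"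
  using assms(2)
proof (induction bs arbitrary: x)
  case (Cons b bs)
  then show ?case by (auto intro: partial_cong_open[OF assms(1)])
qed (use assms in auto)

lemma laplacian_cong_open:
  assumes "open S" "x \<in> S" "\<And>y. y \<in> S \<Longrightarrow> f y = g y"
  shows "laplacian f x = laplacian g x"
proof -
  have "partial b (partial b f) x = partial b (partial b g) x" for b
    using partials_cong_open[OF assms, where bs = "[b, b]"] by simp
  then show ?thesis by (simp add: laplacian_def)
qed

lemma partial_const [simp]: "partial b (\<lambda>x. c) = (\<lambda>x. 0)"
  by (rule ext, rule partial_eq[where f' = "\<lambda>_. 0"]) simp

lemma Ck_on_const [simp]: "Ck_on k (\<lambda>x. c) S"
  by (induction k arbitrary: c) auto

lemma partial_linear:
  assumes "bounded_linear T" "f differentiable (at x)"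
  shows "partial b (\<lambda>x. T (f x)) x = T (partial b f x)"
proof -
  obtain f' where f': "(f has_derivative f') (at x)"
    using assms by (auto simp: differentiable_def)
  show ?thesis
    using partial_eq[OF f'] partial_eq[OF bounded_linear.has_derivative[OF assms(1) f']] by simp
qed

lemma Ck_on_linear:
  assumes "open S" "bounded_linear T" "Ck_on k f S"
  shows "Ck_on k (\<lambda>x. T (f x)) S"
  using assms(3)
proof (induction k arbitrary: f)
  case 0
  then show ?case by (simp add: bounded_linear.continuous_on[OF assms(2)])
next
  case (Suc k)
  have "Ck_on k (partial b (\<lambda>x. T (f x))) S" if "b \<in> Basis" for b
    using Ck_on_cong[OF assms(1) _ Suc.IH[of "partial b f"]] partial_linear[OF assms(2)] Suc.prems that
    by (metis Ck_on.simps(2))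
  moreover have "(\<lambda>x. T (f x)) differentiable (at x)" if "x \<in> S" for x
    using Suc.prems that bounded_linear.has_derivative[OF assms(2)] by (fastforce simp: differentiable_def)
  ultimately show ?case by simp
qed

lemma partial_add:
  assumes "f differentiable (at x)" "g differentiable (at x)"
  shows "partial b (\<lambda>x. f x + g x) x = partial b f x + partial b g x"
proof -
  obtain f' g' where "(f has_derivative f') (at x)" "(g has_derivative g') (at x)"
    using assms by (auto simp: differentiable_def)
  then show ?thesis using partial_eq[OF has_derivative_add] partial_eq by metis
qed

lemma Ck_on_add:
  assumes "open S" "Ck_on k f S" "Ck_on k g S"
  shows "Ck_on k (\<lambda>x. f x + g x) S"
  using assms(2,3)
proof (induction k arbitrary: f g)
  case 0
  then show ?case by (simp add: continuous_on_add)
next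
  case (Suc k)
  have "Ck_on k (partial b (\<lambda>x. f x + g x)) S" if "b \<in> Basis" for b
    by (rule Ck_on_cong[OF assms(1) _ Suc.IH[of "partial b f" "partial b g"]])
      (use Suc.prems that in \<open>auto simp: partial_add\<close>)
  then show ?case using Suc.prems by simp
qed

lemma partial_scaleR:
  fixes f :: "'a::real_normed_vector \<Rightarrow> real"
  assumes "f differentiable (at x)" "g differentiable (at x)"
  shows "partial b (\<lambda>x. f x *\<^sub>R g x) x = f x *\<^sub>R partial b g x + partial b f x *\<^sub>R g x"
proof -
  obtain f' g' where "(f has_derivative f') (at x)" "(g has_derivative g') (at x)"
    using assms by (auto simp: differentiable_def)
  then show ?thesis using partial_eq[OF has_derivative_scaleR] partial_eq by metis
qed

lemma Ck_on_scaleR: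
  fixes f :: "'a::euclidean_space \<Rightarrow> real"
  assumes "open S" "Ck_on k f S" "Ck_on k g S"
  shows "Ck_on k (\<lambda>x. f x *\<^sub>R g x) S"
  using assms(2,3)
proof (induction k arbitrary: f g)
  case 0
  then show ?case by (simp add: continuous_on_scaleR)
next
  case (Suc k)
  have "Ck_on k (partial b (\<lambda>x. f x *\<^sub>R g x)) S" if "b \<in> Basis" for b
    by (rule Ck_on_cong[OF assms(1) _ Ck_on_add[OF assms(1) Suc.IH[of f "partial b g"] Suc.IH[of "partial b f" g]]])
      (use Suc.prems that Ck_on_SucD[OF Suc.prems(1)] Ck_on_SucD[OF Suc.prems(2)] in \<open>auto simp: partial_scaleR\<close>)
  then show ?case using Suc.prems by simp
qed

text \<open>The open sets \<open>V\<close> and \<open>- C\<close> cover the space, and on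
  \<open>- C\<close> the product vanishes whatever values \<open>f\<close> has outside
  \<open>V\<close>.\<close>

lemma Ck_on_scaleR_extend:
  fixes \<zeta> :: "'a::euclidean_space \<Rightarrow> real"
  assumes "open V" "closed C" "C \<subseteq> V" "Ck_on k \<zeta> UNIV" "\<And>z. z \<notin> C \<Longrightarrow> \<zeta> z = 0" "Ck_on k f V"
  shows "Ck_on k (\<lambda>z. \<zeta> z *\<^sub>R f z) UNIV"
proof -
  have "Ck_on k (\<lambda>z. \<zeta> z *\<^sub>R f z) V"
    by (rule Ck_on_scaleR[OF assms(1) Ck_on_subset[OF assms(4)] assms(6)]) simp
  moreover have "Ck_on k (\<lambda>z. \<zeta> z *\<^sub>R f z) (- C)"
    by (rule Ck_on_cong[where f = "\<lambda>_. 0"]) (use assms in auto)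
  ultimately have "Ck_on k (\<lambda>z. \<zeta> z *\<^sub>R f z) (V \<union> - C)"
    using assms by (intro Ck_on_Un) auto
  moreover have "V \<union> - C = UNIV" using assms(3) by blast
  ultimately show ?thesis by simp
qed

lemma partial_sum:
  assumes "\<And>i. i \<in> I \<Longrightarrow> f i differentiable (at x)"
  shows "partial b (\<lambda>x. \<Sum>i\<in>I. f i x) x = (\<Sum>i\<in>I. partial b (f i) x)"
proof -
  obtain f' where f': "\<And>i. i \<in> I \<Longrightarrow> (f i has_derivative f' i) (at x)"
    using assms unfolding differentiable_def by metis
  show ?thesis
    using partial_eq[OF has_derivative_sum[OF f']] by (simp add: partial_eq[OF f'])
qed

lemma Ck_on_sum:
  assumes "open S" "\<And>i. i \<in> I \<Longrightarrow> Ck_on k (f i) S"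
  shows "Ck_on k (\<lambda>x. \<Sum>i\<in>I. f i x) S"
  using assms(2) by (induction I rule: infinite_finite_induct) (auto intro: Ck_on_add[OF assms(1)])

lemma Ck_on_minus: "open S \<Longrightarrow> Ck_on k f S \<Longrightarrow> Ck_on k (\<lambda>x. - f x) S"
  by (rule Ck_on_linear[OF _ bounded_linear_minus[OF bounded_linear_ident]])

lemma Ck_on_diff:
  assumes "open S" "Ck_on k f S" "Ck_on k g S"
  shows "Ck_on k (\<lambda>x. f x - g x) S"
  using Ck_on_add[OF assms(1,2) Ck_on_minus[OF assms(1,3)]] by simp

lemma Ck_on_laplacian:
  assumes "open S" "Ck_on (Suc (Suc k)) f S"
  shows "Ck_on k (laplacian f) S"
proof -
  have "Ck_on k (\<lambda>x. \<Sum>b\<in>Basis. partial b (partial b f) x) S"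
    by (rule Ck_on_sum[OF assms(1)]) (use assms(2) in auto)
  then show ?thesis by (simp add: laplacian_def[abs_def])
qed

lemma partials_sum:
  assumes "open S" "\<And>i. i \<in> I \<Longrightarrow> Ck_on (length bs) (f i) S" "x \<in> S" "set bs \<subseteq> Basis"
  shows "partials bs (\<lambda>x. \<Sum>i\<in>I. f i x) x = (\<Sum>i\<in>I. partials bs (f i) x)"
  using assms(2-)
proof (induction bs arbitrary: x)
  case (Cons b bs)
  have "partials bs (\<lambda>x. \<Sum>i\<in>I. f i x) y = (\<Sum>i\<in>I. partials bs (f i) y)" if "y \<in> S" for y
    using that Cons by (intro Cons.IH) (auto intro: Ck_on_SucD)
  then have "partial b (partials bs (\<lambda>x. \<Sum>i\<in>I. f i x)) x = partial b (\<lambda>x. \<Sum>i\<in>I. partials bs (f i) x) x"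
    by (intro partial_cong_open[OF assms(1) Cons.prems(2)])
  also have "\<dots> = (\<Sum>i\<in>I. partial b (partials bs (f i)) x)"
  proof (rule partial_sum)
    fix i assume "i \<in> I"
    have "Ck_on 1 (partials bs (f i)) S"
      by (rule Ck_on_partials) (use Cons.prems \<open>i \<in> I\<close> in auto)
    then show "partials bs (f i) differentiable at x"
      by (rule Ck_on_differentiable) (use Cons.prems in auto)
  qed
  finally show ?case by simp
qed simp

lemma partials_linear:
  assumes "open S" "bounded_linear T" "Ck_on (length bs) f S" "x \<in> S" "set bs \<subseteq> Basis"
  shows "partials bs (\<lambda>x. T (f x)) x = T (partials bs f x)"
  using assms(3-)
proof (induction bs arbitrary: x)
  case (Cons b bs)
  have "partials bs (\<lambda>x. T (f x)) y = T (partials bs f y)" if "y \<in> S" for y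
    using that Cons by (intro Cons.IH) (auto intro: Ck_on_SucD)
  then have "partial b (partials bs (\<lambda>x. T (f x))) x = partial b (\<lambda>x. T (partials bs f x)) x"
    by (intro partial_cong_open[OF assms(1) Cons.prems(2)])
  also have "\<dots> = T (partial b (partials bs f) x)"
  proof (rule partial_linear[OF assms(2)])
    have "Ck_on 1 (partials bs f) S"
      by (rule Ck_on_partials) (use Cons.prems in auto)
    then show "partials bs f differentiable at x"
      by (rule Ck_on_differentiable) (use Cons.prems in auto)
  qed
  finally show ?case by simp
qed simp

lemma partials_diff:
  assumes "open S" "Ck_on (length bs) f S" "Ck_on (length bs) g S" "x \<in> S" "set bs \<subseteq> Basis"
  shows "partials bs (\<lambda>x. f x - g x) x = partials bs f x - partials bs g x"
proof -
  let ?h = "\<lambda>i::bool. if i then f else (\<lambda>x. - g x)"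
  have "partials bs (\<lambda>x. \<Sum>i\<in>UNIV. ?h i x) x = (\<Sum>i\<in>UNIV. partials bs (?h i) x)"
    by (rule partials_sum[OF assms(1)]) (use assms Ck_on_minus in auto)
  then show ?thesis
    using partials_linear[OF assms(1) bounded_linear_minus[OF bounded_linear_ident] assms(3-5)]
    by (simp add: UNIV_bool)
qed

lemma laplacian_sum:
  assumes "open S" "\<And>i. i \<in> I \<Longrightarrow> Ck_on 2 (f i) S" "x \<in> S"
  shows "laplacian (\<lambda>x. \<Sum>i\<in>I. f i x) x = (\<Sum>i\<in>I. laplacian (f i) x)"
proof -
  have "partials [b, b] (\<lambda>x. \<Sum>i\<in>I. f i x) x = (\<Sum>i\<in>I. partials [b, b] (f i) x)" if "b \<in> Basis" for b
    by (rule partials_sum[OF assms(1)]) (use assms that in \<open>auto simp: numeral_2_eq_2\<close>)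
  then show ?thesis
    unfolding laplacian_def by (simp add: sum.swap[of _ Basis I])
qed

lemma laplacian_linear:
  assumes "open S" "bounded_linear T" "Ck_on 2 f S" "x \<in> S"
  shows "laplacian (\<lambda>x. T (f x)) x = T (laplacian f x)"
proof -
  interpret bounded_linear T by fact
  have "partials [b, b] (\<lambda>x. T (f x)) x = T (partials [b, b] f x)" if "b \<in> Basis" for b
    by (rule partials_linear[OF assms(1,2)]) (use assms that in \<open>auto simp: numeral_2_eq_2\<close>)
  then show ?thesis
    unfolding laplacian_def by (simp add: sum)
qed

lemma laplacian_diff:
  assumes "open S" "Ck_on 2 f S" "Ck_on 2 g S" "x \<in> S"
  shows "laplacian (\<lambda>x. f x - g x) x = laplacian f x - laplacian g x"
proof -
  have "partials [b, b] (\<lambda>x. f x - g x) x = partials [b, b] f x - partials [b, b] g x" if "b \<in> Basis" for b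
    by (rule partials_diff[OF assms(1)]) (use assms that in \<open>auto simp: numeral_2_eq_2\<close>)
  then show ?thesis
    unfolding laplacian_def by (simp add: sum_subtractf)
qed

lemma Ck_on_iterated_laplacian:
  assumes "open S" "Ck_on (k + 2 * j) f S"
  shows "Ck_on k ((laplacian ^^ j) f) S"
  using assms(2)
proof (induction j arbitrary: k)
  case (Suc j)
  then have "Ck_on (Suc (Suc k)) ((laplacian ^^ j) f) S" by (intro Suc.IH) simp
  then show ?case by (simp add: Ck_on_laplacian[OF assms(1)])
qed simp

text \<open>The two directions of the Laplacian are appended at the right end of the list, so no
  commutation of derivatives is involved; the factor counts the summands of the Laplacian.\<close>

lemma norm_partials_laplacian_le:
  fixes f :: "'a::euclidean_space \<Rightarrow> 'b::real_normed_vector"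
  assumes "open S" "x \<in> S" "set cs \<subseteq> Basis" "Ck_on (length cs + 2) f S"
    and "\<And>bs. set bs \<subseteq> Basis \<Longrightarrow> length bs = length cs + 2 \<Longrightarrow> norm (partials bs f x) \<le> B"
  shows "norm (partials cs (laplacian f) x) \<le> real DIM('a) * B"
proof -
  have "partials cs (laplacian f) x = (\<Sum>b\<in>Basis. partials cs (partial b (partial b f)) x)"
    unfolding laplacian_def[abs_def]
    by (rule partials_sum[OF assms(1)]) (use assms(2-4) in auto)
  also have "norm \<dots> \<le> (\<Sum>b\<in>(Basis::'a set). B)"
  proof (rule sum_norm_le)
    fix b :: 'a assume "b \<in> Basis"
    then show "norm (partials cs (partial b (partial b f)) x) \<le> B"
      using assms(5)[of "cs @ [b, b]"] assms(3) by simp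
  qed
  finally show ?thesis by simp
qed

lemma norm_partials_iterated_laplacian_le:
  fixes f :: "'a::euclidean_space \<Rightarrow> 'b::real_normed_vector"
  assumes "open S" "x \<in> S" "set cs \<subseteq> Basis" "Ck_on (length cs + 2 * j) f S"
    and "\<And>bs. set bs \<subseteq> Basis \<Longrightarrow> length bs = length cs + 2 * j \<Longrightarrow> norm (partials bs f x) \<le> B"
  shows "norm (partials cs ((laplacian ^^ j) f) x) \<le> real DIM('a) ^ j * B"
  using assms(4,5)
proof (induction j arbitrary: f B)
  case (Suc j)
  have "norm (partials cs ((laplacian ^^ j) (laplacian f)) x) \<le> real DIM('a) ^ j * (real DIM('a) * B)"
  proof (rule Suc.IH)
    show "Ck_on (length cs + 2 * j) (laplacian f) S"
      using Suc.prems(1) by (intro Ck_on_laplacian[OF assms(1)]) simp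
    fix bs :: "'a list" assume bs: "set bs \<subseteq> Basis" "length bs = length cs + 2 * j"
    show "norm (partials bs (laplacian f) x) \<le> real DIM('a) * B"
    proof (rule norm_partials_laplacian_le[OF assms(1,2) bs(1)])
      show "Ck_on (length bs + 2) f S" using Suc.prems(1) bs(2) by (simp del: Ck_on.simps)
      show "norm (partials bs' f x) \<le> B" if "set bs' \<subseteq> Basis" "length bs' = length bs + 2" for bs'
        by (rule Suc.prems(2)) (use that bs in simp_all)
    qed
  qed
  then show ?case by (simp add: funpow_swap1 mult_ac)
qed (use assms in simp)

section \<open>Symmetry of iterated derivatives\<close>

text \<open>The second difference is symmetric in \<open>a\<close> and \<open>b\<close>, so symmetry
  of second derivatives follows by uniqueness of limits. It is the increment in direction
  \<open>a\<close> of a difference in direction \<open>b\<close>, to which the mean value inequality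
  applies.\<close>

lemma second_difference_tendsto:
  fixes f :: "'a::real_normed_vector \<Rightarrow> 'b::real_normed_vector"
  assumes "open S" "x \<in> S" "\<And>y. y \<in> S \<Longrightarrow> f differentiable (at y)" "partial a f differentiable (at x)"
  shows "((\<lambda>s. (f (x + s *\<^sub>R a + s *\<^sub>R b) - f (x + s *\<^sub>R a) - f (x + s *\<^sub>R b) + f x) /\<^sub>R s\<^sup>2)
    \<longlongrightarrow> partial b (partial a f) x) (at_right 0)"
proof (rule tendstoI)
  fix e :: real assume "e > 0"
  obtain L where L: "(partial a f has_derivative L) (at x)"
    using assms(4) by (auto simp: differentiable_def)
  interpret L: bounded_linear L using L by (rule has_derivative_bounded_linear)
  define N where "N = 2 * norm a + norm b + 1"
  have N: "N > 0" by (simp add: N_def add_nonneg_pos)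
  define e' where "e' = e / (2 * N)"
  have e': "e' > 0" using \<open>e > 0\<close> N by (simp add: e'_def)
  obtain d where d: "d > 0" "\<And>v. norm v < d \<Longrightarrow> norm (partial a f (x + v) - partial a f x - L v) \<le> e' * norm v"
  proof -
    from L e' obtain d where d: "d > 0"
      "\<And>y. norm (y - x) < d \<Longrightarrow> norm (partial a f y - partial a f x - L (y - x)) \<le> e' * norm (y - x)"
      unfolding has_derivative_at_alt by blast
    show ?thesis by (rule that[OF d(1)]) (use d(2)[of "x + v" for v] in simp)
  qed
  obtain r where r: "r > 0" "ball x r \<subseteq> S"
    using openE[OF assms(1,2)] by blast
  have "dist ((f (x + s *\<^sub>R a + s *\<^sub>R b) - f (x + s *\<^sub>R a) - f (x + s *\<^sub>R b) + f x) /\<^sub>R s\<^sup>2) (L b) < e"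
    if s: "0 < s" "s < min d r / N" for s
  proof -
    have small: "norm (u *\<^sub>R a + w *\<^sub>R b) < min d r" if "0 \<le> u" "u \<le> s" "0 \<le> w" "w \<le> s" for u w
    proof -
      have "norm (u *\<^sub>R a + w *\<^sub>R b) \<le> s * norm a + s * norm b"
        using that by (intro order_trans[OF norm_triangle_ineq]) (simp add: add_mono mult_right_mono)
      also have "\<dots> \<le> s * N"
      proof -
        have "norm a + norm b \<le> N" by (simp add: N_def)
        then have "s * (norm a + norm b) \<le> s * N" using s(1) by (intro mult_left_mono) auto
        then show ?thesis by (simp add: algebra_simps)
      qed
      also have "\<dots> < min d r" using s(2) N by (simp add: field_simps)
      finally show ?thesis .
    qed
    \<comment> \<open>The expected value s^2 L b is built in beforehand, so that the derivative
      \<open>G'\<close> is a pure error term, at most of size s e' N.\<close>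
    define G where "G u = f (x + u *\<^sub>R a + s *\<^sub>R b) - f (x + u *\<^sub>R a) - u *\<^sub>R L (s *\<^sub>R b)" for u
    define G' where "G' u = partial a f (x + u *\<^sub>R a + s *\<^sub>R b) - partial a f (x + u *\<^sub>R a) - L (s *\<^sub>R b)" for u
    have fd: "((\<lambda>u. f (x + u *\<^sub>R a + w)) has_derivative (\<lambda>h. h *\<^sub>R partial a f (x + u *\<^sub>R a + w))) (at u within {0..s})"
      if S: "x + u *\<^sub>R a + w \<in> S" for u w
    proof -
      obtain F where F: "(f has_derivative F) (at (x + u *\<^sub>R a + w))"
        using assms(3)[OF S] unfolding differentiable_def by blast
      interpret F: bounded_linear F using F by (rule has_derivative_bounded_linear)
      have "((\<lambda>u. f (x + u *\<^sub>R a + w)) has_derivative (\<lambda>h. F (h *\<^sub>R a))) (at u within {0..s})"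
        by (rule has_derivative_compose[of "\<lambda>u. x + u *\<^sub>R a + w", OF _ F]) (auto intro!: derivative_eq_intros)
      then show ?thesis by (simp add: partial_eq[OF F] F.scaleR)
    qed
    have inS: "x + u *\<^sub>R a + w *\<^sub>R b \<in> S" if "0 \<le> u" "u \<le> s" "0 \<le> w" "w \<le> s" for u w
    proof -
      have "dist x (x + (u *\<^sub>R a + w *\<^sub>R b)) < r"
        using small[OF that] by (metis add_diff_cancel_left' dist_commute dist_norm min_less_iff_conj)
      then show ?thesis using r(2) by (auto simp: add.assoc)
    qed
    have "norm (G s - G 0) \<le> (s * e' * N) * norm (s - 0)"
    proof (rule differentiable_bound[where S = "{0..s}" and f' = "\<lambda>u h. h *\<^sub>R G' u"])
      fix u assume u: "u \<in> {0..s}"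
      have "(G has_derivative (\<lambda>h. h *\<^sub>R partial a f (x + u *\<^sub>R a + s *\<^sub>R b) - h *\<^sub>R partial a f (x + u *\<^sub>R a + 0) - h *\<^sub>R L (s *\<^sub>R b))) (at u within {0..s})"
        unfolding G_def
        using fd[of u "s *\<^sub>R b"] fd[of u 0] inS[of u s] inS[of u 0] u s(1)
        by (intro has_derivative_diff has_derivative_scaleR_left has_derivative_ident) auto
      then show "(G has_derivative (\<lambda>h. h *\<^sub>R G' u)) (at u within {0..s})"
        by (simp add: G'_def scaleR_diff_right)
      have "G' u = (partial a f (x + (u *\<^sub>R a + s *\<^sub>R b)) - partial a f x - L (u *\<^sub>R a + s *\<^sub>R b))
          - (partial a f (x + u *\<^sub>R a) - partial a f x - L (u *\<^sub>R a))"
        by (simp add: G'_def L.add add.assoc)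
      also have "norm \<dots> \<le> e' * norm (u *\<^sub>R a + s *\<^sub>R b) + e' * norm (u *\<^sub>R a)"
        using small[of u s] small[of u 0] u s(1)
        by (intro order_trans[OF norm_triangle_ineq4] add_mono d(2)) auto
      also have "\<dots> \<le> e' * (s * norm a + s * norm b) + e' * (s * norm a)"
        using u e' by (intro add_mono mult_left_mono order_trans[OF norm_triangle_ineq]) (auto intro!: mult_right_mono)
      also have "\<dots> \<le> s * e' * N"
      proof -
        have "0 < s * e'" using s(1) e' by simp
        then show ?thesis by (simp add: N_def algebra_simps)
      qed
      finally show "onorm (\<lambda>h. h *\<^sub>R G' u) \<le> s * e' * N"
        by (intro onorm_le) (simp add: mult.commute mult_left_mono)
    qed (use s in auto)
    then have le: "norm (G s - G 0) \<le> s\<^sup>2 * (e' * N)" using s(1) by (simp add: power2_eq_square mult_ac)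
    have "G s - G 0 = f (x + s *\<^sub>R a + s *\<^sub>R b) - f (x + s *\<^sub>R a) - f (x + s *\<^sub>R b) + f x - s\<^sup>2 *\<^sub>R L b"
      by (simp add: G_def L.scaleR power2_eq_square)
    then have "(f (x + s *\<^sub>R a + s *\<^sub>R b) - f (x + s *\<^sub>R a) - f (x + s *\<^sub>R b) + f x) /\<^sub>R s\<^sup>2 - L b = (G s - G 0) /\<^sub>R s\<^sup>2"
      using s(1) by (simp add: scaleR_diff_right)
    then have "dist ((f (x + s *\<^sub>R a + s *\<^sub>R b) - f (x + s *\<^sub>R a) - f (x + s *\<^sub>R b) + f x) /\<^sub>R s\<^sup>2) (L b) = norm (G s - G 0) / s\<^sup>2"
      using s(1) by (simp add: dist_norm divide_inverse_commute)
    also have "\<dots> \<le> e' * N" using le s(1) by (simp add: field_simps)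
    also have "\<dots> < e" using N \<open>e > 0\<close> by (simp add: e'_def)
    finally show ?thesis .
  qed
  moreover have "0 < min d r / N" using d(1) r(1) N by simp
  ultimately show "\<forall>\<^sub>F s in at_right 0. dist ((f (x + s *\<^sub>R a + s *\<^sub>R b) - f (x + s *\<^sub>R a) - f (x + s *\<^sub>R b) + f x) /\<^sub>R s\<^sup>2) (partial b (partial a f) x) < e"
    unfolding eventually_at_right_field partial_eq[OF L] by blast
qed

lemma partial_commute:
  assumes "open S" "x \<in> S" "Ck_on 2 f S" "a \<in> Basis" "b \<in> Basis"
  shows "partial a (partial b f) x = partial b (partial a f) x"
proof -
  have "partial c f differentiable (at x)" if "c \<in> Basis" for c
    using assms that by (simp add: numeral_2_eq_2)
  moreover have "f differentiable (at y)" if "y \<in> S" for y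
    using assms that by (simp add: numeral_2_eq_2)
  ultimately show ?thesis
    using second_difference_tendsto[OF assms(1,2), of f a b] second_difference_tendsto[OF assms(1,2), of f b a] assms(4,5)
    by (auto simp: algebra_simps intro: tendsto_unique[OF trivial_limit_at_right_real])
qed

lemma partials_move_to_front:
  assumes "open S" "Ck_on (length (us @ b # vs)) f S" "set (us @ b # vs) \<subseteq> Basis" "x \<in> S"
  shows "partials (us @ b # vs) f x = partials (b # us @ vs) f x"
  using assms(2-)
proof (induction us arbitrary: x)
  case (Cons u us)
  have "partials (us @ b # vs) f y = partials (b # us @ vs) f y" if "y \<in> S" for y
    using Cons that Ck_on_SucD by (intro Cons.IH) (auto simp del: Ck_on.simps)
  then have "partial u (partials (us @ b # vs) f) x = partial u (partials (b # us @ vs) f) x"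
    by (rule partial_cong_open[OF assms(1) Cons.prems(3)])
  then have "partials (u # us @ b # vs) f x = partial u (partials (b # us @ vs) f) x" by simp
  also have "\<dots> = partial u (partial b (partials (us @ vs) f)) x" by simp
  also have "\<dots> = partial b (partial u (partials (us @ vs) f)) x"
  proof (rule partial_commute[OF assms(1) Cons.prems(3)])
    show "Ck_on 2 (partials (us @ vs) f) S"
      by (rule Ck_on_partials) (use Cons.prems in \<open>auto simp del: Ck_on.simps\<close>)
  qed (use Cons.prems in auto)
  finally show ?case by simp
qed simp

lemma partials_perm:
  assumes "open S" "Ck_on (length bs) f S" "set bs \<subseteq> Basis" "mset bs = mset cs" "x \<in> S"
  shows "partials bs f x = partials cs f x"
  using assms(2-)
proof (induction bs arbitrary: cs x)
  case (Cons b bs)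
  have "b \<in> set cs" using Cons.prems by (metis list.set_intros(1) mset_eq_setD)
  then obtain us vs where cs: "cs = us @ b # vs" by (meson split_list)
  have m: "mset bs = mset (us @ vs)" using Cons.prems(3) cs by simp
  have "partials bs f y = partials (us @ vs) f y" if "y \<in> S" for y
    using Cons that m Ck_on_SucD by (intro Cons.IH) (auto simp del: Ck_on.simps)
  then have "partial b (partials bs f) x = partial b (partials (us @ vs) f) x"
    by (rule partial_cong_open[OF assms(1) Cons.prems(4)])
  then have "partials (b # bs) f x = partials (b # us @ vs) f x" by simp
  also have "\<dots> = partials cs f x"
    unfolding cs
  proof (rule partials_move_to_front[OF assms(1), symmetric])
    show "Ck_on (length (us @ b # vs)) f S"
      using Cons.prems(1,3) cs by (metis size_mset)
    show "set (us @ b # vs) \<subseteq> Basis"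
      using Cons.prems(2,3) cs by (metis mset_eq_setD)
  qed (use Cons.prems in auto)
  finally show ?case .
qed simp

section \<open>Limits and series of C^k functions\<close>

lemma sum_Basis_inner_scaleR:
  fixes h :: "'a::euclidean_space \<Rightarrow> 'b::real_vector"
  assumes "b \<in> Basis"
  shows "(\<Sum>c\<in>Basis. (b \<bullet> c) *\<^sub>R h c) = h b"
proof -
  have "(\<Sum>c\<in>Basis. (b \<bullet> c) *\<^sub>R h c) = (\<Sum>c\<in>Basis. if c = b then h c else 0)"
    using assms by (intro sum.cong) (auto simp: inner_Basis)
  then show ?thesis using assms by simp
qed

text \<open>The theorem on limits of derivatives works on convex sets, whence the passage to a ball
  inside \<open>S\<close>. Convergence of each partial derivative up to e / DIM gives convergence of
  the whole derivative up to e.\<close>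

lemma has_derivative_limit_partials:
  fixes f :: "nat \<Rightarrow> 'a::euclidean_space \<Rightarrow> 'b::banach"
  assumes "open S" "x \<in> S" "\<And>n y. y \<in> S \<Longrightarrow> f n differentiable (at y)"
    and "\<And>b. b \<in> Basis \<Longrightarrow> uniform_limit S (\<lambda>n. partial b (f n)) (h b) sequentially"
    and "\<And>y. y \<in> S \<Longrightarrow> (\<lambda>n. f n y) \<longlonglongrightarrow> g y"
  shows "(g has_derivative (\<lambda>v. \<Sum>b\<in>Basis. (v \<bullet> b) *\<^sub>R h b x)) (at x)"
proof -
  obtain r where r: "r > 0" "ball x r \<subseteq> S" using openE[OF assms(1,2)] by blast
  have sub: "y \<in> S" if "y \<in> ball x r" for y using r(2) that by blast
  have "\<exists>g. \<forall>y\<in>ball x r. (\<lambda>n. f n y) \<longlonglongrightarrow> g y \<and>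
      (g has_derivative (\<lambda>v. \<Sum>b\<in>Basis. (v \<bullet> b) *\<^sub>R h b y)) (at y within ball x r)"
  proof (rule has_derivative_sequence)
    show "(f n has_derivative (\<lambda>v. \<Sum>b\<in>Basis. (v \<bullet> b) *\<^sub>R partial b (f n) y)) (at y within ball x r)"
      if "y \<in> ball x r" for n y
      by (rule has_derivative_at_withinI[OF has_derivative_partials[OF assms(3)[OF sub[OF that]]]])
    show "\<forall>\<^sub>F n in sequentially. \<forall>y\<in>ball x r. \<forall>v.
        norm ((\<Sum>b\<in>Basis. (v \<bullet> b) *\<^sub>R partial b (f n) y) - (\<Sum>b\<in>Basis. (v \<bullet> b) *\<^sub>R h b y)) \<le> e * norm v"
      if "e > 0" for e
    proof -
      have "\<forall>\<^sub>F n in sequentially. \<forall>y\<in>S. dist (partial b (f n) y) (h b y) < e / DIM('a)"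
        if "b \<in> Basis" for b
        using assms(4)[OF that] \<open>e > 0\<close> by (simp add: uniform_limit_iff)
      then have "\<forall>\<^sub>F n in sequentially. \<forall>b\<in>Basis. \<forall>y\<in>S. dist (partial b (f n) y) (h b y) < e / DIM('a)"
        by (intro eventually_ball_finite) auto
      then show ?thesis
      proof eventually_elim
        case (elim n)
        show ?case
        proof (intro ballI allI)
          fix y v assume "y \<in> ball x r"
          then have "y \<in> S" by (rule sub)
          have "norm ((\<Sum>b\<in>Basis. (v \<bullet> b) *\<^sub>R partial b (f n) y) - (\<Sum>b\<in>Basis. (v \<bullet> b) *\<^sub>R h b y))
            = norm (\<Sum>b\<in>Basis. (v \<bullet> b) *\<^sub>R (partial b (f n) y - h b y))"
            by (simp add: sum_subtractf scaleR_diff_right)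
          also have "\<dots> \<le> (\<Sum>b\<in>(Basis::'a set). norm v * (e / DIM('a)))"
          proof (rule sum_norm_le)
            fix b :: 'a assume b: "b \<in> Basis"
            then have "norm (partial b (f n) y - h b y) \<le> e / DIM('a)"
              using elim \<open>y \<in> S\<close> by (metis dist_norm less_imp_le)
            then show "norm ((v \<bullet> b) *\<^sub>R (partial b (f n) y - h b y)) \<le> norm v * (e / DIM('a))"
              unfolding norm_scaleR real_norm_def
              by (intro mult_mono) (use Basis_le_norm[OF b, of v] in auto)
          qed
          finally show "norm ((\<Sum>b\<in>Basis. (v \<bullet> b) *\<^sub>R partial b (f n) y) - (\<Sum>b\<in>Basis. (v \<bullet> b) *\<^sub>R h b y)) \<le> e * norm v"
            by (simp add: mult.commute)
        qed
      qed
    qed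
    show "(\<lambda>n. f n x) \<longlonglongrightarrow> g x" by (rule assms(5)[OF assms(2)])
  qed (use r in simp_all)
  then obtain g' where g': "\<And>y. y \<in> ball x r \<Longrightarrow> (\<lambda>n. f n y) \<longlonglongrightarrow> g' y"
    "\<And>y. y \<in> ball x r \<Longrightarrow> (g' has_derivative (\<lambda>v. \<Sum>b\<in>Basis. (v \<bullet> b) *\<^sub>R h b y)) (at y within ball x r)"
    by blast
  have eq: "g' y = g y" if "y \<in> ball x r" for y
    by (rule LIMSEQ_unique[OF g'(1)[OF that] assms(5)[OF sub[OF that]]])
  have "x \<in> ball x r" using r(1) by simp
  then have "(g' has_derivative (\<lambda>v. \<Sum>b\<in>Basis. (v \<bullet> b) *\<^sub>R h b x)) (at x)"
    using g'(2)[of x] at_within_open[OF _ open_ball, of x x r] by simp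
  then show ?thesis
    by (rule has_derivative_transform_within_open[OF _ open_ball \<open>x \<in> ball x r\<close> eq])
qed

text \<open>Convergence of the derivatives is part of the conclusion because it is what later
  identifies the derivatives of a series term by term.\<close>

lemma Ck_on_uniform_limit:
  fixes f :: "nat \<Rightarrow> 'a::euclidean_space \<Rightarrow> 'b::banach"
  assumes "open S" "\<And>n. Ck_on k (f n) S"
    and "\<And>bs. set bs \<subseteq> Basis \<Longrightarrow> length bs \<le> k \<Longrightarrow> uniformly_convergent_on S (\<lambda>n. partials bs (f n))"
    and "\<And>x. x \<in> S \<Longrightarrow> (\<lambda>n. f n x) \<longlonglongrightarrow> g x"
  shows "Ck_on k g S \<and> (\<forall>bs. set bs \<subseteq> Basis \<longrightarrow> length bs \<le> k \<longrightarrow>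
    (\<forall>x\<in>S. (\<lambda>n. partials bs (f n) x) \<longlonglongrightarrow> partials bs g x))"
  using assms(2-)
proof (induction k arbitrary: f g)
  case 0
  have "uniformly_convergent_on S f" using "0.prems"(2)[of "[]"] by simp
  then obtain l where l: "uniform_limit S f l sequentially" by (auto simp: uniformly_convergent_on_def)
  then have "continuous_on S l"
    using "0.prems"(1) by (intro uniform_limit_theorem[OF _ l]) auto
  moreover have "l x = g x" if "x \<in> S" for x
    using tendsto_uniform_limitI[OF l that] "0.prems"(3)[OF that] LIMSEQ_unique by blast
  ultimately show ?case using "0.prems"(3) by (auto cong: continuous_on_cong)
next
  case (Suc k)
  have "\<exists>h. \<forall>b\<in>Basis. uniform_limit S (\<lambda>n. partial b (f n)) (h b) sequentially"
    using Suc.prems(2)[of "[b]" for b] by (intro bchoice) (auto simp: uniformly_convergent_on_def)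
  then obtain h where h: "\<And>b. b \<in> Basis \<Longrightarrow> uniform_limit S (\<lambda>n. partial b (f n)) (h b) sequentially"
    by blast
  have gd: "(g has_derivative (\<lambda>v. \<Sum>b\<in>Basis. (v \<bullet> b) *\<^sub>R h b x)) (at x)" if "x \<in> S" for x
    using Suc.prems(1) by (intro has_derivative_limit_partials[OF assms(1) that _ h Suc.prems(3)]) auto
  have pg: "partial b g x = h b x" if "x \<in> S" "b \<in> Basis" for x b
    using partial_eq[OF gd[OF that(1)], of b] sum_Basis_inner_scaleR[OF that(2)] by simp
  have IH: "Ck_on k (partial b g) S \<and> (\<forall>bs. set bs \<subseteq> Basis \<longrightarrow> length bs \<le> k \<longrightarrow>
    (\<forall>x\<in>S. (\<lambda>n. partials bs (partial b (f n)) x) \<longlonglongrightarrow> partials bs (partial b g) x))" if b: "b \<in> Basis" for b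
  proof (rule Suc.IH)
    show "Ck_on k (partial b (f n)) S" for n using Suc.prems(1) b by simp
    show "uniformly_convergent_on S (\<lambda>n. partials bs (partial b (f n)))"
      if "set bs \<subseteq> Basis" "length bs \<le> k" for bs
      using Suc.prems(2)[of "bs @ [b]"] that b by simp
    show "(\<lambda>n. partial b (f n) x) \<longlonglongrightarrow> partial b g x" if "x \<in> S" for x
      using tendsto_uniform_limitI[OF h[OF b] that] pg[OF that b] by simp
  qed
  have "g differentiable (at x)" if "x \<in> S" for x
    using gd[OF that] by (rule differentiableI)
  then have "Ck_on (Suc k) g S" using IH by simp
  moreover have "(\<lambda>n. partials bs (f n) x) \<longlonglongrightarrow> partials bs g x"
    if "set bs \<subseteq> Basis" "length bs \<le> Suc k" "x \<in> S" for bs x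
  \<comment> \<open>Removing the last entry, the derivative taken first, leaves derivatives of
    \<open>partial b (f n)\<close>, which the induction hypothesis covers.\<close>
  proof (cases bs rule: rev_cases)
    case Nil
    then show ?thesis using Suc.prems(3) that by simp
  next
    case (snoc bs' b)
    then show ?thesis using IH[of b] that by simp
  qed
  ultimately show ?case by blast
qed

lemma Ck_on_series:
  fixes f :: "nat \<Rightarrow> 'a::euclidean_space \<Rightarrow> 'b::banach"
  assumes "open S" "\<And>n. Ck_on k (f n) S" "summable K"
    and K: "\<And>n bs x. set bs \<subseteq> Basis \<Longrightarrow> length bs \<le> k \<Longrightarrow> x \<in> S \<Longrightarrow> norm (partials bs (f n) x) \<le> K n"
  shows "Ck_on k (\<lambda>x. \<Sum>n. f n x) S"
    and "set bs \<subseteq> Basis \<Longrightarrow> length bs \<le> k \<Longrightarrow> x \<in> S \<Longrightarrow>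
      (\<lambda>n. partials bs (f n) x) sums partials bs (\<lambda>x. \<Sum>n. f n x) x"
proof -
  have eq: "partials bs (\<lambda>x. \<Sum>i<n. f i x) x = (\<Sum>i<n. partials bs (f i) x)"
    if "set bs \<subseteq> Basis" "length bs \<le> k" "x \<in> S" for bs n x
    by (rule partials_sum[OF assms(1)]) (use that assms(2) Ck_on_mono in blast)+
  have lim: "uniform_limit S (\<lambda>n x. \<Sum>i<n. partials bs (f i) x) (\<lambda>x. \<Sum>i. partials bs (f i) x) sequentially"
    if "set bs \<subseteq> Basis" "length bs \<le> k" for bs
    by (rule Weierstrass_m_test[OF _ assms(3)]) (rule K[OF that])
  have *: "Ck_on k (\<lambda>x. \<Sum>n. f n x) S \<and> (\<forall>bs. set bs \<subseteq> Basis \<longrightarrow> length bs \<le> k \<longrightarrow>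
    (\<forall>x\<in>S. (\<lambda>n. partials bs (\<lambda>x. \<Sum>i<n. f i x) x) \<longlonglongrightarrow> partials bs (\<lambda>x. \<Sum>n. f n x) x))"
  proof (rule Ck_on_uniform_limit[OF assms(1)])
    show "Ck_on k (\<lambda>x. \<Sum>i<n. f i x) S" for n
      by (rule Ck_on_sum[OF assms(1) assms(2)])
    show "uniformly_convergent_on S (\<lambda>n. partials bs (\<lambda>x. \<Sum>i<n. f i x))"
      if "set bs \<subseteq> Basis" "length bs \<le> k" for bs
      unfolding uniformly_convergent_on_def
      by (rule exI, rule uniform_limit_cong'[THEN iffD2, OF eq[OF that] refl lim[OF that]])
    show "(\<lambda>n. \<Sum>i<n. f i x) \<longlonglongrightarrow> (\<Sum>n. f n x)" if "x \<in> S" for x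
      using tendsto_uniform_limitI[OF lim[of "[]"] that] by simp
  qed
  then show "Ck_on k (\<lambda>x. \<Sum>n. f n x) S" by blast
  show "(\<lambda>n. partials bs (f n) x) sums partials bs (\<lambda>x. \<Sum>n. f n x) x"
    if "set bs \<subseteq> Basis" "length bs \<le> k" "x \<in> S"
    using *[THEN conjunct2, rule_format, OF that] unfolding sums_def eq[OF that] .
qed

section \<open>Multi-indices and lists of directions\<close>

lemma ex_list_count_list:
  fixes \<alpha> :: "'d::finite \<Rightarrow> nat"
  shows "\<exists>is. \<forall>i. count_list is i = \<alpha> i"
proof -
  obtain js where js: "mset js = (\<Sum>i\<in>UNIV. replicate_mset (\<alpha> i) i)"
    using ex_mset by blast
  have "count_list js i = \<alpha> i" for i
  proof -
    have "count_list js i = count (\<Sum>i\<in>UNIV. replicate_mset (\<alpha> i) i) i"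
      by (simp flip: js add: count_mset)
    also have "\<dots> = (\<Sum>j\<in>UNIV. if j = i then \<alpha> i else 0)"
      unfolding count_sum by (intro sum.cong) auto
    finally show ?thesis by simp
  qed
  then show ?thesis by blast
qed

text \<open>\<open>mderiv\<close> orders the directions by an arbitrary choice. Only the multiset of
  the chosen list is recorded, which suffices because \<open>partials_perm\<close> makes the order
  irrelevant.\<close>

lemma mderiv_eq_partials:
  fixes \<phi> :: "real ^ 'd::finite \<Rightarrow> 'b::real_normed_vector"
  obtains bs where "set bs \<subseteq> Basis" "length bs = mlength \<alpha>" "mderiv \<alpha> \<phi> = partials bs \<phi>"
    "\<And>is. \<forall>i. count_list is i = \<alpha> i \<Longrightarrow> mset bs = mset (map (\<lambda>i. axis i 1) is)"
proof -
  define js where "js = (SOME is. \<forall>i. count_list is i = \<alpha> i)"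
  have js: "\<forall>i. count_list js i = \<alpha> i"
    unfolding js_def by (rule someI_ex[OF ex_list_count_list])
  define bs :: "(real ^ 'd) list" where "bs = map (\<lambda>i. axis i 1) js"
  show ?thesis
  proof
    show "set bs \<subseteq> Basis" by (auto simp: bs_def Basis_vec_def)
    show "length bs = mlength \<alpha>"
      using sum_count_set[of js UNIV] js by (simp add: bs_def mlength_def)
    show "mderiv \<alpha> \<phi> = partials bs \<phi>"
      by (simp add: mderiv_def bs_def js_def foldr_map o_def)
    show "mset bs = mset (map (\<lambda>i. axis i 1) is)" if "\<forall>i. count_list is i = \<alpha> i" for "is"
    proof -
      have "mset is = mset js"
        using that js by (intro multiset_eqI) (simp add: count_mset)
      then show ?thesis by (simp add: bs_def)
    qed
  qed
qed

lemma partials_eq_mderiv: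
  fixes \<phi> :: "real ^ 'd::finite \<Rightarrow> 'b::real_normed_vector"
  assumes "open S" "x \<in> S" "set bs \<subseteq> Basis" "Ck_on (length bs) \<phi> S"
  obtains \<alpha> where "mlength \<alpha> = length bs" "mderiv \<alpha> \<phi> x = partials bs \<phi> x"
proof -
  have "\<forall>b\<in>set bs. \<exists>i. b = axis i 1" using assms(3) by (auto simp: Basis_vec_def)
  then obtain f where f: "\<And>b. b \<in> set bs \<Longrightarrow> b = axis (f b) 1" by metis
  define js where "js = map f bs"
  have bs: "bs = map (\<lambda>i. axis i 1) js"
    using f by (simp add: js_def map_idI)
  obtain cs where cs: "set cs \<subseteq> Basis" "length cs = mlength (count_list js)" "mderiv (count_list js) \<phi> = partials cs \<phi>"
    "mset cs = mset (map (\<lambda>i. axis i 1) js)"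
    using mderiv_eq_partials[of "count_list js" \<phi>] by (metis (mono_tags))
  show ?thesis
  proof
    show "mlength (count_list js) = length bs"
      using cs(2,4) bs by (metis size_mset)
    show "mderiv (count_list js) \<phi> x = partials bs \<phi> x"
      unfolding cs(3) using cs(4) bs by (intro partials_perm[OF assms(1,4,3) _ assms(2), symmetric]) simp
  qed
qed

section \<open>Functions on a product with the real line\<close>

lemma Basis_pair [simp]: "b \<in> Basis \<Longrightarrow> (b, 0) \<in> Basis" "(0, 1::real) \<in> Basis"
  by (simp_all add: Basis_prod_def)

lemma Basis_pair_cases:
  assumes "(b :: 'a::euclidean_space \<times> real) \<in> Basis"
  obtains c where "b = (c, 0)" "c \<in> Basis" | "b = (0, 1)"
  using assms by (auto simp: Basis_prod_def)

lemma sum_Basis_pair: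
  "(\<Sum>b\<in>(Basis :: ('a::euclidean_space \<times> real) set). f b) = (\<Sum>b\<in>Basis. f (b, 0)) + f (0, 1)"
proof -
  have "inj_on (\<lambda>u::'a. (u, 0::real)) Basis" by (auto intro!: inj_onI)
  then show ?thesis
    unfolding Basis_prod_def by (subst sum.union_disjoint) (auto simp: sum.reindex)
qed

lemma tensor_has_derivative:
  fixes a :: "'a::euclidean_space \<Rightarrow> 'b::real_normed_vector"
  assumes "(E has_real_derivative E') (at (snd z))" "a differentiable (at (fst z))"
  shows "((\<lambda>z. E (snd z) *\<^sub>R a (fst z)) has_derivative
    (\<lambda>h. E (snd z) *\<^sub>R frechet_derivative a (at (fst z)) (fst h) + (E' * snd h) *\<^sub>R a (fst z))) (at z)"
proof -
  have 1: "((\<lambda>z. E (snd z)) has_derivative (\<lambda>h. E' * snd h)) (at z)"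
    using assms(1) unfolding has_field_derivative_def
    by (rule has_derivative_compose[rotated]) (rule has_derivative_snd[OF has_derivative_ident])
  have 2: "((\<lambda>z. a (fst z)) has_derivative (\<lambda>h. frechet_derivative a (at (fst z)) (fst h))) (at z)"
    using assms(2) unfolding frechet_derivative_works
    by (rule has_derivative_compose[rotated]) (rule has_derivative_fst[OF has_derivative_ident])
  show ?thesis by (rule has_derivative_scaleR[OF 1 2])
qed

lemma partial_tensor:
  fixes a :: "'a::euclidean_space \<Rightarrow> 'b::real_normed_vector"
  assumes "(E has_real_derivative E') (at (snd z))" "a differentiable (at (fst z))"
  shows "partial (b, 0) (\<lambda>z. E (snd z) *\<^sub>R a (fst z)) z = E (snd z) *\<^sub>R partial b a (fst z)"
    and "partial (0, 1) (\<lambda>z. E (snd z) *\<^sub>R a (fst z)) z = E' *\<^sub>R a (fst z)"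
proof -
  have "linear (frechet_derivative a (at (fst z)))"
    using assms(2) by (rule linear_frechet_derivative)
  then show "partial (b, 0) (\<lambda>z. E (snd z) *\<^sub>R a (fst z)) z = E (snd z) *\<^sub>R partial b a (fst z)"
    "partial (0, 1) (\<lambda>z. E (snd z) *\<^sub>R a (fst z)) z = E' *\<^sub>R a (fst z)"
    using partial_eq[OF tensor_has_derivative[OF assms]] by (simp_all add: partial_def linear_0)
qed

text \<open>The chain \<open>E 0\<close>, \<open>E 1\<close>, ... of successive derivatives stands
  in for a smoothness predicate on the line, so that the y-derivatives come out in closed
  form.\<close>

lemma Ck_on_tensor:
  fixes a :: "'a::euclidean_space \<Rightarrow> 'b::real_normed_vector"
  assumes "open S" "\<And>i y. i < k \<Longrightarrow> (E i has_real_derivative E (Suc i) y) (at y)"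
    and "continuous_on UNIV (E k)" "Ck_on k a S"
  shows "Ck_on k (\<lambda>z. E 0 (snd z) *\<^sub>R a (fst z)) (S \<times> UNIV)"
  using assms(2-)
proof (induction k arbitrary: E a)
  case 0
  show ?case
    unfolding Ck_on.simps
    by (intro continuous_intros continuous_on_compose2[OF 0(2)] continuous_on_compose2[OF 0(3)[unfolded Ck_on.simps]]) auto
next
  case (Suc k)
  have op: "open (S \<times> (UNIV :: real set))" using assms(1) by (simp add: open_Times)
  have a: "a differentiable (at x)" if "x \<in> S" for x using Suc.prems(3) that by simp
  have E: "(E 0 has_real_derivative E 1 y) (at y)" for y
    using Suc.prems(1)[of 0] by simp
  have "(\<lambda>z. E 0 (snd z) *\<^sub>R a (fst z)) differentiable (at z)" if "z \<in> S \<times> UNIV" for z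
    using tensor_has_derivative[OF E a, of z] that by (intro differentiableI) (auto simp: mem_Times_iff)
  moreover have "Ck_on k (partial b (\<lambda>z. E 0 (snd z) *\<^sub>R a (fst z))) (S \<times> UNIV)" if b: "b \<in> Basis" for b
    using b
  proof (cases b rule: Basis_pair_cases)
    case (1 c)
    have "continuous_on UNIV (E k)"
      by (rule DERIV_continuous_on[OF Suc.prems(1)]) simp
    then have "Ck_on k (\<lambda>z. E 0 (snd z) *\<^sub>R partial c a (fst z)) (S \<times> UNIV)"
      using Suc.prems 1 by (intro Suc.IH) auto
    then show ?thesis
      by (rule Ck_on_cong[OF op, rotated]) (auto simp: 1 partial_tensor(1)[OF E a])
  next
    case 2
    have "Ck_on k (\<lambda>z. E (Suc 0) (snd z) *\<^sub>R a (fst z)) (S \<times> UNIV)"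
      using Suc.prems by (intro Suc.IH Ck_on_SucD[OF Suc.prems(3)]) auto
    then show ?thesis
      by (rule Ck_on_cong[OF op, rotated]) (auto simp: 2 partial_tensor(2)[OF E a])
  qed
  ultimately show ?case by simp
qed

text \<open>The factors depend on different variables, so every derivative falls on exactly one of
  them and no Leibniz sum arises.\<close>

lemma partials_tensor:
  fixes a :: "'a::euclidean_space \<Rightarrow> 'b::real_normed_vector"
  assumes "open S" "\<And>i y. i < k \<Longrightarrow> (E i has_real_derivative E (Suc i) y) (at y)"
    and "Ck_on k a S" "set bs \<subseteq> Basis" "length bs \<le> k"
  shows "\<exists>i cs. set cs \<subseteq> Basis \<and> i + length cs = length bs \<and>
    (\<forall>z \<in> S \<times> UNIV. partials bs (\<lambda>z. E 0 (snd z) *\<^sub>R a (fst z)) z = E i (snd z) *\<^sub>R partials cs a (fst z))"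
  using assms(4,5)
proof (induction bs)
  case Nil
  show ?case by (intro exI[of _ 0] exI[of _ "[]"]) simp
next
  case (Cons b bs)
  then obtain i cs where ics: "set cs \<subseteq> Basis" "i + length cs = length bs"
    "\<And>z. z \<in> S \<times> UNIV \<Longrightarrow> partials bs (\<lambda>z. E 0 (snd z) *\<^sub>R a (fst z)) z = E i (snd z) *\<^sub>R partials cs a (fst z)"
    by auto
  have op: "open (S \<times> (UNIV :: real set))" using assms(1) by (simp add: open_Times)
  have eq: "partials (b # bs) (\<lambda>z. E 0 (snd z) *\<^sub>R a (fst z)) z
      = partial b (\<lambda>z. E i (snd z) *\<^sub>R partials cs a (fst z)) z" if "z \<in> S \<times> UNIV" for z
    using partial_cong_open[OF op that ics(3)] by simp
  have a: "partials cs a differentiable (at x)" if "x \<in> S" for x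
  proof -
    have "Ck_on (1 + length cs) a S"
      using assms(3) by (rule Ck_on_mono) (use Cons.prems ics in simp)
    then have "Ck_on 1 (partials cs a) S"
      by (rule Ck_on_partials[OF ics(1)])
    then show ?thesis using that by simp
  qed
  have E: "(E i has_real_derivative E (Suc i) y) (at y)" for y
    using assms(2) Cons.prems ics(2) by simp
  from Cons.prems have "b \<in> Basis" by simp
  then show ?case
  proof (cases b rule: Basis_pair_cases)
    case (1 c)
    show ?thesis
      by (intro exI[of _ i] exI[of _ "c # cs"])
        (use ics 1 eq partial_tensor(1)[OF E a] in auto)
  next
    case 2
    show ?thesis
      by (intro exI[of _ "Suc i"] exI[of _ "cs"])
        (use ics 2 eq partial_tensor(2)[OF E a] in auto)
  qed
qed

lemma laplacian_tensor:
  fixes a :: "'a::euclidean_space \<Rightarrow> 'b::real_normed_vector"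
  assumes "open S" "\<And>y. (E has_real_derivative E1 y) (at y)" "\<And>y. (E1 has_real_derivative E2 y) (at y)"
    and "Ck_on 2 a S" "fst z \<in> S"
  shows "laplacian (\<lambda>z. E (snd z) *\<^sub>R a (fst z)) z = E2 (snd z) *\<^sub>R a (fst z) + E (snd z) *\<^sub>R laplacian a (fst z)"
proof -
  have op: "open (S \<times> (UNIV :: real set))" using assms(1) by (simp add: open_Times)
  have z: "z \<in> S \<times> UNIV" using assms(5) by (cases z) auto
  have a: "a differentiable (at x)" "b \<in> Basis \<Longrightarrow> partial b a differentiable (at x)" if "x \<in> S" for x b
    using assms(4) that by (simp_all add: numeral_2_eq_2)
  have "partial (b, 0) (partial (b, 0) (\<lambda>z. E (snd z) *\<^sub>R a (fst z))) z = E (snd z) *\<^sub>R partial b (partial b a) (fst z)"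
    if "b \<in> Basis" for b
  proof -
    have "partial (b, 0) (partial (b, 0) (\<lambda>z. E (snd z) *\<^sub>R a (fst z))) z
        = partial (b, 0) (\<lambda>z. E (snd z) *\<^sub>R partial b a (fst z)) z"
      by (rule partial_cong_open[OF op z]) (auto intro!: partial_tensor assms a)
    then show ?thesis using partial_tensor(1)[OF assms(2) a(2)[OF assms(5) that]] by simp
  qed
  moreover have "partial (0, 1) (partial (0, 1) (\<lambda>z. E (snd z) *\<^sub>R a (fst z))) z = E2 (snd z) *\<^sub>R a (fst z)"
  proof -
    have "partial (0, 1) (partial (0, 1) (\<lambda>z. E (snd z) *\<^sub>R a (fst z))) z
        = partial (0, 1) (\<lambda>z. E1 (snd z) *\<^sub>R a (fst z)) z"
      by (rule partial_cong_open[OF op z]) (auto intro!: partial_tensor assms a)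
    then show ?thesis using partial_tensor(2)[OF assms(3) a(1)[OF assms(5)]] by simp
  qed
  ultimately show ?thesis
    unfolding laplacian_def sum_Basis_pair by (simp add: scaleR_sum_right)
qed

section \<open>Traces on horizontal slices and reflection in y\<close>

lemma partial_slice:
  fixes F :: "'a::euclidean_space \<times> real \<Rightarrow> 'b::real_normed_vector"
  assumes "F differentiable (at (x, c))"
  shows "(\<lambda>x. F (x, c)) differentiable (at x)" "partial b (\<lambda>x. F (x, c)) x = partial (b, 0) F (x, c)"
proof -
  obtain F' where F': "(F has_derivative F') (at (x, c))"
    using assms by (auto simp: differentiable_def)
  have "((\<lambda>x. F (x, c)) has_derivative (\<lambda>h. F' (h, 0))) (at x)"
    by (rule has_derivative_compose[of "\<lambda>x. (x, c)", OF _ F']) (auto intro!: derivative_eq_intros)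
  then show "(\<lambda>x. F (x, c)) differentiable (at x)" "partial b (\<lambda>x. F (x, c)) x = partial (b, 0) F (x, c)"
    by (auto simp: differentiable_def partial_eq partial_eq[OF F'])
qed

lemma Ck_on_slice:
  fixes F :: "'a::euclidean_space \<times> real \<Rightarrow> 'b::real_normed_vector"
  assumes "Ck_on k F UNIV"
  shows "Ck_on k (\<lambda>x. F (x, c)) UNIV"
  using assms
proof (induction k arbitrary: F)
  case 0
  then show ?case by (auto intro!: continuous_intros continuous_on_compose2[of UNIV F])
next
  case (Suc k)
  have "partial b (\<lambda>x. F (x, c)) = (\<lambda>x. partial (b, 0) F (x, c))" for b
    using Suc.prems by (auto intro: partial_slice(2))
  then show ?case using Suc by (auto intro: partial_slice(1))
qed

lemma partials_slice:
  fixes F :: "'a::euclidean_space \<times> real \<Rightarrow> 'b::real_normed_vector"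
  assumes "Ck_on (length bs) F UNIV" "set bs \<subseteq> Basis"
  shows "partials bs (\<lambda>x. F (x, c)) x = partials (map (\<lambda>b. (b, 0)) bs) F (x, c)"
  using assms
proof (induction bs arbitrary: x)
  case (Cons b bs)
  have "partials bs (\<lambda>x. F (x, c)) = (\<lambda>x. partials (map (\<lambda>b. (b, 0)) bs) F (x, c))"
    using Cons.IH Cons.prems Ck_on_SucD[of "length bs" F UNIV] by (intro ext) (simp del: Ck_on.simps)
  moreover have "Ck_on 1 (partials (map (\<lambda>b. (b, 0)) bs) F) UNIV"
    using Cons.prems by (intro Ck_on_partials) auto
  ultimately show ?case by (simp add: partial_slice(2))
qed simp

lemma partial_reflect:
  fixes F :: "'a::euclidean_space \<times> real \<Rightarrow> 'b::real_normed_vector"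
  assumes "F differentiable (at (fst z, - snd z))"
  shows "(\<lambda>z. F (fst z, - snd z)) differentiable (at z)"
    and "partial (b, 0) (\<lambda>z. F (fst z, - snd z)) z = partial (b, 0) F (fst z, - snd z)"
    and "partial (0, 1) (\<lambda>z. F (fst z, - snd z)) z = - partial (0, 1) F (fst z, - snd z)"
proof -
  obtain F' where F': "(F has_derivative F') (at (fst z, - snd z))"
    using assms by (auto simp: differentiable_def)
  have neg: "F' (- v) = - F' v" for v
    using F' by (intro linear_neg bounded_linear.linear has_derivative_bounded_linear)
  have *: "((\<lambda>z. F (fst z, - snd z)) has_derivative (\<lambda>h. F' (fst h, - snd h))) (at z)"
    by (rule has_derivative_compose[of "\<lambda>z. (fst z, - snd z)", OF _ F']) (auto intro!: derivative_eq_intros)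
  then show "(\<lambda>z. F (fst z, - snd z)) differentiable (at z)" by (rule differentiableI)
  show "partial (b, 0) (\<lambda>z. F (fst z, - snd z)) z = partial (b, 0) F (fst z, - snd z)"
    by (simp add: partial_eq[OF *] partial_eq[OF F'])
  show "partial (0, 1) (\<lambda>z. F (fst z, - snd z)) z = - partial (0, 1) F (fst z, - snd z)"
    using neg[of "(0, 1)"] by (simp add: partial_eq[OF *] partial_eq[OF F'])
qed

lemma Ck_on_reflect:
  fixes F :: "'a::euclidean_space \<times> real \<Rightarrow> 'b::real_normed_vector"
  assumes "open S" "\<And>z. z \<in> S \<Longrightarrow> (fst z, - snd z) \<in> T" "Ck_on k F T"
  shows "Ck_on k (\<lambda>z. F (fst z, - snd z)) S"
  using assms(3)
proof (induction k arbitrary: F)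
  case 0
  then show ?case
    using assms(2) by (auto intro!: continuous_intros continuous_on_compose2[of T F])
next
  case (Suc k)
  have dF: "F differentiable (at (fst z, - snd z))" if "z \<in> S" for z
    using Suc.prems assms(2)[OF that] by simp
  have "Ck_on k (partial b (\<lambda>z. F (fst z, - snd z))) S" if b: "b \<in> Basis" for b
    using b
  proof (cases b rule: Basis_pair_cases)
    case (1 c)
    have "Ck_on k (\<lambda>z. partial b F (fst z, - snd z)) S"
      using Suc b by simp
    then show ?thesis
      by (rule Ck_on_cong[OF assms(1), rotated]) (simp add: 1 partial_reflect(2)[OF dF])
  next
    case 2
    have "Ck_on k (\<lambda>z. - partial b F (fst z, - snd z)) S"
      using Suc b by (intro Ck_on_minus assms) simp
    then show ?thesis
      by (rule Ck_on_cong[OF assms(1), rotated]) (simp add: 2 partial_reflect(3)[OF dF])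
  qed
  then show ?case using partial_reflect(1)[OF dF] by simp
qed

lemma laplacian_reflect:
  fixes F :: "'a::euclidean_space \<times> real \<Rightarrow> 'b::real_normed_vector"
  assumes "open T" "Ck_on 2 F T" "(fst z, - snd z) \<in> T"
  shows "laplacian (\<lambda>z. F (fst z, - snd z)) z = laplacian F (fst z, - snd z)"
proof -
  let ?S = "(\<lambda>z. (fst z, - snd z)) -` T"
  have op: "open ?S"
    by (intro open_vimage assms continuous_intros)
  have z: "z \<in> ?S" using assms(3) by simp
  have dF: "F differentiable (at w)" "b \<in> Basis \<Longrightarrow> partial b F differentiable (at w)" if "w \<in> T" for w b
    using assms(2) that by (simp_all add: numeral_2_eq_2)
  have "partial (b, 0) (partial (b, 0) (\<lambda>z. F (fst z, - snd z))) z = partial (b, 0) (partial (b, 0) F) (fst z, - snd z)"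
    if "b \<in> Basis" for b
  proof -
    have "partial (b, 0) (partial (b, 0) (\<lambda>z. F (fst z, - snd z))) z
      = partial (b, 0) (\<lambda>z. partial (b, 0) F (fst z, - snd z)) z"
      by (rule partial_cong_open[OF op z]) (auto intro!: partial_reflect dF)
    then show ?thesis using partial_reflect(2)[OF dF(2)[OF assms(3), of "(b, 0)"]] that by simp
  qed
  moreover have "partial (0, 1) (partial (0, 1) (\<lambda>z. F (fst z, - snd z))) z = partial (0, 1) (partial (0, 1) F) (fst z, - snd z)"
  proof -
    have "partial (0, 1) (partial (0, 1) (\<lambda>z. F (fst z, - snd z))) z
      = partial (0, 1) (\<lambda>z. - partial (0, 1) F (fst z, - snd z)) z"
      by (rule partial_cong_open[OF op z]) (auto intro!: partial_reflect dF)
    also have "\<dots> = - partial (0, 1) (\<lambda>z. partial (0, 1) F (fst z, - snd z)) z"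
      using partial_reflect(1)[OF dF(2)[OF assms(3), of "(0, 1)"]]
      by (intro partial_linear[OF bounded_linear_minus[OF bounded_linear_ident]]) simp
    finally show ?thesis using partial_reflect(3)[OF dF(2)[OF assms(3), of "(0, 1)"]] by simp
  qed
  ultimately show ?thesis
    unfolding laplacian_def sum_Basis_pair by simp
qed

section \<open>Mollifiers\<close>

text \<open>Signed kernels are included so that the partial derivatives of a mollifying kernel are
  kernels too.\<close>

definition kernel :: "('a::euclidean_space \<Rightarrow> real) \<Rightarrow> bool" where
  "kernel k \<longleftrightarrow> continuous_on UNIV k \<and> (\<forall>w. 1 \<le> norm w \<longrightarrow> k w = 0)"

text \<open>A weighted average over a ball, integrated over the surrounding cube because kernels
  vanish off the unit ball. Scaling the argument of \<open>f\<close> instead of the kernel keeps r =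
  0 meaningful and makes the dependence on r differentiable for smooth \<open>f\<close>.\<close>

definition cconv :: "('a::euclidean_space \<Rightarrow> real) \<Rightarrow> real \<Rightarrow> ('a \<Rightarrow> 'b::euclidean_space) \<Rightarrow> 'a \<Rightarrow> 'b" where
  "cconv k r f z = integral (cbox (- One) One) (\<lambda>w. k w *\<^sub>R f (z + r *\<^sub>R w))"

lemma cball_subset_cbox_One: "0 \<le> r \<Longrightarrow> cball z r \<subseteq> cbox (z - r *\<^sub>R One) (z + r *\<^sub>R One)"
proof
  fix x :: 'a assume r: "0 \<le> r" and x: "x \<in> cball z r"
  have "\<bar>(x - z) \<bullet> b\<bar> \<le> r" if "b \<in> Basis" for b
    using Basis_le_norm[OF that, of "x - z"] x by (simp add: dist_norm norm_minus_commute)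
  then show "x \<in> cbox (z - r *\<^sub>R One) (z + r *\<^sub>R One)"
    by (force simp: mem_box inner_diff_left inner_add_left abs_le_iff)
qed

lemma kernel_continuous: "kernel k \<Longrightarrow> continuous_on S k"
  using continuous_on_subset[of UNIV k S] by (simp add: kernel_def)

lemma continuous_on_subset_UNIV: "continuous_on UNIV f \<Longrightarrow> continuous_on S f"
  by (erule continuous_on_subset) simp

lemma continuous_on_affine_compose:
  assumes "continuous_on UNIV f" "continuous_on S g"
  shows "continuous_on S (\<lambda>x. f (g x))"
  by (rule continuous_on_compose2[OF assms]) simp

lemma continuous_on_cconv_integrand:
  fixes f :: "'a::euclidean_space \<Rightarrow> 'b::real_normed_vector"
  assumes "kernel k" "continuous_on UNIV f"
  shows "continuous_on S (\<lambda>w. k w *\<^sub>R f (z + r *\<^sub>R w))"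
  by (intro continuous_intros kernel_continuous[OF assms(1)] continuous_on_affine_compose[OF assms(2)])

lemma cconv_integrable:
  fixes f :: "'a::euclidean_space \<Rightarrow> 'b::euclidean_space"
  assumes "kernel k" "continuous_on UNIV f"
  shows "(\<lambda>w. k w *\<^sub>R f (z + r *\<^sub>R w)) integrable_on cbox a b"
  by (intro integrable_continuous continuous_on_cconv_integrand assms)

lemma norm_cconv_le:
  fixes k :: "'a::euclidean_space \<Rightarrow> real" and f :: "'a \<Rightarrow> 'b::euclidean_space"
  assumes "kernel k" "continuous_on UNIV f" "0 \<le> r" "\<And>w. w \<in> cball z r \<Longrightarrow> norm (f w) \<le> e"
  shows "norm (cconv k r f z) \<le> integral (cbox (- One) One) (\<lambda>w. \<bar>k w\<bar>) * e"
proof -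
  have "norm (cconv k r f z) \<le> integral (cbox (- One) One) (\<lambda>w. \<bar>k w\<bar> * e)"
    unfolding cconv_def
  proof (rule integral_norm_bound_integral[OF cconv_integrable[OF assms(1,2)]])
    show "(\<lambda>w. \<bar>k w\<bar> * e) integrable_on cbox (- One) One"
      by (intro integrable_continuous continuous_intros kernel_continuous[OF assms(1)])
    show "norm (k w *\<^sub>R f (z + r *\<^sub>R w)) \<le> \<bar>k w\<bar> * e" for w
    proof (cases "norm w \<le> 1")
      case True
      then have "norm (f (z + r *\<^sub>R w)) \<le> e"
        using assms(3) by (intro assms(4)) (simp add: dist_norm mult_left_le)
      then show ?thesis by (simp add: mult_left_mono)
    next
      case False
      then show ?thesis using assms(1) by (simp add: kernel_def)
    qed
  qed
  then show ?thesis by simp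
qed

lemma continuous_on_cconv:
  assumes "kernel k" "continuous_on UNIV f"
  shows "continuous_on UNIV (cconv k r f)"
  unfolding cconv_def[abs_def]
  by (intro integral_continuous_on_param)
    (auto simp: split_beta intro!: continuous_intros continuous_on_affine_compose[OF assms(2)]
      continuous_on_affine_compose[OF kernel_continuous[OF assms(1)]])

lemma cconv_diff:
  assumes "kernel k" "continuous_on UNIV f" "continuous_on UNIV g"
  shows "cconv k r (\<lambda>w. f w - g w) z = cconv k r f z - cconv k r g z"
  unfolding cconv_def
  by (subst integral_diff[symmetric]) (auto intro!: cconv_integrable assms simp: scaleR_diff_right)

lemma cconv_sum:
  assumes "kernel k" "\<And>i. i \<in> I \<Longrightarrow> continuous_on UNIV (f i)" "finite I"
  shows "cconv k r (\<lambda>w. \<Sum>i\<in>I. f i w) z = (\<Sum>i\<in>I. cconv k r (f i) z)"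
  unfolding cconv_def
  by (subst integral_sum[symmetric]) (auto intro!: cconv_integrable assms simp: scaleR_sum_right)

section \<open>Differentiation under the integral sign\<close>

lemma blinfun_sum_apply:
  fixes h :: "'a::euclidean_space \<Rightarrow> 'b::real_normed_vector"
  shows "blinfun_apply (\<Sum>b\<in>Basis. blinfun_scaleR_left (h b) o\<^sub>L blinfun_inner_left b) v = (\<Sum>b\<in>Basis. (v \<bullet> b) *\<^sub>R h b)"
  by (simp add: blinfun.sum_left)

lemma continuous_on_blinfun_sum:
  fixes h :: "'c::topological_space \<Rightarrow> 'a::euclidean_space \<Rightarrow> 'b::real_normed_vector"
  assumes "\<And>b. b \<in> Basis \<Longrightarrow> continuous_on S (\<lambda>x. h x b)"
  shows "continuous_on S (\<lambda>x. \<Sum>b\<in>Basis. blinfun_scaleR_left (h x b) o\<^sub>L blinfun_inner_left b)"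
  by (intro continuous_intros bounded_linear.continuous_on[OF bounded_linear_blinfun_scaleR_left] assms)

text \<open>The Leibniz rule takes derivatives valued in bounded linear maps: the coordinate form is
  packed into such a map as a sum of rank-one operators and unpacked after integration.\<close>

lemma leibniz_partials:
  fixes f :: "'a::euclidean_space \<Rightarrow> 'c::euclidean_space \<Rightarrow> 'b::euclidean_space"
  assumes "\<And>x t. x \<in> U \<Longrightarrow> t \<in> cbox p q \<Longrightarrow>
      ((\<lambda>x. f x t) has_derivative (\<lambda>v. \<Sum>b\<in>Basis. (v \<bullet> b) *\<^sub>R h b x t)) (at x)"
    and "\<And>x. x \<in> U \<Longrightarrow> f x integrable_on cbox p q"
    and h: "\<And>b. b \<in> Basis \<Longrightarrow> continuous_on UNIV (\<lambda>(x, t). h b x t)"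
    and "open U" "convex U" "x0 \<in> U"
  shows "((\<lambda>x. integral (cbox p q) (f x)) has_derivative
    (\<lambda>v. \<Sum>b\<in>Basis. (v \<bullet> b) *\<^sub>R integral (cbox p q) (h b x0))) (at x0)"
proof -
  let ?fx = "\<lambda>x t. \<Sum>b\<in>Basis. blinfun_scaleR_left (h b x t) o\<^sub>L blinfun_inner_left b"
  have hc: "continuous_on (cbox p q) (h b x0)" if "b \<in> Basis" for b
    using continuous_on_affine_compose[OF h[OF that], of "cbox p q" "\<lambda>t. (x0, t)"]
    by (simp add: continuous_on_Pair)
  have h0: "h b x0 integrable_on cbox p q" if "b \<in> Basis" for b
    by (rule integrable_continuous[OF hc[OF that]])
  have "((\<lambda>x. integral (cbox p q) (f x)) has_derivative integral (cbox p q) (?fx x0)) (at x0 within U)"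
  proof (rule leibniz_rule[OF _ assms(2) _ assms(6,5)])
    show "((\<lambda>x. f x t) has_derivative blinfun_apply (?fx x t)) (at x within U)"
      if "x \<in> U" "t \<in> cbox p q" for x t
      using has_derivative_at_withinI[OF assms(1)[OF that]] unfolding blinfun_sum_apply .
    show "continuous_on (U \<times> cbox p q) (\<lambda>(x, t). ?fx x t)"
      unfolding split_beta
      using h by (intro continuous_on_blinfun_sum) (auto simp: split_beta intro: continuous_on_subset_UNIV)
  qed
  moreover have "blinfun_apply (integral (cbox p q) (?fx x0)) v = (\<Sum>b\<in>Basis. (v \<bullet> b) *\<^sub>R integral (cbox p q) (h b x0))" for v
  proof -
    have "?fx x0 integrable_on cbox p q"
      by (rule integrable_continuous, rule continuous_on_blinfun_sum[where h = "\<lambda>t b. h b x0 t"], rule hc)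
    then have "blinfun_apply (integral (cbox p q) (?fx x0)) v = integral (cbox p q) (\<lambda>t. blinfun_apply (?fx x0 t) v)"
      by (rule blinfun_apply_integral)
    also have "\<dots> = integral (cbox p q) (\<lambda>t. \<Sum>b\<in>Basis. (v \<bullet> b) *\<^sub>R h b x0 t)"
      by (simp only: blinfun_sum_apply)
    also have "\<dots> = (\<Sum>b\<in>Basis. integral (cbox p q) (\<lambda>t. (v \<bullet> b) *\<^sub>R h b x0 t))"
      by (rule integral_sum[OF finite_Basis integrable_cmul[OF h0]])
    finally show ?thesis by (simp only: integral_cmul)
  qed
  ultimately have "((\<lambda>x. integral (cbox p q) (f x)) has_derivative
    (\<lambda>v. \<Sum>b\<in>Basis. (v \<bullet> b) *\<^sub>R integral (cbox p q) (h b x0))) (at x0 within U)"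
    by (rule has_derivative_eq_rhs[OF _ ext])
  then show ?thesis by (simp only: at_within_open[OF assms(6,4)])
qed

lemma cconv_has_derivative_smooth:
  fixes f :: "'a::euclidean_space \<Rightarrow> 'b::euclidean_space"
  assumes "kernel k" "Ck_on 1 f UNIV"
  shows "(cconv k r f has_derivative (\<lambda>v. \<Sum>b\<in>Basis. (v \<bullet> b) *\<^sub>R cconv k r (partial b f) z)) (at z)"
  unfolding cconv_def[abs_def]
proof (rule leibniz_partials[where U = UNIV])
  show "((\<lambda>x. k t *\<^sub>R f (x + r *\<^sub>R t)) has_derivative
    (\<lambda>v. \<Sum>b\<in>Basis. (v \<bullet> b) *\<^sub>R k t *\<^sub>R partial b f (x + r *\<^sub>R t))) (at x)" for x t
  proof -
    have "((\<lambda>x. f (x + r *\<^sub>R t)) has_derivative (\<lambda>v. \<Sum>b\<in>Basis. (v \<bullet> b) *\<^sub>R partial b f (x + r *\<^sub>R t))) (at x)"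
      by (rule has_derivative_compose[OF _ has_derivative_partials[OF Ck_on_differentiable[OF assms(2)]]])
        (auto intro: has_derivative_add_const[OF has_derivative_ident])
    from has_derivative_scaleR_right[OF this, of "k t"] show ?thesis
      by (rule has_derivative_eq_rhs) (simp add: scaleR_sum_right mult.commute)
  qed
  show "continuous_on UNIV (\<lambda>(x, t). k t *\<^sub>R partial b f (x + r *\<^sub>R t))" if "b \<in> Basis" for b
  proof -
    have cf: "continuous_on UNIV (partial b f)" using assms(2) that by simp
    show ?thesis
      unfolding split_beta
      by (intro continuous_intros continuous_on_affine_compose[OF kernel_continuous[OF assms(1)]]
        continuous_on_affine_compose[OF cf])
  qed
  show "(\<lambda>w. k w *\<^sub>R f (x + r *\<^sub>R w)) integrable_on cbox (- One) One" for x
    by (intro cconv_integrable assms Ck_on_imp_continuous[OF assms(2)])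
qed auto

lemma partial_cconv:
  fixes f :: "'a::euclidean_space \<Rightarrow> 'b::euclidean_space"
  assumes "kernel k" "Ck_on 1 f UNIV" "b \<in> Basis"
  shows "partial b (cconv k r f) = cconv k r (partial b f)"
  by (rule ext) (simp only: partial_eq[OF cconv_has_derivative_smooth[OF assms(1,2)]] sum_Basis_inner_scaleR[OF assms(3)])

lemma Ck_on_cconv:
  fixes f :: "'a::euclidean_space \<Rightarrow> 'b::euclidean_space"
  assumes "kernel k" "Ck_on n f UNIV"
  shows "Ck_on n (cconv k r f) UNIV"
  using assms(2)
proof (induction n arbitrary: f)
  case 0
  then show ?case using continuous_on_cconv[OF assms(1)] by simp
next
  case (Suc n)
  have 1: "Ck_on 1 f UNIV" using Suc.prems by (rule Ck_on_mono) simp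
  have "cconv k r f differentiable (at z)" for z
    by (rule differentiableI[OF cconv_has_derivative_smooth[OF assms(1) 1]])
  then show ?case using Suc partial_cconv[OF assms(1) 1] by simp
qed

lemma partials_cconv:
  fixes f :: "'a::euclidean_space \<Rightarrow> 'b::euclidean_space"
  assumes "kernel k" "Ck_on (length bs) f UNIV" "set bs \<subseteq> Basis"
  shows "partials bs (cconv k r f) = cconv k r (partials bs f)"
  using assms(2,3)
proof (induction bs)
  case (Cons b bs)
  have "partials bs (cconv k r f) = cconv k r (partials bs f)"
    using Cons.IH Cons.prems Ck_on_SucD[of "length bs" f UNIV] by (simp del: Ck_on.simps)
  moreover have "Ck_on 1 (partials bs f) UNIV"
    using Cons.prems by (intro Ck_on_partials) auto
  ultimately show ?case using partial_cconv[OF assms(1), of "partials bs f" b] Cons.prems by (simp del: Ck_on.simps One_nat_def)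
qed simp

text \<open>Moves \<open>z\<close> and \<open>r\<close> from \<open>f\<close> to the kernel. Any box
  containing the ball serves, since the integrand vanishes off the ball.\<close>

lemma cconv_substitution:
  fixes f :: "'a::euclidean_space \<Rightarrow> 'b::euclidean_space"
  assumes "kernel k" "continuous_on UNIV f" "0 < r" "cball z r \<subseteq> cbox a b"
  shows "cconv k r f z = (1 / r ^ DIM('a)) *\<^sub>R integral (cbox a b) (\<lambda>w. k ((w - z) /\<^sub>R r) *\<^sub>R f w)"
proof -
  define F where "F w = k ((w - z) /\<^sub>R r) *\<^sub>R f w" for w
  have F0: "F w = 0" if "w \<notin> cball z r" for w
  proof -
    have "1 \<le> norm ((w - z) /\<^sub>R r)"
      unfolding norm_scaleR using that assms(3) by (simp add: dist_norm norm_minus_commute divide_simps)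
    then show ?thesis using assms(1) by (simp add: F_def kernel_def)
  qed
  have int: "(F has_integral integral (cbox c d) F) (cbox c d)" for c d
    unfolding F_def
    by (intro integrable_integral integrable_continuous continuous_intros continuous_on_subset_UNIV[OF assms(2)]
        continuous_on_affine_compose[OF kernel_continuous[OF assms(1)]])
  have "(F has_integral integral (cbox c d) F) UNIV" if "cball z r \<subseteq> cbox c d" for c d
    by (rule has_integral_on_superset[OF int]) (use F0 that in blast)+
  then have "integral (cbox a b) F = integral (cbox (z - r *\<^sub>R One) (z + r *\<^sub>R One)) F"
    using assms(3,4) cball_subset_cbox_One[of r z] has_integral_unique less_imp_le by metis
  moreover have "((\<lambda>x. F (r *\<^sub>R x + z)) has_integral (integral (cbox (z - r *\<^sub>R One) (z + r *\<^sub>R One)) F /\<^sub>R r ^ DIM('a)))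
      (cbox (- One) One)"
    using has_integral_affinity'[OF int[of "z - r *\<^sub>R One" "z + r *\<^sub>R One"] assms(3), where c = z] assms(3) by simp
  moreover have "F (r *\<^sub>R x + z) = k x *\<^sub>R f (z + r *\<^sub>R x)" for x
    using assms(3) by (simp add: F_def add.commute)
  moreover have "F = (\<lambda>w. k ((w - z) /\<^sub>R r) *\<^sub>R f w)" by (rule ext) (rule F_def)
  ultimately show ?thesis
    unfolding cconv_def by (metis (no_types, lifting) ext integral_unique inverse_eq_divide)
qed

text \<open>After \<open>cconv_substitution\<close> the variable sits in the kernel, as (w - z) / r.
  This gives the factor - 1 / r and allows \<open>f\<close> to be merely continuous.\<close>

lemma cconv_has_derivative_kernel:
  fixes f :: "'a::euclidean_space \<Rightarrow> 'b::euclidean_space"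
  assumes "kernel k" "\<And>b. b \<in> Basis \<Longrightarrow> kernel (k' b)"
    and k': "\<And>w. (k has_derivative (\<lambda>v. \<Sum>b\<in>Basis. (v \<bullet> b) *\<^sub>R k' b w)) (at w)"
    and "continuous_on UNIV f" "0 < r"
  shows "(cconv k r f has_derivative (\<lambda>v. \<Sum>b\<in>Basis. (v \<bullet> b) *\<^sub>R (- (1 / r)) *\<^sub>R cconv (k' b) r f z)) (at z)"
proof -
  \<comment> \<open>One box for all centres within distance 1 of \<open>z\<close>, so that the
    domain of integration stays fixed while differentiating.\<close>
  obtain c :: 'a where c: "cball z (1 + r) \<subseteq> cbox (- c) c"
    using bounded_subset_cbox_symmetric[OF bounded_cball] by blast
  have sub: "cball x r \<subseteq> cbox (- c) c" if "x \<in> ball z 1" for x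
  proof
    fix y assume "y \<in> cball x r"
    then have "dist z y \<le> 1 + r" using that dist_triangle[of z y x] by simp
    then show "y \<in> cbox (- c) c" using c by auto
  qed
  have "((\<lambda>x. integral (cbox (- c) c) (\<lambda>w. k ((w - x) /\<^sub>R r) *\<^sub>R f w)) has_derivative
      (\<lambda>v. \<Sum>b\<in>Basis. (v \<bullet> b) *\<^sub>R integral (cbox (- c) c) (\<lambda>w. (- (1 / r)) *\<^sub>R (k' b ((w - z) /\<^sub>R r) *\<^sub>R f w)))) (at z)"
  proof (rule leibniz_partials[where U = "ball z 1"])
    show "((\<lambda>x. k ((t - x) /\<^sub>R r) *\<^sub>R f t) has_derivative
      (\<lambda>v. \<Sum>b\<in>Basis. (v \<bullet> b) *\<^sub>R (- (1 / r)) *\<^sub>R k' b ((t - x) /\<^sub>R r) *\<^sub>R f t)) (at x)" for x t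
    proof -
      have "((\<lambda>x. k ((t - x) /\<^sub>R r)) has_derivative (\<lambda>v. \<Sum>b\<in>Basis. ((- (v /\<^sub>R r)) \<bullet> b) *\<^sub>R k' b ((t - x) /\<^sub>R r))) (at x)"
        by (rule has_derivative_compose[of "\<lambda>x. (t - x) /\<^sub>R r", OF _ k']) (auto intro!: derivative_eq_intros)
      then have "((\<lambda>x. k ((t - x) /\<^sub>R r) *\<^sub>R f t) has_derivative
          (\<lambda>v. (\<Sum>b\<in>Basis. ((- (v /\<^sub>R r)) \<bullet> b) *\<^sub>R k' b ((t - x) /\<^sub>R r)) *\<^sub>R f t)) (at x)"
        by (rule has_derivative_scaleR_left)
      moreover have "(\<Sum>b\<in>Basis. ((- (v /\<^sub>R r)) \<bullet> b) *\<^sub>R k' b ((t - x) /\<^sub>R r)) *\<^sub>R f t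
          = (\<Sum>b\<in>Basis. (v \<bullet> b) *\<^sub>R (- (1 / r)) *\<^sub>R k' b ((t - x) /\<^sub>R r) *\<^sub>R f t)" for v
        unfolding scaleR_sum_left by (intro sum.cong) (simp_all add: divide_inverse_commute)
      ultimately show ?thesis by simp
    qed
    show "(\<lambda>w. k ((w - x) /\<^sub>R r) *\<^sub>R f w) integrable_on cbox (- c) c" for x
      by (intro integrable_continuous continuous_intros continuous_on_subset_UNIV[OF assms(4)]
        continuous_on_affine_compose[OF kernel_continuous[OF assms(1)]])
    show "continuous_on UNIV (\<lambda>(x, t). (- (1 / r)) *\<^sub>R k' b ((t - x) /\<^sub>R r) *\<^sub>R f t)" if "b \<in> Basis" for b
      unfolding split_beta
      by (intro continuous_intros continuous_on_affine_compose[OF assms(4)]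
        continuous_on_affine_compose[OF kernel_continuous[OF assms(2)[OF that]]])
  qed auto
  then have "((\<lambda>x. (1 / r ^ DIM('a)) *\<^sub>R integral (cbox (- c) c) (\<lambda>w. k ((w - x) /\<^sub>R r) *\<^sub>R f w)) has_derivative
      (\<lambda>v. (1 / r ^ DIM('a)) *\<^sub>R (\<Sum>b\<in>Basis. (v \<bullet> b) *\<^sub>R integral (cbox (- c) c) (\<lambda>w. (- (1 / r)) *\<^sub>R (k' b ((w - z) /\<^sub>R r) *\<^sub>R f w))))) (at z)"
    by (rule has_derivative_scaleR_right)
  also have "(\<lambda>v. (1 / r ^ DIM('a)) *\<^sub>R (\<Sum>b\<in>Basis. (v \<bullet> b) *\<^sub>R integral (cbox (- c) c) (\<lambda>w. (- (1 / r)) *\<^sub>R (k' b ((w - z) /\<^sub>R r) *\<^sub>R f w))))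
      = (\<lambda>v. \<Sum>b\<in>Basis. (v \<bullet> b) *\<^sub>R (- (1 / r)) *\<^sub>R cconv (k' b) r f z)"
  proof
    fix v :: 'a
    have "(1 / r ^ DIM('a)) *\<^sub>R ((v \<bullet> b) *\<^sub>R integral (cbox (- c) c) (\<lambda>w. (- (1 / r)) *\<^sub>R (k' b ((w - z) /\<^sub>R r) *\<^sub>R f w)))
      = (v \<bullet> b) *\<^sub>R (- (1 / r)) *\<^sub>R cconv (k' b) r f z" if "b \<in> Basis" for b
      unfolding cconv_substitution[OF assms(2)[OF that] assms(4,5) sub[of z, simplified]] integral_cmul
      by simp
    then show "(1 / r ^ DIM('a)) *\<^sub>R (\<Sum>b\<in>Basis. (v \<bullet> b) *\<^sub>R integral (cbox (- c) c) (\<lambda>w. (- (1 / r)) *\<^sub>R (k' b ((w - z) /\<^sub>R r) *\<^sub>R f w)))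
      = (\<Sum>b\<in>Basis. (v \<bullet> b) *\<^sub>R (- (1 / r)) *\<^sub>R cconv (k' b) r f z)"
      by (simp only: scaleR_sum_right cong: sum.cong)
  qed
  finally show ?thesis
    by (rule has_derivative_transform_within_open[OF _ open_ball centre_in_ball[THEN iffD2, OF zero_less_one]])
      (rule cconv_substitution[OF assms(1,4,5) sub, symmetric])
qed

lemma cconv_has_vector_derivative_scale:
  fixes f :: "'a::euclidean_space \<Rightarrow> 'b::euclidean_space"
  assumes "kernel k" "Ck_on 1 f UNIV"
  shows "((\<lambda>s. cconv k s f z) has_vector_derivative
    (\<Sum>b\<in>Basis. cconv (\<lambda>w. k w * (w \<bullet> b)) s (partial b f) z)) (at s)"
proof -
  have cf: "continuous_on UNIV (partial b f)" if "b \<in> Basis" for b using assms(2) that by simp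
  have "((\<lambda>s. integral (cbox (- One) One) (\<lambda>w. k w *\<^sub>R f (z + s *\<^sub>R w))) has_vector_derivative
      integral (cbox (- One) One) (\<lambda>w. \<Sum>b\<in>Basis. (k w * (w \<bullet> b)) *\<^sub>R partial b f (z + s *\<^sub>R w))) (at s within UNIV)"
  proof (rule leibniz_rule_vector_derivative)
    show "((\<lambda>s. k w *\<^sub>R f (z + s *\<^sub>R w)) has_vector_derivative
        (\<Sum>b\<in>Basis. (k w * (w \<bullet> b)) *\<^sub>R partial b f (z + s *\<^sub>R w))) (at s within UNIV)" for s w
    proof -
      have "((\<lambda>s. f (z + s *\<^sub>R w)) has_derivative (\<lambda>h. \<Sum>b\<in>Basis. ((h *\<^sub>R w) \<bullet> b) *\<^sub>R partial b f (z + s *\<^sub>R w))) (at s)"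
        by (rule has_derivative_compose[OF _ has_derivative_partials[OF Ck_on_differentiable[OF assms(2)]]])
          (auto intro!: derivative_eq_intros)
      then have "((\<lambda>s. k w *\<^sub>R f (z + s *\<^sub>R w)) has_derivative
          (\<lambda>h. k w *\<^sub>R (\<Sum>b\<in>Basis. ((h *\<^sub>R w) \<bullet> b) *\<^sub>R partial b f (z + s *\<^sub>R w)))) (at s)"
        by (rule has_derivative_scaleR_right)
      then show ?thesis
        unfolding has_vector_derivative_def by (simp add: scaleR_sum_right mult_ac)
    qed
    show "(\<lambda>w. k w *\<^sub>R f (z + x *\<^sub>R w)) integrable_on cbox (- One) One" for x
      by (intro cconv_integrable assms Ck_on_imp_continuous[OF assms(2)])
    show "continuous_on (UNIV \<times> cbox (- One) One) (\<lambda>(s, w). \<Sum>b\<in>Basis. (k w * (w \<bullet> b)) *\<^sub>R partial b f (z + s *\<^sub>R w))"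
      unfolding split_beta
      by (intro continuous_intros continuous_on_affine_compose[OF kernel_continuous[OF assms(1)]]
          continuous_on_affine_compose[OF cf])
  qed auto
  moreover have "integral (cbox (- One) One) (\<lambda>w. \<Sum>b\<in>Basis. (k w * (w \<bullet> b)) *\<^sub>R partial b f (z + s *\<^sub>R w))
      = (\<Sum>b\<in>Basis. cconv (\<lambda>w. k w * (w \<bullet> b)) s (partial b f) z)"
    unfolding cconv_def
    by (intro integral_sum integrable_continuous continuous_intros kernel_continuous[OF assms(1)]
          continuous_on_affine_compose[OF cf]) auto
  ultimately show ?thesis by (simp add: cconv_def)
qed

section \<open>The bump kernel and its iterates\<close>

lemma DERIV_max0_power:
  assumes "1 \<le> n"
  shows "((\<lambda>t::real. (max 0 t) ^ Suc n) has_real_derivative real (Suc n) * (max 0 t) ^ n) (at t)"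
proof -
  consider "t > 0" | "t < 0" | "t = 0" by linarith
  then show ?thesis
  proof cases
    case 1
    have "((\<lambda>t::real. t ^ Suc n) has_real_derivative real (Suc n) * (max 0 t) ^ n) (at t)"
      using 1 by (auto intro!: derivative_eq_intros simp del: power_Suc)
    then show ?thesis
      by (rule has_field_derivative_transform_within_open[where S = "{0<..}"]) (use 1 in auto)
  next
    case 2
    have "((\<lambda>t::real. 0) has_real_derivative real (Suc n) * (max 0 t) ^ n) (at t)"
      using 2 assms by (simp add: max_def power_0_left)
    then show ?thesis
      by (rule has_field_derivative_transform_within_open[where S = "{..<0}"]) (use 2 in auto)
  next
    case 3
    have "((\<lambda>h::real. (max 0 h) ^ n) \<longlongrightarrow> (max 0 0) ^ n) (at 0)"
      by (intro tendsto_intros)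
    then have lim: "((\<lambda>h::real. (max 0 h) ^ n) \<longlongrightarrow> 0) (at 0)"
      using assms by (simp add: power_0_left)
    have "((\<lambda>h::real. (max 0 h) ^ Suc n / h) \<longlongrightarrow> 0) (at 0)"
    proof (rule Lim_transform_eventually[OF lim])
      show "\<forall>\<^sub>F h::real in at 0. (max 0 h) ^ n = (max 0 h) ^ Suc n / h"
        unfolding eventually_at_filter using assms by (intro always_eventually) (auto simp: max_def power_0_left)
    qed
    then show ?thesis
      using 3 assms by (simp add: DERIV_def power_0_left)
  qed
qed

text \<open>A truncated polynomial with explicit gradient: that of \<open>bump (Suc n)\<close> is -
  2 (n + 1) w times \<open>bump n\<close>. This relation makes a multiple of \<open>bump 3\<close> a
  radial potential for the kernel built from \<open>bump 2\<close>.\<close>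

definition bump :: "nat \<Rightarrow> 'a::euclidean_space \<Rightarrow> real" where
  "bump n w = (max 0 (1 - w \<bullet> w)) ^ n"

lemma kernel_bump: "1 \<le> n \<Longrightarrow> kernel (bump n)"
proof -
  assume n: "1 \<le> n"
  have "bump n w = 0" if "1 \<le> norm w" for w :: 'a
  proof -
    have "1 \<le> w \<bullet> w" using that by (simp add: power2_norm_eq_inner[symmetric] one_le_power)
    then show ?thesis using n by (simp add: bump_def max_def power_0_left)
  qed
  moreover have "continuous_on UNIV (bump n :: 'a \<Rightarrow> real)"
    unfolding bump_def by (intro continuous_intros)
  ultimately show ?thesis by (simp add: kernel_def)
qed

lemma kernel_mult: "kernel k \<Longrightarrow> continuous_on UNIV g \<Longrightarrow> kernel (\<lambda>w. k w * g w)"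
  by (auto simp: kernel_def intro!: continuous_intros)

lemma kernel_minus: "kernel k \<Longrightarrow> kernel (\<lambda>w. - k w)"
  by (simp add: kernel_def continuous_on_minus)

lemma bump_has_derivative:
  assumes "1 \<le> n"
  shows "(bump (Suc n) has_derivative
    (\<lambda>v. \<Sum>b\<in>Basis. (v \<bullet> b) *\<^sub>R (bump n w * (- 2 * real (Suc n) * (w \<bullet> b))))) (at w)"
proof -
  have "((\<lambda>w::'a. 1 - w \<bullet> w) has_derivative (\<lambda>v. - 2 * (w \<bullet> v))) (at w)"
    by (auto intro!: derivative_eq_intros simp: inner_commute)
  moreover have "((\<lambda>t::real. (max 0 t) ^ Suc n) has_derivative (\<lambda>h. real (Suc n) * (max 0 (1 - w \<bullet> w)) ^ n * h)) (at (1 - w \<bullet> w))"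
    using DERIV_max0_power[OF assms] by (simp add: has_field_derivative_def)
  ultimately have *: "((\<lambda>w::'a. (max 0 (1 - w \<bullet> w)) ^ Suc n) has_derivative
      (\<lambda>v. real (Suc n) * (max 0 (1 - w \<bullet> w)) ^ n * (- 2 * (w \<bullet> v)))) (at w)"
    by (rule has_derivative_compose)
  have "(\<lambda>w::'a. (max 0 (1 - w \<bullet> w)) ^ Suc n) = bump (Suc n)"
    by (auto simp: bump_def)
  moreover have "real (Suc n) * (max 0 (1 - w \<bullet> w)) ^ n * (- 2 * (w \<bullet> v)) =
     (\<Sum>b\<in>Basis. (v \<bullet> b) *\<^sub>R (bump n w * (- 2 * real (Suc n) * (w \<bullet> b))))" for v
    unfolding bump_def euclidean_inner[of w v]
    by (simp add: sum_distrib_left mult_ac del: of_nat_Suc)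
  ultimately show ?thesis using * by simp
qed

definition bump_mass :: "'a::euclidean_space itself \<Rightarrow> real" where
  "bump_mass _ = integral (cbox (- One) One) (bump 2 :: 'a \<Rightarrow> real)"

lemma bump_mass_pos: "bump_mass TYPE('a::euclidean_space) > 0"
proof -
  have cont: "continuous_on (cbox (- One) One) (bump 2 :: 'a \<Rightarrow> real)"
    by (intro kernel_continuous kernel_bump) simp
  have nonneg: "bump 2 w \<ge> 0" for w :: 'a by (simp add: bump_def)
  have "bump_mass TYPE('a) \<ge> 0"
    unfolding bump_mass_def by (intro integral_nonneg integrable_continuous cont) (rule nonneg)
  moreover have "bump_mass TYPE('a) \<noteq> 0"
  proof
    assume "bump_mass TYPE('a) = 0"
    then have "((bump 2 :: 'a \<Rightarrow> real) has_integral 0) (cbox (- One) One)"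
      unfolding bump_mass_def by (metis cont integrable_continuous integrable_integral)
    then have "bump 2 (0 :: 'a) = 0"
      by (rule has_integral_0_cbox_imp_0[OF cont nonneg]) (auto simp: mem_box box_ne_empty)
    then show False by (simp add: bump_def)
  qed
  ultimately show ?thesis by simp
qed

definition moll :: "real \<Rightarrow> ('a::euclidean_space \<Rightarrow> 'b::euclidean_space) \<Rightarrow> 'a \<Rightarrow> 'b" where
  "moll = cconv (\<lambda>w. bump 2 w * (1 / bump_mass TYPE('a)))"

lemma kernel_moll: "kernel (\<lambda>w::'a::euclidean_space. bump 2 w * (1 / bump_mass TYPE('a)))"
  by (intro kernel_mult kernel_bump) (auto intro!: continuous_intros)

lemma continuous_on_moll: "continuous_on UNIV f \<Longrightarrow> continuous_on UNIV (moll r f)"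
  unfolding moll_def by (rule continuous_on_cconv[OF kernel_moll])

lemma norm_moll_le:
  fixes f :: "'a::euclidean_space \<Rightarrow> 'b::euclidean_space"
  assumes "continuous_on UNIV f" "0 \<le> r" "\<And>w. w \<in> cball z r \<Longrightarrow> norm (f w) \<le> e"
  shows "norm (moll r f z) \<le> e"
proof -
  have "norm (moll r f z) \<le> integral (cbox (- One) One) (\<lambda>w::'a. \<bar>bump 2 w * (1 / bump_mass TYPE('a))\<bar>) * e"
    unfolding moll_def by (rule norm_cconv_le[OF kernel_moll assms])
  also have "(\<lambda>w::'a. \<bar>bump 2 w * (1 / bump_mass TYPE('a))\<bar>) = (\<lambda>w. bump 2 w * (1 / bump_mass TYPE('a)))"
    using bump_mass_pos[where 'a = 'a] by (auto simp: bump_def)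
  also have "integral (cbox (- One) One) \<dots> = 1"
    using bump_mass_pos[where 'a = 'a] unfolding bump_mass_def by (subst integral_mult_left) auto
  finally show ?thesis by simp
qed

lemma moll_diff:
  "continuous_on UNIV f \<Longrightarrow> continuous_on UNIV g \<Longrightarrow> moll r (\<lambda>w. f w - g w) z = moll r f z - moll r g z"
  unfolding moll_def by (rule cconv_diff[OF kernel_moll])

lemma Ck_on_moll: "Ck_on n f UNIV \<Longrightarrow> Ck_on n (moll r f) UNIV"
  unfolding moll_def by (rule Ck_on_cconv[OF kernel_moll])

lemma partials_moll:
  "Ck_on (length bs) f UNIV \<Longrightarrow> set bs \<subseteq> Basis \<Longrightarrow> partials bs (moll r f) = moll r (partials bs f)"
  unfolding moll_def by (rule partials_cconv[OF kernel_moll])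

lemma continuous_on_moll_power: "continuous_on UNIV f \<Longrightarrow> continuous_on UNIV ((moll r ^^ m) f)"
  by (induction m) (auto intro: continuous_on_moll)

lemma Ck_on_moll_power: "Ck_on n f UNIV \<Longrightarrow> Ck_on n ((moll r ^^ m) f) UNIV"
  by (induction m) (auto intro: Ck_on_moll)

lemma partials_moll_power:
  "Ck_on (length bs) f UNIV \<Longrightarrow> set bs \<subseteq> Basis \<Longrightarrow> partials bs ((moll r ^^ m) f) = (moll r ^^ m) (partials bs f)"
  by (induction m) (auto simp: partials_moll Ck_on_moll_power)

lemma moll_power_diff:
  "continuous_on UNIV f \<Longrightarrow> continuous_on UNIV g \<Longrightarrow>
    (moll r ^^ m) (\<lambda>w. f w - g w) = (\<lambda>w. (moll r ^^ m) f w - (moll r ^^ m) g w)"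
  by (induction m) (auto simp: moll_diff continuous_on_moll_power)

lemma norm_moll_power_le:
  fixes f :: "'a::euclidean_space \<Rightarrow> 'b::euclidean_space"
  assumes "continuous_on UNIV f" "0 \<le> r" "\<And>w. w \<in> cball z (real m * r) \<Longrightarrow> norm (f w) \<le> e"
  shows "norm ((moll r ^^ m) f z) \<le> e"
  using assms(3)
proof (induction m arbitrary: z)
  case (Suc m)
  have "norm (moll r ((moll r ^^ m) f) z) \<le> e"
  proof (rule norm_moll_le[OF continuous_on_moll_power[OF assms(1)] assms(2)])
    fix w assume w: "w \<in> cball z r"
    show "norm ((moll r ^^ m) f w) \<le> e"
    proof (rule Suc.IH, rule Suc.prems)
      fix u assume "u \<in> cball w (real m * r)"
      then show "u \<in> cball z (real (Suc m) * r)"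
        using w dist_triangle[of z u w] by (simp add: algebra_simps)
    qed
  qed
  then show ?case by simp
qed simp

lemma partial_moll_kernel:
  fixes f :: "'a::euclidean_space \<Rightarrow> 'b::euclidean_space"
  assumes "continuous_on UNIV f" "0 < r"
  defines "k' \<equiv> \<lambda>b w::'a. bump 1 w * (- 4 * (w \<bullet> b) / bump_mass TYPE('a))"
  shows "moll r f differentiable (at z)"
    and "b \<in> Basis \<Longrightarrow> partial b (moll r f) z = (- (1 / r)) *\<^sub>R cconv (k' b) r f z"
    and "kernel (k' b)"
proof -
  show k': "kernel (k' b)" for b
    unfolding k'_def using bump_mass_pos[where 'a = 'a]
    by (intro kernel_mult kernel_bump) (auto intro!: continuous_intros)
  have k: "((\<lambda>w. bump 2 w * (1 / bump_mass TYPE('a))) has_derivative (\<lambda>v. \<Sum>b\<in>Basis. (v \<bullet> b) *\<^sub>R k' b w)) (at w)" for w :: 'a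
  proof -
    have "(bump 2 has_derivative (\<lambda>v. \<Sum>b\<in>Basis. (v \<bullet> b) *\<^sub>R (bump 1 w * (- 4 * (w \<bullet> b))))) (at w)"
      using bump_has_derivative[of 1 w] by (simp add: eval_nat_numeral)
    from has_derivative_mult_left[OF this, of "1 / bump_mass TYPE('a)"] show ?thesis
      by (rule has_derivative_eq_rhs) (rule ext, unfold sum_distrib_right k'_def, rule sum.cong, simp_all)
  qed
  note d = cconv_has_derivative_kernel[OF kernel_moll k' k assms(1,2), of z, folded moll_def]
  show "moll r f differentiable (at z)" by (rule differentiableI[OF d])
  show "partial b (moll r f) z = (- (1 / r)) *\<^sub>R cconv (k' b) r f z" if "b \<in> Basis"
    by (simp only: partial_eq[OF d] sum_Basis_inner_scaleR[OF that])
qed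

text \<open>One constant dominating 1, the integrals of the absolute first partial derivatives of
  the mollifying kernel, and the integral of its radial potential, the rescaled
  \<open>bump 3\<close>.\<close>

definition moll_const :: "'a::euclidean_space itself \<Rightarrow> real" where
  "moll_const _ = 1 + (\<Sum>b\<in>Basis. integral (cbox (- One) One) (\<lambda>w::'a. \<bar>bump 1 w * (- 4 * (w \<bullet> b) / bump_mass TYPE('a))\<bar>))
     + integral (cbox (- One) One) (\<lambda>w::'a. \<bar>bump 3 w * (1 / (6 * bump_mass TYPE('a)))\<bar>)"

lemma kernel_integral_nonneg: "kernel k \<Longrightarrow> 0 \<le> integral (cbox a b) (\<lambda>w. \<bar>k w\<bar>)"
  by (intro integral_nonneg integrable_continuous continuous_intros kernel_continuous) auto

lemma kernel_bump3: "kernel (\<lambda>w::'a::euclidean_space. bump 3 w * (1 / (6 * bump_mass TYPE('a))))"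
  by (intro kernel_mult kernel_bump) (auto intro!: continuous_intros)

lemma moll_const_ge:
  "1 \<le> moll_const TYPE('a::euclidean_space)"
  "b \<in> Basis \<Longrightarrow> integral (cbox (- One) One) (\<lambda>w::'a. \<bar>bump 1 w * (- 4 * (w \<bullet> b) / bump_mass TYPE('a))\<bar>) \<le> moll_const TYPE('a)"
  "integral (cbox (- One) One) (\<lambda>w::'a. \<bar>bump 3 w * (1 / (6 * bump_mass TYPE('a)))\<bar>) \<le> moll_const TYPE('a)"
proof -
  let ?I = "\<lambda>b. integral (cbox (- One) One) (\<lambda>w::'a. \<bar>bump 1 w * (- 4 * (w \<bullet> b) / bump_mass TYPE('a))\<bar>)"
  let ?J = "integral (cbox (- One) One) (\<lambda>w::'a. \<bar>bump 3 w * (1 / (6 * bump_mass TYPE('a)))\<bar>)"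
  have I: "0 \<le> ?I b" for b
    using kernel_integral_nonneg[OF partial_moll_kernel(3)[of "\<lambda>_. 0::real" 1 b]] by simp
  have J: "0 \<le> ?J" by (rule kernel_integral_nonneg[OF kernel_bump3])
  have S: "0 \<le> (\<Sum>b\<in>Basis. ?I b)" by (rule sum_nonneg) (rule I)
  show "1 \<le> moll_const TYPE('a)" "?J \<le> moll_const TYPE('a)"
    using J S by (simp_all add: moll_const_def)
  show "?I b \<le> moll_const TYPE('a)" if "b \<in> Basis"
  proof -
    have "?I b \<le> (\<Sum>b\<in>Basis. ?I b)"
      by (rule member_le_sum[OF that]) (use I in auto)
    then show ?thesis using J unfolding moll_const_def by linarith
  qed
qed

text \<open>Each of the p mollifiers takes one derivative, at the cost \<open>moll_const\<close> /
  r. For r = t / p the bound becomes (C p / t)^p, which up to geometric factors grows like p! / t^p,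
  as for analytic functions.\<close>

lemma moll_power_smooth:
  fixes f :: "'a::euclidean_space \<Rightarrow> 'b::euclidean_space"
  assumes "continuous_on UNIV f" "0 < r"
  shows "Ck_on p ((moll r ^^ p) f) UNIV"
    and "set bs \<subseteq> Basis \<Longrightarrow> length bs = p \<Longrightarrow> (\<And>w. w \<in> cball z (real p * r) \<Longrightarrow> norm (f w) \<le> e) \<Longrightarrow>
      norm (partials bs ((moll r ^^ p) f) z) \<le> (moll_const TYPE('a) / r) ^ p * e"
proof (induction p arbitrary: bs z)
  case 0
  {
    case 1
    show ?case using assms(1) by simp
  next
    case 2
    then show ?case by simp
  }
next
  case (Suc p)
  let ?h = "(moll r ^^ p) f" and ?k = "\<lambda>b w::'a. bump 1 w * (- 4 * (w \<bullet> b) / bump_mass TYPE('a))"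
  have h: "continuous_on UNIV ?h" by (rule continuous_on_moll_power[OF assms(1)])
  note pk = partial_moll_kernel[OF h assms(2)]
  have eq: "partial b (moll r ?h) = (\<lambda>z. (- (1 / r)) *\<^sub>R cconv (?k b) r ?h z)" if "b \<in> Basis" for b
    using pk(2)[OF that] by blast
  {
    case 1
    have "Ck_on p (partial b (moll r ?h)) UNIV" if "b \<in> Basis" for b
      unfolding eq[OF that]
      by (intro Ck_on_linear[OF _ bounded_linear_scaleR_right] Ck_on_cconv[OF pk(3)] Suc.IH(1)) simp
    then show ?case using pk(1) by simp
  next
    case 2
    \<comment> \<open>The innermost derivative is spent on the outermost mollifier; the others pass
      through it to the p remaining ones.\<close>
    then obtain cs b where bs: "bs = cs @ [b]" "length cs = p" "set cs \<subseteq> Basis" "b \<in> Basis"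
      by (cases bs rule: rev_cases) auto
    have C: "Ck_on (length cs) ?h UNIV" using Suc.IH(1) bs by simp
    have "partials bs ((moll r ^^ Suc p) f) z = partials cs (\<lambda>z. (- (1 / r)) *\<^sub>R cconv (?k b) r ?h z) z"
      using bs eq by simp
    also have "\<dots> = (- (1 / r)) *\<^sub>R partials cs (cconv (?k b) r ?h) z"
      by (rule partials_linear[OF open_UNIV bounded_linear_scaleR_right Ck_on_cconv[OF pk(3) C] UNIV_I bs(3)])
    also have "\<dots> = (- (1 / r)) *\<^sub>R cconv (?k b) r (partials cs ?h) z"
      by (simp only: partials_cconv[OF pk(3) C bs(3)])
    finally have "norm (partials bs ((moll r ^^ Suc p) f) z) = (1 / r) * norm (cconv (?k b) r (partials cs ?h) z)"
      using assms(2) by simp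
    also have "norm (cconv (?k b) r (partials cs ?h) z) \<le>
      integral (cbox (- One) One) (\<lambda>w. \<bar>?k b w\<bar>) * ((moll_const TYPE('a) / r) ^ p * e)"
    proof (rule norm_cconv_le[OF pk(3)])
      show "continuous_on UNIV (partials cs ?h)"
        using Ck_on_partials[OF bs(3), of 0 ?h UNIV] C by simp
      fix w assume w: "w \<in> cball z r"
      show "norm (partials cs ?h w) \<le> (moll_const TYPE('a) / r) ^ p * e"
      proof (rule Suc.IH(2)[OF bs(3,2)], rule 2(3))
        fix u assume "u \<in> cball w (real p * r)"
        then show "u \<in> cball z (real (Suc p) * r)"
          using w dist_triangle[of z u w] by (simp add: algebra_simps)
      qed
    qed (use assms(2) in auto)
    also have "\<dots> \<le> moll_const TYPE('a) * ((moll_const TYPE('a) / r) ^ p * e)"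
    proof (rule mult_right_mono[OF moll_const_ge(2)[OF bs(4)]])
      have "0 \<le> norm (f z)" by simp
      also have "\<dots> \<le> e" by (rule 2(3)) (use assms(2) in simp)
      finally have "0 \<le> e" .
      then show "0 \<le> (moll_const TYPE('a) / r) ^ p * e"
        using assms(2) moll_const_ge(1)[where 'a = 'a] by simp
    qed
    finally show ?case using assms(2) by (simp add: mult_left_mono divide_simps mult_ac)
  }
qed

lemma cconv_minus:
  "cconv (\<lambda>w. - k w) r f z = - cconv k r f z"
  by (simp add: cconv_def)

text \<open>Differentiating in the radius: since \<open>\<rho>(w) w\<close> is minus the gradient of the radial function
  \<open>R\<close>, one has \<open>d/ds moll s f = s (R\<^sub>s * \<Delta>f)\<close>.\<close>

lemma norm_moll_minus_le:
  fixes f :: "'a::euclidean_space \<Rightarrow> 'b::euclidean_space"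
  assumes "Ck_on 2 f UNIV" "0 < r" "\<And>w. w \<in> cball z r \<Longrightarrow> norm (laplacian f w) \<le> e"
  shows "norm (moll r f z - f z) \<le> moll_const TYPE('a) * r\<^sup>2 * e"
proof -
  let ?k = "\<lambda>w::'a. bump 2 w * (1 / bump_mass TYPE('a))"
  let ?R = "\<lambda>w::'a. bump 3 w * (1 / (6 * bump_mass TYPE('a)))"
  let ?C = "moll_const TYPE('a)"
  have f1: "Ck_on 1 f UNIV" using assms(1) by (rule Ck_on_mono) simp
  have pf: "Ck_on 1 (partial b f) UNIV" if "b \<in> Basis" for b
    using assms(1) that by (simp add: numeral_2_eq_2)
  \<comment> \<open>The 6 = 2 * 3 cancels the factor from differentiating \<open>bump 3\<close>, so
    the gradient of \<open>?R\<close> is exactly - \<open>?k w\<close> times w.\<close>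
  have R': "(?R has_derivative (\<lambda>v. \<Sum>b\<in>Basis. (v \<bullet> b) *\<^sub>R - (?k w * (w \<bullet> b)))) (at w)" for w
  proof -
    have "(bump 3 has_derivative (\<lambda>v. \<Sum>b\<in>Basis. (v \<bullet> b) *\<^sub>R (bump 2 w * (- 6 * (w \<bullet> b))))) (at w)"
      using bump_has_derivative[of 2 w] by (simp add: eval_nat_numeral)
    from has_derivative_mult_left[OF this, of "1 / (6 * bump_mass TYPE('a))"] show ?thesis
      by (rule has_derivative_eq_rhs) (rule ext, unfold sum_distrib_right, rule sum.cong, simp_all)
  qed
  have kb: "kernel (\<lambda>w. ?k w * (w \<bullet> b))" for b
    by (intro kernel_mult[OF kernel_moll] continuous_intros)
  then have kb': "kernel (\<lambda>w. - (?k w * (w \<bullet> b)))" for b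
    by (rule kernel_minus)
  \<comment> \<open>Integration by parts, obtained by differentiating one convolution in two ways:
    on the kernel \<open>?R\<close> and on the function.\<close>
  have step: "cconv (\<lambda>w. ?k w * (w \<bullet> b)) s (partial b f) z = s *\<^sub>R cconv ?R s (partial b (partial b f)) z"
    if "b \<in> Basis" "0 < s" for b s
  proof -
    have g: "continuous_on UNIV (partial b f)" using pf[OF that(1)] by (rule Ck_on_imp_continuous)
    have "partial b (cconv ?R s (partial b f)) z = (- (1 / s)) *\<^sub>R cconv (\<lambda>w. - (?k w * (w \<bullet> b))) s (partial b f) z"
      by (simp only: partial_eq[OF cconv_has_derivative_kernel[OF kernel_bump3 kb' R' g that(2)]] sum_Basis_inner_scaleR[OF that(1)])
    also have "\<dots> = (1 / s) *\<^sub>R cconv (\<lambda>w. ?k w * (w \<bullet> b)) s (partial b f) z"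
      by (simp add: cconv_minus)
    also have "partial b (cconv ?R s (partial b f)) z = cconv ?R s (partial b (partial b f)) z"
      by (simp only: partial_cconv[OF kernel_bump3 pf[OF that(1)] that(1)])
    finally show ?thesis using that(2) by simp
  qed
  have lap: "continuous_on UNIV (laplacian f)"
    using Ck_on_laplacian[OF open_UNIV, of 0 f] assms(1) by (simp add: numeral_2_eq_2)
  \<comment> \<open>Mean value inequality in the radius, with a linear comparison function; radius 0
    gives back \<open>f\<close> because the kernel has mass 1.\<close>
  have "norm (cconv ?k r f z - cconv ?k 0 f z) \<le> r * (?C * r * e) - 0 * (?C * r * e)"
  proof (rule differentiable_bound_general[where \<phi> = "\<lambda>s. s * (?C * r * e)" and \<phi>' = "\<lambda>_. ?C * r * e"
        and f' = "\<lambda>s. \<Sum>b\<in>Basis. cconv (\<lambda>w. ?k w * (w \<bullet> b)) s (partial b f) z"])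
    show "continuous_on {0..r} (\<lambda>s. cconv ?k s f z)"
      using cconv_has_vector_derivative_scale[OF kernel_moll f1]
      by (intro continuous_at_imp_continuous_on ballI has_vector_derivative_continuous)
    show "((\<lambda>s. cconv ?k s f z) has_vector_derivative (\<Sum>b\<in>Basis. cconv (\<lambda>w. ?k w * (w \<bullet> b)) s (partial b f) z)) (at s)" for s
      by (rule cconv_has_vector_derivative_scale[OF kernel_moll f1])
    fix s assume s: "0 < s" "s < r"
    have "(\<Sum>b\<in>Basis. cconv (\<lambda>w. ?k w * (w \<bullet> b)) s (partial b f) z)
      = s *\<^sub>R (\<Sum>b\<in>Basis. cconv ?R s (partial b (partial b f)) z)"
      unfolding scaleR_sum_right by (rule sum.cong[OF refl step[OF _ s(1)]])
    also have "(\<Sum>b\<in>Basis. cconv ?R s (partial b (partial b f)) z) = cconv ?R s (laplacian f) z"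
      unfolding laplacian_def[abs_def]
      by (rule cconv_sum[OF kernel_bump3, symmetric]) (use pf in auto)
    finally have "norm (\<Sum>b\<in>Basis. cconv (\<lambda>w. ?k w * (w \<bullet> b)) s (partial b f) z) = s * norm (cconv ?R s (laplacian f) z)"
      using s by simp
    also have "\<dots> \<le> r * (?C * e)"
    proof (rule mult_mono)
      have e: "norm (laplacian f w) \<le> e" if "w \<in> cball z s" for w
        using that s by (intro assms(3)) auto
      have "norm (cconv ?R s (laplacian f) z) \<le> integral (cbox (- One) One) (\<lambda>w. \<bar>?R w\<bar>) * e"
        by (rule norm_cconv_le[OF kernel_bump3 lap _ e]) (use s in auto)
      also have "\<dots> \<le> ?C * e"
        using e[of z] s by (intro mult_right_mono moll_const_ge) (auto intro: order_trans[OF norm_ge_zero])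
      finally show "norm (cconv ?R s (laplacian f) z) \<le> ?C * e" .
    qed (use s in auto)
    finally show "norm (\<Sum>b\<in>Basis. cconv (\<lambda>w. ?k w * (w \<bullet> b)) s (partial b f) z) \<le> ?C * r * e"
      by (simp add: mult_ac)
  qed (use assms(2) in \<open>auto intro!: derivative_eq_intros continuous_intros\<close>)
  moreover have "cconv ?k 0 f z = f z"
  proof -
    have "integral (cbox (- One) One) ?k = 1"
      using bump_mass_pos[where 'a = 'a] unfolding bump_mass_def by (subst integral_mult_left) auto
    moreover have "((\<lambda>w. ?k w *\<^sub>R f z) has_integral integral (cbox (- One) One) ?k *\<^sub>R f z) (cbox (- One) One)"
      by (intro has_integral_scaleR_left integrable_integral integrable_continuous kernel_continuous[OF kernel_moll])
    ultimately show ?thesis by (simp add: cconv_def integral_unique)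
  qed
  ultimately show ?thesis by (simp add: moll_def power2_eq_square mult_ac)
qed

text \<open>Every further mollification adds one single-step error, and averaging does not increase
  the errors already made.\<close>

lemma norm_moll_power_minus_le:
  fixes f :: "'a::euclidean_space \<Rightarrow> 'b::euclidean_space"
  assumes "Ck_on 2 f UNIV" "0 < r" "\<And>w. w \<in> cball z (real m * r) \<Longrightarrow> norm (laplacian f w) \<le> e"
  shows "norm ((moll r ^^ m) f z - f z) \<le> real m * (moll_const TYPE('a) * r\<^sup>2 * e)"
  using assms(3)
proof (induction m arbitrary: z)
  case (Suc m)
  have cf: "continuous_on UNIV f" using assms(1) by (rule Ck_on_imp_continuous)
  have "(moll r ^^ Suc m) f z - f z = moll r (\<lambda>w. (moll r ^^ m) f w - f w) z + (moll r f z - f z)"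
    by (simp add: moll_diff[OF continuous_on_moll_power[OF cf] cf])
  also have "norm \<dots> \<le> real m * (moll_const TYPE('a) * r\<^sup>2 * e) + moll_const TYPE('a) * r\<^sup>2 * e"
  proof (rule norm_triangle_mono)
    show "norm (moll r (\<lambda>w. (moll r ^^ m) f w - f w) z) \<le> real m * (moll_const TYPE('a) * r\<^sup>2 * e)"
    proof (rule norm_moll_le)
      show "continuous_on UNIV (\<lambda>w. (moll r ^^ m) f w - f w)"
        by (intro continuous_intros continuous_on_moll_power cf)
      fix w assume w: "w \<in> cball z r"
      show "norm ((moll r ^^ m) f w - f w) \<le> real m * (moll_const TYPE('a) * r\<^sup>2 * e)"
      proof (rule Suc.IH, rule Suc.prems)
        fix u assume "u \<in> cball w (real m * r)"
        then show "u \<in> cball z (real (Suc m) * r)"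
          using w dist_triangle[of z u w] by (simp add: algebra_simps)
      qed
    qed (use assms(2) in simp)
    show "norm (moll r f z - f z) \<le> moll_const TYPE('a) * r\<^sup>2 * e"
    proof (rule norm_moll_minus_le[OF assms(1,2)], rule Suc.prems)
      fix w assume "w \<in> cball z r"
      moreover have "r \<le> real (Suc m) * r" using assms(2) by (simp add: algebra_simps)
      ultimately show "w \<in> cball z (real (Suc m) * r)" by (meson mem_cball order_trans)
    qed
  qed
  finally show ?case by (simp add: algebra_simps)
qed simp

lemma norm_moll_power_minus_const_le:
  fixes f :: "'a::euclidean_space \<Rightarrow> 'b::euclidean_space"
  assumes "continuous_on UNIV f" "0 < r" "\<And>w. w \<in> cball z (real m * r) \<Longrightarrow> norm (f w - c) \<le> e"
  shows "norm ((moll r ^^ m) f z - c) \<le> e"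
proof -
  have "norm ((moll r ^^ m) (\<lambda>_::'a. c) z - c) \<le> real m * (moll_const TYPE('a) * r\<^sup>2 * 0)"
    by (rule norm_moll_power_minus_le) (use assms(2) in \<open>auto simp: laplacian_def\<close>)
  then have "(moll r ^^ m) (\<lambda>_::'a. c) z = c" by simp
  then have "(moll r ^^ m) f z - c = (moll r ^^ m) (\<lambda>w. f w - c) z"
    by (simp add: moll_power_diff[OF assms(1) continuous_on_const])
  also have "norm \<dots> \<le> e"
    by (rule norm_moll_power_le) (use assms in \<open>auto intro!: continuous_intros\<close>)
  finally show ?thesis .
qed

section \<open>Cutoff functions of finite smoothness\<close>

text \<open>A piecewise linear function of the distance to \<open>K\<close> is mollified n times; on
  the zones where it is constant its values survive.\<close>

lemma smooth_cutoff:
  fixes K :: "'a::euclidean_space set"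
  assumes "compact K" "open U" "K \<subseteq> U"
  obtains \<zeta> :: "'a \<Rightarrow> real" and C U1 where "Ck_on n \<zeta> UNIV" "compact C" "C \<subseteq> U" "\<And>x. x \<notin> C \<Longrightarrow> \<zeta> x = 0"
    "open U1" "K \<subseteq> U1" "U1 \<subseteq> U" "\<And>x. x \<in> U1 \<Longrightarrow> \<zeta> x = 1" "\<And>x. \<bar>\<zeta> x\<bar> \<le> 1"
\<comment> \<open>\<open>infdist\<close> to the empty set is 0 by convention, so the construction
  below would not have compact support.\<close>
proof (cases "K = {}")
  case True
  then show ?thesis
    by (intro that[of "\<lambda>_. 0" "{}" "{}"]) auto
next
  case False
  obtain e where e: "0 < e" "(\<Union>x\<in>K. ball x e) \<subseteq> U"
    using compact_subset_open_imp_ball_epsilon_subset[OF assms] by blast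
  \<comment> \<open>The function \<open>g\<close> is 1 up to distance e / 3 and 0 from e / 2 on,
    which leaves margins e / 6 to \<open>U1\<close> and to the complement of \<open>C\<close>; the n
    mollifications reach only e / 12. \<open>Suc n\<close> admits n = 0.\<close>
  define r where "r = e / (12 * real (Suc n))"
  have r: "0 < r" using e(1) by (simp add: r_def)
  have nr: "real n * r \<le> e / 12"
    using e(1) by (simp add: r_def field_simps)
  define g where "g x = max 0 (min 1 (3 - 6 * infdist x K / e))" for x
  have g: "continuous_on UNIV g"
    unfolding g_def by (intro continuous_intros) (use e(1) in auto)
  define \<zeta> where "\<zeta> = (moll r ^^ n) g"
  define C where "C = {x. infdist x K \<le> 2 * e / 3}"
  define U1 where "U1 = {x. infdist x K < e / 6}"
  have near: "\<bar>infdist w K - infdist x K\<bar> \<le> e / 12" if "w \<in> cball x (real n * r)" for w x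
  proof -
    have "dist x w \<le> real n * r" using that by simp
    then show ?thesis
      using nr infdist_triangle[of w K x] infdist_triangle[of x K w] dist_commute[of x w] by linarith
  qed
  have CU: "{x. infdist x K < e} \<subseteq> U"
  proof
    fix x assume x: "x \<in> {x. infdist x K < e}"
    obtain y where "y \<in> K" "infdist x K = dist x y"
      using infdist_attains_inf[OF compact_imp_closed[OF assms(1)] False] by blast
    then have "x \<in> (\<Union>x\<in>K. ball x e)" using x by (auto simp: dist_commute)
    then show "x \<in> U" using e(2) by blast
  qed
  show ?thesis
  proof (rule that)
    show "Ck_on n \<zeta> UNIV" unfolding \<zeta>_def by (rule moll_power_smooth(1)[OF g r])
    show "compact C" unfolding C_def using e(1) False assms(1) by (intro compact_infdist_le) auto
    show "C \<subseteq> U" using CU e(1) by (auto simp: C_def)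
    show "\<zeta> x = 0" if "x \<notin> C" for x
    proof -
      have "norm ((moll r ^^ n) g x) \<le> 0"
      proof (rule norm_moll_power_le[OF g less_imp_le[OF r]])
        fix w assume "w \<in> cball x (real n * r)"
        from near[OF this] have "e / 2 \<le> infdist w K" using that unfolding C_def mem_Collect_eq by linarith
        then have "3 - 6 * infdist w K / e \<le> 0" using e(1) by (simp add: field_simps)
        then show "norm (g w) \<le> 0" by (simp add: g_def)
      qed
      then show ?thesis by (simp add: \<zeta>_def)
    qed
    show "open U1" unfolding U1_def
      by (intro open_Collect_less continuous_intros)
    show "K \<subseteq> U1" using e(1) by (auto simp: U1_def)
    show "U1 \<subseteq> U" using CU e(1) by (auto simp: U1_def)
    show "\<zeta> x = 1" if "x \<in> U1" for x
    proof -
      have "norm ((moll r ^^ n) g x - 1) \<le> 0"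
      proof (rule norm_moll_power_minus_const_le[OF g r])
        fix w assume "w \<in> cball x (real n * r)"
        from near[OF this] have "infdist w K \<le> e / 3" using that e(1) unfolding U1_def mem_Collect_eq by linarith
        then have "1 \<le> 3 - 6 * infdist w K / e" using e(1) by (simp add: field_simps)
        then show "norm (g w - 1) \<le> 0" by (simp add: g_def)
      qed
      then show ?thesis by (simp add: \<zeta>_def)
    qed
    show "\<bar>\<zeta> x\<bar> \<le> 1" for x
      using norm_moll_power_le[OF g less_imp_le[OF r], of x n 1] by (auto simp: \<zeta>_def g_def)
  qed
qed

lemma power_div_fact_le_exp:
  fixes x :: real
  assumes "0 \<le> x"
  shows "x ^ n / fact n \<le> exp x"
proof -
  have "(\<lambda>n. x ^ n / fact n) sums exp x"
    using exp_converges[of x] by (simp add: divide_inverse mult.commute)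
  then show ?thesis
    using assms sum_le_suminf[of "\<lambda>n. x ^ n / fact n" "{n}"] by (simp add: sums_iff)
qed

section \<open>Almost harmonic functions vanishing above a given height\<close>

text \<open>Admissible ratio of the height \<eta> of a layer to the horizontal spread \<delta>. The
  24 leaves the base e / 6 < 1 when derivatives of order 2 J are estimated.\<close>

definition shift_const :: "'a::euclidean_space itself \<Rightarrow> real" where
  "shift_const _ = 1 / (24 * real DIM('a) * moll_const TYPE('a))"

lemma shift_const_pos: "0 < shift_const TYPE('a::euclidean_space)"
  using moll_const_ge(1)[where 'a = 'a] by (simp add: shift_const_def)

text \<open>Iterating \<open>2 J + 2\<close> times a mollifier of radius \<open>\<approx> \<delta> / J\<close> gives, for every single \<open>J\<close>, a
  compactly supported regularization whose derivatives of order \<open>2 J\<close> are as small as those of an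
  analytic function; this replaces analytic cutoffs, which do not exist.\<close>

lemma approx_quasi_analytic:
  fixes a :: "'a::euclidean_space \<Rightarrow> 'b::euclidean_space"
  assumes "uniformly_continuous_on UNIV a" "\<And>x. norm (a x) \<le> B"
    and "0 < \<delta>" "0 < \<eta>" "\<eta> \<le> shift_const TYPE('a) * \<delta>" "0 < \<epsilon>"
  obtains J u where "Ck_on (2 * J + 2) u UNIV"
    "\<And>x. (\<And>w. w \<in> cball x (\<delta> / 2) \<Longrightarrow> a w = 0) \<Longrightarrow> u x = 0"
    "\<And>x. norm (u x - a x) \<le> \<epsilon>"
    "\<And>x. \<eta> ^ (2 * J) / fact (2 * J) * norm ((laplacian ^^ J) u x) \<le> \<epsilon>"
proof -
  let ?C = "moll_const TYPE('a)" and ?n = "real DIM('a)"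
  have C: "1 \<le> ?C" by (rule moll_const_ge(1))
  have n: "1 \<le> ?n" using DIM_positive[where 'a = 'a] by (simp add: Suc_le_eq del: DIM_positive)
  have ca: "continuous_on UNIV a" using assms(1) by (rule uniformly_continuous_imp_continuous)
  have B: "0 \<le> B" using assms(2)[of undefined] norm_ge_zero order_trans by blast
  obtain d where d: "d > 0" "\<And>x y. dist x y < d \<Longrightarrow> dist (a x) (a y) < \<epsilon> / 2"
    using assms(1,6) unfolding uniformly_continuous_on_def by (metis UNIV_I half_gt_zero)
  \<comment> \<open>Two preliminary mollifications, with a radius fixed before J, give a bounded
    Laplacian D. The error m C r^2 D of the main stage, with m r = \<delta> / 4, then tends to 0 as
    J grows. Each of the two stages spreads the support by at most \<delta> / 4.\<close>
  define s where "s = min (\<delta> / 8) (d / 4)"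
  have s: "0 < s" "2 * s \<le> \<delta> / 4" "2 * s < d" using d(1) assms(3) by (auto simp: s_def min_def)
  define a2 where "a2 = (moll s ^^ 2) a"
  have a2C: "Ck_on 2 a2 UNIV" unfolding a2_def by (rule moll_power_smooth(1)[OF ca s(1)])
  have a2a: "norm (a2 x - a x) \<le> \<epsilon> / 2" for x
    unfolding a2_def
  proof (rule norm_moll_power_minus_const_le[OF ca s(1)])
    fix w assume "w \<in> cball x (real 2 * s)"
    then have "dist x w < d" using s(3) by simp
    then show "norm (a w - a x) \<le> \<epsilon> / 2"
      using d(2)[of x w] by (simp add: dist_norm norm_minus_commute)
  qed
  have a2B: "norm (a2 x) \<le> B" for x
    unfolding a2_def by (rule norm_moll_power_le[OF ca]) (use s assms(2) in auto)
  define D where "D = ?n * ((?C / s)\<^sup>2 * B)"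
  have D: "norm (laplacian a2 x) \<le> D" for x
  proof -
    have "norm (partials [] (laplacian a2) x) \<le> ?n * ((?C / s)\<^sup>2 * B)"
    proof (rule norm_partials_laplacian_le[OF open_UNIV UNIV_I])
      show "Ck_on (length ([] :: 'a list) + 2) a2 UNIV" unfolding list.size add_0_left by (rule a2C)
      show "norm (partials bs a2 x) \<le> (?C / s)\<^sup>2 * B"
        if "set bs \<subseteq> Basis" "length bs = length ([] :: 'a list) + 2" for bs
        unfolding a2_def by (rule moll_power_smooth(2)[OF ca s(1)]) (use that assms(2) in auto)
    qed simp
    then show ?thesis by (simp add: D_def)
  qed
  have D0: "0 \<le> D" using D[of undefined] norm_ge_zero order_trans by blast
  have lim1: "(\<lambda>J. ?C * D * \<delta>\<^sup>2 / 16 * inverse (real (Suc J))) \<longlonglongrightarrow> ?C * D * \<delta>\<^sup>2 / 16 * 0"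
    by (intro tendsto_intros LIMSEQ_inverse_real_of_nat)
  have "\<forall>\<^sub>F J in sequentially. ?C * D * \<delta>\<^sup>2 / 16 * inverse (real (Suc J)) < \<epsilon> / 2"
    by (rule order_tendstoD(2)[OF lim1]) (use assms(6) in simp)
  moreover have "\<forall>\<^sub>F J in sequentially. B * exp 2 * (1 / 4 :: real) ^ J < \<epsilon>"
  proof -
    have lim2: "(\<lambda>J. B * exp 2 * (1 / 4) ^ J) \<longlonglongrightarrow> B * exp 2 * 0"
      by (intro tendsto_intros LIMSEQ_realpow_zero) auto
    show ?thesis
      by (rule order_tendstoD(2)[OF lim2]) (use assms(6) in simp)
  qed
  ultimately have "\<forall>\<^sub>F J in sequentially. ?C * D * \<delta>\<^sup>2 / 16 * inverse (real (Suc J)) < \<epsilon> / 2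
      \<and> B * exp 2 * (1 / 4 :: real) ^ J < \<epsilon>"
    by (rule eventually_conj)
  then obtain J where J: "?C * D * \<delta>\<^sup>2 / 16 * inverse (real (Suc J)) < \<epsilon> / 2" "B * exp 2 * (1 / 4) ^ J < \<epsilon>"
    using eventually_happens'[OF sequentially_bot] by blast
  \<comment> \<open>2 J mollifiers take the derivatives of the J-fold Laplacian; two more provide
    the class asserted for \<open>u\<close>.\<close>
  define m where "m = 2 * J + 2"
  define r where "r = \<delta> / (4 * real m)"
  have m: "real (Suc J) \<le> real m" "0 < real m" "real m = real (2 * J) + 2" by (auto simp: m_def)
  have r: "0 < r" "real m * r = \<delta> / 4" using assms(3) m(2) by (auto simp: r_def)
  define u where "u = (moll r ^^ m) a2"
  have ca2: "continuous_on UNIV a2" using a2C by (rule Ck_on_imp_continuous)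
  show ?thesis
  proof (rule that)
    show "Ck_on (2 * J + 2) u UNIV"
      unfolding u_def m_def[symmetric] by (rule moll_power_smooth(1)[OF ca2 r(1)])
    show "u x = 0" if x: "\<And>w. w \<in> cball x (\<delta> / 2) \<Longrightarrow> a w = 0" for x
    proof -
      have "norm ((moll r ^^ m) a2 x) \<le> 0"
      proof (rule norm_moll_power_le[OF ca2 less_imp_le[OF r(1)]])
        fix w assume w: "w \<in> cball x (real m * r)"
        show "norm (a2 w) \<le> 0"
          unfolding a2_def
        proof (rule norm_moll_power_le[OF ca less_imp_le[OF s(1)]])
          fix v assume "v \<in> cball w (real 2 * s)"
          then have "v \<in> cball x (\<delta> / 2)"
            using w r(2) s(2) dist_triangle[of x v w] by simp
          then show "norm (a v) \<le> 0" using x by simp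
        qed
      qed
      then show ?thesis by (simp add: u_def)
    qed
    show "norm (u x - a x) \<le> \<epsilon>" for x
    proof -
      have "norm (u x - a2 x) \<le> real m * (?C * r\<^sup>2 * D)"
        unfolding u_def by (rule norm_moll_power_minus_le[OF a2C r(1) D])
      also have "\<dots> = ?C * D * (real m * r) * (real m * r) / real m"
        using m(2) by (simp add: power2_eq_square)
      also have "\<dots> = ?C * D * \<delta>\<^sup>2 / 16 * inverse (real m)"
        unfolding r(2) by (simp only: power2_eq_square divide_inverse mult_ac) (simp add: mult_ac)
      also have "\<dots> \<le> ?C * D * \<delta>\<^sup>2 / 16 * inverse (real (Suc J))"
        using m D0 C by (intro mult_left_mono le_imp_inverse_le) auto
      finally have "norm (u x - a2 x) \<le> \<epsilon> / 2" using J(1) by linarith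
      then show ?thesis
        using a2a[of x] norm_triangle_ineq[of "u x - a2 x" "a2 x - a x"] by simp
    qed
    show "\<eta> ^ (2 * J) / fact (2 * J) * norm ((laplacian ^^ J) u x) \<le> \<epsilon>" for x
    proof -
      have "norm (partials [] ((laplacian ^^ J) u) x) \<le> ?n ^ J * ((?C / r) ^ (2 * J) * B)"
      proof (rule norm_partials_iterated_laplacian_le[OF open_UNIV UNIV_I])
        have u: "u = (moll r ^^ (2 * J)) ((moll r ^^ 2) a2)"
          unfolding u_def m_def funpow_add o_apply ..
        show "Ck_on (length ([] :: 'a list) + 2 * J) u UNIV"
          using moll_power_smooth(1)[OF ca2 r(1), of m, folded u_def] by (rule Ck_on_mono) (simp add: m_def)
        show "norm (partials bs u x) \<le> (?C / r) ^ (2 * J) * B"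
          if "set bs \<subseteq> Basis" "length bs = length ([] :: 'a list) + 2 * J" for bs
          unfolding u
        proof (rule moll_power_smooth(2)[OF continuous_on_moll_power[OF ca2] r(1) that(1)])
          show "length bs = 2 * J" using that(2) by simp
          show "norm ((moll r ^^ 2) a2 w) \<le> B" for w
            by (rule norm_moll_power_le[OF ca2 less_imp_le[OF r(1)] a2B])
        qed
      qed simp
      also have "\<dots> \<le> ?n ^ (2 * J) * ((?C / r) ^ (2 * J) * B)"
        using n B C r(1) by (intro mult_right_mono power_increasing) auto
      finally have "\<eta> ^ (2 * J) / fact (2 * J) * norm ((laplacian ^^ J) u x)
          \<le> \<eta> ^ (2 * J) / fact (2 * J) * (?n ^ (2 * J) * ((?C / r) ^ (2 * J) * B))"
        using assms(4) by (intro mult_left_mono) auto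
      also have "\<dots> = B * ((\<eta> * ?n * ?C / r) ^ (2 * J) / fact (2 * J))"
      proof -
        have "\<eta> ^ k / F * (?n ^ k * ((?C / r) ^ k * B)) = B * ((\<eta> * ?n * ?C / r) ^ k / F)" for k F
          by (simp add: power_mult_distrib power_divide mult_ac)
        then show ?thesis .
      qed
      \<comment> \<open>By the choice of \<open>shift_const\<close>, \<eta> n C / r is at most m /
        6. Then m^(2J) / (2J)! \<le> e^m = e^2 e^(2J) leaves e^2 (e / 6)^(2J), and (e / 6)^2 \<le> 1
        / 4.\<close>
      also have "\<dots> \<le> B * (exp 2 * (1 / 4) ^ J)"
      proof (rule mult_left_mono[OF _ B])
        have "\<eta> * ?n * ?C \<le> shift_const TYPE('a) * \<delta> * ?n * ?C"
          using assms(5) n C by (intro mult_right_mono) auto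
        also have "\<dots> = \<delta> / 24" using n C by (simp add: shift_const_def)
        finally have "\<eta> * ?n * ?C \<le> r * (real m / 6)" using r(2) by (simp add: mult.commute)
        then have "\<eta> * ?n * ?C / r \<le> real m / 6" using r(1) by (simp add: pos_divide_le_eq mult.commute)
        then have "(\<eta> * ?n * ?C / r) ^ (2 * J) \<le> (real m / 6) ^ (2 * J)"
          using assms(4) n C r(1) by (intro power_mono) auto
        then have "(\<eta> * ?n * ?C / r) ^ (2 * J) / fact (2 * J) \<le> (real m / 6) ^ (2 * J) / fact (2 * J)"
          by (rule divide_right_mono) simp
        also have "\<dots> = (1 / 6) ^ (2 * J) * (real m ^ (2 * J) / fact (2 * J))"
          unfolding power_divide by simp
        also have "\<dots> \<le> (1 / 6) ^ (2 * J) * exp (real m)"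
          by (intro mult_left_mono power_div_fact_le_exp) auto
        also have "exp (real m) = exp 2 * exp 1 ^ (2 * J)"
          unfolding m(3) exp_add by (simp add: exp_of_nat_mult[symmetric])
        also have "(1 / 6 :: real) ^ (2 * J) * (exp 2 * exp 1 ^ (2 * J)) = exp 2 * (exp 1 / 6) ^ (2 * J)"
          unfolding power_divide by simp
        also have "\<dots> = exp 2 * ((exp 1 / 6) ^ 2) ^ J"
          by (simp only: power_mult)
        also have "\<dots> \<le> exp 2 * (1 / 4) ^ J"
        proof (rule mult_left_mono[OF power_mono])
          have "(exp 1 / 6 :: real) ^ 2 \<le> (1 / 2) ^ 2" using exp_le by (intro power_mono) auto
          then show "(exp 1 / 6 :: real) ^ 2 \<le> 1 / 4" by (simp add: power2_eq_square)
        qed simp_all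
        finally show "(\<eta> * ?n * ?C / r) ^ (2 * J) / fact (2 * J) \<le> exp 2 * (1 / 4) ^ J" .
      qed
      finally have "\<eta> ^ (2 * J) / fact (2 * J) * norm ((laplacian ^^ J) u x) \<le> B * (exp 2 * (1 / 4) ^ J)" .
      then show ?thesis using J(2) by (simp add: mult.assoc)
    qed
  qed
qed

text \<open>The \<open>n\<close>-fold antiderivative, vanishing above \<open>c\<close>, of the ramp \<open>max 0 (c - y)\<close>.\<close>

definition ramp :: "real \<Rightarrow> nat \<Rightarrow> real \<Rightarrow> real" where
  "ramp c n y = (max 0 (c - y)) ^ Suc n / fact (Suc n)"

lemma ramp_has_derivative: "(ramp c (Suc n) has_real_derivative - ramp c n y) (at y)"
proof -
  have "((\<lambda>y. (max 0 (c - y)) ^ Suc (Suc n)) has_real_derivative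
      (real (Suc (Suc n)) * (max 0 (c - y)) ^ Suc n) * (- 1)) (at y)"
    by (rule DERIV_chain'[OF _ DERIV_max0_power]) (auto intro!: derivative_eq_intros)
  then have "((\<lambda>y. (max 0 (c - y)) ^ Suc (Suc n) / fact (Suc (Suc n))) has_real_derivative
      (real (Suc (Suc n)) * (max 0 (c - y)) ^ Suc n) * (- 1) / fact (Suc (Suc n))) (at y)"
    by (rule DERIV_cdivide)
  moreover have "(real (Suc (Suc n)) * (max 0 (c - y)) ^ Suc n) * (- 1) / fact (Suc (Suc n)) = - ramp c n y"
    unfolding ramp_def fact_Suc[of "Suc n"] by (simp add: divide_simps del: fact_Suc power_Suc of_nat_Suc)
  ultimately show ?thesis by (simp add: ramp_def[abs_def])
qed

lemma continuous_on_ramp: "continuous_on S (ramp c n)"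
  unfolding ramp_def by (intro continuous_intros) auto

lemma ramp_above: "c \<le> y \<Longrightarrow> ramp c n y = 0"
  by (simp add: ramp_def max_def)

lemma ramp_nonneg: "0 \<le> ramp c n y"
  by (simp add: ramp_def)

lemma ramp_le:
  assumes "0 \<le> y" "c \<le> \<eta>" "0 \<le> \<eta>"
  shows "ramp c n y \<le> \<eta> * (\<eta> ^ n / fact n)"
proof -
  have "ramp c n y \<le> \<eta> ^ Suc n / fact (Suc n)"
    unfolding ramp_def using assms by (intro divide_right_mono power_mono) auto
  also have "\<dots> \<le> \<eta> ^ Suc n / fact n"
    using assms by (intro divide_left_mono fact_mono) auto
  finally show ?thesis by simp
qed

lemma Ck_on_ramp_tensor:
  fixes a :: "'a::euclidean_space \<Rightarrow> 'b::real_normed_vector"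
  assumes "Ck_on 2 a UNIV"
  shows "Ck_on 2 (\<lambda>z. ramp c (n + 2) (snd z) *\<^sub>R a (fst z)) UNIV"
    and "laplacian (\<lambda>z. ramp c (n + 2) (snd z) *\<^sub>R a (fst z)) z =
      ramp c n (snd z) *\<^sub>R a (fst z) + ramp c (n + 2) (snd z) *\<^sub>R laplacian a (fst z)"
proof -
  define E where "E i y = (- 1) ^ i * ramp c (n + 2 - i) y" for i y
  have E: "(E i has_real_derivative E (Suc i) y) (at y)" if "i < 2" for i y
  proof -
    have *: "Suc (n + 2 - Suc i) = n + 2 - i" using that by simp
    have "((\<lambda>y. (- 1) ^ i * ramp c (Suc (n + 2 - Suc i)) y) has_real_derivative (- 1) ^ i * (- ramp c (n + 2 - Suc i) y)) (at y)"
      by (rule DERIV_cmult[OF ramp_has_derivative])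
    then show ?thesis unfolding * by (simp add: E_def[abs_def])
  qed
  have "Ck_on 2 (\<lambda>z. E 0 (snd z) *\<^sub>R a (fst z)) (UNIV \<times> UNIV)"
  proof (rule Ck_on_tensor[where E = E])
    show "continuous_on UNIV (E 2)" unfolding E_def by (intro continuous_intros continuous_on_ramp)
  qed (use E assms in auto)
  then show "Ck_on 2 (\<lambda>z. ramp c (n + 2) (snd z) *\<^sub>R a (fst z)) UNIV" by (simp add: E_def)
  have "laplacian (\<lambda>z. E 0 (snd z) *\<^sub>R a (fst z)) z = E 2 (snd z) *\<^sub>R a (fst z) + E 0 (snd z) *\<^sub>R laplacian a (fst z)"
    by (rule laplacian_tensor[where ?E1.0 = "E 1", OF open_UNIV _ _ assms UNIV_I])
      (use E[of 0] E[of 1] in \<open>simp_all add: numeral_2_eq_2\<close>)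
  then show "laplacian (\<lambda>z. ramp c (n + 2) (snd z) *\<^sub>R a (fst z)) z =
      ramp c n (snd z) *\<^sub>R a (fst z) + ramp c (n + 2) (snd z) *\<^sub>R laplacian a (fst z)"
    by (simp add: E_def)
qed

lemma laplacian_zero:
  assumes "open S" "x \<in> S" "\<And>y. y \<in> S \<Longrightarrow> f y = 0"
  shows "laplacian f x = 0"
  using laplacian_cong_open[OF assms(1,2), of f "\<lambda>_. 0"] assms(3) by (simp add: laplacian_def)

lemma iterated_laplacian_zero:
  assumes "open S" "x \<in> S" "\<And>y. y \<in> S \<Longrightarrow> f y = 0"
  shows "(laplacian ^^ j) f x = 0"
  using assms(2) by (induction j arbitrary: x) (auto simp: assms(3) intro: laplacian_zero[OF assms(1)])

text \<open>With \<open>u\<close> close to \<open>a\<close>, the equation with right-hand side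
  \<open>ramp c 0\<close> times \<open>u\<close> and zero data at height c has the formal solution
  with terms (-1)^j \<open>ramp c (2 * j + 2)\<close> \<Delta>^j u. Truncated after J terms, its
  Laplacian telescopes to the right-hand side minus one remainder, which is small by the choice of J
  and \<open>u\<close>.\<close>

lemma ramp_solution:
  fixes a :: "'a::euclidean_space \<Rightarrow> 'b::euclidean_space"
  assumes "uniformly_continuous_on UNIV a" "\<And>x. norm (a x) \<le> B"
    and "0 < \<delta>" "0 < \<eta>" "\<eta> \<le> shift_const TYPE('a) * \<delta>" "0 < \<epsilon>" "c \<le> \<eta>"
  obtains W where "Ck_on 2 W UNIV" "\<And>z. \<eta> \<le> snd z \<Longrightarrow> W z = 0"
    "\<And>x y. (\<And>w. w \<in> cball x \<delta> \<Longrightarrow> a w = 0) \<Longrightarrow> W (x, y) = 0"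
    "\<And>z. 0 \<le> snd z \<Longrightarrow> norm (laplacian W z - ramp c 0 (snd z) *\<^sub>R a (fst z)) \<le> \<epsilon>"
proof -
  \<comment> \<open>The errors from u - a and from the remainder \<open>S J\<close> are both
    multiplied by at most \<eta>.\<close>
  define \<epsilon>' where "\<epsilon>' = \<epsilon> / (2 * \<eta>)"
  have \<epsilon>': "0 < \<epsilon>'" using assms by (simp add: \<epsilon>'_def)
  obtain J u where u: "Ck_on (2 * J + 2) u UNIV"
    "\<And>x. (\<And>w. w \<in> cball x (\<delta> / 2) \<Longrightarrow> a w = 0) \<Longrightarrow> u x = 0"
    "\<And>x. norm (u x - a x) \<le> \<epsilon>'"
    "\<And>x. \<eta> ^ (2 * J) / fact (2 * J) * norm ((laplacian ^^ J) u x) \<le> \<epsilon>'"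
    using approx_quasi_analytic[OF assms(1-5) \<epsilon>'] by blast
  define T where "T j = (\<lambda>z. ramp c (2 * j + 2) (snd z) *\<^sub>R ((- 1) ^ j *\<^sub>R (laplacian ^^ j) u (fst z)))" for j
  have C: "Ck_on 2 (\<lambda>x. (- 1) ^ j *\<^sub>R (laplacian ^^ j) u x) UNIV" if "j < J" for j
    using that by (intro Ck_on_linear[OF _ bounded_linear_scaleR_right] Ck_on_iterated_laplacian Ck_on_mono[OF u(1)]) auto
  have T: "Ck_on 2 (T j) UNIV" if "j < J" for j
    unfolding T_def by (rule Ck_on_ramp_tensor(1)[OF C[OF that]])
  define S where "S j z = ramp c (2 * j) (snd z) *\<^sub>R ((- 1) ^ j *\<^sub>R (laplacian ^^ j) u (fst z))" for j z
  have lapT: "laplacian (T j) z = S j z - S (Suc j) z" if "j < J" for j z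
  proof -
    have "laplacian (\<lambda>x. (- 1) ^ j *\<^sub>R (laplacian ^^ j) u x) x = (- 1) ^ j *\<^sub>R laplacian ((laplacian ^^ j) u) x" for x
      using that
      by (intro laplacian_linear[OF open_UNIV bounded_linear_scaleR_right] Ck_on_iterated_laplacian Ck_on_mono[OF u(1)]) auto
    then show ?thesis
      unfolding T_def Ck_on_ramp_tensor(2)[OF C[OF that]] by (simp add: S_def)
  qed
  define W where "W z = (\<Sum>j<J. T j z)" for z
  have lapW: "laplacian W z = S 0 z - S J z" for z
  proof -
    have "laplacian W z = (\<Sum>j<J. laplacian (T j) z)"
      unfolding W_def[abs_def] by (rule laplacian_sum[OF open_UNIV]) (use T in auto)
    also have "\<dots> = (\<Sum>j<J. S j z - S (Suc j) z)" by (rule sum.cong) (use lapT in auto)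
    also have "\<dots> = S 0 z - S J z" by (induction J) auto
    finally show ?thesis .
  qed
  show ?thesis
  proof (rule that)
    show "Ck_on 2 W UNIV" unfolding W_def by (rule Ck_on_sum[OF open_UNIV]) (use T in auto)
    show "W z = 0" if "\<eta> \<le> snd z" for z
      using that assms(7) by (simp add: W_def T_def ramp_above)
    show "W (x, y) = 0" if x: "\<And>w. w \<in> cball x \<delta> \<Longrightarrow> a w = 0" for x y
    proof -
      have "u v = 0" if "v \<in> ball x (\<delta> / 2)" for v
      proof (rule u(2), rule x)
        fix w assume "w \<in> cball v (\<delta> / 2)"
        then show "w \<in> cball x \<delta>" using that dist_triangle[of x w v] by simp
      qed
      then have "(laplacian ^^ j) u x = 0" for j
        using assms(3) by (intro iterated_laplacian_zero[OF open_ball, of x x "\<delta> / 2"]) auto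
      then show ?thesis by (simp add: W_def T_def)
    qed
    show "norm (laplacian W z - ramp c 0 (snd z) *\<^sub>R a (fst z)) \<le> \<epsilon>" if y: "0 \<le> snd z" for z
    proof -
      have "laplacian W z - ramp c 0 (snd z) *\<^sub>R a (fst z) = ramp c 0 (snd z) *\<^sub>R (u (fst z) - a (fst z)) - S J z"
        unfolding lapW by (simp add: S_def scaleR_diff_right)
      also have "norm \<dots> \<le> \<eta> * \<epsilon>' + \<eta> * \<epsilon>'"
      proof (rule order_trans[OF norm_triangle_ineq4 add_mono])
        show "norm (ramp c 0 (snd z) *\<^sub>R (u (fst z) - a (fst z))) \<le> \<eta> * \<epsilon>'"
          using ramp_le[OF y assms(7), of 0] u(3)[of "fst z"] assms(4) ramp_nonneg[of c 0 "snd z"]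
          by (simp add: mult_mono)
        have "norm (S J z) = ramp c (2 * J) (snd z) * norm ((laplacian ^^ J) u (fst z))"
          by (simp add: S_def abs_mult abs_of_nonneg[OF ramp_nonneg] power_abs)
        also have "\<dots> \<le> \<eta> * (\<eta> ^ (2 * J) / fact (2 * J)) * norm ((laplacian ^^ J) u (fst z))"
          using ramp_le[OF y assms(7)] assms(4) by (intro mult_right_mono) auto
        also have "\<dots> \<le> \<eta> * \<epsilon>'"
          unfolding mult.assoc by (rule mult_left_mono[OF u(4)]) (use assms(4) in simp)
        finally show "norm (S J z) \<le> \<eta> * \<epsilon>'" .
      qed
      also have "\<dots> = \<epsilon>" using assms(4) by (simp add: \<epsilon>'_def)
      finally show ?thesis .
    qed
  qed
qed

section \<open>Data depending on both variables\<close>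

lemma uniformly_continuous_bounded_support:
  fixes g :: "'a::euclidean_space \<Rightarrow> 'b::real_normed_vector"
  assumes "continuous_on UNIV g" "\<And>z. R < norm z \<Longrightarrow> g z = 0"
  shows "uniformly_continuous_on UNIV g" "\<exists>B. \<forall>z. norm (g z) \<le> B"
proof -
  have uc: "uniformly_continuous_on (cball 0 (R + 1)) g"
    by (rule compact_uniformly_continuous[OF continuous_on_subset_UNIV[OF assms(1)] compact_cball])
  show "uniformly_continuous_on UNIV g"
    unfolding uniformly_continuous_on_def
  proof (intro allI impI)
    fix e :: real assume "0 < e"
    then obtain d where d: "0 < d"
      "\<And>x y. x \<in> cball 0 (R + 1) \<Longrightarrow> y \<in> cball 0 (R + 1) \<Longrightarrow> dist y x < d \<Longrightarrow> dist (g y) (g x) < e"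
      using uc unfolding uniformly_continuous_on_def by metis
    have "dist (g y) (g x) < e" if "dist y x < min d 1" for x y
    proof (cases "norm x \<le> R + 1 \<and> norm y \<le> R + 1")
      case True
      then show ?thesis using d(2) that by simp
    next
      case False
      have "\<bar>norm y - norm x\<bar> < 1" using norm_triangle_ineq3[of y x] that by (simp add: dist_norm)
      then have "g x = 0" "g y = 0" using False by (auto intro!: assms(2))
      then show ?thesis using \<open>0 < e\<close> by simp
    qed
    then show "\<exists>d>0. \<forall>x\<in>UNIV. \<forall>y\<in>UNIV. dist y x < d \<longrightarrow> dist (g y) (g x) < e"
      using d(1) by (intro exI[of _ "min d 1"]) auto
  qed
  have "compact (g ` cball 0 R)"
    by (intro compact_continuous_image continuous_on_subset_UNIV[OF assms(1)] compact_cball)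
  then obtain B where B: "\<And>z. z \<in> cball 0 R \<Longrightarrow> norm (g z) \<le> B"
    using compact_imp_bounded bounded_iff by (metis imageI)
  have "norm (g z) \<le> max B 0" for z
    using B[of z] assms(2)[of z] by (cases "R < norm z") auto
  then show "\<exists>B. \<forall>z. norm (g z) \<le> B" by blast
qed

text \<open>A difference of consecutive ramps is h below its interval, falls linearly on it and is 0
  above. Thus the terms before k vanish at y, those after k telescope to \<open>g (Suc k)\<close>,
  and the k-th one interpolates.\<close>

lemma piecewise_linear_interpolation:
  fixes g :: "nat \<Rightarrow> 'b::real_vector"
  assumes "0 < h" "k < n" "real k * h \<le> y" "y \<le> real (Suc k) * h" "g n = 0"
  shows "(\<Sum>i<n. (ramp (real (Suc i) * h) 0 y - ramp (real i * h) 0 y) *\<^sub>R ((g i - g (Suc i)) /\<^sub>R h))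
    = g (Suc k) + ((real (Suc k) * h - y) / h) *\<^sub>R (g k - g (Suc k))"
proof -
  let ?f = "\<lambda>i. (ramp (real (Suc i) * h) 0 y - ramp (real i * h) 0 y) *\<^sub>R ((g i - g (Suc i)) /\<^sub>R h)"
  have split: "sum f {..<n} = sum f {..<k} + (f k + sum f {Suc k..<n})" for f :: "nat \<Rightarrow> 'b"
    using sum.atLeastLessThan_concat[OF le0 Suc_leI[OF assms(2)], of f, symmetric, folded lessThan_atLeast0]
    by (simp only: sum.lessThan_Suc add.assoc)
  have "sum ?f {..<n} = sum ?f {..<k} + (?f k + sum ?f {Suc k..<n})" by (rule split)
  also have "sum ?f {..<k} = 0"
  proof (rule sum.neutral, rule ballI)
    fix i assume "i \<in> {..<k}"
    then have "real i * h \<le> real k * h" "real (Suc i) * h \<le> real k * h"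
      using assms(1) by (intro mult_right_mono; simp)+
    then have "real i * h \<le> y" "real (Suc i) * h \<le> y" using assms(3) by linarith+
    then show "?f i = 0" by (simp add: ramp_above)
  qed
  also have "?f k = ((real (Suc k) * h - y) / h) *\<^sub>R (g k - g (Suc k))"
    using assms(3,4) by (simp add: ramp_def max_def divide_inverse)
  also have "sum ?f {Suc k..<n} = (\<Sum>i=Suc k..<n. - (g (Suc i) - g i))"
  proof (rule sum.cong[OF refl])
    fix i assume "i \<in> {Suc k..<n}"
    then have "real (Suc k) * h \<le> real i * h" "real (Suc k) * h \<le> real (Suc i) * h"
      using assms(1) by (intro mult_right_mono; simp)+
    then have "y \<le> real i * h" "y \<le> real (Suc i) * h" using assms(4) by linarith+
    then have "ramp (real (Suc i) * h) 0 y - ramp (real i * h) 0 y = h"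
      by (simp add: ramp_def max_def algebra_simps)
    then show "?f i = - (g (Suc i) - g i)" using assms(1) by simp
  qed
  also have "\<dots> = g (Suc k)"
    by (simp only: sum_negf sum_Suc_diff'[OF Suc_leI[OF assms(2)]]) (simp add: assms(5))
  finally show ?thesis by simp
qed

text \<open>Linear interpolation in y turns \<open>g\<close> into a finite sum of ramps times
  functions of x, each treated by \<open>ramp_solution\<close>. Half of \<epsilon> goes to 2 N ramps
  with error \<epsilon> / (4 N) each, half to the interpolation.\<close>

lemma almost_solution_above:
  fixes g :: "'a::euclidean_space \<times> real \<Rightarrow> 'b::euclidean_space"
  assumes "continuous_on UNIV g" "\<And>z. R < norm z \<Longrightarrow> g z = 0" "\<And>z. \<eta> \<le> snd z \<Longrightarrow> g z = 0"
    and "0 < \<delta>" "0 < \<eta>" "\<eta> \<le> shift_const TYPE('a) * \<delta>" "0 < \<epsilon>"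
  obtains W where "Ck_on 2 W UNIV" "\<And>z. \<eta> \<le> snd z \<Longrightarrow> W z = 0"
    "\<And>x y. \<forall>w\<in>cball x \<delta>. \<forall>t. g (w, t) = 0 \<Longrightarrow> W (x, y) = 0"
    "\<And>z. 0 \<le> snd z \<Longrightarrow> norm (laplacian W z - g z) \<le> \<epsilon>"
proof -
  have uc: "uniformly_continuous_on UNIV g"
    by (rule uniformly_continuous_bounded_support(1)[OF assms(1,2)])
  obtain B where B: "\<And>z. norm (g z) \<le> B"
    using uniformly_continuous_bounded_support(2)[OF assms(1,2)] by blast
  obtain d where d: "0 < d" "\<And>z z'. dist z' z < d \<Longrightarrow> dist (g z') (g z) < \<epsilon> / 4"
    using uc assms(7) unfolding uniformly_continuous_on_def by (metis UNIV_I divide_pos_pos zero_less_numeral)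
  obtain n where n: "\<eta> / d < real (Suc n)" using reals_Archimedean2[of "\<eta> / d"] by (metis less_Suc_eq of_nat_less_iff order_less_trans)
  define N where "N = Suc n"
  have N0: "0 < N" by (simp add: N_def)
  define h where "h = \<eta> / real N"
  have h: "0 < h" "h < d" "real N * h = \<eta>"
    using n d(1) assms(5) by (auto simp: h_def N_def field_simps simp del: of_nat_Suc)
  have gclose: "norm (g (x, t) - g (x, t')) \<le> \<epsilon> / 4" if "\<bar>t - t'\<bar> \<le> h" for x t t'
    using d(2)[of "(x, t)" "(x, t')"] that h(2) by (simp add: dist_norm dist_Pair_Pair)
  define a where "a i = (\<lambda>x. (g (x, real i * h) - g (x, real (Suc i) * h)) /\<^sub>R h)" for i
  have ga: "uniformly_continuous_on UNIV (\<lambda>x. g (x, t))" for t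
    unfolding uniformly_continuous_on_def
  proof (intro allI impI)
    fix e :: real assume "0 < e"
    then obtain d where "0 < d" "\<And>z z'. dist z' z < d \<Longrightarrow> dist (g z') (g z) < e"
      using uc unfolding uniformly_continuous_on_def by (metis UNIV_I)
    then show "\<exists>d>0. \<forall>x\<in>UNIV. \<forall>x'\<in>UNIV. dist x' x < d \<longrightarrow> dist (g (x', t)) (g (x, t)) < e"
      by (intro exI[of _ d]) (simp add: dist_Pair_Pair)
  qed
  have ua: "uniformly_continuous_on UNIV (a i)" for i
    unfolding a_def
    by (intro bounded_linear.uniformly_continuous_on[OF bounded_linear_scaleR_right] uniformly_continuous_on_diff ga)
  have Ba: "norm (a i x) \<le> 2 * B / h" for i x
    unfolding a_def norm_scaleR using h(1) B norm_triangle_ineq4[of "g (x, real i * h)" "g (x, real (Suc i) * h)"]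
    by (simp add: divide_simps) (smt (verit) B)
  define P where "P i c W \<longleftrightarrow> Ck_on 2 W UNIV \<and> (\<forall>z. \<eta> \<le> snd z \<longrightarrow> W z = 0) \<and>
      (\<forall>x y. (\<forall>w \<in> cball x \<delta>. a i w = 0) \<longrightarrow> W (x, y) = 0) \<and>
      (\<forall>z. 0 \<le> snd z \<longrightarrow> norm (laplacian W z - ramp c 0 (snd z) *\<^sub>R a i (fst z)) \<le> \<epsilon> / (4 * real N))"
    for i c and W :: "'a \<times> real \<Rightarrow> 'b"
  have "\<exists>W. P i c W" if c: "c \<le> \<eta>" for i c
  proof -
    have "0 < \<epsilon> / (4 * real N)" using assms(7) by (simp add: N_def)
    from ramp_solution[OF ua Ba assms(4-6) this c, of i] show ?thesis
      unfolding P_def by metis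
  qed
  then have "\<forall>i c. \<exists>W. c \<le> \<eta> \<longrightarrow> P i c W" by blast
  then obtain w where "\<forall>i c. c \<le> \<eta> \<longrightarrow> P i c (w i c)" by metis
  then have w: "\<And>i c. c \<le> \<eta> \<Longrightarrow> Ck_on 2 (w i c) UNIV" "\<And>i c z. c \<le> \<eta> \<Longrightarrow> \<eta> \<le> snd z \<Longrightarrow> w i c z = 0"
      "\<And>i c x y. c \<le> \<eta> \<Longrightarrow> (\<forall>w \<in> cball x \<delta>. a i w = 0) \<Longrightarrow> w i c (x, y) = 0"
      "\<And>i c z. c \<le> \<eta> \<Longrightarrow> 0 \<le> snd z \<Longrightarrow> norm (laplacian (w i c) z - ramp c 0 (snd z) *\<^sub>R a i (fst z)) \<le> \<epsilon> / (4 * real N)"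
    unfolding P_def by blast+
  have le: "real i * h \<le> \<eta>" "real (Suc i) * h \<le> \<eta>" if "i < N" for i
    unfolding h(3)[symmetric] using that h(1) by (intro mult_right_mono; simp)+
  define v where "v i z = w i (real (Suc i) * h) z - w i (real i * h) z" for i z
  have v: "Ck_on 2 (v i) UNIV" if "i < N" for i
    unfolding v_def[abs_def] by (intro Ck_on_diff w le that open_UNIV)
  define W where "W z = (\<Sum>i<N. v i z)" for z
  show ?thesis
  proof (rule that)
    show "Ck_on 2 W UNIV" unfolding W_def by (rule Ck_on_sum[OF open_UNIV]) (use v in auto)
    show "W z = 0" if "\<eta> \<le> snd z" for z
      unfolding W_def v_def by (rule sum.neutral) (use w(2)[OF _ that] le in auto)
    show "W (x, y) = 0" if "\<forall>w\<in>cball x \<delta>. \<forall>t. g (w, t) = 0" for x y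
    proof -
      have "\<forall>w \<in> cball x \<delta>. a i w = 0" for i using that by (simp add: a_def)
      then show ?thesis
        unfolding W_def v_def using w(3) le by (intro sum.neutral) auto
    qed
    show "norm (laplacian W z - g z) \<le> \<epsilon>" if y: "0 \<le> snd z" for z
    proof -
      obtain x y where z: "z = (x, y)" by fastforce
      let ?p = "\<Sum>i<N. (ramp (real (Suc i) * h) 0 y - ramp (real i * h) 0 y) *\<^sub>R a i x"
      have lapW: "laplacian W z = (\<Sum>i<N. laplacian (v i) z)"
        unfolding W_def[abs_def] by (rule laplacian_sum[OF open_UNIV]) (use v in auto)
      have lapv: "laplacian (v i) z = laplacian (w i (real (Suc i) * h)) z - laplacian (w i (real i * h)) z" if "i < N" for i
        unfolding v_def[abs_def] by (intro laplacian_diff[OF open_UNIV] w le that UNIV_I)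
      have "laplacian W z - ?p = (\<Sum>i<N. laplacian (v i) z - (ramp (real (Suc i) * h) 0 y - ramp (real i * h) 0 y) *\<^sub>R a i x)"
        by (simp only: lapW sum_subtractf)
      also have "\<dots> = (\<Sum>i<N. (laplacian (w i (real (Suc i) * h)) z - ramp (real (Suc i) * h) 0 y *\<^sub>R a i x)
          - (laplacian (w i (real i * h)) z - ramp (real i * h) 0 y *\<^sub>R a i x))"
        by (rule sum.cong[OF refl]) (simp add: lapv scaleR_diff_left del: of_nat_Suc)
      also have "norm \<dots> \<le> (\<Sum>i<N. \<epsilon> / (4 * real N) + \<epsilon> / (4 * real N))"
      proof (rule sum_norm_le)
        fix i assume i: "i \<in> {..<N}"
        show "norm ((laplacian (w i (real (Suc i) * h)) z - ramp (real (Suc i) * h) 0 y *\<^sub>R a i x)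
          - (laplacian (w i (real i * h)) z - ramp (real i * h) 0 y *\<^sub>R a i x)) \<le> \<epsilon> / (4 * real N) + \<epsilon> / (4 * real N)"
          using w(4)[OF le(1) y, of i i] w(4)[OF le(2) y, of i i] i z
          by (intro order_trans[OF norm_triangle_ineq4 add_mono]) auto
      qed
      also have "\<dots> = \<epsilon> / 2" using N0 by simp
      finally have 1: "norm (laplacian W z - ?p) \<le> \<epsilon> / 2" .
      have 2: "norm (?p - g (x, y)) \<le> \<epsilon> / 2"
      proof (cases "\<eta> \<le> y")
        case True
        have "?p = 0"
        proof (rule sum.neutral, rule ballI)
          fix i assume "i \<in> {..<N}"
          then have "real i * h \<le> y" "real (Suc i) * h \<le> y" using le[of i] True by auto
          then show "(ramp (real (Suc i) * h) 0 y - ramp (real i * h) 0 y) *\<^sub>R a i x = 0"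
            by (simp add: ramp_above del: of_nat_Suc)
        qed
        then show ?thesis using assms(3)[of "(x, y)"] True assms(7) by simp
      next
        case False
        define k where "k = nat \<lfloor>y / h\<rfloor>"
        have "0 \<le> y / h" using y z h(1) by simp
        then have "real k \<le> y / h" "y / h < real k + 1"
          unfolding k_def by linarith+
        then have k: "real k * h \<le> y" "y \<le> real (Suc k) * h"
          using h(1) by (simp_all add: field_simps)
        have "real k * h < real N * h" using k(1) False h(3) by linarith
        then have "k < N" using h(1) by simp
        have "?p = g (x, real (Suc k) * h) + ((real (Suc k) * h - y) / h) *\<^sub>R (g (x, real k * h) - g (x, real (Suc k) * h))"
          unfolding a_def
          by (rule piecewise_linear_interpolation[where g = "\<lambda>i. g (x, real i * h)", OF h(1) \<open>k < N\<close> k])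
            (simp add: h(3) assms(3))
        then have "?p - g (x, y) = (g (x, real (Suc k) * h) - g (x, y))
            + ((real (Suc k) * h - y) / h) *\<^sub>R (g (x, real k * h) - g (x, real (Suc k) * h))"
          by simp
        also have "norm \<dots> \<le> \<epsilon> / 4 + 1 * (\<epsilon> / 4)"
        proof (rule order_trans[OF norm_triangle_ineq add_mono])
          show "norm (g (x, real (Suc k) * h) - g (x, y)) \<le> \<epsilon> / 4"
            using k by (intro gclose) (simp add: algebra_simps)
          have "\<bar>(real (Suc k) * h - y) / h\<bar> \<le> 1"
            using k h(1) by (simp add: field_simps)
          moreover have "norm (g (x, real k * h) - g (x, real (Suc k) * h)) \<le> \<epsilon> / 4"
            using h(1) by (intro gclose) (simp add: algebra_simps)
          ultimately show "norm (((real (Suc k) * h - y) / h) *\<^sub>R (g (x, real k * h) - g (x, real (Suc k) * h))) \<le> 1 * (\<epsilon> / 4)"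
            unfolding norm_scaleR by (intro mult_mono) auto
        qed
        finally show ?thesis by simp
      qed
      have "laplacian W z - g z = (laplacian W z - ?p) + (?p - g (x, y))" by (simp add: z)
      then show ?thesis using norm_triangle_le[OF add_mono[OF 1 2]] by simp
    qed
  qed
qed

section \<open>Solving the Poisson equation up to a prescribed error on a half-space\<close>

text \<open>The datum \<open>f\<close> is small near \<open>K\<close> only, but no restriction is imposed on the growth of \<open>W\<close> as
  \<open>y \<longrightarrow> 0\<close> away from \<open>K\<close>. So \<open>f\<close> may be solved with a uniform error, the error in the layer
  below height \<open>\<eta>\<^sub>1\<close> taken as a new datum, and so on: the corrections live on shrinking layers, hence
  their sum is locally finite, and they never reach a neighbourhood of \<open>K\<close>.\<close>

lemma almost_solution_half_space:
  fixes f :: "'a::euclidean_space \<times> real \<Rightarrow> 'b::euclidean_space"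
  assumes f: "continuous_on UNIV f" "\<And>z. R < norm z \<Longrightarrow> f z = 0"
    and K: "compact K" "open U" "K \<subseteq> U"
    and e: "\<And>y. 0 < y \<Longrightarrow> 0 < e y" "\<And>y y'. 0 < y \<Longrightarrow> y \<le> y' \<Longrightarrow> e y \<le> e y'"
    and fU: "\<And>x y. x \<in> U \<Longrightarrow> 0 < y \<Longrightarrow> norm (f (x, y)) \<le> A * e y"
  obtains W U' C where "open U'" "K \<subseteq> U'" "Ck_on 2 W {z. 0 < snd z}" "\<And>x y. x \<in> U' \<Longrightarrow> W (x, y) = 0"
    "\<And>z. 0 < snd z \<Longrightarrow> norm (laplacian W z - f z) \<le> C * e (snd z)"
proof -
  obtain \<zeta> :: "'a \<Rightarrow> real" and C U1 where \<zeta>: "Ck_on 0 \<zeta> UNIV" "compact C" "C \<subseteq> U" "\<And>x. x \<notin> C \<Longrightarrow> \<zeta> x = 0"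
    "open U1" "K \<subseteq> U1" "U1 \<subseteq> U" "\<And>x. x \<in> U1 \<Longrightarrow> \<zeta> x = 1" "\<And>x. \<bar>\<zeta> x\<bar> \<le> 1"
    by (rule smooth_cutoff[OF K, of 0]) (rule that)
  obtain \<rho> where \<rho>: "0 < \<rho>" "(\<Union>x\<in>K. ball x \<rho>) \<subseteq> U1"
    using compact_subset_open_imp_ball_epsilon_subset[OF K(1) \<zeta>(5,6)] by blast
  obtain B where B: "\<And>z. norm (f z) \<le> B"
    using uniformly_continuous_bounded_support(2)[OF f] by blast
  have B0: "0 \<le> B" using B[of undefined] norm_ge_zero order_trans by blast
  \<comment> \<open>The radii fall from \<rho> towards \<rho> / 2, and \<open>\<delta> k\<close> is
    half of the k-th decrement; hence the spreads of all steps together never reach the \<rho> / 2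
    neighbourhood of K.\<close>
  define N where "N k = (\<Union>x\<in>K. ball x (\<rho> * (1 / 2 + (1 / 2) ^ Suc k)))" for k :: nat
  define \<delta> where "\<delta> k = \<rho> * (1 / 2) ^ (k + 3)" for k :: nat
  define \<eta> where "\<eta> k = shift_const TYPE('a) * \<delta> k" for k
  define \<tau> where "\<tau> k y = max 0 (min 1 (2 - 2 * \<bar>y\<bar> / \<eta> k))" for k and y :: real
  \<comment> \<open>The error of step k is kept only above height \<eta> (k + 1) / 2, where e is at
    least its value there; the factor 2^(-k) makes the errors summable.\<close>
  define \<epsilon> where "\<epsilon> k = (1 / 2) ^ k * e (\<eta> (Suc k) / 2)" for k
  have N_open: "open (N k)" for k by (auto simp: N_def)
  have \<delta>: "0 < \<delta> k" for k using \<rho>(1) by (simp add: \<delta>_def)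
  have N_step: "w \<in> N k" if xN: "x \<in> N (Suc k)" and xw: "w \<in> cball x (\<delta> k)" for x w k
  proof -
    obtain v where v: "v \<in> K" "dist v x < \<rho> * (1 / 2 + (1 / 2) ^ Suc (Suc k))"
      using xN unfolding N_def UN_iff mem_ball by blast
    have "dist v w < \<rho> * (1 / 2 + (1 / 2) ^ Suc (Suc k)) + \<delta> k"
      using dist_triangle[of v w x] v(2) xw unfolding mem_cball by linarith
    also have "\<dots> \<le> \<rho> * (1 / 2 + (1 / 2) ^ Suc k)"
    proof -
      have "0 \<le> \<rho> * (1 / 2) ^ k" using \<rho>(1) by simp
      then show ?thesis by (simp add: \<delta>_def power_add power3_eq_cube distrib_left)
    qed
    finally show ?thesis using v(1) unfolding N_def UN_iff mem_ball by blast
  qed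
  have \<eta>: "0 < \<eta> k" for k using \<delta> shift_const_pos[where 'a = 'a] by (simp add: \<eta>_def)
  have \<eta>_lim: "\<exists>n. \<eta> n < y" if "0 < y" for y
  proof -
    have "(\<lambda>n. shift_const TYPE('a) * (\<rho> * ((1 / 2) ^ n * (1 / 2) ^ 3))) \<longlonglongrightarrow> shift_const TYPE('a) * (\<rho> * (0 * (1 / 2) ^ 3))"
      by (intro tendsto_intros LIMSEQ_realpow_zero) auto
    then have "\<eta> \<longlonglongrightarrow> 0" by (simp add: \<eta>_def[abs_def] \<delta>_def power_add)
    then have "\<forall>\<^sub>F n in sequentially. \<eta> n < y" using that by (rule order_tendstoD(2))
    then show ?thesis by (rule eventually_happens'[OF sequentially_bot])
  qed
  have \<eta>_mono: "\<eta> j \<le> \<eta> k" if "k \<le> j" for j k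
    unfolding \<eta>_def \<delta>_def using that \<rho>(1) shift_const_pos[where 'a = 'a]
    by (intro mult_left_mono power_decreasing) auto
  have \<epsilon>: "0 < \<epsilon> k" for k using e(1) \<eta> by (simp add: \<epsilon>_def)
  have \<tau>_cont: "continuous_on UNIV (\<tau> k)" for k
    unfolding \<tau>_def using \<eta>[of k] by (intro continuous_intros) auto
  have \<tau>_0: "\<tau> k y = 0" if "\<eta> k \<le> \<bar>y\<bar>" for k y
    using that \<eta>[of k] by (simp add: \<tau>_def field_simps max_def min_def)
  have \<tau>_1: "\<tau> k y = 1" if "\<bar>y\<bar> \<le> \<eta> k / 2" for k y
    using that \<eta>[of k] by (simp add: \<tau>_def field_simps max_def min_def)
  have \<tau>_01: "0 \<le> 1 - \<tau> k y" "1 - \<tau> k y \<le> 1" for k y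
    by (auto simp: \<tau>_def)
  \<comment> \<open>Only this part of \<open>f\<close> has to be solved. Of the rest, \<zeta> f is
    bounded by the hypothesis on \<open>U\<close>, and the part cut off by \<open>\<tau> 0\<close>
    lives above height \<eta> 0 / 2, where e is bounded below.\<close>
  define g0 where "g0 z = \<tau> 0 (snd z) *\<^sub>R (1 - \<zeta> (fst z)) *\<^sub>R f z" for z
  \<comment> \<open>The last conjunct pins the start of the sequence, since dependent choice returns
    just some \<open>G\<close> with \<open>Adm k (G k)\<close>.\<close>
  define Adm where "Adm k g \<longleftrightarrow> continuous_on UNIV g \<and> (\<exists>R. \<forall>z. R < norm z \<longrightarrow> g z = 0) \<and>
      (\<forall>z. \<eta> k \<le> snd z \<longrightarrow> g z = 0) \<and> (\<forall>z. fst z \<in> N k \<longrightarrow> g z = 0) \<and> (k = 0 \<longrightarrow> g = g0)"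
    for k and g :: "'a \<times> real \<Rightarrow> 'b"
  \<comment> \<open>The next datum \<open>g'\<close> is the error of the present step, confined to a
    thinner layer; what \<open>\<tau>\<close> cuts off remains as final error.\<close>
  define Q where "Q k g g' W \<longleftrightarrow> Ck_on 2 W UNIV \<and> (\<forall>z. \<eta> k \<le> snd z \<longrightarrow> W z = 0) \<and>
      (\<forall>z. fst z \<in> N (Suc k) \<longrightarrow> W z = 0) \<and> (\<forall>z. 0 \<le> snd z \<longrightarrow> norm (laplacian W z - g z) \<le> \<epsilon> k) \<and>
      g' = (\<lambda>z. \<tau> (Suc k) (snd z) *\<^sub>R (g z - laplacian W z))"
    for k and g g' W :: "'a \<times> real \<Rightarrow> 'b"
  have "Adm 0 g0"
    unfolding Adm_def
  proof (intro conjI allI impI)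
    have \<zeta>c: "continuous_on UNIV \<zeta>" using \<zeta>(1) by simp
    show "continuous_on UNIV g0"
      unfolding g0_def
      by (intro continuous_intros f(1) continuous_on_affine_compose[OF \<tau>_cont] continuous_on_affine_compose[OF \<zeta>c])
    show "\<exists>R. \<forall>z. R < norm z \<longrightarrow> g0 z = 0" using f(2) by (auto simp: g0_def)
    show "g0 z = 0" if "\<eta> 0 \<le> snd z" for z using that \<tau>_0[of 0 "snd z"] by (simp add: g0_def)
    show "g0 z = 0" if "fst z \<in> N 0" for z
    proof -
      have "N 0 = (\<Union>x\<in>K. ball x \<rho>)" by (simp add: N_def)
      then have "fst z \<in> U1" using that \<rho>(2) by blast
      then show ?thesis using \<zeta>(8) by (simp add: g0_def)
    qed
  qed simp
  moreover have "\<exists>g'. Adm (Suc k) g' \<and> (\<exists>W. Q k g g' W)" if "Adm k g" for k g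
  proof -
    obtain R where g: "continuous_on UNIV g" "\<And>z. R < norm z \<Longrightarrow> g z = 0" "\<And>z. \<eta> k \<le> snd z \<Longrightarrow> g z = 0"
        "\<And>z. fst z \<in> N k \<Longrightarrow> g z = 0"
      using \<open>Adm k g\<close> unfolding Adm_def by blast
    obtain W where W: "Ck_on 2 W UNIV" "\<And>z. \<eta> k \<le> snd z \<Longrightarrow> W z = 0"
      "\<And>x y. \<forall>w\<in>cball x (\<delta> k). \<forall>t. g (w, t) = 0 \<Longrightarrow> W (x, y) = 0"
      "\<And>z. 0 \<le> snd z \<Longrightarrow> norm (laplacian W z - g z) \<le> \<epsilon> k"
      by (rule almost_solution_above[OF g(1-3) \<delta>[of k] \<eta>[of k] eq_refl[OF \<eta>_def] \<epsilon>[of k]]) (assumption | rule that)+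
    have lapW: "continuous_on UNIV (laplacian W)"
      using Ck_on_laplacian[OF open_UNIV, of 0 W] W(1) by (simp add: numeral_2_eq_2)
    have WN: "W z = 0" if "fst z \<in> N (Suc k)" for z
      using W(3)[of "fst z" "snd z"] g(4) N_step[OF that] by simp
    define g' where "g' = (\<lambda>z. \<tau> (Suc k) (snd z) *\<^sub>R (g z - laplacian W z))"
    have "Adm (Suc k) g'"
      unfolding Adm_def
    proof (intro conjI allI impI)
      show "continuous_on UNIV g'"
        unfolding g'_def by (intro continuous_intros g(1) lapW continuous_on_affine_compose[OF \<tau>_cont])
      show "\<exists>R. \<forall>z. R < norm z \<longrightarrow> g' z = 0"
      proof (intro exI allI impI)
        fix z :: "'a \<times> real" assume z: "R + \<delta> k + \<eta> (Suc k) < norm z"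
        show "g' z = 0"
        proof (cases "\<eta> (Suc k) \<le> \<bar>snd z\<bar>")
          case True
          then show ?thesis using \<tau>_0 by (simp add: g'_def)
        next
          case False
          have "norm z \<le> norm (fst z) + \<bar>snd z\<bar>" using norm_Pair_le[of "fst z" "snd z"] by simp
          then have far: "R + \<delta> k < norm (fst z)" using z False by simp
          have "g z = 0"
            using norm_fst_le[of "fst z" "snd z"] far \<delta>[of k] by (intro g(2)) simp
          moreover have "laplacian W z = 0"
          proof (rule laplacian_zero[of "{z. R + \<delta> k < norm (fst z)}"])
            show "open {z :: 'a \<times> real. R + \<delta> k < norm (fst z)}"
              by (intro open_Collect_less continuous_intros)
            fix u :: "'a \<times> real" assume u: "u \<in> {z. R + \<delta> k < norm (fst z)}"
            have "g (w, t) = 0" if "w \<in> cball (fst u) (\<delta> k)" for w t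
            proof (rule g(2))
              have "norm (fst u) \<le> norm w + \<delta> k"
                using that norm_triangle_sub[of "fst u" w] by (simp add: dist_norm)
              then show "R < norm (w, t)" using u norm_fst_le[of w t] by simp
            qed
            then show "W u = 0" using W(3)[of "fst u" "snd u"] by simp
          qed (use far in simp)
          ultimately show ?thesis by (simp add: g'_def)
        qed
      qed
      show "g' z = 0" if "\<eta> (Suc k) \<le> snd z" for z using that \<tau>_0[of "Suc k" "snd z"] by (simp add: g'_def)
      show "g' z = 0" if "fst z \<in> N (Suc k)" for z
      proof -
        have "g z = 0" using N_step[OF that, of "fst z"] \<delta>[of k] by (intro g(4)) auto
        moreover have "laplacian W z = 0"
          by (rule laplacian_zero[of "N (Suc k) \<times> UNIV"])
            (use that WN N_open in \<open>auto simp: open_Times mem_Times_iff\<close>)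
        ultimately show ?thesis by (simp add: g'_def)
      qed
    qed simp
    then show ?thesis using W(1,2,4) WN unfolding Q_def g'_def by blast
  qed
  ultimately obtain G where G: "\<And>k. Adm k (G k)" "\<And>k. \<exists>W. Q k (G k) (G (Suc k)) W"
    using dependent_nat_choice[of Adm "\<lambda>k g g'. \<exists>W. Q k g g' W"] by blast
  obtain W where W: "\<And>k. Q k (G k) (G (Suc k)) (W k)" using G(2) by metis
  have G0: "G 0 = g0" using G(1)[of 0] by (simp add: Adm_def)
  define Wt where "Wt z = (\<Sum>k. W k z)" for z
  have fin: "Wt z = (\<Sum>k<n. W k z)" if "\<eta> n < snd z" for z n
    unfolding Wt_def
  proof (rule suminf_finite)
    fix k assume "k \<notin> {..<n}"
    then have "\<eta> k \<le> snd z" using \<eta>_mono[of n k] that by simp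
    then show "W k z = 0" using W[of k] unfolding Q_def by blast
  qed simp
  have op: "open {z :: 'a \<times> real. \<eta> n < snd z}" for n
    by (intro open_Collect_less continuous_intros)
  have W2: "Ck_on 2 (W k) UNIV" for k using W[of k] unfolding Q_def by blast
  have est: "norm (laplacian Wt z - g0 z) \<le> 2 * e (snd z)" if y: "0 < snd z" for z
  proof -
    obtain n where n: "\<eta> n < snd z" using \<eta>_lim[OF y] by blast
    have "laplacian Wt z = laplacian (\<lambda>z. \<Sum>k<n. W k z) z"
      by (rule laplacian_cong_open[OF op[of n]]) (use n fin in auto)
    also have "\<dots> = (\<Sum>k<n. laplacian (W k) z)"
      by (rule laplacian_sum[OF open_UNIV]) (use W2 in auto)
    finally have lap: "laplacian Wt z = (\<Sum>k<n. laplacian (W k) z)" .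
    let ?r = "\<lambda>k. (1 - \<tau> (Suc k) (snd z)) *\<^sub>R (G k z - laplacian (W k) z)"
    \<comment> \<open>Each residual splits into the part passed on, \<open>G (Suc k)\<close>, and
      the part \<open>?r\<close> left behind; above height \<open>\<eta> n\<close> nothing more is
      passed on.\<close>
    have "g0 z - (\<Sum>k<n. laplacian (W k) z) = G n z + (\<Sum>k<n. ?r k)"
    proof (induction n)
      case (Suc n)
      have "G (Suc n) z = \<tau> (Suc n) (snd z) *\<^sub>R (G n z - laplacian (W n) z)"
        using W[of n] unfolding Q_def by (metis (no_types, lifting))
      then have "G n z - laplacian (W n) z = G (Suc n) z + ?r n"
        by (simp add: scaleR_diff_left)
      then show ?case using Suc by (simp add: algebra_simps)
    qed (simp add: G0)
    moreover have "G n z = 0" using G(1)[of n] less_imp_le[OF n] unfolding Adm_def by blast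
    ultimately have "g0 z - laplacian Wt z = (\<Sum>k<n. ?r k)"
      by (simp only: add_0_left lap)
    then have "norm (laplacian Wt z - g0 z) = norm (\<Sum>k<n. ?r k)"
      by (simp only: norm_minus_commute[of _ "g0 z"])
    also have "\<dots> \<le> (\<Sum>k<n. (1 / 2) ^ k * e (snd z))"
    proof (rule sum_norm_le)
      fix k
      show "norm (?r k) \<le> (1 / 2) ^ k * e (snd z)"
      proof (cases "snd z \<le> \<eta> (Suc k) / 2")
        case True
        then show ?thesis using \<tau>_1[of "snd z" "Suc k"] y e(1)[OF y] by simp
      next
        case False
        have "norm (?r k) \<le> 1 * norm (G k z - laplacian (W k) z)"
          unfolding norm_scaleR using \<tau>_01 by (intro mult_right_mono) auto
        also have "\<dots> \<le> \<epsilon> k"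
          using W[of k] less_imp_le[OF y] unfolding Q_def mult_1 by (subst norm_minus_commute) blast
        also have "\<dots> \<le> (1 / 2) ^ k * e (snd z)"
          unfolding \<epsilon>_def using \<eta>[of "Suc k"] False by (intro mult_left_mono e(2)) auto
        finally show ?thesis .
      qed
    qed
    also have "\<dots> = (\<Sum>k<n. (1 / 2) ^ k) * e (snd z)" by (simp add: sum_distrib_right)
    also have "(\<Sum>k<n. (1 / 2 :: real) ^ k) \<le> 2"
      using sum_gp_strict[of "1 / 2 :: real" n] by simp
    finally show ?thesis using e(1)[OF y] by simp
  qed
  show ?thesis
  proof (rule that)
    show "open (\<Union>x\<in>K. ball x (\<rho> / 2))" by auto
    show "K \<subseteq> (\<Union>x\<in>K. ball x (\<rho> / 2))" using \<rho>(1) by auto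
    show "Ck_on 2 Wt {z. 0 < snd z}"
    proof (rule Ck_on_local)
      fix z :: "'a \<times> real" assume "z \<in> {z. 0 < snd z}"
      then obtain n where n: "\<eta> n < snd z" using \<eta>_lim by blast
      have "Ck_on 2 (\<lambda>z. \<Sum>k<n. W k z) {z. \<eta> n < snd z}"
        by (rule Ck_on_sum[OF op]) (rule Ck_on_subset[OF W2 subset_UNIV])
      then have "Ck_on 2 Wt {z. \<eta> n < snd z}"
        by (rule Ck_on_cong[OF op, rotated]) (simp add: fin)
      then show "\<exists>U. open U \<and> z \<in> U \<and> Ck_on 2 Wt U" using op n by blast
    qed
    show "Wt (x, y) = 0" if xK: "x \<in> (\<Union>x\<in>K. ball x (\<rho> / 2))" for x y
    proof -
      have "x \<in> N (Suc k)" for k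
      proof -
        obtain v where "v \<in> K" "dist v x < \<rho> / 2" using xK by auto
        moreover have "\<rho> / 2 \<le> \<rho> * (1 / 2 + (1 / 2) ^ Suc (Suc k))" using \<rho>(1) by (simp add: algebra_simps)
        ultimately show ?thesis unfolding N_def by (metis UN_I mem_ball order_less_le_trans)
      qed
      then have "W k (x, y) = 0" for k using W[of k] unfolding Q_def by (metis fst_conv)
      then show ?thesis by (simp add: Wt_def)
    qed
    show "norm (laplacian Wt z - f z) \<le> (2 + (\<bar>A\<bar> + 2 * B / e (\<eta> 0 / 2))) * e (snd z)" if y: "0 < snd z" for z
    proof -
      have "f z - g0 z = \<zeta> (fst z) *\<^sub>R f z + (1 - \<tau> 0 (snd z)) *\<^sub>R (1 - \<zeta> (fst z)) *\<^sub>R f z"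
        by (simp add: g0_def scaleR_diff_left)
      also have "norm \<dots> \<le> \<bar>A\<bar> * e (snd z) + 2 * B / e (\<eta> 0 / 2) * e (snd z)"
      proof (rule order_trans[OF norm_triangle_ineq add_mono])
        show "norm (\<zeta> (fst z) *\<^sub>R f z) \<le> \<bar>A\<bar> * e (snd z)"
        proof (cases "fst z \<in> C")
          case True
          then have "norm (f z) \<le> A * e (snd z)" using fU[of "fst z" "snd z"] \<zeta>(3) y by auto
          then have "norm (f z) \<le> \<bar>A\<bar> * e (snd z)"
            using e(1)[OF y] by (meson abs_ge_self less_imp_le mult_right_mono order_trans)
          then show ?thesis
            unfolding norm_scaleR using \<zeta>(9)[of "fst z"] mult_left_le_one_le[of "norm (f z)" "\<bar>\<zeta> (fst z)\<bar>"] by simp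
        next
          case False
          then show ?thesis using \<zeta>(4) e(1)[OF y] by simp
        qed
        show "norm ((1 - \<tau> 0 (snd z)) *\<^sub>R (1 - \<zeta> (fst z)) *\<^sub>R f z) \<le> 2 * B / e (\<eta> 0 / 2) * e (snd z)"
        proof (cases "snd z \<le> \<eta> 0 / 2")
          case True
          then show ?thesis using \<tau>_1[of "snd z" 0] y e(1)[OF y] B0 e(1)[of "\<eta> 0 / 2"] \<eta>[of 0] by simp
        next
          case False
          have "norm ((1 - \<tau> 0 (snd z)) *\<^sub>R (1 - \<zeta> (fst z)) *\<^sub>R f z) \<le> 1 * (2 * B)"
            unfolding norm_scaleR using \<tau>_01[of 0 "snd z"] \<zeta>(9)[of "fst z"] B[of z]
            by (intro mult_mono) (auto simp: abs_le_iff)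
          also have "\<dots> = 2 * B / e (\<eta> 0 / 2) * e (\<eta> 0 / 2)"
            using e(1)[of "\<eta> 0 / 2"] \<eta>[of 0] by simp
          also have "\<dots> \<le> 2 * B / e (\<eta> 0 / 2) * e (snd z)"
            using False \<eta>[of 0] B0 e(1)[of "\<eta> 0 / 2"] by (intro mult_left_mono e(2)) auto
          finally show ?thesis .
        qed
      qed
      finally have "norm (g0 z - f z) \<le> \<bar>A\<bar> * e (snd z) + 2 * B / e (\<eta> 0 / 2) * e (snd z)"
        by (simp add: norm_minus_commute)
      then have "norm ((laplacian Wt z - g0 z) + (g0 z - f z)) \<le> 2 * e (snd z) + (\<bar>A\<bar> * e (snd z) + 2 * B / e (\<eta> 0 / 2) * e (snd z))"
        by (intro norm_triangle_mono est y)
      then show ?thesis by (simp add: ring_distribs)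
    qed
  qed
qed

section \<open>Almost harmonic extensions by truncated power series\<close>

text \<open>Third differences of truncated powers: \<open>spline 1\<close> is the quadratic B-spline
  on [0, 3] and \<open>spline 2\<close> its integral from u to infinity, hence a C^2 transition from
  1 to 0.\<close>

definition spline :: "nat \<Rightarrow> real \<Rightarrow> real" where
  "spline n u = ramp 3 n u - 3 * ramp 2 n u + 3 * ramp 1 n u - ramp 0 n u"

lemma spline_has_derivative: "(spline (Suc n) has_real_derivative - spline n u) (at u)"
proof -
  have "((\<lambda>u. ramp 3 (Suc n) u - 3 * ramp 2 (Suc n) u + 3 * ramp 1 (Suc n) u - ramp 0 (Suc n) u) has_real_derivative
      (- ramp 3 n u - 3 * - ramp 2 n u + 3 * - ramp 1 n u - - ramp 0 n u)) (at u)"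
    by (intro DERIV_diff DERIV_add DERIV_cmult ramp_has_derivative)
  then show ?thesis by (simp add: spline_def[abs_def] algebra_simps)
qed

lemma continuous_on_spline: "continuous_on S (spline n)"
  unfolding spline_def[abs_def] by (intro continuous_intros continuous_on_ramp)

lemma spline_left:
  assumes "u \<le> 0"
  shows "spline 2 u = 1" "spline 1 u = 0" "spline 0 u = 0"
proof -
  have m: "max 0 (3 - u) = 3 - u" "max 0 (2 - u) = 2 - u" "max 0 (1 - u) = 1 - u" "max 0 (0 - u) = - u"
    using assms by auto
  have r: "ramp c 2 u = max 0 (c - u) * max 0 (c - u) * max 0 (c - u) / 6"
    "ramp c 1 u = max 0 (c - u) * max 0 (c - u) / 2" "ramp c 0 u = max 0 (c - u)" for c
    unfolding ramp_def by (simp_all add: eval_nat_numeral)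
  show "spline 2 u = 1" "spline 1 u = 0" "spline 0 u = 0"
    unfolding spline_def r m by (simp_all add: field_simps)
qed

lemma spline_right: "3 \<le> u \<Longrightarrow> spline n u = 0"
  by (simp add: spline_def ramp_above)

lemma abs_spline_le:
  assumes "n \<le> 2"
  shows "\<bar>spline n u\<bar> \<le> 40"
proof (cases "u \<le> 0")
  case True
  then show ?thesis using assms spline_left[of u] by (auto simp: le_Suc_eq numeral_2_eq_2)
next
  case False
  \<comment> \<open>The coefficients 1, 3, 3, 1 of the four ramps turn this into the bound
    40.\<close>
  have "ramp c n u \<le> 5" if "c \<le> 3" for c
  proof -
    have "ramp c n u \<le> 3 ^ Suc n / fact (Suc n)"
      unfolding ramp_def using False that by (intro divide_right_mono power_mono) auto
    also have "\<dots> \<le> 5"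
      using assms by (auto simp: le_Suc_eq numeral_2_eq_2 fact_numeral)
    finally show ?thesis .
  qed
  from this[of 3] this[of 2] this[of 1] this[of 0] show ?thesis
    using ramp_nonneg[of 3 n u] ramp_nonneg[of 2 n u] ramp_nonneg[of 1 n u] ramp_nonneg[of 0 n u]
    unfolding spline_def by linarith
qed

text \<open>The square comes from two derivatives of a monomial of degree p; the geometric decay of
  the terms absorbs it.\<close>

lemma sq_mult_half_power_le: "(real p + 1)\<^sup>2 * (1 / 2) ^ p \<le> 8 * (3 / 4) ^ p"
proof -
  have "(real p + 1)\<^sup>2 \<le> 8 * (3 / 2) ^ p"
  proof (cases "p < 4")
    case True
    then have "p = 0 \<or> p = 1 \<or> p = 2 \<or> p = 3" by auto
    then show ?thesis by (auto simp: power2_eq_square eval_nat_numeral)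
  next
    case False
    then have "4 \<le> p" by simp
    then show ?thesis
    proof (induction p rule: dec_induct)
      case base
      then show ?case by (simp add: power2_eq_square eval_nat_numeral)
    next
      case (step p)
      have a: "4 \<le> real p" using step.hyps by simp
      then have b: "real p * 4 \<le> real p * real p" by (intro mult_left_mono) auto
      have "(real (Suc p) + 1)\<^sup>2 \<le> 3 / 2 * (real p + 1)\<^sup>2"
        unfolding power2_eq_square by (simp add: field_simps) (use a b in linarith)
      then show ?case using step.IH by simp
    qed
  qed
  then have "(real p + 1)\<^sup>2 * (1 / 2) ^ p \<le> 8 * (3 / 2) ^ p * (1 / 2) ^ p"
    by (intro mult_right_mono) auto
  also have "\<dots> = 8 * (3 / 4) ^ p"
    by (simp add: mult.assoc power_mult_distrib[symmetric])
  finally show ?thesis .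
qed

definition monom_deriv :: "nat \<Rightarrow> nat \<Rightarrow> real \<Rightarrow> real" where
  "monom_deriv k p y = (if k \<le> p then y ^ (p - k) / fact (p - k) else 0)"

lemma monom_deriv_has_derivative: "(monom_deriv k p has_real_derivative monom_deriv (Suc k) p y) (at y)"
proof (cases "Suc k \<le> p")
  case True
  then obtain m where m: "p - k = Suc m" "p - Suc k = m" by (metis Suc_diff_Suc Suc_le_eq)
  have "((\<lambda>y. y ^ Suc m / fact (Suc m)) has_real_derivative real (Suc m) * y ^ m / fact (Suc m)) (at y)"
    using DERIV_cdivide[OF DERIV_pow[of "Suc m" y UNIV], of "fact (Suc m)"] by (simp del: fact_Suc power_Suc of_nat_Suc)
  moreover have "real (Suc m) * y ^ m / fact (Suc m) = y ^ m / fact m"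
    unfolding fact_Suc of_nat_mult by (simp del: of_nat_Suc)
  ultimately show ?thesis using True m by (simp add: monom_deriv_def[abs_def] del: fact_Suc power_Suc)
next
  case False
  then have "monom_deriv k p = (\<lambda>_. if k \<le> p then 1 else 0)"
    by (auto simp: monom_deriv_def fun_eq_iff)
  then show ?thesis using False by (simp add: monom_deriv_def)
qed

text \<open>The power of y restores the degree lost, and each derivative contributes a factor at
  most p.\<close>

lemma abs_monom_deriv_le: "\<bar>y\<bar> ^ k * \<bar>monom_deriv k p y\<bar> \<le> real p ^ k * (\<bar>y\<bar> ^ p / fact p)"
proof (cases "k \<le> p")
  case True
  have "fact p \<le> real p ^ k * fact (p - k)"
    using True
  proof (induction k)
    case (Suc k)
    then have eq: "p - k = Suc (p - Suc k)" by simp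
    have "fact p \<le> real p ^ k * fact (p - k)" using Suc by simp
    also have "\<dots> = real p ^ k * (real (p - k) * fact (p - Suc k))" by (simp add: eq del: of_nat_Suc)
    also have "\<dots> \<le> real p ^ k * (real p * fact (p - Suc k))"
      by (intro mult_left_mono mult_right_mono) auto
    finally show ?case by (simp add: mult_ac)
  qed simp
  then have "1 / fact (p - k) \<le> real p ^ k / fact p"
    by (simp add: field_simps)
  then have "\<bar>y\<bar> ^ p * (1 / fact (p - k)) \<le> \<bar>y\<bar> ^ p * (real p ^ k / fact p)"
    by (intro mult_left_mono) auto
  moreover have "\<bar>y\<bar> ^ k * \<bar>monom_deriv k p y\<bar> = \<bar>y\<bar> ^ p * (1 / fact (p - k))"
    using True by (simp add: monom_deriv_def power_abs abs_mult power_add[symmetric])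
  ultimately show ?thesis by (simp add: mult_ac)
qed (simp add: monom_deriv_def)

section \<open>Cutoff heights and majorants\<close>

text \<open>\<open>\<alpha>\<close> and \<open>\<nu>\<close> stand for the starred sequences of
  \<open>L\<close> and \<open>N\<close>. The coefficients will be bounded by multiples of B^p
  \<alpha>_p p!, whose factorial cancels against y^p / p!; \<open>quot_le\<close> is [M.1]*_w for
  this pair.\<close>

locale dynkin =
  fixes \<alpha> \<nu> :: "nat \<Rightarrow> real" and C B :: real
  assumes pos: "\<And>p. 0 < \<alpha> p" "\<And>p. 0 < \<nu> p" and zero: "\<alpha> 0 = 1" "\<nu> 0 = 1"
    and C: "1 \<le> C" and B: "0 < B"
    and quot_le: "\<And>p q. 1 \<le> q \<Longrightarrow> q \<le> p \<Longrightarrow> quot \<alpha> q \<le> C * quot \<nu> p"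
begin

definition \<mu> :: "nat \<Rightarrow> real" where "\<mu> p = Max (quot \<alpha> ` {1..p})"

text \<open>The 4 makes consecutive values of \<open>T\<close> at least halve for y \<le> 2 s_p.
  Indices up to p + 2 are included because c_p meets the cutoffs of both its own term and the term p
  - 2.\<close>

definition s :: "nat \<Rightarrow> real" where "s p = 1 / (4 * B * \<mu> (p + 2))"

text \<open>Majorant of the p-th Taylor term at height y. The bound aimed at is \<open>X q y\<close>
  for every q: its infimum over q is exp (- \<omega>(1 / (h y))) with the associated function of
  \<open>\<nu>\<close>.\<close>

definition T :: "nat \<Rightarrow> real \<Rightarrow> real" where "T p y = \<alpha> p * (B * y) ^ p"

text \<open>C comes from \<open>\<alpha>_le_\<nu>\<close>. The 4 is the one in \<open>s\<close>: as
  soon as y \<ge> s_p, the factors by which \<open>X\<close> grows beyond index p + 1 are at least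
  1.\<close>

definition h :: real where "h = 4 * C * B"

definition X :: "nat \<Rightarrow> real \<Rightarrow> real" where "X q y = \<nu> q * (h * y) ^ q"

lemma quot_pos: "0 < quot \<alpha> p" "0 < quot \<nu> p"
  using pos by (simp_all add: quot_def)

lemma quot_le_\<mu>: "1 \<le> q \<Longrightarrow> q \<le> p \<Longrightarrow> quot \<alpha> q \<le> \<mu> p"
  unfolding \<mu>_def by (rule Max_ge) auto

lemma \<mu>_le: "1 \<le> p \<Longrightarrow> (\<And>q. 1 \<le> q \<Longrightarrow> q \<le> p \<Longrightarrow> quot \<alpha> q \<le> x) \<Longrightarrow> \<mu> p \<le> x"
  unfolding \<mu>_def by (subst Max_le_iff) auto

lemma \<mu>_pos: "1 \<le> p \<Longrightarrow> 0 < \<mu> p"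
  using quot_le_\<mu>[of 1 p] quot_pos(1)[of 1] by simp

lemma s_pos: "0 < s p"
  using B \<mu>_pos[of "p + 2"] by (simp add: s_def)

lemma s_antimono: "p \<le> q \<Longrightarrow> s q \<le> s p"
proof -
  assume "p \<le> q"
  then have "\<mu> (p + 2) \<le> \<mu> (q + 2)" by (intro \<mu>_le quot_le_\<mu>) auto
  then show ?thesis
    unfolding s_def using B \<mu>_pos[of "p + 2"] by (intro divide_left_mono mult_left_mono mult_pos_pos) auto
qed

lemma T_Suc: "T (Suc p) y = T p y * (B * y * quot \<alpha> (Suc p))"
  using pos(1)[of p] by (simp add: T_def quot_def)

lemma X_Suc: "X (Suc p) y = X p y * (h * y * quot \<nu> (Suc p))"
  using pos(2)[of p] by (simp add: X_def quot_def)

lemma T_nonneg: "0 \<le> y \<Longrightarrow> 0 \<le> T p y"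
  using pos(1)[of p] B by (simp add: T_def)

lemma X_nonneg: "0 \<le> y \<Longrightarrow> 0 \<le> X p y"
  using pos(2)[of p] B C by (simp add: X_def h_def)

lemma T_decay:
  assumes "0 \<le> y" "y \<le> 2 * s p" "q \<le> r" "r \<le> p + 2"
  shows "T r y \<le> T q y * (1 / 2) ^ (r - q)"
  using assms(3,4)
proof (induction r rule: dec_induct)
  case (step r)
  have "B * y * quot \<alpha> (Suc r) \<le> B * (2 * s p) * \<mu> (p + 2)"
    using step.prems assms(1,2) B quot_pos(1)[of "Suc r"] s_pos[of p]
    by (intro mult_mono mult_left_mono quot_le_\<mu>) auto
  also have "\<dots> = 1 / 2" using B \<mu>_pos[of "p + 2"] by (simp add: s_def)
  finally have "B * y * quot \<alpha> (Suc r) \<le> 1 / 2" .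
  then have "T (Suc r) y \<le> T r y * (1 / 2)"
    unfolding T_Suc using T_nonneg[OF assms(1)] by (intro mult_left_mono)
  also have "\<dots> \<le> T q y * (1 / 2) ^ (r - q) * (1 / 2)"
    using step by (intro mult_right_mono) auto
  finally show ?case using step.hyps by (simp add: Suc_diff_le)
qed simp

lemma \<alpha>_le_\<nu>: "\<alpha> p \<le> C ^ p * \<nu> p"
proof (induction p)
  case (Suc p)
  have "\<alpha> (Suc p) = \<alpha> p * quot \<alpha> (Suc p)" using pos(1)[of p] by (simp add: quot_def)
  also have "\<dots> \<le> (C ^ p * \<nu> p) * (C * quot \<nu> (Suc p))"
    using Suc quot_le[of "Suc p" "Suc p"] quot_pos(1)[of "Suc p"] pos(2)[of p] C
    by (intro mult_mono) auto
  also have "\<dots> = C ^ Suc p * \<nu> (Suc p)" using pos(2)[of p] by (simp add: quot_def)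
  finally show ?case .
qed (simp add: zero)

lemma T_le_X: "0 \<le> y \<Longrightarrow> T p y \<le> (1 / 4) ^ p * X p y"
proof -
  assume y: "0 \<le> y"
  have "T p y \<le> (C ^ p * \<nu> p) * (B * y) ^ p"
    unfolding T_def using \<alpha>_le_\<nu>[of p] B y by (intro mult_right_mono) auto
  also have "\<dots> = (1 / 4) ^ p * X p y"
    by (simp add: X_def h_def power_mult_distrib power_divide)
  finally show ?thesis .
qed

text \<open>On the range of y where the p-th error term lives, two regimes meet. If q \<le> p, the
  values of \<open>T\<close> decay geometrically from q to p since y is below the upper limit. If q
  > p, the values of \<open>X\<close> grow from p + 1 to q since y is above the lower limit.\<close>

lemma key_bound:
  assumes y: "s p \<le> y" "y \<le> 2 * s (p - 2)"
  defines "\<kappa> \<equiv> 4 * B * quot \<alpha> 1"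
  shows "y\<^sup>2 * T p y \<le> (4 * (s 0)\<^sup>2 + 2 * s 0 / \<kappa>) * (1 / 2) ^ p * X q y"
proof -
  have y0: "0 < y" using y(1) s_pos[of p] by simp
  have ys: "y \<le> 2 * s 0" using y(2) s_antimono[of 0 "p - 2"] by simp
  have \<kappa>: "0 < \<kappa>" using B quot_pos(1)[of 1] by (simp add: \<kappa>_def)
  have "(1 / 4) ^ p * X p y \<le> (1 / 2) ^ p * X p y" for p
    using X_nonneg[of y p] y0 by (intro mult_right_mono power_mono) auto
  then have TX: "T p y \<le> (1 / 2) ^ p * X p y" for p
    using T_le_X[of y p] y0 by (meson less_imp_le order_trans)
  show ?thesis
  proof (cases "q \<le> p")
    case True
    have "T p y \<le> T q y * (1 / 2) ^ (p - q)"
      by (rule T_decay[OF _ y(2) True]) (use y0 in auto)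
    also have "\<dots> \<le> ((1 / 2) ^ q * X q y) * (1 / 2) ^ (p - q)"
      using TX by (intro mult_right_mono) auto
    also have "\<dots> = ((1 / 2) ^ q * (1 / 2) ^ (p - q)) * X q y" by simp
    also have "\<dots> = (1 / 2) ^ p * X q y"
      using True by (simp only: power_add[symmetric] le_add_diff_inverse)
    finally have "y\<^sup>2 * T p y \<le> (2 * s 0)\<^sup>2 * ((1 / 2) ^ p * X q y)"
      using ys y0 T_nonneg[of y p] by (intro mult_mono power_mono) auto
    also have "\<dots> \<le> (4 * (s 0)\<^sup>2 + 2 * s 0 / \<kappa>) * ((1 / 2) ^ p * X q y)"
      using X_nonneg[of y q] y0 s_pos[of 0] \<kappa> by (intro mult_right_mono) (auto simp: power_mult_distrib)
    finally show ?thesis by (simp only: mult.assoc)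
  next
    case False
    then have "Suc p \<le> q" by simp
    then have "X (Suc p) y \<le> X q y"
    proof (induction q rule: dec_induct)
      case (step q)
      \<comment> \<open>Here the present index must be at least p + 1: only then do all indices up
        to p + 2 stay below its successor.\<close>
      have "\<mu> (p + 2) \<le> C * quot \<nu> (Suc q)"
        using step.hyps by (intro \<mu>_le quot_le) auto
      then have "4 * B * s p * \<mu> (p + 2) \<le> 4 * B * y * (C * quot \<nu> (Suc q))"
        using B y(1) s_pos[of p] \<mu>_pos[of "p + 2"] by (intro mult_mono) auto
      moreover have "4 * B * s p * \<mu> (p + 2) = 1" using B \<mu>_pos[of "p + 2"] by (simp add: s_def)
      ultimately have "1 \<le> h * y * quot \<nu> (Suc q)" by (simp add: h_def mult_ac)
      then have "X q y * 1 \<le> X (Suc q) y"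
        unfolding X_Suc using X_nonneg[of y q] y0 by (intro mult_left_mono) auto
      then show ?case using step.IH by simp
    qed simp
    \<comment> \<open>The single step from p to p + 1 escapes that argument; it is compared with the
      first quotient of \<open>\<alpha>\<close>, at the price of one factor y.\<close>
    moreover have "X p y * (\<kappa> * y) \<le> X (Suc p) y"
    proof -
      have "quot \<alpha> 1 \<le> C * quot \<nu> (Suc p)" by (rule quot_le) auto
      then have "4 * B * y * quot \<alpha> 1 \<le> 4 * B * y * (C * quot \<nu> (Suc p))"
        using B y0 by (intro mult_left_mono) auto
      then have "\<kappa> * y \<le> h * y * quot \<nu> (Suc p)" by (simp add: \<kappa>_def h_def mult_ac)
      then show ?thesis unfolding X_Suc using X_nonneg[of y p] y0 by (intro mult_left_mono) auto
    qed
    ultimately have X: "X p y * y \<le> X q y / \<kappa>" using \<kappa> by (simp add: field_simps)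
    have "y\<^sup>2 * T p y \<le> y\<^sup>2 * ((1 / 2) ^ p * X p y)"
      using TX by (intro mult_left_mono) auto
    also have "\<dots> = (y * (1 / 2) ^ p) * (X p y * y)" by (simp add: power2_eq_square)
    also have "\<dots> \<le> (2 * s 0 * (1 / 2) ^ p) * (X q y / \<kappa>)"
      using X ys y0 X_nonneg[of y p] s_pos[of 0] by (intro mult_mono) auto
    also have "\<dots> = 2 * s 0 / \<kappa> * ((1 / 2) ^ p * X q y)" by simp
    also have "\<dots> \<le> (4 * (s 0)\<^sup>2 + 2 * s 0 / \<kappa>) * ((1 / 2) ^ p * X q y)"
      using X_nonneg[of y q] y0 by (intro mult_right_mono) auto
    finally show ?thesis by (simp only: mult.assoc)
  qed
qed

section \<open>Cut-off Taylor terms\<close>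

text \<open>Using y^2 instead of the absolute value keeps the cutoff C^2; the transition interval
  [0, 3] of the spline becomes s_p \<le> |y| \<le> 2 s_p.\<close>

definition \<theta> :: "nat \<Rightarrow> real \<Rightarrow> real" where "\<theta> p y = spline 2 (y\<^sup>2 / (s p)\<^sup>2 - 1)"
definition \<theta>1 :: "nat \<Rightarrow> real \<Rightarrow> real" where "\<theta>1 p y = - (spline 1 (y\<^sup>2 / (s p)\<^sup>2 - 1) * (2 * y / (s p)\<^sup>2))"
definition \<theta>2 :: "nat \<Rightarrow> real \<Rightarrow> real" where
  "\<theta>2 p y = spline 0 (y\<^sup>2 / (s p)\<^sup>2 - 1) * (2 * y / (s p)\<^sup>2)\<^sup>2 - spline 1 (y\<^sup>2 / (s p)\<^sup>2 - 1) * (2 / (s p)\<^sup>2)"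

lemma \<theta>_deriv: "(\<theta> p has_real_derivative \<theta>1 p y) (at y)" "(\<theta>1 p has_real_derivative \<theta>2 p y) (at y)"
proof -
  have u: "((\<lambda>y. y\<^sup>2 / (s p)\<^sup>2 - 1) has_real_derivative 2 * y / (s p)\<^sup>2) (at y)"
    using DERIV_diff[OF DERIV_cdivide[OF DERIV_pow[of 2 y UNIV], of "(s p)\<^sup>2"] DERIV_const[of 1]] by simp
  have sp: "((\<lambda>y. spline (Suc n) (y\<^sup>2 / (s p)\<^sup>2 - 1)) has_real_derivative - spline n (y\<^sup>2 / (s p)\<^sup>2 - 1) * (2 * y / (s p)\<^sup>2)) (at y)" for n
    by (rule DERIV_chain'[OF u spline_has_derivative])
  show "(\<theta> p has_real_derivative \<theta>1 p y) (at y)"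
    using sp[of 1] by (simp add: \<theta>_def[abs_def] \<theta>1_def numeral_2_eq_2)
  have v: "((\<lambda>y. 2 * y / (s p)\<^sup>2) has_real_derivative 2 / (s p)\<^sup>2) (at y)"
    by (rule DERIV_cdivide[OF DERIV_cmult_Id])
  have "((\<lambda>y. - (spline (Suc 0) (y\<^sup>2 / (s p)\<^sup>2 - 1) * (2 * y / (s p)\<^sup>2))) has_real_derivative
      - ((- spline 0 (y\<^sup>2 / (s p)\<^sup>2 - 1) * (2 * y / (s p)\<^sup>2)) * (2 * y / (s p)\<^sup>2) + (2 / (s p)\<^sup>2) * spline (Suc 0) (y\<^sup>2 / (s p)\<^sup>2 - 1))) (at y)"
    by (intro DERIV_minus DERIV_mult sp v)
  moreover have "- ((- a * u) * u + v * b) = a * u\<^sup>2 - b * v" for a b u v :: real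
    by (simp add: power2_eq_square algebra_simps)
  ultimately show "(\<theta>1 p has_real_derivative \<theta>2 p y) (at y)"
    unfolding \<theta>1_def[abs_def] \<theta>2_def One_nat_def by (simp only:)
qed

lemma \<theta>_inner:
  assumes "\<bar>y\<bar> \<le> s p"
  shows "\<theta> p y = 1" "\<theta>1 p y = 0" "\<theta>2 p y = 0"
proof -
  have "\<bar>y\<bar>\<^sup>2 \<le> (s p)\<^sup>2" using assms by (intro power_mono) auto
  then have "y\<^sup>2 / (s p)\<^sup>2 - 1 \<le> 0" using s_pos[of p] by (simp add: field_simps)
  from spline_left[OF this] show "\<theta> p y = 1" "\<theta>1 p y = 0" "\<theta>2 p y = 0"
    by (simp_all add: \<theta>_def \<theta>1_def \<theta>2_def)
qed

lemma \<theta>_outer: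
  assumes "2 * s p \<le> \<bar>y\<bar>"
  shows "\<theta> p y = 0" "\<theta>1 p y = 0" "\<theta>2 p y = 0"
proof -
  have "(2 * s p)\<^sup>2 \<le> \<bar>y\<bar>\<^sup>2" using assms s_pos[of p] by (intro power_mono) auto
  then have "3 \<le> y\<^sup>2 / (s p)\<^sup>2 - 1" using s_pos[of p] by (simp add: field_simps power_mult_distrib)
  from spline_right[OF this] show "\<theta> p y = 0" "\<theta>1 p y = 0" "\<theta>2 p y = 0"
    by (simp_all add: \<theta>_def \<theta>1_def \<theta>2_def)
qed

lemma \<theta>_bounds:
  "\<bar>\<theta> p y\<bar> \<le> 40" "s p * \<bar>\<theta>1 p y\<bar> \<le> 160" "(s p)\<^sup>2 * \<bar>\<theta>2 p y\<bar> \<le> 720"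
  "\<bar>y\<bar> * \<bar>\<theta>1 p y\<bar> \<le> 320" "y\<^sup>2 * \<bar>\<theta>2 p y\<bar> \<le> 2880"
proof -
  show "\<bar>\<theta> p y\<bar> \<le> 40" unfolding \<theta>_def by (rule abs_spline_le) simp
  have "s p * \<bar>\<theta>1 p y\<bar> \<le> 160 \<and> (s p)\<^sup>2 * \<bar>\<theta>2 p y\<bar> \<le> 720 \<and> \<bar>y\<bar> * \<bar>\<theta>1 p y\<bar> \<le> 320 \<and> y\<^sup>2 * \<bar>\<theta>2 p y\<bar> \<le> 2880"
  proof (cases "2 * s p \<le> \<bar>y\<bar>")
    case True
    then show ?thesis by (simp add: \<theta>_outer)
  next
    case False
    define t where "t = \<bar>y\<bar> / s p"
    have t: "0 \<le> t" "t \<le> 2" "\<bar>y\<bar> = t * s p" using False s_pos[of p] by (auto simp: t_def field_simps)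
    let ?u = "y\<^sup>2 / (s p)\<^sup>2 - 1"
    have sp: "\<bar>spline 0 ?u\<bar> \<le> 40" "\<bar>spline 1 ?u\<bar> \<le> 40" by (rule abs_spline_le; simp)+
    have 1: "s p * \<bar>\<theta>1 p y\<bar> = \<bar>spline 1 ?u\<bar> * (2 * t)"
      unfolding \<theta>1_def using t(1) s_pos[of p] by (simp add: abs_mult t(3) power2_eq_square)
    also have "\<dots> \<le> 40 * (2 * 2)" using t sp(2) by (intro mult_mono) auto
    finally have b1: "s p * \<bar>\<theta>1 p y\<bar> \<le> 160" by simp
    have "(s p)\<^sup>2 * \<bar>\<theta>2 p y\<bar> \<le> \<bar>spline 0 ?u\<bar> * (2 * t)\<^sup>2 + \<bar>spline 1 ?u\<bar> * 2"
    proof -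
      have "\<bar>\<theta>2 p y\<bar> \<le> \<bar>spline 0 ?u * (2 * y / (s p)\<^sup>2)\<^sup>2\<bar> + \<bar>spline 1 ?u * (2 / (s p)\<^sup>2)\<bar>"
        unfolding \<theta>2_def by (rule abs_triangle_ineq4)
      then have "(s p)\<^sup>2 * \<bar>\<theta>2 p y\<bar> \<le> (s p)\<^sup>2 * (\<bar>spline 0 ?u * (2 * y / (s p)\<^sup>2)\<^sup>2\<bar> + \<bar>spline 1 ?u * (2 / (s p)\<^sup>2)\<bar>)"
        by (intro mult_left_mono) auto
      moreover have "(2 * y / (s p)\<^sup>2)\<^sup>2 = (2 * t / s p)\<^sup>2"
      proof -
        have "(2 * y / (s p)\<^sup>2)\<^sup>2 = (2 * \<bar>y\<bar> / (s p)\<^sup>2)\<^sup>2" by (simp add: power_divide power_mult_distrib)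
        then show ?thesis unfolding t(3) using s_pos[of p] by (simp add: power2_eq_square)
      qed
      moreover have "(s p)\<^sup>2 * \<bar>spline 0 ?u * (2 * t / s p)\<^sup>2\<bar> = \<bar>spline 0 ?u\<bar> * (2 * t)\<^sup>2"
        "(s p)\<^sup>2 * \<bar>spline 1 ?u * (2 / (s p)\<^sup>2)\<bar> = \<bar>spline 1 ?u\<bar> * 2"
        using s_pos[of p] by (simp_all add: abs_mult power_divide)
      ultimately show ?thesis by (simp only: distrib_left)
    qed
    also have "\<dots> \<le> 40 * (2 * 2)\<^sup>2 + 40 * 2"
      using t sp by (intro add_mono mult_mono power_mono) auto
    finally have b2: "(s p)\<^sup>2 * \<bar>\<theta>2 p y\<bar> \<le> 720" by simp
    have "\<bar>y\<bar> * \<bar>\<theta>1 p y\<bar> = t * (s p * \<bar>\<theta>1 p y\<bar>)" by (simp add: t(3))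
    also have "\<dots> \<le> 2 * 160" using t b1 s_pos[of p] by (intro mult_mono) auto
    finally have b3: "\<bar>y\<bar> * \<bar>\<theta>1 p y\<bar> \<le> 320" by simp
    have "y\<^sup>2 = \<bar>y\<bar>\<^sup>2" by simp
    then have "y\<^sup>2 * \<bar>\<theta>2 p y\<bar> = t\<^sup>2 * ((s p)\<^sup>2 * \<bar>\<theta>2 p y\<bar>)" unfolding t(3) by (simp add: power_mult_distrib)
    also have "\<dots> \<le> 2\<^sup>2 * 720" using t b2 by (intro mult_mono power_mono) auto
    finally show ?thesis using b1 b2 b3 by simp
  qed
  then show "s p * \<bar>\<theta>1 p y\<bar> \<le> 160" "(s p)\<^sup>2 * \<bar>\<theta>2 p y\<bar> \<le> 720"
    "\<bar>y\<bar> * \<bar>\<theta>1 p y\<bar> \<le> 320" "y\<^sup>2 * \<bar>\<theta>2 p y\<bar> \<le> 2880" by auto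
qed

text \<open>Derivatives of order i \<le> 2 of the cut-off monomial by the Leibniz rule, as a chain
  in the sense of \<open>Ck_on_tensor\<close>.\<close>

definition E :: "nat \<Rightarrow> nat \<Rightarrow> real \<Rightarrow> real" where
  "E p i y = (if i = 0 then \<theta> p y * monom_deriv 0 p y
    else if i = 1 then \<theta>1 p y * monom_deriv 0 p y + \<theta> p y * monom_deriv 1 p y
    else \<theta>2 p y * monom_deriv 0 p y + 2 * \<theta>1 p y * monom_deriv 1 p y + \<theta> p y * monom_deriv 2 p y)"

lemma E_deriv: "i < 2 \<Longrightarrow> (E p i has_real_derivative E p (Suc i) y) (at y)"
proof -
  assume "i < 2"
  then consider "i = 0" | "i = 1" by linarith
  then show ?thesis
  proof cases
    case 1
    have "((\<lambda>y. \<theta> p y * monom_deriv 0 p y) has_real_derivative \<theta>1 p y * monom_deriv 0 p y + monom_deriv (Suc 0) p y * \<theta> p y) (at y)"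
      by (rule DERIV_mult[OF \<theta>_deriv(1) monom_deriv_has_derivative])
    then show ?thesis using 1 by (simp add: E_def[abs_def] mult.commute)
  next
    case 2
    have "((\<lambda>y. \<theta>1 p y * monom_deriv 0 p y + \<theta> p y * monom_deriv 1 p y) has_real_derivative
      (\<theta>2 p y * monom_deriv 0 p y + monom_deriv (Suc 0) p y * \<theta>1 p y) + (\<theta>1 p y * monom_deriv 1 p y + monom_deriv (Suc 1) p y * \<theta> p y)) (at y)"
      by (intro DERIV_add DERIV_mult \<theta>_deriv monom_deriv_has_derivative)
    then show ?thesis using 2 by (simp add: E_def[abs_def] algebra_simps numeral_2_eq_2)
  qed
qed

lemma continuous_on_E2: "continuous_on UNIV (E p 2)"
proof -
  have m: "continuous_on UNIV (monom_deriv k p)" for k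
    by (rule DERIV_continuous_on[OF DERIV_subset[OF monom_deriv_has_derivative]]) simp
  have t: "continuous_on UNIV (\<theta> p)" "continuous_on UNIV (\<theta>1 p)"
    by (rule DERIV_continuous_on[OF DERIV_subset], rule \<theta>_deriv, simp)+
  have "continuous_on UNIV (\<theta>2 p)"
    unfolding \<theta>2_def[abs_def] using s_pos[of p]
    by (intro continuous_intros continuous_on_affine_compose[OF continuous_on_spline]) auto
  then show ?thesis unfolding E_def[abs_def] using m t by (auto intro!: continuous_intros)
qed

text \<open>The monomials are estimated at the edge 2 s_p of the support, where they are largest;
  each derivative of cutoff or monomial costs a multiple of (p + 1) / s_p.\<close>

lemma abs_E_le:
  assumes "i \<le> 2"
  shows "(s p) ^ i * \<bar>E p i y\<bar> \<le> 720 * (real p + 1)\<^sup>2 * ((2 * s p) ^ p / fact p)"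
proof (cases "2 * s p \<le> \<bar>y\<bar>")
  case True
  then show ?thesis using s_pos[of p] by (simp add: E_def \<theta>_outer)
next
  case False
  define D where "D = (2 * s p) ^ p / fact p"
  have D: "0 \<le> D" using s_pos[of p] by (simp add: D_def)
  have m: "(s p) ^ k * \<bar>monom_deriv k p y\<bar> \<le> real p ^ k * D" for k
  proof (cases "k \<le> p")
    case True
    have "(s p) ^ k * \<bar>monom_deriv k p y\<bar> \<le> (2 * s p) ^ k * \<bar>monom_deriv k p (2 * s p)\<bar>"
    proof (rule mult_mono)
      have "\<bar>y\<bar> ^ (p - k) \<le> (2 * s p) ^ (p - k)" using False by (intro power_mono) auto
      then show "\<bar>monom_deriv k p y\<bar> \<le> \<bar>monom_deriv k p (2 * s p)\<bar>"
        using True s_pos[of p] by (simp add: monom_deriv_def abs_mult power_abs divide_right_mono)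
    qed (use s_pos[of p] in \<open>auto intro!: power_mono\<close>)
    also have "\<dots> \<le> real p ^ k * D"
      using abs_monom_deriv_le[where y = "2 * s p" and k = k and p = p] s_pos[of p] by (simp add: D_def)
    finally show ?thesis .
  next
    case False
    then have "monom_deriv k p y = 0" by (simp add: monom_deriv_def)
    moreover have "0 \<le> real p ^ k * D" using D by (intro mult_nonneg_nonneg) auto
    ultimately show ?thesis by (simp only: abs_zero mult_zero_right)
  qed
  have m0: "\<bar>monom_deriv 0 p y\<bar> \<le> D" and m1: "s p * \<bar>monom_deriv 1 p y\<bar> \<le> real p * D"
    using m[of 0] m[of 1] by simp_all
  note m2 = m[of 2]
  note tb = \<theta>_bounds[where p = p and y = y]
  consider "i = 0" | "i = 1" | "i = 2" using assms by linarith
  then have "(s p) ^ i * \<bar>E p i y\<bar> \<le> (720 + 320 * real p + 40 * (real p)\<^sup>2) * D"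
  proof cases
    case 1
    have "\<bar>\<theta> p y * monom_deriv 0 p y\<bar> \<le> 40 * D"
      unfolding abs_mult by (rule mult_mono[OF tb(1) m0]) auto
    also have "\<dots> \<le> (720 + 320 * real p + 40 * (real p)\<^sup>2) * D"
      using D by (intro mult_right_mono) auto
    finally show ?thesis using 1 by (simp add: E_def)
  next
    case 2
    have "s p * \<bar>E p 1 y\<bar> \<le> s p * (\<bar>\<theta>1 p y\<bar> * \<bar>monom_deriv 0 p y\<bar> + \<bar>\<theta> p y\<bar> * \<bar>monom_deriv 1 p y\<bar>)"
      using s_pos[of p] unfolding E_def abs_mult[symmetric] by (intro mult_left_mono) (auto intro: abs_triangle_ineq)
    also have "\<dots> = (s p * \<bar>\<theta>1 p y\<bar>) * \<bar>monom_deriv 0 p y\<bar> + \<bar>\<theta> p y\<bar> * (s p * \<bar>monom_deriv 1 p y\<bar>)"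
      by (simp add: algebra_simps)
    also have "\<dots> \<le> 160 * D + 40 * (real p * D)"
      by (intro add_mono mult_mono[OF tb(2) m0] mult_mono[OF tb(1) m1]) (use s_pos[of p] in auto)
    also have "\<dots> = (160 + 40 * real p) * D" by (simp add: algebra_simps)
    also have "\<dots> \<le> (720 + 320 * real p + 40 * (real p)\<^sup>2) * D"
      using D by (intro mult_right_mono) auto
    finally show ?thesis using 2 by simp
  next
    case 3
    have "(s p)\<^sup>2 * \<bar>E p 2 y\<bar> \<le> (s p)\<^sup>2 * (\<bar>\<theta>2 p y\<bar> * \<bar>monom_deriv 0 p y\<bar> + 2 * (\<bar>\<theta>1 p y\<bar> * \<bar>monom_deriv 1 p y\<bar>) + \<bar>\<theta> p y\<bar> * \<bar>monom_deriv 2 p y\<bar>)"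
    proof (rule mult_left_mono)
      have "\<bar>E p 2 y\<bar> \<le> \<bar>\<theta>2 p y * monom_deriv 0 p y\<bar> + \<bar>2 * \<theta>1 p y * monom_deriv 1 p y\<bar> + \<bar>\<theta> p y * monom_deriv 2 p y\<bar>"
        unfolding E_def by simp
      then show "\<bar>E p 2 y\<bar> \<le> \<bar>\<theta>2 p y\<bar> * \<bar>monom_deriv 0 p y\<bar> + 2 * (\<bar>\<theta>1 p y\<bar> * \<bar>monom_deriv 1 p y\<bar>) + \<bar>\<theta> p y\<bar> * \<bar>monom_deriv 2 p y\<bar>"
        by (simp add: abs_mult)
    qed simp
    also have "\<dots> = ((s p)\<^sup>2 * \<bar>\<theta>2 p y\<bar>) * \<bar>monom_deriv 0 p y\<bar> + 2 * ((s p * \<bar>\<theta>1 p y\<bar>) * (s p * \<bar>monom_deriv 1 p y\<bar>)) + \<bar>\<theta> p y\<bar> * ((s p)\<^sup>2 * \<bar>monom_deriv 2 p y\<bar>)"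
      by (simp add: algebra_simps power2_eq_square)
    also have "\<dots> \<le> 720 * D + 2 * (160 * (real p * D)) + 40 * ((real p)\<^sup>2 * D)"
      by (intro add_mono mult_mono[OF tb(3) m0] mult_mono[OF tb(1) m2]
          mult_left_mono[OF mult_mono[OF tb(2) m1]]) (use s_pos[of p] in auto)
    also have "\<dots> = (720 + 320 * real p + 40 * (real p)\<^sup>2) * D" by (simp add: algebra_simps)
    finally show ?thesis using 3 by simp
  qed
  also have "\<dots> \<le> (720 * (real p + 1)\<^sup>2) * D"
    using D by (intro mult_right_mono) (auto simp: power2_eq_square algebra_simps)
  finally show ?thesis unfolding D_def .
qed

text \<open>The factor of c_p in the Laplacian of the series: the second y-derivative of the p-th
  term, together with the term p - 2, whose Laplacian in x produces - c_p.\<close>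

definition Q :: "nat \<Rightarrow> real \<Rightarrow> real" where
  "Q p y = E p 2 y - (if 2 \<le> p then E (p - 2) 0 y else 0)"

text \<open>The second derivative of y^p / p! is the monomial of the term p - 2, so wherever both
  cutoffs are constant with equal values everything cancels. For p < 2 the truncated
  \<open>p - 2\<close> is harmless because \<open>monom_deriv 2 p\<close> vanishes.\<close>

lemma Q_eq: "Q p y = \<theta>2 p y * monom_deriv 0 p y + 2 * \<theta>1 p y * monom_deriv 1 p y
    + (\<theta> p y - \<theta> (p - 2) y) * monom_deriv 2 p y"
  by (auto simp: Q_def E_def monom_deriv_def algebra_simps)

lemma Q_support: "Q p y \<noteq> 0 \<Longrightarrow> s p \<le> \<bar>y\<bar> \<and> \<bar>y\<bar> \<le> 2 * s (p - 2)"
proof (rule ccontr)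
  assume Q: "Q p y \<noteq> 0" and "\<not> (s p \<le> \<bar>y\<bar> \<and> \<bar>y\<bar> \<le> 2 * s (p - 2))"
  then consider "\<bar>y\<bar> \<le> s p" | "2 * s (p - 2) \<le> \<bar>y\<bar>" by linarith
  then show False
  proof cases
    case 1
    then have "\<bar>y\<bar> \<le> s (p - 2)" using s_antimono[of "p - 2" p] by simp
    then show False using Q 1 by (simp add: Q_eq \<theta>_inner)
  next
    case 2
    then have "2 * s p \<le> \<bar>y\<bar>" using s_antimono[of "p - 2" p] by simp
    then show False using Q 2 by (simp add: Q_eq \<theta>_outer)
  qed
qed

text \<open>Derivatives of a cutoff are supported where |y| is comparable to s_p, so one factor |y|
  compensates each of them, as it does for the monomials.\<close>

lemma Q_bound: "y\<^sup>2 * \<bar>Q p y\<bar> \<le> 2880 * (real p + 1)\<^sup>2 * (\<bar>y\<bar> ^ p / fact p)"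
proof -
  define D where "D = \<bar>y\<bar> ^ p / fact p"
  have D: "0 \<le> D" by (simp add: D_def)
  have m0: "\<bar>monom_deriv 0 p y\<bar> \<le> D" and m1: "\<bar>y\<bar> * \<bar>monom_deriv 1 p y\<bar> \<le> real p * D"
    and m2: "\<bar>y\<bar>\<^sup>2 * \<bar>monom_deriv 2 p y\<bar> \<le> (real p)\<^sup>2 * D"
    using abs_monom_deriv_le[where y = y and k = 0 and p = p] abs_monom_deriv_le[where y = y and k = 1 and p = p]
      abs_monom_deriv_le[where y = y and k = 2 and p = p] by (simp_all add: D_def)
  note tb = \<theta>_bounds[where p = p and y = y]
  have t: "\<bar>\<theta> p y - \<theta> (p - 2) y\<bar> \<le> 80"
    using \<theta>_bounds(1)[where p = p and y = y] \<theta>_bounds(1)[where p = "p - 2" and y = y] by linarith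
  have y2: "y\<^sup>2 = \<bar>y\<bar>\<^sup>2" "y\<^sup>2 = \<bar>y\<bar> * \<bar>y\<bar>" by (simp_all add: power2_eq_square abs_mult[symmetric])
  have "\<bar>Q p y\<bar> \<le> \<bar>\<theta>2 p y\<bar> * \<bar>monom_deriv 0 p y\<bar> + 2 * (\<bar>\<theta>1 p y\<bar> * \<bar>monom_deriv 1 p y\<bar>)
      + \<bar>\<theta> p y - \<theta> (p - 2) y\<bar> * \<bar>monom_deriv 2 p y\<bar>"
  proof -
    have "\<bar>a * a' + 2 * b * b' + c * c'\<bar> \<le> \<bar>a\<bar> * \<bar>a'\<bar> + 2 * (\<bar>b\<bar> * \<bar>b'\<bar>) + \<bar>c\<bar> * \<bar>c'\<bar>" for a a' b b' c c' :: real
      using abs_triangle_ineq[of "a * a' + 2 * b * b'" "c * c'"] abs_triangle_ineq[of "a * a'" "2 * b * b'"]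
      by (simp add: abs_mult)
    then show ?thesis unfolding Q_eq .
  qed
  then have "y\<^sup>2 * \<bar>Q p y\<bar> \<le> y\<^sup>2 * (\<bar>\<theta>2 p y\<bar> * \<bar>monom_deriv 0 p y\<bar> + 2 * (\<bar>\<theta>1 p y\<bar> * \<bar>monom_deriv 1 p y\<bar>)
      + \<bar>\<theta> p y - \<theta> (p - 2) y\<bar> * \<bar>monom_deriv 2 p y\<bar>)"
    by (intro mult_left_mono) auto
  also have "\<dots> = (y\<^sup>2 * \<bar>\<theta>2 p y\<bar>) * \<bar>monom_deriv 0 p y\<bar> + 2 * ((\<bar>y\<bar> * \<bar>\<theta>1 p y\<bar>) * (\<bar>y\<bar> * \<bar>monom_deriv 1 p y\<bar>))
      + \<bar>\<theta> p y - \<theta> (p - 2) y\<bar> * (\<bar>y\<bar>\<^sup>2 * \<bar>monom_deriv 2 p y\<bar>)"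
    unfolding y2(2) power2_eq_square by (simp add: algebra_simps)
  also have "\<dots> \<le> 2880 * D + 2 * (320 * (real p * D)) + 80 * ((real p)\<^sup>2 * D)"
    by (intro add_mono mult_mono[OF tb(5) m0] mult_mono[OF t m2] mult_left_mono[OF mult_mono[OF tb(4) m1]]) auto
  also have "\<dots> = (2880 + 640 * real p + 80 * (real p)\<^sup>2) * D" by (simp add: algebra_simps)
  also have "\<dots> \<le> (2880 * (real p + 1)\<^sup>2) * D"
    using D by (intro mult_right_mono) (auto simp: power2_eq_square algebra_simps)
  finally show ?thesis unfolding D_def .
qed

definition L :: "nat \<Rightarrow> real" where
  "L p = 720 * (real p + 1)\<^sup>2 * T p (2 * s p) * (1 + 1 / s p + 1 / (s p)\<^sup>2)"

text \<open>The factors 1 / s_p^2 may blow up. Starting the decay at index 2 leaves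
  \<open>T 2 (2 * s p)\<close>, a multiple of s_p^2, which cancels them.\<close>

lemma summable_L: "summable L"
proof (rule summable_comparison_test_ev)
  let ?M = "720 * (16 * \<alpha> 2 * B\<^sup>2) * ((s 0)\<^sup>2 + s 0 + 1) * 8"
  have "norm (L p) \<le> ?M * (3 / 4) ^ p" if p: "2 \<le> p" for p
  proof -
    have "T p (2 * s p) \<le> T 2 (2 * s p) * (1 / 2) ^ (p - 2)"
      by (rule T_decay) (use s_pos[of p] p in auto)
    also have "(1 / 2 :: real) ^ (p - 2) = 4 * (1 / 2) ^ p"
    proof -
      have "(1 / 2 :: real) ^ p = (1 / 2) ^ (p - 2) * (1 / 2) ^ 2"
        using p by (simp only: power_add[symmetric] le_add_diff_inverse2)
      then show ?thesis by (simp add: power2_eq_square)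
    qed
    also have "T 2 (2 * s p) * (4 * (1 / 2) ^ p) = 16 * \<alpha> 2 * B\<^sup>2 * (s p)\<^sup>2 * (1 / 2) ^ p"
      by (simp add: T_def power_mult_distrib)
    finally have T: "T p (2 * s p) \<le> 16 * \<alpha> 2 * B\<^sup>2 * (s p)\<^sup>2 * (1 / 2) ^ p" .
    have sp: "0 < 1 + 1 / s p + 1 / (s p)\<^sup>2" using s_pos[of p] by (simp add: add_pos_pos)
    have "norm (L p) = 720 * (real p + 1)\<^sup>2 * T p (2 * s p) * (1 + 1 / s p + 1 / (s p)\<^sup>2)"
      using T_nonneg[of "2 * s p" p] s_pos[of p] sp by (simp add: L_def abs_mult)
    also have "\<dots> \<le> 720 * (real p + 1)\<^sup>2 * (16 * \<alpha> 2 * B\<^sup>2 * (s p)\<^sup>2 * (1 / 2) ^ p) * (1 + 1 / s p + 1 / (s p)\<^sup>2)"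
      using T sp by (intro mult_right_mono mult_left_mono) auto
    also have "\<dots> = 720 * (16 * \<alpha> 2 * B\<^sup>2) * ((s p)\<^sup>2 * (1 + 1 / s p + 1 / (s p)\<^sup>2)) * ((real p + 1)\<^sup>2 * (1 / 2) ^ p)"
      by (simp only: mult_ac)
    also have "(s p)\<^sup>2 * (1 + 1 / s p + 1 / (s p)\<^sup>2) = (s p)\<^sup>2 + s p + 1"
      using s_pos[of p] by (simp add: distrib_left power2_eq_square)
    also have "720 * (16 * \<alpha> 2 * B\<^sup>2) * ((s p)\<^sup>2 + s p + 1) * ((real p + 1)\<^sup>2 * (1 / 2) ^ p)
        \<le> 720 * (16 * \<alpha> 2 * B\<^sup>2) * ((s 0)\<^sup>2 + s 0 + 1) * (8 * (3 / 4) ^ p)"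
      using s_antimono[of 0 p] s_pos[of p] pos(1)[of 2] s_pos[of 0]
      by (intro mult_mono mult_left_mono add_mono power_mono sq_mult_half_power_le) auto
    finally show ?thesis by (simp only: mult.assoc)
  qed
  then show "\<forall>\<^sub>F p in sequentially. norm (L p) \<le> ?M * (3 / 4) ^ p"
    unfolding eventually_sequentially by blast
  show "summable (\<lambda>p. ?M * (3 / 4) ^ p)"
    by (intro summable_mult summable_geometric) simp
qed

lemma E_le_L:
  assumes "i \<le> 2"
  shows "\<bar>E p i y\<bar> * (B ^ p * \<alpha> p * fact p) \<le> L p"
proof -
  have sp: "0 < s p" by (rule s_pos)
  have F: "0 \<le> B ^ p * \<alpha> p * fact p" using B pos(1)[of p] by simp
  have "\<bar>E p i y\<bar> \<le> 720 * (real p + 1)\<^sup>2 * ((2 * s p) ^ p / fact p) / (s p) ^ i"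
    using abs_E_le[OF assms, of p y] sp by (simp add: field_simps)
  then have "\<bar>E p i y\<bar> * (B ^ p * \<alpha> p * fact p) \<le> 720 * (real p + 1)\<^sup>2 * ((2 * s p) ^ p / fact p) / (s p) ^ i * (B ^ p * \<alpha> p * fact p)"
    using F by (rule mult_right_mono)
  also have "\<dots> = 720 * (real p + 1)\<^sup>2 * T p (2 * s p) * (1 / (s p) ^ i)"
    by (simp add: T_def power_mult_distrib)
  also have "\<dots> \<le> L p"
    unfolding L_def
  proof (rule mult_left_mono)
    have "i = 0 \<or> i = 1 \<or> i = 2" using assms by auto
    then show "1 / (s p) ^ i \<le> 1 + 1 / s p + 1 / (s p)\<^sup>2" using sp by auto
    show "0 \<le> 720 * (real p + 1)\<^sup>2 * T p (2 * s p)" using T_nonneg[of "2 * s p" p] sp by simp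
  qed
  finally show ?thesis .
qed

text \<open>The constant \<open>K\<close> is the same for all \<open>q\<close>, so that taking the
  infimum over \<open>q\<close> later yields the exponential of an associated function.\<close>

lemma extension:
  fixes c :: "nat \<Rightarrow> 'a::euclidean_space \<Rightarrow> 'b::euclidean_space"
  assumes "open S" "\<And>p. Ck_on 2 (c p) S" "0 \<le> C1"
    and bnd: "\<And>p bs x. set bs \<subseteq> Basis \<Longrightarrow> length bs \<le> 2 \<Longrightarrow> x \<in> S \<Longrightarrow>
      norm (partials bs (c p) x) \<le> C1 * (B ^ p * \<alpha> p * fact p)"
    and rec: "\<And>p x. x \<in> S \<Longrightarrow> laplacian (c p) x = - c (p + 2) x"
  obtains \<Phi> K where "Ck_on 2 \<Phi> (S \<times> UNIV)" "\<And>x. x \<in> S \<Longrightarrow> \<Phi> (x, 0) = c 0 x"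
    "\<And>x. x \<in> S \<Longrightarrow> partial (0, 1) \<Phi> (x, 0) = c 1 x" "\<And>x y. 2 * s 0 \<le> \<bar>y\<bar> \<Longrightarrow> \<Phi> (x, y) = 0"
    "\<And>x y q. x \<in> S \<Longrightarrow> y \<noteq> 0 \<Longrightarrow> y ^ 4 * norm (laplacian \<Phi> (x, y)) \<le> K * X q \<bar>y\<bar>" "0 \<le> K"
proof -
  have op: "open (S \<times> (UNIV :: real set))" using assms(1) by (simp add: open_Times)
  define f where "f p = (\<lambda>z. E p 0 (snd z) *\<^sub>R c p (fst z))" for p
  have fC: "Ck_on 2 (f p) (S \<times> UNIV)" for p
    unfolding f_def by (rule Ck_on_tensor[OF assms(1) E_deriv continuous_on_E2 assms(2)])
  have sumL: "summable (\<lambda>p. C1 * L p)" by (intro summable_mult summable_L)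
  have fb: "norm (partials bs (f p) z) \<le> C1 * L p" if bs: "set bs \<subseteq> Basis" "length bs \<le> 2" "z \<in> S \<times> UNIV" for p bs z
  proof -
    obtain i cs where ics: "set cs \<subseteq> Basis" "i + length cs = length bs"
      "\<And>z. z \<in> S \<times> UNIV \<Longrightarrow> partials bs (f p) z = E p i (snd z) *\<^sub>R partials cs (c p) (fst z)"
      using partials_tensor[where E = "E p" and a = "c p" and k = 2, OF assms(1) E_deriv assms(2) bs(1,2)]
      unfolding f_def by blast
    have "norm (partials bs (f p) z) = \<bar>E p i (snd z)\<bar> * norm (partials cs (c p) (fst z))"
      using ics(3)[OF bs(3)] by simp
    also have "\<dots> \<le> \<bar>E p i (snd z)\<bar> * (C1 * (B ^ p * \<alpha> p * fact p))"
      using ics bs by (intro mult_left_mono bnd) (auto simp: mem_Times_iff)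
    also have "\<dots> = C1 * (\<bar>E p i (snd z)\<bar> * (B ^ p * \<alpha> p * fact p))" by simp
    also have "\<dots> \<le> C1 * L p"
      using ics(2) bs(2) assms(3) by (intro mult_left_mono E_le_L) auto
    finally show ?thesis .
  qed
  define \<Phi> where "\<Phi> z = (\<Sum>p. f p z)" for z
  note ser = Ck_on_series[OF op fC sumL fb]
  have \<Phi>C: "Ck_on 2 \<Phi> (S \<times> UNIV)" unfolding \<Phi>_def[abs_def] by (rule ser(1))
  have der: "(\<lambda>p. partials bs (f p) z) sums partials bs \<Phi> z"
    if "set bs \<subseteq> Basis" "length bs \<le> 2" "z \<in> S \<times> UNIV" for bs z
    unfolding \<Phi>_def[abs_def] by (rule ser(2)[OF _ _ _ that])
  have E0: "E p 0 0 = (if p = 0 then 1 else 0)" "E p 1 0 = (if p = 1 then 1 else 0)" for p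
    using \<theta>_inner[of 0 p] s_pos[of p] by (auto simp: E_def monom_deriv_def power_0_left)
  have lap: "norm (y ^ 4 *\<^sub>R laplacian \<Phi> (x, y)) \<le> 92160 * C1 * (4 * (s 0)\<^sup>2 + 2 * s 0 / (4 * B * quot \<alpha> 1)) * X q \<bar>y\<bar>"
    if x: "x \<in> S" and y: "y \<noteq> 0" for x y q
  proof -
    let ?K = "4 * (s 0)\<^sup>2 + 2 * s 0 / (4 * B * quot \<alpha> 1)"
    have z: "(x, y) \<in> S \<times> UNIV" using x by simp
    have "(\<lambda>p. \<Sum>b\<in>Basis. partials [b, b] (f p) (x, y)) sums (\<Sum>b\<in>Basis. partials [b, b] \<Phi> (x, y))"
      by (rule sums_sum, rule der[OF _ _ z]) simp_all
    then have "(\<lambda>p. laplacian (f p) (x, y)) sums laplacian \<Phi> (x, y)"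
      by (simp add: laplacian_def)
    moreover have "laplacian (f p) (x, y) = E p 2 y *\<^sub>R c p x - E p 0 y *\<^sub>R c (p + 2) x" for p
    proof -
      have "laplacian (f p) (x, y) = E p 2 (snd (x, y)) *\<^sub>R c p (fst (x, y)) + E p 0 (snd (x, y)) *\<^sub>R laplacian (c p) (fst (x, y))"
        unfolding f_def
        by (rule laplacian_tensor[OF assms(1) _ _ assms(2), where ?E1.0 = "E p 1"])
          (use E_deriv[of 0] E_deriv[of 1] x in \<open>simp_all add: numeral_2_eq_2\<close>)
      then show ?thesis using rec[OF x, of p] by simp
    qed
    ultimately have "(\<lambda>p. E p 2 y *\<^sub>R c p x - E p 0 y *\<^sub>R c (p + 2) x) sums laplacian \<Phi> (x, y)" by simp
    moreover
    \<comment> \<open>The two parts of the Laplacian must converge separately before they are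
      regrouped. The recursion bounds c_(p+2) by second derivatives of c_p, so the majorant with
      index p applies.\<close>
    have sb: "summable (\<lambda>p. E p 0 y *\<^sub>R c (p + 2) x)"
    proof (rule summable_comparison_test')
      show "summable (\<lambda>p. real DIM('a) * (C1 * L p))" by (rule summable_mult[OF sumL])
      fix p
      have "norm (c (p + 2) x) \<le> real DIM('a) * (C1 * (B ^ p * \<alpha> p * fact p))"
      proof -
        have "norm (partials [] (laplacian (c p)) x) \<le> real DIM('a) * (C1 * (B ^ p * \<alpha> p * fact p))"
        proof (rule norm_partials_laplacian_le[OF assms(1) x])
          show "Ck_on (length ([] :: 'a list) + 2) (c p) S"
            unfolding list.size add_0_left by (rule assms(2))
          show "norm (partials bs (c p) x) \<le> C1 * (B ^ p * \<alpha> p * fact p)"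
            if "set bs \<subseteq> Basis" "length bs = length ([] :: 'a list) + 2" for bs
            by (rule bnd[OF that(1) _ x]) (use that(2) in simp)
        qed simp
        then show ?thesis using rec[OF x, of p] by simp
      qed
      then have "norm (E p 0 y *\<^sub>R c (p + 2) x) \<le> \<bar>E p 0 y\<bar> * (real DIM('a) * (C1 * (B ^ p * \<alpha> p * fact p)))"
        unfolding norm_scaleR by (intro mult_left_mono) auto
      also have "\<dots> = real DIM('a) * (C1 * (\<bar>E p 0 y\<bar> * (B ^ p * \<alpha> p * fact p)))" by (simp only: mult_ac)
      also have "\<dots> \<le> real DIM('a) * (C1 * L p)"
        using assms(3) by (intro mult_left_mono E_le_L) auto
      finally show "norm (E p 0 y *\<^sub>R c (p + 2) x) \<le> real DIM('a) * (C1 * L p)" .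
    qed
    \<comment> \<open>Regrouping by c_p shifts the second series by two places; \<open>b\<close>
      fills them with zeros.\<close>
    define b where "b p = (if 2 \<le> p then E (p - 2) 0 y *\<^sub>R c p x else 0)" for p
    have "b sums (\<Sum>p. E p 0 y *\<^sub>R c (p + 2) x)"
    proof -
      have "(\<lambda>p. b (p + 2)) sums (\<Sum>p. E p 0 y *\<^sub>R c (p + 2) x)"
        using summable_sums[OF sb] by (simp add: b_def)
      then have "b sums ((\<Sum>p. E p 0 y *\<^sub>R c (p + 2) x) + (\<Sum>p<2. b p))"
        by (simp only: sums_iff_shift)
      then show ?thesis by (simp add: b_def numeral_2_eq_2)
    qed
    ultimately have "(\<lambda>p. (E p 2 y *\<^sub>R c p x - E p 0 y *\<^sub>R c (p + 2) x) + E p 0 y *\<^sub>R c (p + 2) x - b p) sums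
        (laplacian \<Phi> (x, y) + (\<Sum>p. E p 0 y *\<^sub>R c (p + 2) x) - (\<Sum>p. E p 0 y *\<^sub>R c (p + 2) x))"
      by (intro sums_diff sums_add summable_sums[OF sb])
    moreover have "(E p 2 y *\<^sub>R c p x - E p 0 y *\<^sub>R c (p + 2) x) + E p 0 y *\<^sub>R c (p + 2) x - b p = Q p y *\<^sub>R c p x" for p
      by (simp add: Q_def b_def scaleR_diff_left)
    ultimately have "(\<lambda>p. Q p y *\<^sub>R c p x) sums laplacian \<Phi> (x, y)" by simp
    then have sums4: "(\<lambda>p. y ^ 4 *\<^sub>R Q p y *\<^sub>R c p x) sums (y ^ 4 *\<^sub>R laplacian \<Phi> (x, y))"
      by (rule sums_scaleR_right)
    let ?G = "\<lambda>p. 2880 * C1 * ?K * X q \<bar>y\<bar> * (8 * (3 / 4) ^ p)"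
    have K0: "0 \<le> ?K" using s_pos[of 0] B quot_pos(1)[of 1] by simp
    have XX: "0 \<le> X q \<bar>y\<bar>" by (rule X_nonneg) simp
    have "norm (y ^ 4 *\<^sub>R Q p y *\<^sub>R c p x) \<le> ?G p" for p
    proof (cases "Q p y = 0")
      case True
      have "0 \<le> ?G p" using assms(3) K0 XX by (intro mult_nonneg_nonneg) auto
      then show ?thesis using True by simp
    next
      case False
      have cb: "norm (c p x) \<le> C1 * (B ^ p * \<alpha> p * fact p)" using bnd[of "[]" x p] x by simp
      \<comment> \<open>Of the four powers of y, two undo the y-derivatives in
        \<open>Q_bound\<close> and two are taken by \<open>key_bound\<close>.\<close>
      have "norm (y ^ 4 *\<^sub>R Q p y *\<^sub>R c p x) = y\<^sup>2 * (y\<^sup>2 * \<bar>Q p y\<bar>) * norm (c p x)"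
        by (simp add: power2_eq_square eval_nat_numeral abs_mult)
      also have "\<dots> \<le> y\<^sup>2 * (2880 * (real p + 1)\<^sup>2 * (\<bar>y\<bar> ^ p / fact p)) * (C1 * (B ^ p * \<alpha> p * fact p))"
        by (rule mult_mono[OF mult_left_mono[OF Q_bound] cb]) auto
      also have "\<dots> = 2880 * C1 * (real p + 1)\<^sup>2 * (\<bar>y\<bar>\<^sup>2 * T p \<bar>y\<bar>)"
        by (simp add: T_def power_mult_distrib)
      also have "\<dots> \<le> 2880 * C1 * (real p + 1)\<^sup>2 * (?K * (1 / 2) ^ p * X q \<bar>y\<bar>)"
        using Q_support[OF False] assms(3) by (intro mult_left_mono key_bound) auto
      also have "\<dots> = 2880 * C1 * ?K * X q \<bar>y\<bar> * ((real p + 1)\<^sup>2 * (1 / 2) ^ p)" by (simp only: mult_ac)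
      also have "\<dots> \<le> ?G p"
        using assms(3) K0 XX by (intro mult_left_mono sq_mult_half_power_le mult_nonneg_nonneg) auto
      finally show ?thesis .
    qed
    moreover have Gsum: "?G sums (2880 * C1 * ?K * X q \<bar>y\<bar> * (8 * (1 / (1 - 3 / 4))))"
      by (intro sums_mult geometric_sums) simp
    ultimately have "norm (\<Sum>p. y ^ 4 *\<^sub>R Q p y *\<^sub>R c p x) \<le> suminf ?G"
      by (intro norm_suminf_le) (auto dest: sums_summable)
    then have "norm (y ^ 4 *\<^sub>R laplacian \<Phi> (x, y)) \<le> 2880 * C1 * ?K * X q \<bar>y\<bar> * (8 * (1 / (1 - 3 / 4)))"
      unfolding sums_unique[OF sums4, symmetric] sums_unique[OF Gsum, symmetric] .
    moreover have "2880 * C1 * k * x * (8 * (1 / (1 - 3 / 4))) = 92160 * C1 * k * x" for k x :: real by simp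
    ultimately show ?thesis by (simp only:)
  qed
  show ?thesis
  proof (rule that[OF \<Phi>C])
    show "\<Phi> (x, 0) = c 0 x" if "x \<in> S" for x
    proof -
      have "f p (x, 0) = (if p = 0 then c p x else 0)" for p by (simp add: f_def E0)
      then have "(\<lambda>p. f p (x, 0)) sums c 0 x" using sums_single[of 0 "\<lambda>p. c p x"] by simp
      then show ?thesis unfolding \<Phi>_def by (rule sums_unique[symmetric])
    qed
    show "partial (0, 1) \<Phi> (x, 0) = c 1 x" if x: "x \<in> S" for x
    proof -
      have d: "partial (0, 1) (f p) (x, 0) = E p 1 0 *\<^sub>R c p x" for p
        unfolding f_def using partial_tensor(2)[of "E p 0" "E p 1 (snd (x, 0))" "(x, 0)" "c p"] E_deriv[of 0 p]
          Ck_on_differentiable[OF assms(2) _ x] by simp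
      have "partial (0, 1) (f p) (x, 0) = (if p = 1 then c p x else 0)" for p
        unfolding d E0(2) by simp
      then have "(\<lambda>p. partial (0, 1) (f p) (x, 0)) sums c 1 x" using sums_single[of 1 "\<lambda>p. c p x"] by simp
      moreover have "(\<lambda>p. partial (0, 1) (f p) (x, 0)) sums partial (0, 1) \<Phi> (x, 0)"
        using der[of "[(0, 1)]" "(x, 0)"] x by simp
      ultimately show ?thesis using sums_unique2 by blast
    qed
    show "\<Phi> (x, y) = 0" if "2 * s 0 \<le> \<bar>y\<bar>" for x y
    proof -
      have "2 * s p \<le> \<bar>y\<bar>" for p using s_antimono[of 0 p] that by simp
      then show ?thesis by (simp add: \<Phi>_def f_def E_def \<theta>_outer)
    qed
    show "y ^ 4 * norm (laplacian \<Phi> (x, y)) \<le> 92160 * C1 * (4 * (s 0)\<^sup>2 + 2 * s 0 / (4 * B * quot \<alpha> 1)) * X q \<bar>y\<bar>"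
      if "x \<in> S" "y \<noteq> 0" for x y q
      using lap[OF that, of q] by simp
    show "0 \<le> 92160 * C1 * (4 * (s 0)\<^sup>2 + 2 * s 0 / (4 * B * quot \<alpha> 1))"
      using assms(3) s_pos[of 0] B quot_pos(1)[of 1] by simp
  qed
qed

end

section \<open>Boundary values of almost harmonic functions\<close>

text \<open>As many mollifiers as there are derivatives are differentiated; the remaining ones only
  average and enlarge the ball.\<close>

lemma moll_power_smooth_le:
  fixes f :: "'a::euclidean_space \<Rightarrow> 'b::euclidean_space"
  assumes "continuous_on UNIV f" "0 < r" "set bs \<subseteq> Basis" "length bs \<le> m"
    "\<And>w. w \<in> cball z (real m * r) \<Longrightarrow> norm (f w) \<le> e"
  shows "norm (partials bs ((moll r ^^ m) f) z) \<le> (moll_const TYPE('a) / r) ^ length bs * e"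
proof -
  obtain k where k: "m = length bs + k" using assms(4) le_Suc_ex by blast
  have "norm (partials bs ((moll r ^^ length bs) ((moll r ^^ k) f)) z) \<le> (moll_const TYPE('a) / r) ^ length bs * e"
  proof (rule moll_power_smooth(2)[OF continuous_on_moll_power[OF assms(1)] assms(2,3) refl])
    fix w assume w: "w \<in> cball z (real (length bs) * r)"
    show "norm ((moll r ^^ k) f w) \<le> e"
    proof (rule norm_moll_power_le[OF assms(1) less_imp_le[OF assms(2)]], rule assms(5))
      fix u assume "u \<in> cball w (real k * r)"
      then show "u \<in> cball z (real m * r)"
        using w dist_triangle[of z u w] by (simp add: k algebra_simps)
    qed
  qed
  then show ?thesis by (simp add: k funpow_add)
qed

lemma moll_power_sum:
  assumes "\<And>i. i \<in> I \<Longrightarrow> continuous_on UNIV (f i)" "finite I"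
  shows "(moll r ^^ m) (\<lambda>w. \<Sum>i\<in>I. f i w) = (\<lambda>w. \<Sum>i\<in>I. (moll r ^^ m) (f i) w)"
proof (induction m)
  case (Suc m)
  have "moll r (\<lambda>w. \<Sum>i\<in>I. (moll r ^^ m) (f i) w) = (\<lambda>w. \<Sum>i\<in>I. moll r ((moll r ^^ m) (f i)) w)"
    unfolding moll_def
    by (rule ext, rule cconv_sum[OF kernel_moll _ assms(2)]) (use continuous_on_moll_power assms(1) in \<open>auto simp: moll_def\<close>)
  then show ?case using Suc by simp
qed simp

lemma laplacian_moll_power:
  assumes "Ck_on 2 f UNIV"
  shows "laplacian ((moll r ^^ m) f) = (moll r ^^ m) (laplacian f)"
proof -
  have "partials [b, b] ((moll r ^^ m) f) = (moll r ^^ m) (partials [b, b] f)" if "b \<in> Basis" for b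
    by (rule partials_moll_power) (use assms that in \<open>auto simp: numeral_2_eq_2\<close>)
  then have "laplacian ((moll r ^^ m) f) = (\<lambda>z. \<Sum>b\<in>Basis. (moll r ^^ m) (partial b (partial b f)) z)"
    by (auto simp: laplacian_def fun_eq_iff)
  also have "\<dots> = (moll r ^^ m) (laplacian f)"
    unfolding laplacian_def[abs_def]
    by (rule moll_power_sum[symmetric]) (use assms in \<open>auto simp: numeral_2_eq_2\<close>)
  finally show ?thesis .
qed

lemma laplacian_partials:
  assumes "open S" "Ck_on (length cs + 2) f S" "set cs \<subseteq> Basis" "z \<in> S"
  shows "laplacian (partials cs f) z = partials cs (laplacian f) z"
proof -
  have "partials cs (laplacian f) z = (\<Sum>b\<in>Basis. partials cs (partial b (partial b f)) z)"
    unfolding laplacian_def[abs_def]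
    by (rule partials_sum[OF assms(1)]) (use assms in auto)
  also have "\<dots> = (\<Sum>b\<in>Basis. partial b (partial b (partials cs f)) z)"
  proof (rule sum.cong[OF refl])
    fix b :: 'a assume b: "b \<in> Basis"
    have "partials (cs @ [b, b]) f z = partials ([b, b] @ cs) f z"
      by (rule partials_perm[OF assms(1) _ _ _ assms(4)]) (use assms b in \<open>auto simp del: Ck_on.simps\<close>)
    then show "partials cs (partial b (partial b f)) z = partial b (partial b (partials cs f)) z" by simp
  qed
  finally show ?thesis by (simp add: laplacian_def)
qed

text \<open>Compares two mollifications of \<open>f\<close> through their composition, so that the derivatives fall
  on a mollifier while the Laplacian of \<open>f\<close> controls the difference.\<close>

lemma moll_power_compare:
  fixes f :: "'a::euclidean_space \<Rightarrow> 'b::euclidean_space"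
  assumes f: "Ck_on 2 f UNIV" and t: "0 < t" and cs: "set cs \<subseteq> Basis" "length cs + 2 \<le> m"
    and lap: "\<And>w. w \<in> cball z (2 * t) \<Longrightarrow> norm (laplacian f w) \<le> e"
  shows "norm (partials cs ((moll (t / 2 / real m) ^^ m) f) z - partials cs ((moll (t / real m) ^^ m) f) z)
    \<le> 2 * moll_const TYPE('a) * t\<^sup>2 * (2 * moll_const TYPE('a) * real m / t) ^ length cs * e"
proof -
  let ?C = "moll_const TYPE('a)" and ?n = "length cs"
  have C: "1 \<le> ?C" by (rule moll_const_ge(1))
  have m: "1 \<le> real m" "0 < real m" using cs(2) by auto
  define r where "r = t / real m"
  have r: "0 < r" "real m * r = t" "0 < r / 2" "real m * (r / 2) = t / 2" using t m by (auto simp: r_def)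
  have r2: "t / 2 / real m = r / 2" by (simp add: r_def)
  define P where "P = (moll r ^^ m) f"
  have cf: "continuous_on UNIV f" using f by (rule Ck_on_imp_continuous)
  have cP: "continuous_on UNIV P" unfolding P_def by (rule continuous_on_moll_power[OF cf])
  have Pm: "Ck_on m P UNIV" unfolding P_def by (rule moll_power_smooth(1)[OF cf r(1)])
  have cl: "continuous_on UNIV (laplacian f)"
    using Ck_on_laplacian[OF open_UNIV, of 0 f] f by (simp add: numeral_2_eq_2)
  have "0 \<le> norm (laplacian f z)" by simp
  also have "\<dots> \<le> e" using t by (intro lap) simp
  finally have e: "0 \<le> e" .
  have sub: "u \<in> cball z (2 * t)" if "u \<in> cball w t" "w \<in> cball z (t / 2)" for u w
    using that dist_triangle[of z u w] t by simp
  have mr: "real m * (?C * r\<^sup>2 * x) \<le> ?C * t\<^sup>2 * x" if "0 \<le> x" for x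
  proof -
    have "real m * r\<^sup>2 = t * r" unfolding power2_eq_square using r(2) by (simp add: mult.assoc[symmetric])
    also have "\<dots> \<le> t * t" using m t by (intro mult_left_mono) (auto simp: r_def divide_le_eq)
    finally have "?C * x * (real m * r\<^sup>2) \<le> ?C * x * t\<^sup>2"
      unfolding power2_eq_square using C that by (intro mult_left_mono) auto
    then show ?thesis by (simp add: mult_ac)
  qed
  have dev: "norm (f w - P w) \<le> ?C * t\<^sup>2 * e" if "w \<in> cball z (t / 2)" for w
  proof -
    have "norm (P w - f w) \<le> real m * (?C * r\<^sup>2 * e)"
      unfolding P_def by (rule norm_moll_power_minus_le[OF f r(1)], rule lap) (use sub that r(2) in auto)
    then show ?thesis using mr[OF e] by (simp add: norm_minus_commute)
  qed
  have pow: "(?C / (r / 2)) ^ ?n = (2 * ?C * real m / t) ^ ?n" using t m by (simp add: r_def field_simps)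
  have Cn: "Ck_on ?n P UNIV" using Pm by (rule Ck_on_mono) (use cs in auto)
  have smooth: "Ck_on ?n ((moll (r / 2) ^^ m) g) UNIV" if "continuous_on UNIV g" for g :: "'a \<Rightarrow> 'b"
    by (rule Ck_on_mono[OF moll_power_smooth(1)[OF that r(3)]]) (use cs in auto)
  \<comment> \<open>First change: under the fine mollifier, which takes the derivatives,
    \<open>f\<close> is replaced by its coarse mollification \<open>P\<close>; f - P is controlled
    by the Laplacian.\<close>
  have 1: "norm (partials cs ((moll (r / 2) ^^ m) f) z - partials cs ((moll (r / 2) ^^ m) P) z)
      \<le> (2 * ?C * real m / t) ^ ?n * (?C * t\<^sup>2 * e)"
  proof -
    have "partials cs ((moll (r / 2) ^^ m) f) z - partials cs ((moll (r / 2) ^^ m) P) z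
      = partials cs ((moll (r / 2) ^^ m) (\<lambda>w. f w - P w)) z"
      unfolding moll_power_diff[OF cf cP]
      by (rule partials_diff[OF open_UNIV smooth[OF cf] smooth[OF cP] UNIV_I cs(1), symmetric])
    moreover have "norm (partials cs ((moll (r / 2) ^^ m) (\<lambda>w. f w - P w)) z) \<le> (?C / (r / 2)) ^ ?n * (?C * t\<^sup>2 * e)"
    proof (rule moll_power_smooth_le[OF _ r(3) cs(1)])
      show "continuous_on UNIV (\<lambda>w. f w - P w)" by (intro continuous_intros cf cP)
      show "norm (f w - P w) \<le> ?C * t\<^sup>2 * e" if "w \<in> cball z (real m * (r / 2))" for w
        using dev that unfolding r(4) .
    qed (use cs in simp)
    ultimately show ?thesis unfolding pow by simp
  qed
  \<comment> \<open>Second change: the fine mollifier is removed. The derivatives are now borne by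
    the coarse one, and the Laplacian of a derivative of \<open>P\<close> is a derivative of the
    mollified Laplacian of \<open>f\<close>.\<close>
  have 2: "norm (partials cs ((moll (r / 2) ^^ m) P) z - partials cs P z) \<le> (2 * ?C * real m / t) ^ ?n * (?C * t\<^sup>2 * e)"
  proof -
    have "Ck_on 2 (partials cs P) UNIV"
      by (rule Ck_on_partials[OF cs(1) Ck_on_mono[OF Pm]]) (use cs in simp)
    moreover have "norm (laplacian (partials cs P) w) \<le> (2 * ?C * real m / t) ^ ?n * e" if w: "w \<in> cball z (t / 2)" for w
    proof -
      have "laplacian (partials cs P) w = partials cs (laplacian P) w"
        by (rule laplacian_partials[OF open_UNIV Ck_on_mono[OF Pm cs(2)] cs(1) UNIV_I])
      also have "laplacian P = (moll r ^^ m) (laplacian f)"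
        unfolding P_def by (rule laplacian_moll_power[OF f])
      also have "norm (partials cs \<dots> w) \<le> (?C / r) ^ ?n * e"
        by (rule moll_power_smooth_le[OF cl r(1) cs(1)], use cs in simp, rule lap) (use sub w r(2) in auto)
      also have "\<dots> \<le> (?C / (r / 2)) ^ ?n * e"
        using C r(1) e by (intro mult_right_mono power_mono divide_left_mono) auto
      finally show ?thesis unfolding pow .
    qed
    ultimately have "norm ((moll (r / 2) ^^ m) (partials cs P) z - partials cs P z)
        \<le> real m * (?C * (r / 2)\<^sup>2 * ((2 * ?C * real m / t) ^ ?n * e))"
      using r(4) by (intro norm_moll_power_minus_le[OF _ r(3)]) auto
    also have "\<dots> \<le> real m * (?C * r\<^sup>2 * ((2 * ?C * real m / t) ^ ?n * e))"
      using C r(1) e t m by (intro mult_left_mono mult_right_mono power_mono mult_nonneg_nonneg) auto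
    also have "\<dots> \<le> ?C * t\<^sup>2 * ((2 * ?C * real m / t) ^ ?n * e)"
      using C e t m by (intro mr mult_nonneg_nonneg) auto
    finally show ?thesis using partials_moll_power[OF Cn cs(1)] by (simp add: mult_ac)
  qed
  have "norm (partials cs ((moll (r / 2) ^^ m) f) z - partials cs P z)
      \<le> (2 * ?C * real m / t) ^ ?n * (?C * t\<^sup>2 * e) + (2 * ?C * real m / t) ^ ?n * (?C * t\<^sup>2 * e)"
    using norm_triangle_mono[OF 1 2] by simp
  then show ?thesis unfolding r2 P_def r_def[symmetric] by (simp add: mult_ac)
qed

text \<open>P + j + 2 mollifiers under P + j derivatives produce this power; the exponential series
  turns it into a factorial. The base 6 is 3 from e \<le> 3 and 2 from P + 1 \<le> 2^P.\<close>

lemma power_Suc_le_fact: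
  fixes P j :: nat
  assumes "j \<le> 1"
  shows "real (P + j + 2) ^ (P + j) \<le> 27 * 6 ^ P * fact P"
proof -
  have "real (P + j + 2) ^ (P + j) \<le> exp (real (P + j + 2)) * fact (P + j)"
    using power_div_fact_le_exp[of "real (P + j + 2)" "P + j"] by (simp add: pos_divide_le_eq)
  also have "\<dots> \<le> (27 * 3 ^ P) * (2 ^ P * fact P)"
  proof (rule mult_mono)
    have "exp (real (P + j + 2)) \<le> exp (real (P + 3))" using assms by simp
    also have "\<dots> = exp 1 ^ (P + 3)" using exp_of_nat_mult[of "P + 3" "1::real"] by simp
    also have "\<dots> \<le> 3 ^ (P + 3)" using exp_le by (intro power_mono) auto
    finally show "exp (real (P + j + 2)) \<le> 27 * 3 ^ P" by (simp add: power_add)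
    have "fact (P + j) \<le> (fact (Suc P) :: real)" using assms by (intro fact_mono) auto
    also have "\<dots> = real (Suc P) * fact P" by simp
    also have "\<dots> \<le> 2 ^ P * fact P"
    proof (rule mult_right_mono)
      have "Suc P \<le> 2 ^ P" by (simp add: Suc_leI)
      then show "real (Suc P) \<le> 2 ^ P" by (metis of_nat_le_iff of_nat_numeral of_nat_power)
    qed simp
    finally show "fact (P + j) \<le> (2 ^ P * fact P :: real)" .
  qed auto
  also have "\<dots> = 27 * 6 ^ P * fact P"
    by (simp add: power_mult_distrib[symmetric])
  finally show ?thesis .
qed

text \<open>\<open>cs0\<close> selects the trace itself or its normal derivative. The trace is the
  coarsest mollification plus a telescoping series: the former contributes the analytic term G^p p!,
  the latter the term with \<nu>.\<close>

lemma boundary_value_estimate: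
  fixes f :: "'a::euclidean_space \<times> real \<Rightarrow> 'b::euclidean_space" and \<nu> :: "nat \<Rightarrow> real"
  assumes f: "Ck_on 2 f UNIV" and B: "\<And>z. norm (f z) \<le> B" and S: "open S" and \<rho>: "0 < \<rho>"
    and lap: "\<And>x w t q. x \<in> S \<Longrightarrow> 0 < t \<Longrightarrow> t \<le> \<rho> \<Longrightarrow> w \<in> cball (x, 0) t \<Longrightarrow> norm (laplacian f w) \<le> A * \<nu> q * t ^ q"
    and A: "0 \<le> A" "\<And>q. 0 \<le> \<nu> q"
    and cs0: "set cs0 \<subseteq> Basis" "length cs0 \<le> 1"
  defines "\<phi> \<equiv> \<lambda>x. partials cs0 f (x, 0)"
  shows "Cinf_on \<phi> S"
    and "\<exists>D G. 0 < D \<and> 0 < G \<and> (\<forall>bs x. set bs \<subseteq> Basis \<longrightarrow> x \<in> S \<longrightarrow> norm (partials bs \<phi> x)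
      \<le> D * (G ^ length bs * fact (length bs)
          + (24 * moll_const TYPE('a \<times> real)) ^ length bs * fact (length bs) * \<nu> (length bs)))"
proof -
  let ?C = "moll_const TYPE('a \<times> real)" and ?j = "length cs0"
  have C: "1 \<le> ?C" by (rule moll_const_ge(1))
  have B0: "0 \<le> B" using B[of undefined] norm_ge_zero order_trans by blast
  \<comment> \<open>Starts at \<rho> / 2 because \<open>moll_power_compare\<close> looks at the
    Laplacian within distance 2 t.\<close>
  define t where "t k = \<rho> / 2 * (1 / 2) ^ k" for k :: nat
  have t: "0 < t k" "t k \<le> \<rho> / 2" "2 * t k \<le> \<rho>" "t (Suc k) = t k / 2" for k
    using \<rho> by (auto simp: t_def power_le_one)
  have cf: "continuous_on UNIV f" using f by (rule Ck_on_imp_continuous)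
  have cf0: "Ck_on ?j f UNIV" using f by (rule Ck_on_mono) (use cs0 in simp)
  have cphi: "continuous_on UNIV (partials cs0 f)"
    using Ck_on_partials[OF cs0(1), of 0 f UNIV] cf0 by simp
  define Z where "Z m q = 2 * ?C * (1 + \<rho>) * A * (2 * ?C * real m) ^ (q + ?j) * 2 ^ q * \<nu> q" for m q
  have Z0: "0 \<le> Z m q" for m q
    unfolding Z_def using C \<rho> A by (intro mult_nonneg_nonneg) auto
  have main: "Ck_on P \<phi> S \<and> (\<forall>bs x. set bs \<subseteq> Basis \<longrightarrow> length bs = P \<longrightarrow> x \<in> S \<longrightarrow> norm (partials bs \<phi> x)
      \<le> (?C * real (P + ?j + 2) / (\<rho> / 2)) ^ (P + ?j) * B + \<rho> * Z (P + ?j + 2) P)" for P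
  proof -
    \<comment> \<open>The number of mollifiers grows with the order: one for each derivative and two
      for the Laplacian in \<open>moll_power_compare\<close>. At fixed total radius each has radius
      t / m, which is the source of the factorials.\<close>
    define m where "m = P + ?j + 2"
    have m: "0 < real m" by (simp add: m_def)
    define G where "G k = (moll (t k / real m) ^^ m) f" for k
    define g where "g k x = partials cs0 (G k) (x, 0)" for k x
    have Gm: "Ck_on m (G k) UNIV" for k
      unfolding G_def by (rule moll_power_smooth(1)[OF cf]) (use t m in simp)
    have Pg: "Ck_on P (\<lambda>x. g k x) UNIV" for k
      unfolding g_def
      by (rule Ck_on_slice[OF Ck_on_partials[OF cs0(1) Ck_on_mono[OF Gm]]]) (simp add: m_def)
    have eq: "partials bs (g k) x = partials (map (\<lambda>b. (b, 0)) bs @ cs0) (G k) (x, 0)"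
      if "set bs \<subseteq> Basis" "length bs \<le> P" for bs k x
    proof -
      have "Ck_on (length bs) (partials cs0 (G k)) UNIV"
        by (rule Ck_on_partials[OF cs0(1) Ck_on_mono[OF Gm]]) (use that in \<open>simp add: m_def\<close>)
      then show ?thesis unfolding g_def using that by (simp add: partials_slice)
    qed
    have diff: "norm (partials bs (g (Suc k)) x - partials bs (g k) x) \<le> Z m (length bs) * t k"
      if bs: "set bs \<subseteq> Basis" "length bs \<le> P" "x \<in> S" for bs k x
    proof -
      let ?cs = "map (\<lambda>b. (b, 0 :: real)) bs @ cs0" and ?q = "length bs"
      have "norm (partials ?cs ((moll (t k / 2 / real m) ^^ m) f) (x, 0) - partials ?cs ((moll (t k / real m) ^^ m) f) (x, 0))
        \<le> 2 * ?C * (t k)\<^sup>2 * (2 * ?C * real m / t k) ^ length ?cs * (A * \<nu> ?q * (2 * t k) ^ ?q)"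
      proof (rule moll_power_compare[OF f t(1)])
        show "set ?cs \<subseteq> Basis" using bs(1) cs0(1) by auto
        show "length ?cs + 2 \<le> m" using bs(2) by (simp add: m_def)
        show "norm (laplacian f w) \<le> A * \<nu> ?q * (2 * t k) ^ ?q" if "w \<in> cball (x, 0) (2 * t k)" for w
          by (rule lap[OF bs(3) _ t(3) that]) (use t(1)[of k] in simp)
      qed
      also have "2 * ?C * (t k)\<^sup>2 * (2 * ?C * real m / t k) ^ length ?cs * (A * \<nu> ?q * (2 * t k) ^ ?q)
          = 2 * ?C * ((t k)\<^sup>2 / (t k) ^ ?j) * A * (2 * ?C * real m) ^ (?q + ?j) * 2 ^ ?q * \<nu> ?q"
      proof -
        have "2 * c * T\<^sup>2 * (M / T) ^ (q + j) * (a * n * (2 * T) ^ q) = 2 * c * (T\<^sup>2 / T ^ j) * a * M ^ (q + j) * 2 ^ q * n"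
          if "0 < T" for c T M a n :: real and q j
          using that by (simp add: power_divide power_mult_distrib power_add)
        from this[OF t(1)] show ?thesis by simp
      qed
      \<comment> \<open>The q + j derivatives cost t^(-q - j), and \<open>lap\<close> for this very
        q returns t^q. With the factor t^2 at least one power of t remains since j \<le> 1, so the
        series over k converges.\<close>
      also have "\<dots> \<le> 2 * ?C * ((1 + \<rho>) * t k) * A * (2 * ?C * real m) ^ (?q + ?j) * 2 ^ ?q * \<nu> ?q"
      proof -
        have "?j = 0 \<or> ?j = 1" using cs0(2) by linarith
        then have "(t k)\<^sup>2 / (t k) ^ ?j \<le> (1 + \<rho>) * t k"
        proof
          assume "?j = 0"
          moreover have "t k * t k \<le> (1 + \<rho>) * t k" using t(1,2)[of k] \<rho> by (intro mult_right_mono) auto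
          ultimately show ?thesis by (simp add: power2_eq_square)
        next
          assume "?j = 1"
          moreover have "1 * t k \<le> (1 + \<rho>) * t k" using t(1)[of k] \<rho> by (intro mult_right_mono) auto
          ultimately show ?thesis using t(1)[of k] by (simp add: power2_eq_square)
        qed
        then show ?thesis
          using C A by (intro mult_right_mono mult_left_mono) auto
      qed
      finally show ?thesis
        using eq[OF bs(1,2)] by (simp add: G_def t(4) Z_def mult_ac)
    qed
    have sumt: "(\<lambda>k. Z m q * t k) sums (Z m q * \<rho>)" for q
    proof -
      have "(\<lambda>k. Z m q * (\<rho> / 2 * (1 / 2) ^ k)) sums (Z m q * (\<rho> / 2 * (1 / (1 - 1 / 2))))"
        by (intro sums_mult geometric_sums) simp
      then show ?thesis by (simp add: t_def)
    qed
    have tele: "partials bs (g k) x = partials bs (g 0) x + (\<Sum>i<k. partials bs (g (Suc i)) x - partials bs (g i) x)" for bs k x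
      using sum_lessThan_telescope[of "\<lambda>i. partials bs (g i) x" k] by simp
    have "Ck_on P \<phi> S \<and> (\<forall>bs. set bs \<subseteq> Basis \<longrightarrow> length bs \<le> P \<longrightarrow>
      (\<forall>x\<in>S. (\<lambda>n. partials bs (g n) x) \<longlonglongrightarrow> partials bs \<phi> x))"
    proof (rule Ck_on_uniform_limit[OF S])
      show "Ck_on P (g n) S" for n by (rule Ck_on_subset[OF Pg subset_UNIV])
      show "uniformly_convergent_on S (\<lambda>n. partials bs (g n))" if bs: "set bs \<subseteq> Basis" "length bs \<le> P" for bs
      proof -
        have "uniform_limit S (\<lambda>k x. \<Sum>i<k. partials bs (g (Suc i)) x - partials bs (g i) x)
          (\<lambda>x. \<Sum>i. partials bs (g (Suc i)) x - partials bs (g i) x) sequentially"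
          by (rule Weierstrass_m_test[OF diff[OF bs] sums_summable[OF sumt]])
        then have "uniform_limit S (\<lambda>k x. partials bs (g 0) x + (\<Sum>i<k. partials bs (g (Suc i)) x - partials bs (g i) x))
          (\<lambda>x. partials bs (g 0) x + (\<Sum>i. partials bs (g (Suc i)) x - partials bs (g i) x)) sequentially"
          by (intro uniform_limit_add uniform_limit_const)
        then have "uniform_limit S (\<lambda>k x. partials bs (g k) x)
          (\<lambda>x. partials bs (g 0) x + (\<Sum>i. partials bs (g (Suc i)) x - partials bs (g i) x)) sequentially"
          by (simp only: tele[symmetric])
        then show ?thesis unfolding uniformly_convergent_on_def by blast
      qed
      show "(\<lambda>n. g n x) \<longlonglongrightarrow> \<phi> x" if "x \<in> S" for x
      proof (rule LIMSEQ_I)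
        fix e :: real assume e: "0 < e"
        have "isCont (partials cs0 f) (x, 0)"
          using cphi by (simp add: continuous_on_eq_continuous_at)
        then obtain d where d: "0 < d" "\<And>w :: 'a \<times> real. dist w (x, 0) < d \<Longrightarrow> dist (partials cs0 f w) (partials cs0 f (x, 0)) < e / 2"
          unfolding continuous_at_eps_delta using e by (metis half_gt_zero)
        have "t \<longlonglongrightarrow> \<rho> / 2 * 0"
          unfolding t_def[abs_def] by (intro tendsto_intros LIMSEQ_realpow_zero) auto
        then have "\<forall>\<^sub>F k in sequentially. t k < d" using d(1) by (intro order_tendstoD(2)) auto
        then obtain N where N: "\<And>k. N \<le> k \<Longrightarrow> t k < d" unfolding eventually_sequentially by blast
        have "norm (g k x - \<phi> x) < e" if "N \<le> k" for k
        proof -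
          have "g k x = (moll (t k / real m) ^^ m) (partials cs0 f) (x, 0)"
            unfolding g_def G_def by (simp only: partials_moll_power[OF cf0 cs0(1)])
          moreover have "norm ((moll (t k / real m) ^^ m) (partials cs0 f) (x, 0) - \<phi> x) \<le> e / 2"
          proof (rule norm_moll_power_minus_const_le[OF cphi])
            fix w :: "'a \<times> real" assume "w \<in> cball (x, 0) (real m * (t k / real m))"
            then have "dist w (x, 0) < d" using N[OF that] m by (simp add: dist_commute)
            then show "norm (partials cs0 f w - \<phi> x) \<le> e / 2"
              using d(2)[of w] by (simp add: \<phi>_def dist_norm)
          qed (use t m in simp)
          ultimately show ?thesis using e by simp
        qed
        then show "\<exists>N. \<forall>k\<ge>N. norm (g k x - \<phi> x) < e" by blast
      qed
    qed
    moreover have "norm (partials bs \<phi> x) \<le> (?C * real m / (\<rho> / 2)) ^ (P + ?j) * B + \<rho> * Z m P"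
      if bs: "set bs \<subseteq> Basis" "length bs = P" "x \<in> S" and lim: "(\<lambda>n. partials bs (g n) x) \<longlonglongrightarrow> partials bs \<phi> x" for bs x
    proof (rule LIMSEQ_le_const2[OF tendsto_norm[OF lim]], intro exI allI impI)
      fix k :: nat
      have "norm (partials bs (g 0) x) \<le> (?C / (t 0 / real m)) ^ length (map (\<lambda>b. (b, 0 :: real)) bs @ cs0) * B"
        unfolding eq[OF bs(1) eq_refl[OF bs(2)]] G_def
        by (rule moll_power_smooth_le[OF cf _ _ _ B]) (use t m bs cs0 in \<open>auto simp: m_def\<close>)
      then have g0: "norm (partials bs (g 0) x) \<le> (?C * real m / (\<rho> / 2)) ^ (P + ?j) * B"
        using bs(2) by (simp add: t_def mult_ac)
      have "norm (\<Sum>i<k. partials bs (g (Suc i)) x - partials bs (g i) x) \<le> (\<Sum>i<k. Z m P * t i)"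
        by (rule sum_norm_le) (use diff[OF bs(1) eq_refl[OF bs(2)] bs(3)] bs(2) in simp)
      also have "\<dots> \<le> Z m P * \<rho>"
        using sum_le_suminf[OF sums_summable[OF sumt], of "{..<k}" P] sums_unique[OF sumt, of P] Z0 t(1)
        by (simp add: less_imp_le)
      finally show "norm (partials bs (g k) x) \<le> (?C * real m / (\<rho> / 2)) ^ (P + ?j) * B + \<rho> * Z m P"
        unfolding tele[of bs k x] by (intro norm_triangle_mono g0) (simp add: mult.commute)
    qed
    ultimately show ?thesis unfolding m_def by blast
  qed
  then show "Cinf_on \<phi> S" by (simp add: Cinf_on_def)
  let ?G = "6 * ?C / (\<rho> / 2)"
  define D where "D = 27 * (1 + ?C / (\<rho> / 2)) * B + 1 + \<rho> * (2 * ?C * (1 + \<rho>) * A * (2 * ?C) * 27)"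
  have D1: "27 * (1 + ?C / (\<rho> / 2)) * B \<le> D" "\<rho> * (2 * ?C * (1 + \<rho>) * A * (2 * ?C) * 27) \<le> D" "0 < D"
  proof -
    have "0 \<le> 27 * (1 + ?C / (\<rho> / 2)) * B" "0 \<le> \<rho> * (2 * ?C * (1 + \<rho>) * A * (2 * ?C) * 27)"
      using C \<rho> A B0 by simp_all
    then show "27 * (1 + ?C / (\<rho> / 2)) * B \<le> D" "\<rho> * (2 * ?C * (1 + \<rho>) * A * (2 * ?C) * 27) \<le> D" "0 < D"
      unfolding D_def by linarith+
  qed
  have pj: "c ^ (P + ?j) \<le> (1 + c) * c ^ P" if "0 \<le> c" for c :: real and P
  proof -
    have "?j = 0 \<or> ?j = 1" using cs0(2) by linarith
    then show ?thesis using that by (auto simp: algebra_simps)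
  qed
  have pj2: "c ^ (P + ?j) \<le> c * c ^ P" if "1 \<le> c" for c :: real and P
    using power_increasing[of "P + ?j" "Suc P" c] that cs0(2) by simp
  have "norm (partials bs \<phi> x) \<le> D * (?G ^ P * fact P + (24 * ?C) ^ P * fact P * \<nu> P)"
    if bs: "set bs \<subseteq> Basis" "x \<in> S" and P: "P = length bs" for bs x P
  proof -
    note fl = power_Suc_le_fact[OF cs0(2), of P]
    have "norm (partials bs \<phi> x) \<le> (?C * real (P + ?j + 2) / (\<rho> / 2)) ^ (P + ?j) * B + \<rho> * Z (P + ?j + 2) P"
      using main[of P] bs P by blast
    also have "(?C * real (P + ?j + 2) / (\<rho> / 2)) ^ (P + ?j) * B \<le> D * (?G ^ P * fact P)"
    proof -
      have "(?C * real (P + ?j + 2) / (\<rho> / 2)) ^ (P + ?j) * B = (?C / (\<rho> / 2)) ^ (P + ?j) * real (P + ?j + 2) ^ (P + ?j) * B"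
        by (simp only: power_mult_distrib[symmetric] times_divide_eq_left)
      also have "\<dots> \<le> ((1 + ?C / (\<rho> / 2)) * (?C / (\<rho> / 2)) ^ P) * (27 * 6 ^ P * fact P) * B"
        using C \<rho> B0 by (intro mult_right_mono mult_mono pj fl) auto
      also have "\<dots> = (27 * (1 + ?C / (\<rho> / 2)) * B) * ((6 * (?C / (\<rho> / 2))) ^ P * fact P)"
        unfolding power_mult_distrib by (simp only: mult_ac)
      also have "\<dots> \<le> D * ((6 * (?C / (\<rho> / 2))) ^ P * fact P)"
        using C \<rho> D1(1) by (intro mult_right_mono) auto
      finally show ?thesis by (simp only: times_divide_eq_right)
    qed
    also have "\<rho> * Z (P + ?j + 2) P \<le> D * ((24 * ?C) ^ P * fact P * \<nu> P)"
    proof -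
      have "(2 * ?C * real (P + ?j + 2)) ^ (P + ?j) \<le> (2 * ?C * (2 * ?C) ^ P) * (27 * 6 ^ P * fact P)"
        unfolding power_mult_distrib[of "2 * ?C"]
        using C by (intro mult_mono pj2 fl) auto
      then have "\<rho> * Z (P + ?j + 2) P \<le> \<rho> * (2 * ?C * (1 + \<rho>) * A * ((2 * ?C * (2 * ?C) ^ P) * (27 * 6 ^ P * fact P)) * 2 ^ P * \<nu> P)"
        unfolding Z_def using C \<rho> A by (intro mult_left_mono mult_right_mono) auto
      also have "\<dots> = (\<rho> * (2 * ?C * (1 + \<rho>) * A * (2 * ?C) * 27)) * (((2 * ?C) ^ P * 6 ^ P * 2 ^ P) * fact P * \<nu> P)"
        by (simp only: mult_ac)
      \<comment> \<open>The base 24: a 2 from halving the radius, 6 from the factorial bound, and a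
        2 from the ball of radius 2 t.\<close>
      also have "(2 * ?C) ^ P * 6 ^ P * 2 ^ P = (24 * ?C) ^ P"
        unfolding power_mult_distrib[symmetric] by (simp add: mult_ac)
      also have "(\<rho> * (2 * ?C * (1 + \<rho>) * A * (2 * ?C) * 27)) * ((24 * ?C) ^ P * fact P * \<nu> P) \<le> D * ((24 * ?C) ^ P * fact P * \<nu> P)"
        using C A D1(2) by (intro mult_right_mono) auto
      finally show ?thesis .
    qed
    finally show ?thesis by (simp add: distrib_left)
  qed
  then show "\<exists>D G. 0 < D \<and> 0 < G \<and> (\<forall>bs x. set bs \<subseteq> Basis \<longrightarrow> x \<in> S \<longrightarrow> norm (partials bs \<phi> x)
      \<le> D * (G ^ length bs * fact (length bs) + (24 * ?C) ^ length bs * fact (length bs) * \<nu> (length bs)))"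
    using D1(3) C \<rho> by (intro exI[of _ D] exI[of _ ?G]) auto
qed

section \<open>Weight sequences\<close>

lemma SUP_ennreal_finite_iff:
  assumes "\<And>x. x \<in> S \<Longrightarrow> 0 \<le> g x"
  shows "(SUP x\<in>S. ennreal (g x)) < \<infinity> \<longleftrightarrow> (\<exists>K. \<forall>x\<in>S. g x \<le> K)"
proof
  assume fin: "(SUP x\<in>S. ennreal (g x)) < \<infinity>"
  have "g x \<le> enn2real (SUP x\<in>S. ennreal (g x))" if "x \<in> S" for x
  proof -
    have "ennreal (g x) \<le> (SUP x\<in>S. ennreal (g x))" using that by (rule SUP_upper)
    then have "enn2real (ennreal (g x)) \<le> enn2real (SUP x\<in>S. ennreal (g x))"
      using fin by (intro enn2real_mono) auto
    then show ?thesis using assms[OF that] by simp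
  qed
  then show "\<exists>K. \<forall>x\<in>S. g x \<le> K" by blast
next
  assume "\<exists>K. \<forall>x\<in>S. g x \<le> K"
  then obtain K where "\<And>x. x \<in> S \<Longrightarrow> g x \<le> K" by blast
  then have "(SUP x\<in>S. ennreal (g x)) \<le> ennreal K" by (intro SUP_least ennreal_leI)
  then show "(SUP x\<in>S. ennreal (g x)) < \<infinity>" using ennreal_less_top[of K] by (simp add: le_less_trans)
qed

lemma weight_sequence_pos: "weight_sequence M \<Longrightarrow> 0 < M p"
  by (simp add: weight_sequence_def)

lemma star_pos: "weight_sequence M \<Longrightarrow> 0 < star M p"
  by (simp add: weight_sequence_def star_def)

text \<open>Gives the real-valued supremum in \<open>assoc_fun\<close> its meaning: (NA) with H = 1
  / t says that t^p p! / M_p is bounded.\<close>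

lemma assoc_fun_bdd:
  assumes "weight_sequence M" "seq_NA M" "0 < t"
  shows "bdd_above (range (\<lambda>p. ln (t ^ p / star M p)))"
proof -
  have "0 < 1 / t" using assms(3) by simp
  then obtain C where C: "0 < C" "\<And>p. fact p \<le> C * (1 / t) ^ p * M p"
    using assms(2) unfolding seq_NA_def by blast
  have "ln (t ^ p / star M p) \<le> ln C" for p
  proof -
    have "t ^ p * fact p \<le> t ^ p * (C * (1 / t) ^ p * M p)"
      using C(2)[of p] assms(3) by (intro mult_left_mono) auto
    then have "t ^ p / star M p \<le> C"
      using assms(3) weight_sequence_pos[OF assms(1), of p] by (simp add: star_def field_simps power_divide)
    then show ?thesis
      using assms(3) star_pos[OF assms(1), of p] C(1) by (intro ln_mono) auto
  qed
  then show ?thesis by (intro bdd_aboveI[of _ "ln C"]) auto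
qed

lemma power_div_star_le_exp_assoc_fun:
  assumes "weight_sequence M" "seq_NA M" "0 < t"
  shows "t ^ q / star M q \<le> exp (assoc_fun (star M) t)"
proof -
  have "ln (t ^ q / star M q) \<le> assoc_fun (star M) t"
    unfolding assoc_fun_def by (rule cSUP_upper[OF UNIV_I assoc_fun_bdd[OF assms]])
  then have "exp (ln (t ^ q / star M q)) \<le> exp (assoc_fun (star M) t)" by simp
  then show ?thesis using assms(3) star_pos[OF assms(1), of q] by simp
qed

lemma exp_assoc_fun_le:
  assumes "weight_sequence M" "0 < t" "0 < K" "\<And>q. t ^ q / star M q \<le> K"
  shows "exp (assoc_fun (star M) t) \<le> K"
proof -
  have "assoc_fun (star M) t \<le> ln K"
    unfolding assoc_fun_def
    by (rule cSUP_least) (use assms star_pos[OF assms(1)] in \<open>auto intro!: ln_mono\<close>)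
  then have "exp (assoc_fun (star M) t) \<le> exp (ln K)" by simp
  then show ?thesis using assms(3) by simp
qed

lemma assoc_fun_mono:
  assumes "weight_sequence M" "seq_NA M" "0 < t" "t \<le> t'"
  shows "assoc_fun (star M) t \<le> assoc_fun (star M) t'"
  unfolding assoc_fun_def
proof (rule cSUP_mono)
  show "bdd_above (range (\<lambda>p. ln (t' ^ p / star M p)))"
    using assms by (intro assoc_fun_bdd) auto
  show "\<exists>q\<in>UNIV. ln (t ^ p / star M p) \<le> ln (t' ^ q / star M q)" for p
    using assms star_pos[OF assms(1), of p]
    by (intro bexI[of _ p] ln_mono divide_right_mono power_mono) auto
qed simp

lemma almost_harmonic_ext_iff:
  "almost_harmonic_ext \<phi>0 \<phi>1 \<Theta> M h V \<longleftrightarrow> (\<exists>\<Phi> K. Ck_on 2 \<Phi> V \<and> (\<forall>x\<in>\<Theta>. \<Phi> (x, 0) = \<phi>0 x) \<and>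
    (\<forall>x\<in>\<Theta>. partial (0, 1) \<Phi> (x, 0) = \<phi>1 x) \<and>
    (\<forall>z\<in>V. snd z \<noteq> 0 \<longrightarrow> norm (laplacian \<Phi> z) * exp (assoc_fun (star M) (1 / (h * \<bar>snd z\<bar>))) \<le> K))"
proof -
  have "(SUP (x, y)\<in>{(x, y) \<in> V. y \<noteq> 0}. ennreal (norm (laplacian \<Phi> (x, y)) * exp (assoc_fun (star M) (1 / (h * \<bar>y\<bar>))))) < \<infinity>
    \<longleftrightarrow> (\<exists>K. \<forall>z\<in>V. snd z \<noteq> 0 \<longrightarrow> norm (laplacian \<Phi> z) * exp (assoc_fun (star M) (1 / (h * \<bar>snd z\<bar>))) \<le> K)"
    for \<Phi> :: "(real ^ 'a) \<times> real \<Rightarrow> complex"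
    using SUP_ennreal_finite_iff[of "{(x, y) \<in> V. y \<noteq> 0}"
        "\<lambda>z. norm (laplacian \<Phi> z) * exp (assoc_fun (star M) (1 / (h * \<bar>snd z\<bar>)))"]
    by (simp add: case_prod_beta' Ball_def imp_conjL)
  then show ?thesis unfolding almost_harmonic_ext_def by blast
qed

text \<open>Bounds over lists of directions replace those over multi-indices from here on; every
  list is a rearrangement of one behind some multi-index.\<close>

lemma B_space_iff:
  fixes \<phi> :: "real ^ 'd::finite \<Rightarrow> complex"
  assumes "open \<Theta>" "weight_sequence M" "0 < h"
  shows "\<phi> \<in> B_space M h \<Theta> \<longleftrightarrow> Cinf_on \<phi> \<Theta> \<and>
    (\<exists>K. \<forall>bs. set bs \<subseteq> Basis \<longrightarrow> (\<forall>x\<in>\<Theta>. norm (partials bs \<phi> x) \<le> K * (h ^ length bs * M (length bs))))"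
proof -
  let ?d = "\<lambda>p. h ^ p * M p"
  have d: "0 < ?d p" for p using assms(3) weight_sequence_pos[OF assms(2)] by simp
  let ?g = "\<lambda>(\<alpha>, x). norm (mderiv \<alpha> \<phi> x) / ?d (mlength \<alpha>)"
  have "B_norm M h \<Theta> \<phi> = (SUP z\<in>UNIV \<times> \<Theta>. ennreal (?g z))"
    unfolding B_norm_def
    by (intro antisym SUP_least) (auto intro!: SUP_upper2[of "(\<alpha>, x)" for \<alpha> x] intro: SUP_upper2)
  moreover have "0 \<le> ?g z" for z using d by (cases z) (simp add: less_imp_le)
  ultimately have "B_norm M h \<Theta> \<phi> < \<infinity> \<longleftrightarrow> (\<exists>K. \<forall>z\<in>UNIV \<times> \<Theta>. ?g z \<le> K)"
    by (simp only: SUP_ennreal_finite_iff)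
  also have "\<dots> \<longleftrightarrow> (\<exists>K. \<forall>\<alpha>. \<forall>x\<in>\<Theta>. norm (mderiv \<alpha> \<phi> x) \<le> K * ?d (mlength \<alpha>))"
    using d by (simp add: pos_divide_le_eq)
  finally have B: "B_norm M h \<Theta> \<phi> < \<infinity> \<longleftrightarrow> (\<exists>K. \<forall>\<alpha>. \<forall>x\<in>\<Theta>. norm (mderiv \<alpha> \<phi> x) \<le> K * ?d (mlength \<alpha>))" .
  have "(\<forall>\<alpha>. \<forall>x\<in>\<Theta>. norm (mderiv \<alpha> \<phi> x) \<le> K * ?d (mlength \<alpha>)) \<longleftrightarrow>
    (\<forall>bs. set bs \<subseteq> Basis \<longrightarrow> (\<forall>x\<in>\<Theta>. norm (partials bs \<phi> x) \<le> K * ?d (length bs)))" if cinf: "Cinf_on \<phi> \<Theta>" for K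
  proof (intro iffI allI impI ballI)
    fix bs :: "(real ^ 'd) list" and x
    assume *: "\<forall>\<alpha>. \<forall>x\<in>\<Theta>. norm (mderiv \<alpha> \<phi> x) \<le> K * ?d (mlength \<alpha>)" and bs: "set bs \<subseteq> Basis" "x \<in> \<Theta>"
    obtain \<alpha> where "mlength \<alpha> = length bs" "mderiv \<alpha> \<phi> x = partials bs \<phi> x"
      using partials_eq_mderiv[OF assms(1) bs(2,1), of \<phi>] cinf unfolding Cinf_on_def by metis
    then show "norm (partials bs \<phi> x) \<le> K * ?d (length bs)" using * bs(2) by metis
  next
    fix \<alpha> :: "'d \<Rightarrow> nat" and x
    assume *: "\<forall>bs. set bs \<subseteq> Basis \<longrightarrow> (\<forall>x\<in>\<Theta>. norm (partials bs \<phi> x) \<le> K * ?d (length bs))" and x: "x \<in> \<Theta>"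
    obtain bs where "set bs \<subseteq> Basis" "length bs = mlength \<alpha>" "mderiv \<alpha> \<phi> = partials bs \<phi>"
      using mderiv_eq_partials[of \<alpha> \<phi>] by metis
    then show "norm (mderiv \<alpha> \<phi> x) \<le> K * ?d (mlength \<alpha>)" using * x by metis
  qed
  then show ?thesis unfolding B_space_def mem_Collect_eq B by blast
qed

lemma B_space_mono:
  fixes \<phi> :: "real ^ 'd::finite \<Rightarrow> complex"
  assumes "open \<Theta>" "weight_sequence M" "weight_sequence N" "0 < h" "h \<le> k" "M \<le> N" "\<phi> \<in> B_space M h \<Theta>"
  shows "\<phi> \<in> B_space N k \<Theta>"
proof -
  obtain K where K: "Cinf_on \<phi> \<Theta>"
    "\<And>bs x. set bs \<subseteq> Basis \<Longrightarrow> x \<in> \<Theta> \<Longrightarrow> norm (partials bs \<phi> x) \<le> K * (h ^ length bs * M (length bs))"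
    using assms(7) B_space_iff[OF assms(1,2,4)] by blast
  have "norm (partials bs \<phi> x) \<le> \<bar>K\<bar> * (k ^ length bs * N (length bs))" if "set bs \<subseteq> Basis" "x \<in> \<Theta>" for bs x
  proof -
    have "0 \<le> h ^ length bs * M (length bs)" "0 \<le> k ^ length bs"
      using assms(4,5) weight_sequence_pos[OF assms(2), of "length bs"] by auto
    moreover have "h ^ length bs * M (length bs) \<le> k ^ length bs * N (length bs)"
      using assms(4,5,6) weight_sequence_pos[OF assms(2), of "length bs"]
      by (intro mult_mono power_mono) (auto simp: le_fun_def)
    ultimately have "K * (h ^ length bs * M (length bs)) \<le> \<bar>K\<bar> * (k ^ length bs * N (length bs))"
      by (intro mult_mono[OF abs_ge_self _ abs_ge_zero])
    then show ?thesis using K(2)[OF that] by linarith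
  qed
  then show ?thesis using K(1) B_space_iff[OF assms(1,3)] assms(4,5) by fastforce
qed

section \<open>Losing orders of differentiation within the matrix\<close>

text \<open>For k = 1 this is the inequality of [M.2]'; the two brackets differ only in which of the
  two sequences is prescribed.\<close>

definition shift_le :: "nat \<Rightarrow> (nat \<Rightarrow> real) \<Rightarrow> (nat \<Rightarrow> real) \<Rightarrow> bool" where
  "shift_le k M N \<longleftrightarrow> (\<exists>C>0. \<exists>H>0. \<forall>p. M (p + k) \<le> C * H ^ p * N p)"

lemma shift_le_trans:
  assumes "shift_le j M L" "shift_le k L N"
  shows "shift_le (j + k) M N"
proof -
  obtain C H C' H' where "0 < C" "0 < H" "0 < C'" "0 < H'"
    and M: "\<And>p. M (p + j) \<le> C * H ^ p * L p" and L: "\<And>p. L (p + k) \<le> C' * H' ^ p * N p"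
    using assms unfolding shift_le_def by blast
  have "M (p + (j + k)) \<le> (C * H ^ k * C') * (H * H') ^ p * N p" for p
  proof -
    have "M (p + (j + k)) \<le> C * H ^ (p + k) * L (p + k)"
      using M[of "p + k"] by (simp add: add_ac)
    also have "\<dots> \<le> C * H ^ (p + k) * (C' * H' ^ p * N p)"
      using L[of p] \<open>0 < C\<close> \<open>0 < H\<close> by (intro mult_left_mono) auto
    finally show ?thesis by (simp add: power_add power_mult_distrib mult_ac)
  qed
  then show ?thesis
    unfolding shift_le_def using \<open>0 < C\<close> \<open>0 < H\<close> \<open>0 < C'\<close> \<open>0 < H'\<close>
    by (intro exI[of _ "C * H ^ k * C'"] exI[of _ "H * H'"] conjI) auto
qed

text \<open>\<open>M\<close> bounds the data, the shift by 2 pays for a C^2 estimate of the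
  coefficients, \<open>L\<close> and \<open>N\<close> are the pair of \<open>dynkin\<close>, and the
  shift by 4 pays for y^4. In the Roumieu case the chain is built forwards from \<open>M\<close>, in
  the Beurling case backwards from \<open>Q\<close>.\<close>

definition admissible :: "(nat \<Rightarrow> real) \<Rightarrow> (nat \<Rightarrow> real) \<Rightarrow> (nat \<Rightarrow> real) \<Rightarrow> (nat \<Rightarrow> real) \<Rightarrow> bool" where
  "admissible M L N Q \<longleftrightarrow> shift_le 2 M L \<and> shift_le 4 N Q \<and>
    (\<exists>C>0. \<forall>p\<ge>1. \<forall>q. 1 \<le> q \<and> q \<le> p \<longrightarrow> quot (star L) q \<le> C * quot (star N) p)"

lemma ex_admissible_Roumieu:
  assumes "matrix_M1_star_w Roumieu \<MM>" "matrix_M2' Roumieu \<MM>" "M \<in> \<MM>"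
  shows "\<exists>L\<in>\<MM>. \<exists>N\<in>\<MM>. \<exists>Q\<in>\<MM>. admissible M L N Q"
proof -
  have step: "\<exists>N\<in>\<MM>. shift_le 1 M N" if "M \<in> \<MM>" for M
    using assms(2) that unfolding matrix_M2'_def shift_le_def by simp
  have step2: "\<exists>N\<in>\<MM>. shift_le 2 M N" if "M \<in> \<MM>" for M
    using step[OF that] step shift_le_trans[of 1 M _ 1] by (metis one_add_one)
  have step4: "\<exists>N\<in>\<MM>. shift_le 4 M N" if "M \<in> \<MM>" for M
    using step2[OF that] step2 shift_le_trans[of 2 M _ 2] by (metis numeral_Bit0)
  obtain L where L: "L \<in> \<MM>" "shift_le 2 M L" using step2[OF assms(3)] by blast
  obtain N where N: "N \<in> \<MM>" "\<exists>C>0. \<forall>p\<ge>1. \<forall>q. 1 \<le> q \<and> q \<le> p \<longrightarrow> quot (star L) q \<le> C * quot (star N) p"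
    using assms(1) L(1) unfolding matrix_M1_star_w_def bracket.case by blast
  obtain Q where "Q \<in> \<MM>" "shift_le 4 N Q" using step4[OF N(1)] by blast
  then show ?thesis using L N unfolding admissible_def by blast
qed

lemma ex_admissible_Beurling:
  assumes "matrix_M1_star_w Beurling \<MM>" "matrix_M2' Beurling \<MM>" "Q \<in> \<MM>"
  shows "\<exists>M\<in>\<MM>. \<exists>L\<in>\<MM>. \<exists>N\<in>\<MM>. admissible M L N Q"
proof -
  have step: "\<exists>N\<in>\<MM>. shift_le 1 N M" if "M \<in> \<MM>" for M
    using assms(2) that unfolding matrix_M2'_def shift_le_def by simp
  have step2: "\<exists>N\<in>\<MM>. shift_le 2 N M" if "M \<in> \<MM>" for M
    using step[OF that] step shift_le_trans[of 1 _ _ 1 M] by (metis one_add_one)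
  have step4: "\<exists>N\<in>\<MM>. shift_le 4 N M" if "M \<in> \<MM>" for M
    using step2[OF that] step2 shift_le_trans[of 2 _ _ 2 M] by (metis numeral_Bit0)
  obtain N where N: "N \<in> \<MM>" "shift_le 4 N Q" using step4[OF assms(3)] by blast
  obtain L where L: "L \<in> \<MM>" "\<exists>C>0. \<forall>p\<ge>1. \<forall>q. 1 \<le> q \<and> q \<le> p \<longrightarrow> quot (star L) q \<le> C * quot (star N) p"
    using assms(1) N(1) unfolding matrix_M1_star_w_def bracket.case by blast
  obtain M where "M \<in> \<MM>" "shift_le 2 M L" using step2[OF L(1)] by blast
  then show ?thesis using L N unfolding admissible_def by blast
qed

section \<open>From almost harmonic extensions to ultradifferentiability\<close>

text \<open>The extension is cut off to a function on the whole space, where the mollifiers act. The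
  new scale is a fixed multiple of \<open>h\<close>, so in the Beurling case every positive scale is
  reached.\<close>

lemma ultradifferentiable_of_almost_harmonic_ext:
  fixes \<phi>0 \<phi>1 :: "real ^ 'd::finite \<Rightarrow> complex"
  assumes M: "weight_sequence M" "seq_NA M" and h: "0 < h"
    and \<Theta>: "open \<Theta>" "compact (closure \<Theta>)" "closure \<Theta> \<subseteq> \<Theta>'"
    and V: "open_nbhd \<Theta>' V" and ext: "almost_harmonic_ext \<phi>0 \<phi>1 \<Theta>' M h V"
  defines "k \<equiv> 24 * moll_const TYPE((real ^ 'd) \<times> real) * h"
  shows "\<phi>0 \<in> B_space M k \<Theta>" "\<phi>1 \<in> B_space M k \<Theta>"
proof -
  let ?C = "moll_const TYPE((real ^ 'd) \<times> real)"
  obtain \<Phi> A where \<Phi>: "Ck_on 2 \<Phi> V" "\<And>x. x \<in> \<Theta>' \<Longrightarrow> \<Phi> (x, 0) = \<phi>0 x"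
    "\<And>x. x \<in> \<Theta>' \<Longrightarrow> partial (0, 1) \<Phi> (x, 0) = \<phi>1 x"
    and A: "\<And>z. z \<in> V \<Longrightarrow> snd z \<noteq> 0 \<Longrightarrow> norm (laplacian \<Phi> z) * exp (assoc_fun (star M) (1 / (h * \<bar>snd z\<bar>))) \<le> A"
    using ext unfolding almost_harmonic_ext_iff by blast
  have Vo: "open V" "\<And>x. x \<in> \<Theta>' \<Longrightarrow> (x, 0) \<in> V" using V unfolding open_nbhd_def by auto
  let ?K = "closure \<Theta> \<times> {0 :: real}"
  have K: "compact ?K" "?K \<subseteq> V" using \<Theta> Vo by (auto intro!: compact_Times)
  obtain \<zeta> :: "(real ^ 'd) \<times> real \<Rightarrow> real" and C U1 where \<zeta>: "Ck_on 2 \<zeta> UNIV" "compact C" "C \<subseteq> V" "\<And>z. z \<notin> C \<Longrightarrow> \<zeta> z = 0"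
    "open U1" "?K \<subseteq> U1" "U1 \<subseteq> V" "\<And>z. z \<in> U1 \<Longrightarrow> \<zeta> z = 1" "\<And>z. \<bar>\<zeta> z\<bar> \<le> 1"
    by (rule smooth_cutoff[OF K(1) Vo(1) K(2), of 2]) (rule that)
  define f where "f z = \<zeta> z *\<^sub>R \<Phi> z" for z
  have f: "Ck_on 2 f UNIV"
    unfolding f_def
    by (rule Ck_on_scaleR_extend[OF Vo(1) compact_imp_closed[OF \<zeta>(2)] \<zeta>(3) \<zeta>(1) \<zeta>(4) \<Phi>(1)])
  obtain R where R: "\<And>z. z \<in> C \<Longrightarrow> norm z \<le> R" using compact_imp_bounded[OF \<zeta>(2)] unfolding bounded_iff by blast
  have "f z = 0" if "R < norm z" for z
    using R[of z] \<zeta>(4)[of z] that by (cases "z \<in> C") (auto simp: f_def)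
  then obtain B where B: "\<And>z. norm (f z) \<le> B"
    using uniformly_continuous_bounded_support(2)[OF Ck_on_imp_continuous[OF f], of R] by blast
  have fU: "f z = \<Phi> z" if "z \<in> U1" for z using \<zeta>(8)[OF that] by (simp add: f_def)
  obtain \<rho> where \<rho>: "0 < \<rho>" "(\<Union>z\<in>?K. ball z \<rho>) \<subseteq> U1"
    using compact_subset_open_imp_ball_epsilon_subset[OF K(1) \<zeta>(5,6)] by blast
  define \<nu> where "\<nu> q = star M q * h ^ q" for q
  have \<nu>: "0 \<le> \<nu> q" for q using star_pos[OF M(1), of q] h by (simp add: \<nu>_def)
  have lapc: "continuous_on UNIV (laplacian f)"
    using Ck_on_laplacian[OF open_UNIV, of 0 f] f by (simp add: numeral_2_eq_2)
  \<comment> \<open>The exponential weight dominates each single term of its supremum; only these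
    polynomial bounds, one for every q, are carried on.\<close>
  have lap1: "norm (laplacian f z) \<le> \<bar>A\<bar> * \<nu> q * \<bar>snd z\<bar> ^ q" if z: "z \<in> U1" "snd z \<noteq> 0" for z q
  proof -
    let ?t = "1 / (h * \<bar>snd z\<bar>)"
    have t: "0 < ?t" using h z(2) by simp
    have eq: "laplacian f z = laplacian \<Phi> z" by (rule laplacian_cong_open[OF \<zeta>(5) z(1) fU])
    have "norm (laplacian f z) * (?t ^ q / star M q) \<le> norm (laplacian \<Phi> z) * exp (assoc_fun (star M) ?t)"
      unfolding eq by (rule mult_left_mono[OF power_div_star_le_exp_assoc_fun[OF M t]]) simp
    also have "\<dots> \<le> \<bar>A\<bar>" using A[of z] z \<zeta>(7) by auto
    finally have "norm (laplacian f z) \<le> \<bar>A\<bar> / (?t ^ q / star M q)"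
      using t star_pos[OF M(1), of q] by (subst pos_le_divide_eq) auto
    also have "\<dots> = \<bar>A\<bar> * \<nu> q * \<bar>snd z\<bar> ^ q"
      by (simp add: \<nu>_def power_divide power_mult_distrib)
    finally show ?thesis .
  qed
  \<comment> \<open>Points with y = 0 are reached by continuity of the Laplacian.\<close>
  have lap2: "norm (laplacian f z) \<le> \<bar>A\<bar> * \<nu> q * \<bar>snd z\<bar> ^ q" if z: "z \<in> U1" for z q
  proof (cases "snd z = 0")
    case True
    have c: "((\<lambda>y. (fst z, y)) \<longlongrightarrow> (fst z, 0)) (at 0)" by (intro tendsto_intros)
    have z0: "z = (fst z, 0)" using True by (metis prod.collapse)
    have "\<forall>\<^sub>F y in at 0. (fst z, y) \<in> U1"
      using topological_tendstoD[OF c \<zeta>(5)] z z0 by simp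
    moreover have "\<forall>\<^sub>F y in at (0::real). y \<noteq> 0" by (simp add: eventually_at_filter)
    ultimately have "\<forall>\<^sub>F y in at 0. norm (laplacian f (fst z, y)) \<le> \<bar>A\<bar> * \<nu> q * \<bar>y\<bar> ^ q"
      by eventually_elim (use lap1[of "(fst z, _)"] in simp)
    moreover have "((\<lambda>y. norm (laplacian f (fst z, y))) \<longlongrightarrow> norm (laplacian f (fst z, 0))) (at 0)"
      using lapc by (intro tendsto_norm isCont_tendsto_compose[OF _ c]) (simp add: continuous_on_eq_continuous_at)
    moreover have "((\<lambda>y. \<bar>A\<bar> * \<nu> q * \<bar>y\<bar> ^ q) \<longlongrightarrow> \<bar>A\<bar> * \<nu> q * \<bar>0::real\<bar> ^ q) (at 0)"
      by (intro tendsto_intros)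
    ultimately have "norm (laplacian f (fst z, 0)) \<le> \<bar>A\<bar> * \<nu> q * \<bar>0::real\<bar> ^ q"
      by (intro tendsto_le[OF trivial_limit_at])
    then show ?thesis using z0 True by simp
  qed (use lap1 z in blast)
  have lap: "norm (laplacian f w) \<le> \<bar>A\<bar> * \<nu> q * t ^ q"
    if "x \<in> \<Theta>" "0 < t" "t \<le> \<rho> / 2" "w \<in> cball (x, 0) t" for x w t q
  proof -
    have "(x, 0) \<in> ?K" using that(1) closure_subset by auto
    moreover have "w \<in> ball (x, 0) \<rho>" using that \<rho>(1) by simp
    ultimately have "w \<in> U1" using \<rho>(2) by blast
    moreover have "\<bar>snd w\<bar> \<le> t"
      using that(4) dist_snd_le[of "(x, 0)" w] by (simp add: dist_real_def)
    ultimately show ?thesis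
      using lap2[of w q] \<nu>[of q] by (meson abs_ge_zero mult_left_mono mult_nonneg_nonneg order_trans power_mono)
  qed
  have B_sp: "\<phi> \<in> B_space M k \<Theta>"
    if cs: "set cs \<subseteq> Basis" "length cs \<le> 1" and \<phi>: "\<And>x. x \<in> \<Theta> \<Longrightarrow> partials cs f (x, 0) = \<phi> x" for cs \<phi>
  proof -
    let ?\<psi> = "\<lambda>x. partials cs f (x, 0)"
    have \<rho>2: "0 < \<rho> / 2" using \<rho>(1) by simp
    have est1: "Cinf_on ?\<psi> \<Theta>"
      by (rule boundary_value_estimate(1)[where A = "\<bar>A\<bar>" and \<nu> = \<nu>, OF f B \<Theta>(1) \<rho>2 _ abs_ge_zero \<nu> cs])
        (rule lap)
    have est2: "\<exists>D G. 0 < D \<and> 0 < G \<and> (\<forall>bs x. set bs \<subseteq> Basis \<longrightarrow> x \<in> \<Theta> \<longrightarrow> norm (partials bs ?\<psi> x)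
      \<le> D * (G ^ length bs * fact (length bs) + (24 * ?C) ^ length bs * fact (length bs) * \<nu> (length bs)))"
      by (rule boundary_value_estimate(2)[where A = "\<bar>A\<bar>" and \<nu> = \<nu>, OF f B \<Theta>(1) \<rho>2 _ abs_ge_zero \<nu> cs])
        (rule lap)
    have C1: "Cinf_on \<phi> \<Theta>"
      using est1 Ck_on_cong[OF \<Theta>(1), of ?\<psi> \<phi>] \<phi> unfolding Cinf_on_def by blast
    obtain D G where DG: "0 < D" "0 < G" "\<And>bs x. set bs \<subseteq> Basis \<Longrightarrow> x \<in> \<Theta> \<Longrightarrow> norm (partials bs ?\<psi> x)
      \<le> D * (G ^ length bs * fact (length bs) + (24 * ?C) ^ length bs * fact (length bs) * \<nu> (length bs))"
      using est2 by metis
    have k: "0 < k" using h moll_const_ge(1)[where 'a = "(real ^ 'd) \<times> real"] by (simp add: k_def)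
    \<comment> \<open>(NA) with H = k / G turns the analytic term G^p p! into a multiple of k^p
      M_p.\<close>
    obtain c where c: "0 < c" "\<And>p. fact p \<le> c * (k / G) ^ p * M p"
      using M(2) k DG(2) unfolding seq_NA_def by (metis divide_pos_pos)
    have "norm (partials bs \<phi> x) \<le> (D * (c + 1)) * (k ^ length bs * M (length bs))" if bs: "set bs \<subseteq> Basis" "x \<in> \<Theta>" for bs x
    proof -
      let ?p = "length bs"
      have "partials bs \<phi> x = partials bs ?\<psi> x"
        by (rule partials_cong_open[OF \<Theta>(1) bs(2) \<phi>[symmetric]])
      then have "norm (partials bs \<phi> x) \<le> D * (G ^ ?p * fact ?p + (24 * ?C) ^ ?p * fact ?p * \<nu> ?p)"
        using DG(3)[OF bs] by simp
      also have "G ^ ?p * fact ?p \<le> G ^ ?p * (c * (k / G) ^ ?p * M ?p)"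
        using c(2) DG(2) by (intro mult_left_mono) auto
      also have "G ^ ?p * (c * (k / G) ^ ?p * M ?p) = c * (k ^ ?p * M ?p)"
        using DG(2) by (simp add: power_divide)
      also have "(24 * ?C) ^ ?p * fact ?p * \<nu> ?p = k ^ ?p * M ?p"
        by (simp add: \<nu>_def star_def k_def power_mult_distrib)
      finally show ?thesis using DG(1) by (simp add: algebra_simps)
    qed
    then show ?thesis using C1 B_space_iff[OF \<Theta>(1) M(1) k] by blast
  qed
  have \<Theta>U: "(x, 0) \<in> U1" "x \<in> \<Theta>'" if "x \<in> \<Theta>" for x
    using that \<zeta>(6) \<Theta>(3) closure_subset[of \<Theta>] by auto
  show "\<phi>0 \<in> B_space M k \<Theta>"
    by (rule B_sp[of "[]"]) (use fU \<Phi>(2) \<Theta>U in auto)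
  show "\<phi>1 \<in> B_space M k \<Theta>"
    by (rule B_sp[of "[(0, 1)]"]) (use \<Phi>(3) \<Theta>U partial_cong_open[OF \<zeta>(5) _ fU] in auto)
qed

section \<open>From ultradifferentiability to almost harmonic extensions\<close>

text \<open>As the quotients of \<open>M\<close> increase, all are at least the first one; so each
  of the at most three steps from n to p + 2 loses at most the factor
  \<open>max 1 (1 / (h * quot M 1))\<close>.\<close>

lemma weight_sequence_shift:
  assumes "weight_sequence M" "0 < h" "n \<le> p + 2" "p \<le> n + 1"
  shows "h ^ n * M n \<le> (max 1 (1 / (h * quot M 1))) ^ 3 * (h ^ (p + 2) * M (p + 2))"
proof -
  define L where "L = max 1 (1 / (h * quot M 1))"
  define x where "x n = h ^ n * M n" for n
  have pos: "0 < M k" for k using assms(1) by (simp add: weight_sequence_def)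
  have q: "0 < quot M 1" using pos by (simp add: quot_def)
  have x: "0 < x k" for k using pos assms(2) by (simp add: x_def)
  have L: "1 \<le> L" by (simp add: L_def)
  have step: "x k \<le> L * x (Suc k)" for k
  proof -
    have "quot M 1 \<le> quot M (Suc k)"
      using assms(1) unfolding weight_sequence_def mono_on_def by auto
    then have "quot M 1 * M k \<le> M (Suc k)"
      using pos[of k] by (simp add: quot_def pos_le_divide_eq)
    then have "h ^ Suc k * (quot M 1 * M k) \<le> h ^ Suc k * M (Suc k)"
      using assms(2) by (intro mult_left_mono) auto
    then have "x k * (h * quot M 1) \<le> x (Suc k)" by (simp add: x_def mult_ac)
    then have "x k \<le> 1 / (h * quot M 1) * x (Suc k)" using assms(2) q by (simp add: field_simps)
    also have "\<dots> \<le> L * x (Suc k)" using x[of "Suc k"] by (intro mult_right_mono) (auto simp: L_def)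
    finally show ?thesis .
  qed
  have "x n \<le> L ^ e * x (n + e)" for e
  proof (induction e)
    case (Suc e)
    have "L ^ e * x (n + e) \<le> L ^ e * (L * x (Suc (n + e)))"
      using step L by (intro mult_left_mono) auto
    then show ?case using Suc by (simp add: mult_ac)
  qed simp
  from this[of "p + 2 - n"] have "x n \<le> L ^ (p + 2 - n) * x (p + 2)" using assms(3) by simp
  also have "\<dots> \<le> L ^ 3 * x (p + 2)"
    using L assms(3,4) x[of "p + 2"] by (intro mult_right_mono power_increasing) auto
  finally show ?thesis by (simp add: x_def L_def)
qed

lemma exp_assoc_fun_bound:
  assumes "weight_sequence Q" "0 < t" "0 \<le> a" "\<And>q. a * (t ^ q / star Q q) \<le> K"
  shows "a * exp (assoc_fun (star Q) t) \<le> K"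
proof (cases "a = 0")
  case True
  then show ?thesis using assms(4)[of 0] by simp
next
  case False
  then have a: "0 < a" using assms(3) by simp
  have "0 < a * (t ^ 0 / star Q 0)" using a star_pos[OF assms(1)] by simp
  then have K: "0 < K" using assms(4)[of 0] by linarith
  have "exp (assoc_fun (star Q) t) \<le> K / a"
    by (rule exp_assoc_fun_le[OF assms(1,2)]) (use K a assms(4) in \<open>auto simp: pos_le_divide_eq mult.commute\<close>)
  then show ?thesis using a by (simp add: pos_le_divide_eq mult.commute)
qed

text \<open>\<open>H\<close> is chosen before \<open>h\<close> and the data. The Beurling case
  depends on this order: the scale of the data is there taken as a prescribed scale divided by
  \<open>H\<close>.\<close>

lemma local_almost_harmonic_ext:
  fixes \<phi>0 \<phi>1 :: "real ^ 'd::finite \<Rightarrow> complex"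
  assumes w: "weight_sequence M" "weight_sequence L" "weight_sequence N" "weight_sequence Q"
    and adm: "admissible M L N Q"
  obtains H where "0 < H" "\<And>h (\<Theta>' :: (real ^ 'd) set) \<phi>0 \<phi>1. 0 < h \<Longrightarrow> open \<Theta>' \<Longrightarrow> \<phi>0 \<in> B_space M h \<Theta>' \<Longrightarrow> \<phi>1 \<in> B_space M h \<Theta>' \<Longrightarrow>
    \<exists>\<Phi> K Y. Ck_on 2 \<Phi> (\<Theta>' \<times> UNIV) \<and> (\<forall>x\<in>\<Theta>'. \<Phi> (x, 0) = \<phi>0 x) \<and> (\<forall>x\<in>\<Theta>'. partial (0, 1) \<Phi> (x, 0) = \<phi>1 x) \<and>
      (\<forall>x y. Y \<le> \<bar>y\<bar> \<longrightarrow> \<Phi> (x, y) = 0) \<and>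
      (\<forall>x\<in>\<Theta>'. \<forall>y. y \<noteq> 0 \<longrightarrow> norm (laplacian \<Phi> (x, y)) * exp (assoc_fun (star Q) (1 / (H * h * \<bar>y\<bar>))) \<le> K)"
proof -
  obtain C2 H2 where M2: "0 < C2" "0 < H2" "\<And>p. M (p + 2) \<le> C2 * H2 ^ p * L p"
    using adm unfolding admissible_def shift_le_def by blast
  obtain C4 H4 where M4: "0 < C4" "0 < H4" "\<And>p. N (p + 4) \<le> C4 * H4 ^ p * Q p"
    using adm unfolding admissible_def shift_le_def by blast
  obtain C' where C': "0 < C'" "\<And>p q. 1 \<le> q \<Longrightarrow> q \<le> p \<Longrightarrow> quot (star L) q \<le> C' * quot (star N) p"
    using adm unfolding admissible_def by (meson order_trans)
  define C where "C = max 1 C'"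
  let ?d = "real DIM(real ^ 'd)"
  have d: "1 \<le> ?d" using DIM_positive[where 'a = "real ^ 'd"] by (simp add: Suc_le_eq del: DIM_positive)
  \<comment> \<open>4 C B with B = d H2 h is the scale \<open>h\<close> inside
    \<open>dynkin\<close>; d is the price of one Laplacian, H2 and H4 come from the two
    shifts.\<close>
  have H0: "0 < 4 * C * ?d * H2 * H4" using M2 M4 d by (simp add: C_def max.strict_coboundedI1)
  show ?thesis
  proof (rule that[OF H0])
    fix h :: real and \<Theta>' :: "(real ^ 'd) set" and \<phi>0 \<phi>1 :: "real ^ 'd \<Rightarrow> complex"
    assume h: "0 < h" and op: "open \<Theta>'" and "\<phi>0 \<in> B_space M h \<Theta>'" "\<phi>1 \<in> B_space M h \<Theta>'"
    then obtain K0 K1 where K0: "Cinf_on \<phi>0 \<Theta>'" "Cinf_on \<phi>1 \<Theta>'"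
      "\<And>bs x. set bs \<subseteq> Basis \<Longrightarrow> x \<in> \<Theta>' \<Longrightarrow> norm (partials bs \<phi>0 x) \<le> K0 * (h ^ length bs * M (length bs))"
      "\<And>bs x. set bs \<subseteq> Basis \<Longrightarrow> x \<in> \<Theta>' \<Longrightarrow> norm (partials bs \<phi>1 x) \<le> K1 * (h ^ length bs * M (length bs))"
      using B_space_iff[OF op w(1) h] by metis
    define K where "K = \<bar>K0\<bar> + \<bar>K1\<bar>"
    define \<psi> where "\<psi> p = (if even p then \<phi>0 else \<phi>1)" for p :: nat
    have \<psi>C: "Ck_on k (\<psi> p) \<Theta>'" for k p using K0(1,2) by (simp add: \<psi>_def Cinf_on_def)
    have xM: "0 \<le> h ^ n * M n" for n using h weight_sequence_pos[OF w(1), of n] by simp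
    have \<psi>b: "norm (partials bs (\<psi> p) x) \<le> K * (h ^ length bs * M (length bs))"
      if "set bs \<subseteq> Basis" "x \<in> \<Theta>'" for bs x p
    proof -
      have "K0 * (h ^ length bs * M (length bs)) \<le> K * (h ^ length bs * M (length bs))"
        "K1 * (h ^ length bs * M (length bs)) \<le> K * (h ^ length bs * M (length bs))"
        using xM by (auto simp: K_def intro!: mult_right_mono)
      then show ?thesis using K0(3,4)[OF that] by (auto simp: \<psi>_def)
    qed
    \<comment> \<open>Explicit solution of the recursion from the overview; \<open>\<psi>\<close>
      picks the initial datum by the parity of p.\<close>
    define c where "c p x = (- 1) ^ (p div 2) *\<^sub>R (laplacian ^^ (p div 2)) (\<psi> p) x" for p x
    define B where "B = ?d * H2 * h"
    define \<Lambda> where "\<Lambda> = (max 1 (1 / (h * quot M 1))) ^ 3"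
    define C1 where "C1 = K * \<Lambda> * h\<^sup>2 * C2"
    have B: "0 < B" using d M2 h by (simp add: B_def)
    have K: "0 \<le> K" "0 \<le> \<Lambda>" "0 \<le> C1" using M2 by (auto simp: K_def \<Lambda>_def C1_def)
    have cC: "Ck_on k (c p) \<Theta>'" for k p
      unfolding c_def by (intro Ck_on_linear[OF op bounded_linear_scaleR_right] Ck_on_iterated_laplacian[OF op] \<psi>C)
    interpret dynkin "star L" "star N" C B
    proof
      show "star L 0 = 1" "star N 0 = 1" using w(2,3) by (simp_all add: star_def weight_sequence_def)
      show "quot (star L) q \<le> C * quot (star N) p" if "1 \<le> q" "q \<le> p" for p q
      proof -
        have "0 < quot (star N) p" using star_pos[OF w(3)] by (simp add: quot_def)
        then have "C' * quot (star N) p \<le> C * quot (star N) p" by (intro mult_right_mono) (auto simp: C_def)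
        then show ?thesis using C'(2)[OF that] by linarith
      qed
    qed (use star_pos w B in \<open>auto simp: C_def\<close>)
    have cb: "norm (partials bs (c p) x) \<le> C1 * (B ^ p * star L p * fact p)"
      if bs: "set bs \<subseteq> Basis" "length bs \<le> 2" "x \<in> \<Theta>'" for p bs x
    proof -
      \<comment> \<open>The number of derivatives falling on \<open>\<psi> p\<close>: it may be as
        small as p - 1 for odd p and as large as p + 2 for even p.\<close>
      define n where "n = length bs + 2 * (p div 2)"
      have n: "n \<le> p + 2" "p \<le> n + 1" using bs(2) by (auto simp: n_def)
      have "partials bs (c p) x = (- 1) ^ (p div 2) *\<^sub>R partials bs ((laplacian ^^ (p div 2)) (\<psi> p)) x"
        unfolding c_def
        by (rule partials_linear[OF op bounded_linear_scaleR_right Ck_on_iterated_laplacian[OF op \<psi>C] bs(3,1)])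
      then have "norm (partials bs (c p) x) = norm (partials bs ((laplacian ^^ (p div 2)) (\<psi> p)) x)"
        by (simp add: power_abs)
      also have "\<dots> \<le> ?d ^ (p div 2) * (K * (h ^ n * M n))"
        by (rule norm_partials_iterated_laplacian_le[OF op bs(3,1) \<psi>C]) (use \<psi>b[OF _ bs(3)] in \<open>metis n_def\<close>)
      also have "\<dots> \<le> ?d ^ p * (K * (\<Lambda> * (h ^ (p + 2) * (C2 * H2 ^ p * L p))))"
      proof (rule mult_mono)
        show "?d ^ (p div 2) \<le> ?d ^ p" using d by (intro power_increasing) auto
        have "h ^ n * M n \<le> \<Lambda> * (h ^ (p + 2) * M (p + 2))"
          unfolding \<Lambda>_def by (rule weight_sequence_shift[OF w(1) h n])
        also have "\<dots> \<le> \<Lambda> * (h ^ (p + 2) * (C2 * H2 ^ p * L p))"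
          using M2(3)[of p] h K(2) by (intro mult_left_mono) auto
        finally show "K * (h ^ n * M n) \<le> K * (\<Lambda> * (h ^ (p + 2) * (C2 * H2 ^ p * L p)))"
          using K(1) by (rule mult_left_mono)
        show "0 \<le> K * (h ^ n * M n)" using K(1) xM by (rule mult_nonneg_nonneg)
      qed (use d in simp)
      also have "\<dots> = C1 * (B ^ p * star L p * fact p)"
        by (simp add: C1_def B_def star_def power_mult_distrib power_add power2_eq_square)
      finally show ?thesis .
    qed
    have rec: "laplacian (c p) x = - c (p + 2) x" if "x \<in> \<Theta>'" for p x
    proof -
      have "laplacian (c p) x = (- 1) ^ (p div 2) *\<^sub>R laplacian ((laplacian ^^ (p div 2)) (\<psi> p)) x"
        unfolding c_def
        by (rule laplacian_linear[OF op bounded_linear_scaleR_right Ck_on_iterated_laplacian[OF op \<psi>C] that])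
      then show ?thesis by (simp add: c_def \<psi>_def)
    qed
    obtain \<Phi> A where \<Phi>: "Ck_on 2 \<Phi> (\<Theta>' \<times> UNIV)" "\<And>x. x \<in> \<Theta>' \<Longrightarrow> \<Phi> (x, 0) = c 0 x"
      "\<And>x. x \<in> \<Theta>' \<Longrightarrow> partial (0, 1) \<Phi> (x, 0) = c 1 x" "\<And>x y. 2 * s 0 \<le> \<bar>y\<bar> \<Longrightarrow> \<Phi> (x, y) = 0"
      "\<And>x y q. x \<in> \<Theta>' \<Longrightarrow> y \<noteq> 0 \<Longrightarrow> y ^ 4 * norm (laplacian \<Phi> (x, y)) \<le> A * X q \<bar>y\<bar>" "0 \<le> A"
      by (rule extension[of \<Theta>' c C1]) (rule op | rule cC | rule K(3) | erule (2) cb | erule rec | blast)+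
    have hh: "dynkin.h C B = 4 * C * B" by (rule h_def)
    have bound: "norm (laplacian \<Phi> (x, y)) * exp (assoc_fun (star Q) (1 / (4 * C * ?d * H2 * H4 * h * \<bar>y\<bar>))) \<le> A * C4 * (4 * C * B) ^ 4"
      if x: "x \<in> \<Theta>'" and y: "y \<noteq> 0" for x y
    proof (rule exp_assoc_fun_bound[OF w(4)])
      show "0 < 1 / (4 * C * ?d * H2 * H4 * h * \<bar>y\<bar>)" using H0 h y by simp
      fix q
      let ?Y = "4 * C * B * \<bar>y\<bar>"
      have Y: "0 < ?Y" using y B by (simp add: C_def max.strict_coboundedI1)
      \<comment> \<open>The bound is used at q + 4: four of its powers of y cancel y^4, the other q
        match the q-th term of the associated function of \<open>Q\<close>.\<close>
      have s1: "y ^ 4 * norm (laplacian \<Phi> (x, y)) \<le> A * (star N (q + 4) * ?Y ^ (q + 4))"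
        using \<Phi>(5)[OF x y, of "q + 4"] unfolding X_def hh .
      have s2: "star N (q + 4) * ?Y ^ (q + 4) \<le> (C4 * H4 ^ q * star Q q) * ?Y ^ (q + 4)"
      proof (rule mult_right_mono)
        have "star N (q + 4) \<le> (C4 * H4 ^ q * Q q) / fact (q + 4)"
          unfolding star_def using M4(3)[of q] by (intro divide_right_mono) auto
        also have "\<dots> \<le> (C4 * H4 ^ q * Q q) / fact q"
          using M4(1,2) weight_sequence_pos[OF w(4), of q] by (intro divide_left_mono fact_mono) auto
        finally show "star N (q + 4) \<le> C4 * H4 ^ q * star Q q" by (simp add: star_def)
      qed (use Y in auto)
      have s3: "(C4 * H4 ^ q * star Q q) * ?Y ^ (q + 4) = y ^ 4 * (C4 * (4 * C * B) ^ 4 * star Q q * (H4 * ?Y) ^ q)"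
        by (simp add: power_add power_mult_distrib power_even_abs)
      have "y ^ 4 * norm (laplacian \<Phi> (x, y)) \<le> A * (y ^ 4 * (C4 * (4 * C * B) ^ 4 * star Q q * (H4 * ?Y) ^ q))"
        using s1 mult_left_mono[OF s2 \<Phi>(6)] unfolding s3 by (rule order_trans)
      then have "y ^ 4 * norm (laplacian \<Phi> (x, y)) \<le> y ^ 4 * (A * (C4 * (4 * C * B) ^ 4 * star Q q * (H4 * ?Y) ^ q))"
        by (simp only: mult.left_commute[of A])
      then have "norm (laplacian \<Phi> (x, y)) \<le> A * (C4 * (4 * C * B) ^ 4 * star Q q * (H4 * ?Y) ^ q)"
        using y by (subst (asm) mult_le_cancel_left_pos) (auto simp: zero_less_power_eq)
      then have "norm (laplacian \<Phi> (x, y)) / (star Q q * (H4 * ?Y) ^ q) \<le> A * C4 * (4 * C * B) ^ 4"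
        by (subst pos_divide_le_eq[OF mult_pos_pos[OF star_pos[OF w(4)] zero_less_power[OF mult_pos_pos[OF M4(2) Y]]]])
          (simp only: mult_ac)
      moreover have "4 * C * ?d * H2 * H4 * h * \<bar>y\<bar> = H4 * ?Y" by (simp add: B_def)
      ultimately show "norm (laplacian \<Phi> (x, y)) * ((1 / (4 * C * ?d * H2 * H4 * h * \<bar>y\<bar>)) ^ q / star Q q) \<le> A * C4 * (4 * C * B) ^ 4"
        by (simp only:) (simp add: power_divide mult.commute)
    qed simp
    show "\<exists>\<Phi> K Y. Ck_on 2 \<Phi> (\<Theta>' \<times> UNIV) \<and> (\<forall>x\<in>\<Theta>'. \<Phi> (x, 0) = \<phi>0 x) \<and> (\<forall>x\<in>\<Theta>'. partial (0, 1) \<Phi> (x, 0) = \<phi>1 x) \<and>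
      (\<forall>x y. Y \<le> \<bar>y\<bar> \<longrightarrow> \<Phi> (x, y) = 0) \<and>
      (\<forall>x\<in>\<Theta>'. \<forall>y. y \<noteq> 0 \<longrightarrow> norm (laplacian \<Phi> (x, y)) * exp (assoc_fun (star Q) (1 / (4 * C * ?d * H2 * H4 * h * \<bar>y\<bar>))) \<le> K)"
    proof (intro exI conjI ballI allI impI)
      show "Ck_on 2 \<Phi> (\<Theta>' \<times> UNIV)" by (rule \<Phi>(1))
      show "\<Phi> (x, 0) = \<phi>0 x" if "x \<in> \<Theta>'" for x using \<Phi>(2)[OF that] by (simp add: c_def \<psi>_def)
      show "partial (0, 1) \<Phi> (x, 0) = \<phi>1 x" if "x \<in> \<Theta>'" for x using \<Phi>(3)[OF that] by (simp add: c_def \<psi>_def)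
      show "\<Phi> (x, y) = 0" if "2 * s 0 \<le> \<bar>y\<bar>" for x y by (rule \<Phi>(4)[OF that])
    qed (rule bound)
  qed
qed

text \<open>One function serves every \<open>V\<close>: it is C^2 off the hyperplane y = 0 and near
  the closure of \<Theta>, and \<open>V\<close> meets the hyperplane only in \<Theta>.\<close>

lemma almost_harmonic_ext_of_local:
  fixes \<phi>0 \<phi>1 :: "real ^ 'd::finite \<Rightarrow> complex"
  assumes Q: "weight_sequence Q" "seq_NA Q" and k: "0 < k"
    and \<Theta>: "open \<Theta>'" "compact (closure \<Theta>)" "closure \<Theta> \<subseteq> \<Theta>'"
    and \<Phi>: "Ck_on 2 \<Phi> (\<Theta>' \<times> UNIV)" "\<And>x. x \<in> \<Theta>' \<Longrightarrow> \<Phi> (x, 0) = \<phi>0 x"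
      "\<And>x. x \<in> \<Theta>' \<Longrightarrow> partial (0, 1) \<Phi> (x, 0) = \<phi>1 x" "\<And>x y. Y \<le> \<bar>y\<bar> \<Longrightarrow> \<Phi> (x, y) = 0"
    and bound: "\<And>x y. x \<in> \<Theta>' \<Longrightarrow> y \<noteq> 0 \<Longrightarrow>
      norm (laplacian \<Phi> (x, y)) * exp (assoc_fun (star Q) (1 / (k * \<bar>y\<bar>))) \<le> A"
    and V: "open_nbhd \<Theta> V"
  shows "almost_harmonic_ext \<phi>0 \<phi>1 \<Theta> Q k V"
proof -
  define e where "e y = exp (- assoc_fun (star Q) (1 / (k * y)))" for y
  have e0: "0 < e y" for y by (simp add: e_def)
  have e_mono: "e y \<le> e y'" if "0 < y" "y \<le> y'" for y y'
    unfolding e_def using that k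
    by (simp add: assoc_fun_mono[OF Q] divide_left_mono)
  obtain \<zeta> :: "real ^ 'd \<Rightarrow> real" and C U where \<zeta>: "Ck_on 2 \<zeta> UNIV" "compact C" "C \<subseteq> \<Theta>'" "\<And>x. x \<notin> C \<Longrightarrow> \<zeta> x = 0"
    "open U" "closure \<Theta> \<subseteq> U" "U \<subseteq> \<Theta>'" "\<And>x. x \<in> U \<Longrightarrow> \<zeta> x = 1" "\<And>x. \<bar>\<zeta> x\<bar> \<le> 1"
    by (rule smooth_cutoff[OF \<Theta>(2,1,3), of 2]) (rule that)
  define u where "u z = \<zeta> (fst z) *\<^sub>R \<Phi> z" for z
  \<comment> \<open>The constant 1 with its vanishing derivatives as scalar factor shows that
    \<zeta>, read as a function of both variables, is C^2.\<close>
  have "Ck_on 2 (\<lambda>z. (\<lambda>i y. if i = 0 then 1 else 0) (0 :: nat) (snd z) *\<^sub>R \<zeta> (fst z)) (UNIV \<times> (UNIV :: real set))"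
    by (rule Ck_on_tensor[where E = "\<lambda>i y. if i = 0 then 1 else 0", OF open_UNIV _ _ \<zeta>(1)]) auto
  then have \<zeta>2: "Ck_on 2 (\<lambda>z :: (real ^ 'd) \<times> real. \<zeta> (fst z)) UNIV" by simp
  have C: "closed C" using \<zeta>(2) by (rule compact_imp_closed)
  have u: "Ck_on 2 u UNIV"
    unfolding u_def
    by (rule Ck_on_scaleR_extend[OF _ _ _ \<zeta>2 _ \<Phi>(1), of "C \<times> UNIV"])
      (use \<Theta>(1) C \<zeta>(3,4) in \<open>auto simp: open_Times closed_Times mem_Times_iff\<close>)
  define f where "f = laplacian u"
  have fc: "continuous_on UNIV f"
    using Ck_on_laplacian[OF open_UNIV, of 0 u] u by (simp add: f_def numeral_2_eq_2)
  obtain R where R: "\<And>x. x \<in> C \<Longrightarrow> norm x \<le> R" using compact_imp_bounded[OF \<zeta>(2)] unfolding bounded_iff by blast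
  have f0: "f z = 0" if z: "\<bar>R\<bar> + \<bar>Y\<bar> < norm z" for z
    unfolding f_def
  proof (rule laplacian_zero[of "{z. fst z \<notin> C} \<union> {z. \<bar>Y\<bar> < \<bar>snd z\<bar>}"])
    have "open ((- C) \<times> (UNIV :: real set))" using C by (intro open_Times) auto
    moreover have "(- C) \<times> (UNIV :: real set) = {z. fst z \<notin> C}" by auto
    ultimately show "open ({z. fst z \<notin> C} \<union> {z. \<bar>Y\<bar> < \<bar>snd z\<bar>})"
      by (intro open_Un open_Collect_less continuous_intros) auto
    have "norm z \<le> norm (fst z) + \<bar>snd z\<bar>" using norm_Pair_le[of "fst z" "snd z"] by simp
    then show "z \<in> {z. fst z \<notin> C} \<union> {z. \<bar>Y\<bar> < \<bar>snd z\<bar>}" using z R[of "fst z"] by auto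
    show "u w = 0" if "w \<in> {z. fst z \<notin> C} \<union> {z. \<bar>Y\<bar> < \<bar>snd z\<bar>}" for w
    proof (cases "fst w \<in> C")
      case True
      then have "Y \<le> \<bar>snd w\<bar>" using that by auto
      then show ?thesis using \<Phi>(4)[of "snd w" "fst w"] by (simp add: u_def)
    qed (simp add: u_def \<zeta>(4))
  qed
  have uU: "u z = \<Phi> z" if "z \<in> U \<times> UNIV" for z using that \<zeta>(8) by (auto simp: u_def)
  have opU: "open (U \<times> (UNIV :: real set))" using \<zeta>(5) by (simp add: open_Times)
  have fU: "norm (f (x, y)) \<le> A * e \<bar>y\<bar>" if "x \<in> U" "y \<noteq> 0" for x y
  proof -
    have "f (x, y) = laplacian \<Phi> (x, y)"
      unfolding f_def by (rule laplacian_cong_open[OF opU _ uU]) (use that in auto)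
    then have "norm (f (x, y)) * exp (assoc_fun (star Q) (1 / (k * \<bar>y\<bar>))) \<le> A"
      using bound[of x y] that \<zeta>(7) by auto
    then show ?thesis by (simp add: e_def exp_minus field_simps)
  qed
  have fU1: "norm (f (x, y)) \<le> A * e y" if "x \<in> U" "0 < y" for x y
    using fU[of x y] that by simp
  obtain W1 U1 C1 where W1: "open U1" "closure \<Theta> \<subseteq> U1" "Ck_on 2 W1 {z. 0 < snd z}" "\<And>x y. x \<in> U1 \<Longrightarrow> W1 (x, y) = 0"
    "\<And>z. 0 < snd z \<Longrightarrow> norm (laplacian W1 z - f z) \<le> C1 * e (snd z)"
    by (rule almost_solution_half_space[of f "\<bar>R\<bar> + \<bar>Y\<bar>" "closure \<Theta>" U e A])
      (rule fc f0 \<Theta>(2) \<zeta>(5,6) e0 e_mono fU1 that; assumption)+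
  \<comment> \<open>The lower half-space is reduced to the upper one by reflection.\<close>
  define f' where "f' z = f (fst z, - snd z)" for z
  have f'c: "continuous_on UNIV f'"
    unfolding f'_def by (rule continuous_on_compose2[OF fc]) (auto intro!: continuous_intros)
  have f'0: "f' z = 0" if "\<bar>R\<bar> + \<bar>Y\<bar> < norm z" for z
    unfolding f'_def by (rule f0) (use that in \<open>simp add: norm_prod_def\<close>)
  have f'U: "norm (f' (x, y)) \<le> A * e y" if "x \<in> U" "0 < y" for x y
    using fU[of x "- y"] that by (simp add: f'_def)
  obtain W2 U2 C2 where W2: "open U2" "closure \<Theta> \<subseteq> U2" "Ck_on 2 W2 {z. 0 < snd z}" "\<And>x y. x \<in> U2 \<Longrightarrow> W2 (x, y) = 0"
    "\<And>z. 0 < snd z \<Longrightarrow> norm (laplacian W2 z - f' z) \<le> C2 * e (snd z)"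
    by (rule almost_solution_half_space[of f' "\<bar>R\<bar> + \<bar>Y\<bar>" "closure \<Theta>" U e A])
      (rule f'c f'0 \<Theta>(2) \<zeta>(5,6) e0 e_mono f'U that; assumption)+
  define W2' where "W2' z = W2 (fst z, - snd z)" for z
  \<comment> \<open>The value 0 on the hyperplane fits, as both corrections vanish near the closure
    of \<Theta>; hence \<Psi> agrees with u there.\<close>
  define \<Psi> where "\<Psi> z = u z - (if 0 < snd z then W1 z else if snd z < 0 then W2' z else 0)" for z
  have opp: "open {z :: (real ^ 'd) \<times> real. 0 < snd z}" "open {z :: (real ^ 'd) \<times> real. snd z < 0}"
    by (intro open_Collect_less continuous_intros)+
  have u': "Ck_on 2 u S" for S by (rule Ck_on_subset[OF u subset_UNIV])
  have W2': "Ck_on 2 W2' {z. snd z < 0}"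
    unfolding W2'_def by (rule Ck_on_reflect[OF opp(2) _ W2(3)]) auto
  have \<Psi>1: "Ck_on 2 \<Psi> {z. 0 < snd z}"
    by (rule Ck_on_cong[OF opp(1) _ Ck_on_diff[OF opp(1) u' W1(3)]]) (simp add: \<Psi>_def)
  have \<Psi>2: "Ck_on 2 \<Psi> {z. snd z < 0}"
    by (rule Ck_on_cong[OF opp(2) _ Ck_on_diff[OF opp(2) u' W2']]) (simp add: \<Psi>_def)
  have op0: "open ((U1 \<inter> U2) \<times> (UNIV :: real set))" using W1(1) W2(1) by (intro open_Times) auto
  have \<Psi>u: "\<Psi> z = u z" if "z \<in> (U1 \<inter> U2) \<times> UNIV" for z
    using that W1(4) W2(4) by (auto simp: \<Psi>_def W2'_def)
  have \<Psi>0: "Ck_on 2 \<Psi> ((U1 \<inter> U2) \<times> UNIV)"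
    by (rule Ck_on_cong[OF op0 \<Psi>u[symmetric] u'])
  have \<Theta>sub: "x \<in> U1" "x \<in> U2" "x \<in> U" "x \<in> \<Theta>'" if "x \<in> \<Theta>" for x
    using that closure_subset[of \<Theta>] W1(2) W2(2) \<zeta>(6) \<Theta>(3) by auto
  have VC: "Ck_on 2 \<Psi> V"
  proof (rule Ck_on_local)
    fix z assume z: "z \<in> V"
    consider "0 < snd z" | "snd z < 0" | "snd z = 0" by linarith
    then show "\<exists>U. open U \<and> z \<in> U \<and> Ck_on 2 \<Psi> U"
    proof cases
      case 3
      then have "z \<in> V \<inter> (UNIV \<times> {0})" using z by (auto simp: mem_Times_iff)
      moreover have "V \<inter> (UNIV \<times> {0}) = \<Theta> \<times> {0}" using V by (simp add: open_nbhd_def)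
      ultimately have "z \<in> \<Theta> \<times> {0}" by (simp only:)
      then have "fst z \<in> \<Theta>" by auto
      then have "z \<in> (U1 \<inter> U2) \<times> UNIV" using \<Theta>sub by (auto simp: mem_Times_iff)
      then show ?thesis using op0 \<Psi>0 by blast
    qed (use opp \<Psi>1 \<Psi>2 in blast)+
  qed
  have "\<Psi> (x, 0) = \<phi>0 x" if "x \<in> \<Theta>" for x
    using \<Theta>sub[OF that] \<Phi>(2) \<zeta>(8) by (simp add: \<Psi>_def u_def)
  moreover have "partial (0, 1) \<Psi> (x, 0) = \<phi>1 x" if "x \<in> \<Theta>" for x
  proof -
    have "partial (0, 1) \<Psi> (x, 0) = partial (0, 1) u (x, 0)"
      by (rule partial_cong_open[OF op0 _ \<Psi>u]) (use \<Theta>sub[OF that] in auto)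
    also have "\<dots> = partial (0, 1) \<Phi> (x, 0)"
      by (rule partial_cong_open[OF opU _ uU]) (use \<Theta>sub[OF that] in auto)
    finally show ?thesis using \<Phi>(3) \<Theta>sub[OF that] by simp
  qed
  moreover have "norm (laplacian \<Psi> z) * exp (assoc_fun (star Q) (1 / (k * \<bar>snd z\<bar>))) \<le> max C1 C2"
    if "snd z \<noteq> 0" for z
  proof -
    have "norm (laplacian \<Psi> z) \<le> max C1 C2 * e \<bar>snd z\<bar>"
    proof (cases "0 < snd z")
      case True
      have "laplacian \<Psi> z = laplacian (\<lambda>z. u z - W1 z) z"
        by (rule laplacian_cong_open[OF opp(1)]) (use True in \<open>auto simp: \<Psi>_def\<close>)
      also have "\<dots> = f z - laplacian W1 z"
        unfolding f_def by (rule laplacian_diff[OF opp(1) u' W1(3)]) (use True in simp)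
      finally have "norm (laplacian \<Psi> z) \<le> C1 * e (snd z)" using W1(5)[OF True] by (simp add: norm_minus_commute)
      also have "\<dots> \<le> max C1 C2 * e (snd z)" using e0[of "snd z"] by (intro mult_right_mono) auto
      finally show ?thesis using True by simp
    next
      case False
      then have neg: "snd z < 0" using that by simp
      have "laplacian \<Psi> z = laplacian (\<lambda>z. u z - W2' z) z"
        by (rule laplacian_cong_open[OF opp(2)]) (use neg in \<open>auto simp: \<Psi>_def\<close>)
      also have "\<dots> = f z - laplacian W2' z"
        unfolding f_def by (rule laplacian_diff[OF opp(2) u' W2']) (use neg in simp)
      also have "laplacian W2' z = laplacian W2 (fst z, - snd z)"
        unfolding W2'_def by (rule laplacian_reflect[OF opp(1) W2(3)]) (use neg in simp)
      also have "f z = f' (fst z, - snd z)" by (simp add: f'_def)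
      finally have "norm (laplacian \<Psi> z) \<le> C2 * e (- snd z)"
        using W2(5)[of "(fst z, - snd z)"] neg by (simp add: norm_minus_commute)
      also have "\<dots> \<le> max C1 C2 * e (- snd z)" using e0[of "- snd z"] by (intro mult_right_mono) auto
      finally show ?thesis using neg by simp
    qed
    then show ?thesis by (simp add: e_def exp_minus field_simps)
  qed
  ultimately show ?thesis unfolding almost_harmonic_ext_iff using VC by blast
qed

section \<open>Quantifiers over the sets and over the matrix\<close>

text \<open>The set on which a cutoff equals 1 contains an open neighbourhood whose closure stays in
  the compact support.\<close>

lemma rel_compact_between:
  fixes \<Theta> \<Omega> :: "'a::euclidean_space set"
  assumes "\<Theta> \<Subset> \<Omega>" "open \<Omega>"
  obtains \<Theta>' where "\<Theta>' \<Subset> \<Omega>" "closure \<Theta> \<subseteq> \<Theta>'"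
proof -
  have K: "compact (closure \<Theta>)" "closure \<Theta> \<subseteq> \<Omega>" using assms(1) by (auto simp: rel_compact_open_def)
  obtain \<zeta> :: "'a \<Rightarrow> real" and C U where "Ck_on 0 \<zeta> UNIV" "compact C" "C \<subseteq> \<Omega>" "\<And>x. x \<notin> C \<Longrightarrow> \<zeta> x = 0"
    "open U" "closure \<Theta> \<subseteq> U" "U \<subseteq> \<Omega>" "\<And>x. x \<in> U \<Longrightarrow> \<zeta> x = 1" "\<And>x. \<bar>\<zeta> x\<bar> \<le> 1"
    by (rule smooth_cutoff[OF K(1) assms(2) K(2), of 0]) (rule that)
  moreover from this have "U \<subseteq> C" by force
  ultimately have "closure U \<subseteq> C" "compact (closure U)"
    by (meson closure_minimal compact_imp_closed, meson closure_minimal compact_closure compact_imp_bounded compact_imp_closed bounded_subset)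
  then show ?thesis using that[of U] \<open>open U\<close> \<open>closure \<Theta> \<subseteq> U\<close> \<open>C \<subseteq> \<Omega>\<close> unfolding rel_compact_open_def by blast
qed

theorem theorem3p1:
  fixes br :: bracket
    and \<MM> :: "(nat \<Rightarrow> real) set"
    and \<Omega> :: "(real ^ 'd::finite) set"
    and \<phi>0 \<phi>1 :: "real ^ 'd \<Rightarrow> complex"
  assumes "weight_matrix \<MM>"
    and "matrix_M1_star_w br \<MM>"
    and "matrix_M2' br \<MM>"
    and "matrix_NA \<MM>"
    and "open \<Omega>"
  defines "a \<equiv> \<phi>0 \<in> E_matrix_space br \<MM> \<Omega> \<and> \<phi>1 \<in> E_matrix_space br \<MM> \<Omega>"
    and "b \<equiv> \<forall>\<Theta>. \<Theta> \<Subset> \<Omega> \<longrightarrow> bracket_quant br \<MM> (\<lambda>M h.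
               \<exists>V. open_nbhd \<Theta> V \<and> almost_harmonic_ext \<phi>0 \<phi>1 \<Theta> M h V)"
    and "c \<equiv> \<forall>\<Theta>. \<Theta> \<Subset> \<Omega> \<longrightarrow> bracket_quant br \<MM> (\<lambda>M h.
               \<forall>V. open_nbhd \<Theta> V \<longrightarrow> almost_harmonic_ext \<phi>0 \<phi>1 \<Theta> M h V)"
  shows "(a \<longleftrightarrow> b) \<and> (b \<longleftrightarrow> c)"
proof -
  have ws: "weight_sequence M" "seq_NA M" if "M \<in> \<MM>" for M
    using assms(1,4) that by (auto simp: weight_matrix_def matrix_NA_def)
  have ca: "almost_harmonic_ext \<phi>0 \<phi>1 \<Theta> Q (H * h) V"
    if "Q \<in> \<MM>" "0 < H" "0 < h" "open \<Theta>'" "\<Theta> \<Subset> \<Omega>" "closure \<Theta> \<subseteq> \<Theta>'" "open_nbhd \<Theta> V"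
      and ex: "\<exists>\<Phi> K Y. Ck_on 2 \<Phi> (\<Theta>' \<times> UNIV) \<and> (\<forall>x\<in>\<Theta>'. \<Phi> (x, 0) = \<phi>0 x) \<and> (\<forall>x\<in>\<Theta>'. partial (0, 1) \<Phi> (x, 0) = \<phi>1 x) \<and>
      (\<forall>x y. Y \<le> \<bar>y\<bar> \<longrightarrow> \<Phi> (x, y) = 0) \<and>
      (\<forall>x\<in>\<Theta>'. \<forall>y. y \<noteq> 0 \<longrightarrow> norm (laplacian \<Phi> (x, y)) * exp (assoc_fun (star Q) (1 / (H * h * \<bar>y\<bar>))) \<le> K)"
    for Q H h \<Theta> \<Theta>' V
  proof -
    have "compact (closure \<Theta>)" using that(5) by (simp add: rel_compact_open_def)
    moreover obtain \<Phi> K Y where "Ck_on 2 \<Phi> (\<Theta>' \<times> UNIV)" "\<And>x. x \<in> \<Theta>' \<Longrightarrow> \<Phi> (x, 0) = \<phi>0 x"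
      "\<And>x. x \<in> \<Theta>' \<Longrightarrow> partial (0, 1) \<Phi> (x, 0) = \<phi>1 x" "\<And>x y. Y \<le> \<bar>y\<bar> \<Longrightarrow> \<Phi> (x, y) = 0"
      "\<And>x y. x \<in> \<Theta>' \<Longrightarrow> y \<noteq> 0 \<Longrightarrow>
        norm (laplacian \<Phi> (x, y)) * exp (assoc_fun (star Q) (1 / (H * h * \<bar>y\<bar>))) \<le> K"
      using ex by blast
    moreover have "0 < H * h" using that(2,3) by simp
    ultimately show ?thesis
      by (intro almost_harmonic_ext_of_local[OF ws[OF that(1)] _ that(4) _ that(6) _ _ _ _ _ that(7)]) assumption+
  qed
  have "a \<Longrightarrow> c"
  proof -
    assume a
    then have E: "\<phi>0 \<in> B_matrix_space br \<MM> \<Theta>" "\<phi>1 \<in> B_matrix_space br \<MM> \<Theta>" if "\<Theta> \<Subset> \<Omega>" for \<Theta>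
      using that unfolding a_def E_matrix_space_def by auto
    show c
      unfolding c_def
    proof (intro allI impI)
      fix \<Theta> assume \<Theta>: "\<Theta> \<Subset> \<Omega>"
      obtain \<Theta>' where \<Theta>': "\<Theta>' \<Subset> \<Omega>" "closure \<Theta> \<subseteq> \<Theta>'" using rel_compact_between[OF \<Theta> assms(5)] by blast
      have op: "open \<Theta>'" using \<Theta>'(1) by (simp add: rel_compact_open_def)
      show "bracket_quant br \<MM> (\<lambda>M h. \<forall>V. open_nbhd \<Theta> V \<longrightarrow> almost_harmonic_ext \<phi>0 \<phi>1 \<Theta> M h V)"
      proof (cases br)
        case Beurling
        have "almost_harmonic_ext \<phi>0 \<phi>1 \<Theta> Q k V" if Q: "Q \<in> \<MM>" and k: "0 < k" and V: "open_nbhd \<Theta> V" for Q k V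
        proof -
          \<comment> \<open>The sequence \<open>Q\<close> and the scale k are prescribed; the data
            are in the class for every sequence and scale, in particular for \<open>M\<close> and k
            / H.\<close>
          obtain M L N where MLN: "M \<in> \<MM>" "L \<in> \<MM>" "N \<in> \<MM>" "admissible M L N Q"
            using ex_admissible_Beurling[of \<MM> Q] assms(2,3) Beurling Q by blast
          obtain H where H: "0 < H" and ext: "\<And>h (\<Theta>' :: (real ^ 'd) set) \<phi>0 \<phi>1. 0 < h \<Longrightarrow> open \<Theta>' \<Longrightarrow> \<phi>0 \<in> B_space M h \<Theta>' \<Longrightarrow> \<phi>1 \<in> B_space M h \<Theta>' \<Longrightarrow>
            \<exists>\<Phi> K Y. Ck_on 2 \<Phi> (\<Theta>' \<times> UNIV) \<and> (\<forall>x\<in>\<Theta>'. \<Phi> (x, 0) = \<phi>0 x) \<and> (\<forall>x\<in>\<Theta>'. partial (0, 1) \<Phi> (x, 0) = \<phi>1 x) \<and>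
            (\<forall>x y. Y \<le> \<bar>y\<bar> \<longrightarrow> \<Phi> (x, y) = 0) \<and>
            (\<forall>x\<in>\<Theta>'. \<forall>y. y \<noteq> 0 \<longrightarrow> norm (laplacian \<Phi> (x, y)) * exp (assoc_fun (star Q) (1 / (H * h * \<bar>y\<bar>))) \<le> K)"
            using local_almost_harmonic_ext[OF ws(1)[OF MLN(1)] ws(1)[OF MLN(2)] ws(1)[OF MLN(3)] ws(1)[OF Q] MLN(4)] by blast
          have h: "0 < k / H" using k H by simp
          have "\<phi>0 \<in> B_space M (k / H) \<Theta>'" "\<phi>1 \<in> B_space M (k / H) \<Theta>'"
            using E[OF \<Theta>'(1)] Beurling MLN(1) h unfolding B_matrix_space_def by auto
          from ca[OF Q H h op \<Theta> \<Theta>'(2) V ext[OF h op this]] show ?thesis using H by simp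
        qed
        then show ?thesis using Beurling by (simp add: bracket_quant_def)
      next
        case Roumieu
        obtain M0 h0 M1 h1 where M01: "M0 \<in> \<MM>" "0 < h0" "\<phi>0 \<in> B_space M0 h0 \<Theta>'" "M1 \<in> \<MM>" "0 < h1" "\<phi>1 \<in> B_space M1 h1 \<Theta>'"
          using E[OF \<Theta>'(1)] Roumieu unfolding B_matrix_space_def by auto
        \<comment> \<open>The two data may belong to different sequences; the total order of the
          matrix supplies a common one.\<close>
        have "M0 \<le> M1 \<or> M1 \<le> M0" using assms(1) M01(1,4) unfolding weight_matrix_def by blast
        then obtain M where M: "M \<in> \<MM>" "M0 \<le> M" "M1 \<le> M" using M01(1,4) by blast
        define h where "h = max h0 h1"
        have h: "0 < h" "h0 \<le> h" "h1 \<le> h" using M01(2) by (auto simp: h_def)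
        have \<phi>: "\<phi>0 \<in> B_space M h \<Theta>'" "\<phi>1 \<in> B_space M h \<Theta>'"
          using B_space_mono[OF op ws(1)[OF M01(1)] ws(1)[OF M(1)] M01(2) h(2) M(2) M01(3)]
            B_space_mono[OF op ws(1)[OF M01(4)] ws(1)[OF M(1)] M01(5) h(3) M(3) M01(6)] by blast+
        obtain L N Q where MLN: "L \<in> \<MM>" "N \<in> \<MM>" "Q \<in> \<MM>" "admissible M L N Q"
          using ex_admissible_Roumieu[of \<MM> M] assms(2,3) Roumieu M(1) by blast
        obtain H where H: "0 < H" and ext: "\<And>h (\<Theta>' :: (real ^ 'd) set) \<phi>0 \<phi>1. 0 < h \<Longrightarrow> open \<Theta>' \<Longrightarrow> \<phi>0 \<in> B_space M h \<Theta>' \<Longrightarrow> \<phi>1 \<in> B_space M h \<Theta>' \<Longrightarrow>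
            \<exists>\<Phi> K Y. Ck_on 2 \<Phi> (\<Theta>' \<times> UNIV) \<and> (\<forall>x\<in>\<Theta>'. \<Phi> (x, 0) = \<phi>0 x) \<and> (\<forall>x\<in>\<Theta>'. partial (0, 1) \<Phi> (x, 0) = \<phi>1 x) \<and>
            (\<forall>x y. Y \<le> \<bar>y\<bar> \<longrightarrow> \<Phi> (x, y) = 0) \<and>
            (\<forall>x\<in>\<Theta>'. \<forall>y. y \<noteq> 0 \<longrightarrow> norm (laplacian \<Phi> (x, y)) * exp (assoc_fun (star Q) (1 / (H * h * \<bar>y\<bar>))) \<le> K)"
          using local_almost_harmonic_ext[OF ws(1)[OF M(1)] ws(1)[OF MLN(1)] ws(1)[OF MLN(2)] ws(1)[OF MLN(3)] MLN(4)] by blast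
        have "almost_harmonic_ext \<phi>0 \<phi>1 \<Theta> Q (H * h) V" if "open_nbhd \<Theta> V" for V
          by (rule ca[OF MLN(3) H h(1) op \<Theta> \<Theta>'(2) that ext[OF h(1) op \<phi>]])
        moreover have "0 < H * h" using H h(1) by simp
        ultimately show ?thesis using Roumieu MLN(3) unfolding bracket_quant_def by auto
      qed
    qed
  qed
  moreover have "c \<Longrightarrow> b"
  proof -
    assume c
    \<comment> \<open>Without a witness (c) could hold vacuously; the cylinder over \<Theta> is
      one.\<close>
    have "open_nbhd \<Theta> (\<Theta> \<times> UNIV)" if "\<Theta> \<Subset> \<Omega>" for \<Theta>
      using that by (auto simp: open_nbhd_def rel_compact_open_def open_Times)
    then show b
      using \<open>c\<close> unfolding b_def c_def bracket_quant_def by (cases br) (simp; blast)+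
  qed
  moreover have "b \<Longrightarrow> a"
  proof -
    assume b
    let ?C = "24 * moll_const TYPE((real ^ 'd) \<times> real)"
    have C: "0 < ?C" using moll_const_ge(1)[where 'a = "(real ^ 'd) \<times> real"] by simp
    have "\<phi>0 \<in> B_matrix_space br \<MM> \<Theta> \<and> \<phi>1 \<in> B_matrix_space br \<MM> \<Theta>" if \<Theta>: "\<Theta> \<Subset> \<Omega>" for \<Theta>
    proof -
      \<comment> \<open>Uniform bounds on \<Theta> need room around its closure, so (b) is applied
        to a larger set.\<close>
      obtain \<Theta>' where \<Theta>': "\<Theta>' \<Subset> \<Omega>" "closure \<Theta> \<subseteq> \<Theta>'" using rel_compact_between[OF \<Theta> assms(5)] by blast
      have q: "bracket_quant br \<MM> (\<lambda>M h. \<exists>V. open_nbhd \<Theta>' V \<and> almost_harmonic_ext \<phi>0 \<phi>1 \<Theta>' M h V)"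
        using \<open>b\<close> \<Theta>'(1) unfolding b_def by blast
      have \<Theta>o: "open \<Theta>" "compact (closure \<Theta>)" using \<Theta> by (auto simp: rel_compact_open_def)
      have main: "\<phi>0 \<in> B_space M (?C * h) \<Theta> \<and> \<phi>1 \<in> B_space M (?C * h) \<Theta>"
        if "M \<in> \<MM>" "0 < h" "\<exists>V. open_nbhd \<Theta>' V \<and> almost_harmonic_ext \<phi>0 \<phi>1 \<Theta>' M h V" for M h
        using ultradifferentiable_of_almost_harmonic_ext[OF ws[OF that(1)] that(2) \<Theta>o \<Theta>'(2)] that(3) by blast
      show ?thesis
      proof (cases br)
        case Beurling
        have "\<phi>0 \<in> B_space M k \<Theta> \<and> \<phi>1 \<in> B_space M k \<Theta>" if "M \<in> \<MM>" "0 < k" for M k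
        proof -
          have "0 < k / ?C" using that(2) C by simp
          moreover from this have "\<exists>V. open_nbhd \<Theta>' V \<and> almost_harmonic_ext \<phi>0 \<phi>1 \<Theta>' M (k / ?C) V"
            using q Beurling that(1) unfolding bracket_quant_def by simp
          ultimately show ?thesis using main[OF that(1), of "k / ?C"] C by simp
        qed
        then show ?thesis using Beurling by (simp add: B_matrix_space_def)
      next
        case Roumieu
        then obtain M h where "M \<in> \<MM>" "0 < h" "\<exists>V. open_nbhd \<Theta>' V \<and> almost_harmonic_ext \<phi>0 \<phi>1 \<Theta>' M h V"
          using q unfolding bracket_quant_def by auto
        then have "M \<in> \<MM>" "?C * h \<in> {0<..}" "\<phi>0 \<in> B_space M (?C * h) \<Theta>" "\<phi>1 \<in> B_space M (?C * h) \<Theta>"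
          using main[of M h] C by auto
        then show ?thesis unfolding B_matrix_space_def Roumieu bracket.case by blast
      qed
    qed
    then show a unfolding a_def E_matrix_space_def by blast
  qed
  ultimately show ?thesis by blast
qed

end
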